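(* Let $M$ be a Riemannian manifold and let $p\ge1$ be an integer. Assume there is a stochastic differential equation $dx_t=X(x_t)\circ dB_t+A(x_t)\,dt$ on $M$ which is strongly $p$-complete and strongly $p^{th}$-moment stable. Then all bounded closed ($C^\infty$) $p$-forms on $M$ are exact. In particular the natural map from $H_K^p(M,\mathbb{R})$ to $H^p(M,\mathbb{R})$ is trivial.
   Context: Setting: $M$ is connected and smooth; $B_t$ is an $m$-dimensional Brownian motion on a filtered probability space; $X:\mathbb{R}^m\times M\to TM$ is $C^2$ with $X(x):\mathbb{R}^m\to T_xM$ linear; $A$ is a $C^2$ vector field; the equation is Stratonovich. $F_t(x)$, $0\le t<\xi(x)$, is the maximal solution (partial flow, $C^1$ in $x$ on the open set $\{x:t<\xi(x)\}$, continuous in $t$ for $C^1$ convergence on compacta) starting at $x$ with explosion time $\xi(x)$; $T_xF_t$ is its derivative at $x$ with operator norm $|T_xF_t|$. Let $S_p$ be the set of images of smooth singular $p$-simplices in $M$ (smooth meaning extending smoothly over an open neighbourhood). The equation is strongly $p$-complete if the solution can be chosen jointly continuous in time and space a.s. for all time when restricted to any $K\in S_p$; equivalently $\inf_{x\in K}\xi(x)=\infty$ a.s. for all $K\in S_p$. It is strongly $p^{th}$-moment stable if for every compact $K\subset M$, $$\mu_K(p)=\limsup_{t\to\infty}\ \sup_{x\in K}\frac1t\log E|T_xF_t|^p<0.$$ $H^p(M,\mathbb{R})$ is the $p^{th}$ de Rham cohomology group and $H_K^p(M,\mathbb{R})$ the de Rham cohomology group for compactly supported $p$-forms. A form $\phi$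 is bounded if $\sup_{x\in M}|\phi_x|<\infty$. *)

theory Defs
  imports "HOL-Probability.Probability" "HOL-Algebra.Coset"
begin

section \<open>Smooth manifolds given by atlases\<close>

fun Ck_on :: "nat \<Rightarrow> 'x::real_normed_vector set \<Rightarrow> ('x \<Rightarrow> 'y::real_normed_vector) \<Rightarrow> bool" where
  "Ck_on 0 S f \<longleftrightarrow> continuous_on S f"
| "Ck_on (Suc k) S f \<longleftrightarrow> (\<forall>x\<in>S. f differentiable (at x)) \<and>
     (\<forall>u. Ck_on k S (\<lambda>x. frechet_derivative f (at x) u))"

definition smooth_on :: "'x::real_normed_vector set \<Rightarrow> ('x \<Rightarrow> 'y::real_normed_vector) \<Rightarrow> bool" where
  "smooth_on S f \<longleftrightarrow> (\<forall>k. Ck_on k S f)"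

text \<open>A chart is its domain together with its coordinate map; only the values of the coordinate
  map on the domain are relevant. The manifold is the whole type \<^typ>\<open>'a\<close>.\<close>

type_synonym ('a, 'e) chart = "'a set \<times> ('a \<Rightarrow> 'e)"

definition chart_inv :: "('a, 'e) chart \<Rightarrow> 'e \<Rightarrow> 'a" where
  "chart_inv c = inv_into (fst c) (snd c)"

definition smooth_atlas ::
  "('a::{second_countable_topology,t2_space}, 'e::euclidean_space) chart set \<Rightarrow> bool" where
  "smooth_atlas \<A> \<longleftrightarrow>
     (\<Union>c\<in>\<A>. fst c) = UNIV \<and>
     (\<forall>c\<in>\<A>. open (fst c) \<and> open (snd c ` fst c) \<and>
        homeomorphism (fst c) (snd c ` fst c) (snd c) (chart_inv c)) \<and>
     (\<forall>c\<in>\<A>. \<forall>d\<in>\<A>. smooth_on (snd c ` (fst c \<inter> fst d)) (snd d \<circ> chart_inv c))"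

definition chart_at :: "('a, 'e) chart set \<Rightarrow> 'a \<Rightarrow> ('a, 'e) chart" where
  "chart_at \<A> x = (SOME c. c \<in> \<A> \<and> x \<in> fst c)"

text \<open>A tangent vector at \<open>x\<close> is the family of its coordinate vectors in all charts around \<open>x\<close>,
  related by the derivatives of the coordinate changes. The value \<open>0\<close> at the remaining charts is a
  normalisation which makes equality of tangent vectors equality of families.\<close>

type_synonym ('a, 'e) tangent = "('a, 'e) chart \<Rightarrow> 'e"

definition coord_change ::
  "('a, 'e::euclidean_space) chart \<Rightarrow> ('a, 'e) chart \<Rightarrow> 'a \<Rightarrow> 'e \<Rightarrow> 'e" where
  "coord_change c d x = frechet_derivative (snd d \<circ> chart_inv c) (at (snd c x))"

definition tangent_space ::
  "('a, 'e::euclidean_space) chart set \<Rightarrow> 'a \<Rightarrow> ('a, 'e) tangent set" where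
  "tangent_space \<A> x = {v.
     (\<forall>c d. c \<in> \<A> \<and> d \<in> \<A> \<and> x \<in> fst c \<inter> fst d \<longrightarrow> v d = coord_change c d x (v c)) \<and>
     (\<forall>c. c \<notin> \<A> \<or> x \<notin> fst c \<longrightarrow> v c = 0)}"

definition tangent_of ::
  "('a, 'e::euclidean_space) chart set \<Rightarrow> ('a, 'e) chart \<Rightarrow> 'a \<Rightarrow> 'e \<Rightarrow> ('a, 'e) tangent" where
  "tangent_of \<A> c x u = (\<lambda>d. if d \<in> \<A> \<and> x \<in> fst d then coord_change c d x u else 0)"

definition lin_comb ::
  "real \<Rightarrow> ('a, 'e::euclidean_space) tangent \<Rightarrow> real \<Rightarrow> ('a, 'e) tangent \<Rightarrow> ('a, 'e) tangent" where
  "lin_comb a v b w = (\<lambda>c. a *\<^sub>R v c + b *\<^sub>R w c)"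

definition riemannian_metric ::
  "('a, 'e::euclidean_space) chart set \<Rightarrow>
   ('a \<Rightarrow> ('a, 'e) tangent \<Rightarrow> ('a, 'e) tangent \<Rightarrow> real) \<Rightarrow> bool" where
  "riemannian_metric \<A> g \<longleftrightarrow>
     (\<forall>x. \<forall>u\<in>tangent_space \<A> x. \<forall>v\<in>tangent_space \<A> x. \<forall>w\<in>tangent_space \<A> x. \<forall>a b.
        g x u v = g x v u \<and> g x (lin_comb a u b v) w = a * g x u w + b * g x v w \<and>
        0 \<le> g x u u \<and> (g x u u = 0 \<longrightarrow> u = (\<lambda>_. 0))) \<and>
     (\<forall>c\<in>\<A>. \<forall>u v. smooth_on (snd c ` fst c)
        (\<lambda>y. g (chart_inv c y) (tangent_of \<A> c (chart_inv c y) u) (tangent_of \<A> c (chart_inv c y) v)))"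

definition smooth_fun :: "('a, 'e::euclidean_space) chart set \<Rightarrow> ('a \<Rightarrow> real) \<Rightarrow> bool" where
  "smooth_fun \<A> f \<longleftrightarrow> (\<forall>c\<in>\<A>. smooth_on (snd c ` fst c) (f \<circ> chart_inv c))"

definition differential ::
  "('a, 'e::euclidean_space) chart set \<Rightarrow> ('a \<Rightarrow> real) \<Rightarrow> 'a \<Rightarrow> ('a, 'e) tangent \<Rightarrow> real" where
  "differential \<A> f x v =
     (let c = chart_at \<A> x in frechet_derivative (f \<circ> chart_inv c) (at (snd c x)) (v c))"

definition Ck_vector_field ::
  "nat \<Rightarrow> ('a, 'e::euclidean_space) chart set \<Rightarrow> ('a \<Rightarrow> ('a, 'e) tangent) \<Rightarrow> bool" where
  "Ck_vector_field k \<A> V \<longleftrightarrow> (\<forall>x. V x \<in> tangent_space \<A> x) \<and>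
     (\<forall>c\<in>\<A>. Ck_on k (snd c ` fst c) (\<lambda>y. V (chart_inv c y) c))"

definition tangent_map ::
  "('a, 'e::euclidean_space) chart set \<Rightarrow> ('a \<Rightarrow> 'a) \<Rightarrow> 'a \<Rightarrow> ('a, 'e) tangent \<Rightarrow> ('a, 'e) tangent" where
  "tangent_map \<A> G x v = (\<lambda>d. if d \<in> \<A> \<and> G x \<in> fst d
     then let c = chart_at \<A> x in frechet_derivative (snd d \<circ> G \<circ> chart_inv c) (at (snd c x)) (v c)
     else 0)"

definition tangent_map_norm ::
  "('a, 'e::euclidean_space) chart set \<Rightarrow>
   ('a \<Rightarrow> ('a, 'e) tangent \<Rightarrow> ('a, 'e) tangent \<Rightarrow> real) \<Rightarrow> ('a \<Rightarrow> 'a) \<Rightarrow> 'a \<Rightarrow> real" where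
  "tangent_map_norm \<A> g G x =
     (SUP v \<in> {v \<in> tangent_space \<A> x. g x v v \<le> 1}.
        sqrt (g (G x) (tangent_map \<A> G x v) (tangent_map \<A> G x v)))"

definition C1_map_on ::
  "('a::topological_space, 'e::euclidean_space) chart set \<Rightarrow> 'a set \<Rightarrow> ('a \<Rightarrow> 'a) \<Rightarrow> bool" where
  "C1_map_on \<A> U G \<longleftrightarrow> continuous_on U G \<and>
     (\<forall>c\<in>\<A>. \<forall>d\<in>\<A>. Ck_on 1 (snd c ` (fst c \<inter> U \<inter> G -` fst d)) (snd d \<circ> G \<circ> chart_inv c))"

text \<open>\<open>C\<^sup>1\<close> convergence on compacta of maps \<open>G i\<close>, defined on \<open>U i\<close>, to \<open>H\<close>, defined on \<open>W\<close>:
  uniform convergence in charts of the maps and of their first derivatives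
  (the weak, or compact-open, \<open>C\<^sup>1\<close> topology).\<close>

definition C1_tendsto ::
  "('a::topological_space, 'e::euclidean_space) chart set \<Rightarrow> ('i \<Rightarrow> 'a set) \<Rightarrow> ('i \<Rightarrow> 'a \<Rightarrow> 'a) \<Rightarrow>
   'a set \<Rightarrow> ('a \<Rightarrow> 'a) \<Rightarrow> 'i filter \<Rightarrow> bool" where
  "C1_tendsto \<A> U G W H \<Phi> \<longleftrightarrow>
     (\<forall>c\<in>\<A>. \<forall>d\<in>\<A>. \<forall>K. compact K \<and> K \<subseteq> fst c \<inter> W \<and> H ` K \<subseteq> fst d \<longrightarrow>
        (\<forall>\<^sub>F i in \<Phi>. K \<subseteq> U i \<and> G i ` K \<subseteq> fst d) \<and>
        uniform_limit (snd c ` K)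
          (\<lambda>i. snd d \<circ> G i \<circ> chart_inv c) (snd d \<circ> H \<circ> chart_inv c) \<Phi> \<and>
        (\<forall>u. uniform_limit (snd c ` K)
          (\<lambda>i y. frechet_derivative (snd d \<circ> G i \<circ> chart_inv c) (at y) u)
          (\<lambda>y. frechet_derivative (snd d \<circ> H \<circ> chart_inv c) (at y) u) \<Phi>))"

text \<open>\<open>S\<^sub>p\<close> for \<open>p = CARD('p)\<close>. The standard \<open>p\<close>-simplex is realised as the convex hull of the
  origin and the unit vectors of \<open>\<real>\<^sup>p\<close>.\<close>

definition smooth_simplices ::
  "'p::finite itself \<Rightarrow> ('a::topological_space, 'e::euclidean_space) chart set \<Rightarrow> 'a set set" where
  "smooth_simplices T \<A> = {\<sigma> ` (convex hull (insert 0 Basis)) | \<sigma> :: real^'p \<Rightarrow> 'a.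
     \<exists>W. open W \<and> convex hull (insert 0 Basis) \<subseteq> W \<and> continuous_on W \<sigma> \<and>
       (\<forall>c\<in>\<A>. smooth_on (W \<inter> \<sigma> -` fst c) (snd c \<circ> \<sigma>))}"

section \<open>Differential forms and de Rham cohomology\<close>

text \<open>The value of a \<open>p\<close>-form at \<open>x\<close> is a function of lists of \<open>p\<close> tangent vectors at \<open>x\<close>; on all other
  lists it is \<open>0\<close>, so that equality of forms is equality of functions.\<close>

type_synonym ('a, 'e) form = "'a \<Rightarrow> ('a, 'e) tangent list \<Rightarrow> real"

definition local_form ::
  "('a, 'e::euclidean_space) chart set \<Rightarrow> ('a, 'e) chart \<Rightarrow> ('a, 'e) form \<Rightarrow> 'e list \<Rightarrow> 'e \<Rightarrow> real" where
  "local_form \<A> c \<phi> us y = \<phi> (chart_inv c y) (map (tangent_of \<A> c (chart_inv c y)) us)"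

definition forms :: "('a, 'e::euclidean_space) chart set \<Rightarrow> nat \<Rightarrow> ('a, 'e) form set" where
  "forms \<A> p = {\<phi>.
     (\<forall>x vs. \<not> (length vs = p \<and> set vs \<subseteq> tangent_space \<A> x) \<longrightarrow> \<phi> x vs = 0) \<and>
     (\<forall>x vs. length vs = p \<and> set vs \<subseteq> tangent_space \<A> x \<longrightarrow>
        (\<forall>i<p. \<forall>v\<in>tangent_space \<A> x. \<forall>w\<in>tangent_space \<A> x. \<forall>a b.
           \<phi> x (vs[i := lin_comb a v b w]) = a * \<phi> x (vs[i := v]) + b * \<phi> x (vs[i := w])) \<and>
        (\<forall>i<p. \<forall>j<p. i \<noteq> j \<and> vs ! i = vs ! j \<longrightarrow> \<phi> x vs = 0)) \<and>
     (\<forall>c\<in>\<A>. \<forall>us. length us = p \<longrightarrow> smooth_on (snd c ` fst c) (local_form \<A> c \<phi> us))}"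

text \<open>In a chart,
  \<open>d\<phi>(v\<^sub>0, \<dots>, v\<^sub>p) = \<Sum>\<^sub>i (-1)\<^sup>i D[\<phi>(v\<^sub>0, \<dots>, v\<^sub>i\<^sub>-\<^sub>1, v\<^sub>i\<^sub>+\<^sub>1, \<dots>, v\<^sub>p)](v\<^sub>i)\<close> for constant vectors \<open>v\<^sub>i\<close>.
  The result does not depend on the chart.\<close>

definition ext_deriv :: "('a, 'e::euclidean_space) chart set \<Rightarrow> ('a, 'e) form \<Rightarrow> ('a, 'e) form" where
  "ext_deriv \<A> \<phi> = (\<lambda>x vs. if set vs \<subseteq> tangent_space \<A> x
     then let c = chart_at \<A> x; us = map (\<lambda>v. v c) vs in
       (\<Sum>i<length us. (-1) ^ i *
          frechet_derivative (local_form \<A> c \<phi> (take i us @ drop (Suc i) us)) (at (snd c x)) (us ! i))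
     else 0)"

definition zero_form :: "('a, 'e) form" where
  "zero_form = (\<lambda>x vs. 0)"

definition closed_forms :: "('a, 'e::euclidean_space) chart set \<Rightarrow> nat \<Rightarrow> ('a, 'e) form set" where
  "closed_forms \<A> p = {\<phi> \<in> forms \<A> p. ext_deriv \<A> \<phi> = zero_form}"

definition exact_forms :: "('a, 'e::euclidean_space) chart set \<Rightarrow> nat \<Rightarrow> ('a, 'e) form set" where
  "exact_forms \<A> p = (if p = 0 then {zero_form} else ext_deriv \<A> ` forms \<A> (p - 1))"

definition compactly_supported :: "('a::topological_space, 'e) form \<Rightarrow> bool" where
  "compactly_supported \<phi> \<longleftrightarrow> compact (closure {x. \<exists>vs. \<phi> x vs \<noteq> 0})"

definition exact_forms_K ::
  "('a::topological_space, 'e::euclidean_space) chart set \<Rightarrow> nat \<Rightarrow> ('a, 'e) form set" where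
  "exact_forms_K \<A> p = (if p = 0 then {zero_form}
     else ext_deriv \<A> ` {\<psi> \<in> forms \<A> (p - 1). compactly_supported \<psi>})"

definition form_group :: "('a, 'e) form set \<Rightarrow> ('a, 'e) form monoid" where
  "form_group S = \<lparr>carrier = S, mult = (\<lambda>\<phi> \<psi> x vs. \<phi> x vs + \<psi> x vs), one = zero_form\<rparr>"

definition de_rham ::
  "('a, 'e::euclidean_space) chart set \<Rightarrow> nat \<Rightarrow> ('a, 'e) form set monoid" where
  "de_rham \<A> p = form_group (closed_forms \<A> p) Mod exact_forms \<A> p"

definition de_rham_K ::
  "('a::topological_space, 'e::euclidean_space) chart set \<Rightarrow> nat \<Rightarrow> ('a, 'e) form set monoid" where
  "de_rham_K \<A> p =
     form_group {\<phi> \<in> closed_forms \<A> p. compactly_supported \<phi>} Mod exact_forms_K \<A> p"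

text \<open>The map \<open>[\<phi>]\<^sub>K \<mapsto> [\<phi>]\<close>; all representatives \<open>\<phi>\<close> of a class give the same coset.\<close>

definition natural_map ::
  "('a, 'e::euclidean_space) chart set \<Rightarrow> nat \<Rightarrow> ('a, 'e) form set \<Rightarrow> ('a, 'e) form set" where
  "natural_map \<A> p C = (\<Union>\<phi>\<in>C. exact_forms \<A> p #>\<^bsub>form_group (closed_forms \<A> p)\<^esub> \<phi>)"

definition form_norm ::
  "('a, 'e::euclidean_space) chart set \<Rightarrow>
   ('a \<Rightarrow> ('a, 'e) tangent \<Rightarrow> ('a, 'e) tangent \<Rightarrow> real) \<Rightarrow> nat \<Rightarrow> ('a, 'e) form \<Rightarrow> 'a \<Rightarrow> real" where
  "form_norm \<A> g p \<phi> x =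
     (SUP vs \<in> {vs. length vs = p \<and> (\<forall>v\<in>set vs. v \<in> tangent_space \<A> x \<and> g x v v \<le> 1)}. \<bar>\<phi> x vs\<bar>)"

definition bounded_form ::
  "('a, 'e::euclidean_space) chart set \<Rightarrow>
   ('a \<Rightarrow> ('a, 'e) tangent \<Rightarrow> ('a, 'e) tangent \<Rightarrow> real) \<Rightarrow> nat \<Rightarrow> ('a, 'e) form \<Rightarrow> bool" where
  "bounded_form \<A> g p \<phi> \<longleftrightarrow> bdd_above (range (form_norm \<A> g p \<phi>))"

section \<open>Brownian motion, semimartingales and the Stratonovich integral\<close>

text \<open>Processes are indexed by \<open>t \<ge> 0\<close>. A filtration is indexed by all of \<open>\<real>\<close>, but its members with
  negative index play no role.\<close>

definition filtered_prob_space :: "'w measure \<Rightarrow> (real \<Rightarrow> 'w measure) \<Rightarrow> bool" where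
  "filtered_prob_space P \<F> \<longleftrightarrow> prob_space P \<and> filtration (space P) \<F> \<and> (\<forall>t. subalgebra P (\<F> t))"

definition adapted_process ::
  "(real \<Rightarrow> 'w measure) \<Rightarrow> (real \<Rightarrow> 'w \<Rightarrow> 'b::topological_space) \<Rightarrow> bool" where
  "adapted_process \<F> Y \<longleftrightarrow> (\<forall>t\<ge>0. Y t \<in> borel_measurable (\<F> t))"

definition brownian_motion ::
  "'w measure \<Rightarrow> (real \<Rightarrow> 'w measure) \<Rightarrow> (real \<Rightarrow> 'w \<Rightarrow> real^'m) \<Rightarrow> bool" where
  "brownian_motion P \<F> B \<longleftrightarrow>
     adapted_process \<F> B \<and>
     (AE \<omega> in P. B 0 \<omega> = 0 \<and> continuous_on {0..} (\<lambda>t. B t \<omega>)) \<and>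
     (\<forall>s t. 0 \<le> s \<and> s < t \<longrightarrow>
        distributed P lborel (\<lambda>\<omega>. B t \<omega> - B s \<omega>)
          (\<lambda>z. ennreal (\<Prod>k\<in>UNIV. normal_density 0 (sqrt (t - s)) (z $ k))) \<and>
        prob_space.indep_set P (sets (\<F> s))
          {(\<lambda>\<omega>. B t \<omega> - B s \<omega>) -` U \<inter> space P | U. U \<in> sets borel})"

definition martingale ::
  "'w measure \<Rightarrow> (real \<Rightarrow> 'w measure) \<Rightarrow> (real \<Rightarrow> 'w \<Rightarrow> real) \<Rightarrow> bool" where
  "martingale P \<F> L \<longleftrightarrow> adapted_process \<F> L \<and> (\<forall>t\<ge>0. integrable P (L t)) \<and>
     (\<forall>s t. 0 \<le> s \<and> s \<le> t \<longrightarrow> (AE \<omega> in P. real_cond_exp P (\<F> s) (L t) \<omega> = L s \<omega>))"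

definition continuous_local_martingale ::
  "'w measure \<Rightarrow> (real \<Rightarrow> 'w measure) \<Rightarrow> (real \<Rightarrow> 'w \<Rightarrow> real) \<Rightarrow> bool" where
  "continuous_local_martingale P \<F> L \<longleftrightarrow>
     adapted_process \<F> L \<and> (AE \<omega> in P. continuous_on {0..} (\<lambda>t. L t \<omega>)) \<and>
     (\<exists>\<tau> :: nat \<Rightarrow> 'w \<Rightarrow> real.
        (\<forall>n. stopping_time \<F> (\<tau> n) \<and> (\<forall>\<omega>\<in>space P. 0 \<le> \<tau> n \<omega> \<and> \<tau> n \<omega> \<le> \<tau> (Suc n) \<omega>)) \<and>
        (AE \<omega> in P. filterlim (\<lambda>n. \<tau> n \<omega>) at_top sequentially) \<and>
        (\<forall>n. martingale P \<F> (\<lambda>t \<omega>. L (min t (\<tau> n \<omega>)) \<omega> - L 0 \<omega>)))"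

text \<open>The process of finite variation is written as the difference of two increasing ones.\<close>

definition continuous_semimartingale ::
  "'w measure \<Rightarrow> (real \<Rightarrow> 'w measure) \<Rightarrow> (real \<Rightarrow> 'w \<Rightarrow> real) \<Rightarrow> bool" where
  "continuous_semimartingale P \<F> Y \<longleftrightarrow>
     (\<exists>L V\<^sub>1 V\<^sub>2. continuous_local_martingale P \<F> L \<and> adapted_process \<F> V\<^sub>1 \<and> adapted_process \<F> V\<^sub>2 \<and>
        (AE \<omega> in P. continuous_on {0..} (\<lambda>t. V\<^sub>1 t \<omega>) \<and> mono_on {0..} (\<lambda>t. V\<^sub>1 t \<omega>) \<and>
           continuous_on {0..} (\<lambda>t. V\<^sub>2 t \<omega>) \<and> mono_on {0..} (\<lambda>t. V\<^sub>2 t \<omega>) \<and>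
           (\<forall>t\<ge>0. Y t \<omega> = L t \<omega> + V\<^sub>1 t \<omega> - V\<^sub>2 t \<omega>)))"

text \<open>\<open>I = \<integral>\<^sub>0\<^sup>t Y\<^sub>s \<circ> dB\<^sub>s\<close>, that is \<open>\<Sum>\<^sub>k \<integral>\<^sub>0\<^sup>t Y\<^sup>k\<^sub>s \<circ> dB\<^sup>k\<^sub>s\<close>: limit in probability of the symmetric
  (trapezoidal) Riemann sums as the mesh of the partition of \<open>[0,t]\<close> tends to \<open>0\<close>. The measurability
  conditions are needed because \<^const>\<open>measure\<close> is \<open>0\<close> on non-measurable sets.\<close>

definition stratonovich_sum ::
  "(real \<Rightarrow> 'w \<Rightarrow> real^'m) \<Rightarrow> (real \<Rightarrow> 'w \<Rightarrow> real^'m) \<Rightarrow> nat \<Rightarrow> (nat \<Rightarrow> real) \<Rightarrow> 'w \<Rightarrow> real" where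
  "stratonovich_sum B Y n r \<omega> =
     (\<Sum>i<n. ((1/2) *\<^sub>R (Y (r i) \<omega> + Y (r (Suc i)) \<omega>)) \<bullet> (B (r (Suc i)) \<omega> - B (r i) \<omega>))"

definition has_stratonovich_integral ::
  "'w measure \<Rightarrow> (real \<Rightarrow> 'w \<Rightarrow> real^'m) \<Rightarrow> (real \<Rightarrow> 'w \<Rightarrow> real^'m) \<Rightarrow> real \<Rightarrow> ('w \<Rightarrow> real) \<Rightarrow> bool" where
  "has_stratonovich_integral P B Y t I \<longleftrightarrow>
     I \<in> borel_measurable P \<and> (\<forall>s\<in>{0..t}. B s \<in> borel_measurable P \<and> Y s \<in> borel_measurable P) \<and>
     (\<forall>\<epsilon>>0. \<exists>\<delta>>0. \<forall>n r. r 0 = 0 \<and> r n = t \<and> (\<forall>i<n. r i < r (Suc i) \<and> r (Suc i) - r i < \<delta>) \<longrightarrow>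
        measure P {\<omega> \<in> space P. \<epsilon> < \<bar>stratonovich_sum B Y n r \<omega> - I \<omega>\<bar>} < \<epsilon>)"

section \<open>Stochastic differential equations and their flows\<close>

definition C2_sde ::
  "('a, 'e::euclidean_space) chart set \<Rightarrow> ('a \<Rightarrow> real^'m \<Rightarrow> ('a, 'e) tangent) \<Rightarrow>
   ('a \<Rightarrow> ('a, 'e) tangent) \<Rightarrow> bool" where
  "C2_sde \<A> X A \<longleftrightarrow>
     (\<forall>x a e b e'. X x (a *\<^sub>R e + b *\<^sub>R e') = lin_comb a (X x e) b (X x e')) \<and>
     (\<forall>e. Ck_vector_field 2 \<A> (\<lambda>x. X x e)) \<and> Ck_vector_field 2 \<A> A"

text \<open>A process \<open>x\<close> with lifetime \<open>\<zeta>\<close> is regarded as sitting at the point at infinity from time \<open>\<zeta>\<close> on,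
  where compactly supported functions vanish.\<close>

definition killed ::
  "('w \<Rightarrow> ereal) \<Rightarrow> (real \<Rightarrow> 'w \<Rightarrow> 'a) \<Rightarrow> ('a \<Rightarrow> real) \<Rightarrow> real \<Rightarrow> 'w \<Rightarrow> real" where
  "killed \<zeta> x f t \<omega> = (if ereal t < \<zeta> \<omega> then f (x t \<omega>) else 0)"

text \<open>\<open>x\<close> is a maximal solution of \<open>dx\<^sub>t = X(x\<^sub>t) \<circ> dB\<^sub>t + A(x\<^sub>t) dt\<close> started at \<open>x\<^sub>0\<close> with explosion time
  \<open>\<zeta>\<close>: it is a semimartingale on \<open>M\<close> which leaves every compact set as \<open>t \<up> \<zeta> < \<infinity>\<close>, and
  \<open>f(x\<^sub>t) = f(x\<^sub>0) + \<integral>\<^sub>0\<^sup>t df(X(x\<^sub>s) \<circ> dB\<^sub>s) + \<integral>\<^sub>0\<^sup>t df(A(x\<^sub>s)) ds\<close> for all test functions \<open>f\<close>.\<close>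

definition maximal_solution ::
  "'w measure \<Rightarrow> (real \<Rightarrow> 'w measure) \<Rightarrow> (real \<Rightarrow> 'w \<Rightarrow> real^'m) \<Rightarrow>
   ('a::topological_space, 'e::euclidean_space) chart set \<Rightarrow> ('a \<Rightarrow> real^'m \<Rightarrow> ('a, 'e) tangent) \<Rightarrow>
   ('a \<Rightarrow> ('a, 'e) tangent) \<Rightarrow> 'a \<Rightarrow> ('w \<Rightarrow> ereal) \<Rightarrow> (real \<Rightarrow> 'w \<Rightarrow> 'a) \<Rightarrow> bool" where
  "maximal_solution P \<F> B \<A> X A x\<^sub>0 \<zeta> x \<longleftrightarrow>
     (AE \<omega> in P. 0 < \<zeta> \<omega> \<and> x 0 \<omega> = x\<^sub>0 \<and> continuous_on {t. 0 \<le> t \<and> ereal t < \<zeta> \<omega>} (\<lambda>t. x t \<omega>)) \<and>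
     (\<forall>t\<ge>0. \<forall>U. open U \<longrightarrow> {\<omega> \<in> space P. ereal t < \<zeta> \<omega> \<and> x t \<omega> \<in> U} \<in> sets (\<F> t)) \<and>
     (AE \<omega> in P. \<zeta> \<omega> < \<infinity> \<longrightarrow> (\<forall>K. compact K \<longrightarrow>
        (\<exists>s\<ge>0. ereal s < \<zeta> \<omega> \<and> (\<forall>t>s. ereal t < \<zeta> \<omega> \<longrightarrow> x t \<omega> \<notin> K)))) \<and>
     (\<forall>f. smooth_fun \<A> f \<and> compact (closure {y. f y \<noteq> 0}) \<longrightarrow>
        continuous_semimartingale P \<F> (killed \<zeta> x f) \<and>
        (\<forall>t\<ge>0. \<exists>I.
           has_stratonovich_integral P B
             (\<lambda>s \<omega>. \<chi> k. killed \<zeta> x (\<lambda>y. differential \<A> f y (X y (axis k 1))) s \<omega>) t I \<and>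
           (AE \<omega> in P. killed \<zeta> x f t \<omega> = f x\<^sub>0 + I \<omega> +
              (LBINT s:{0..t}. killed \<zeta> x (\<lambda>y. differential \<A> f y (A y)) s \<omega>))))"

text \<open>The flow \<open>F t \<omega> x\<close> is meaningful for \<open>0 \<le> t < \<xi> \<omega> x\<close> only; other values are arbitrary.\<close>

definition sde_flow ::
  "'w measure \<Rightarrow> (real \<Rightarrow> 'w measure) \<Rightarrow> (real \<Rightarrow> 'w \<Rightarrow> real^'m) \<Rightarrow>
   ('a::topological_space, 'e::euclidean_space) chart set \<Rightarrow> ('a \<Rightarrow> real^'m \<Rightarrow> ('a, 'e) tangent) \<Rightarrow>
   ('a \<Rightarrow> ('a, 'e) tangent) \<Rightarrow> ('w \<Rightarrow> 'a \<Rightarrow> ereal) \<Rightarrow> (real \<Rightarrow> 'w \<Rightarrow> 'a \<Rightarrow> 'a) \<Rightarrow> bool" where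
  "sde_flow P \<F> B \<A> X A \<xi> F \<longleftrightarrow>
     (\<forall>x. maximal_solution P \<F> B \<A> X A x (\<lambda>\<omega>. \<xi> \<omega> x) (\<lambda>t \<omega>. F t \<omega> x)) \<and>
     (AE \<omega> in P. (\<forall>x. 0 < \<xi> \<omega> x \<and> F 0 \<omega> x = x) \<and>
        (\<forall>t\<ge>0. open {x. ereal t < \<xi> \<omega> x} \<and> C1_map_on \<A> {x. ereal t < \<xi> \<omega> x} (F t \<omega>) \<and>
           C1_tendsto \<A> (\<lambda>s. {x. ereal s < \<xi> \<omega> x}) (\<lambda>s. F s \<omega>)
             {x. ereal t < \<xi> \<omega> x} (F t \<omega>) (at t within {0..})))"

definition strongly_complete ::
  "'p::finite itself \<Rightarrow> 'w measure \<Rightarrow> ('a::topological_space, 'e::euclidean_space) chart set \<Rightarrow>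
   ('w \<Rightarrow> 'a \<Rightarrow> ereal) \<Rightarrow> bool" where
  "strongly_complete T P \<A> \<xi> \<longleftrightarrow>
     (\<forall>K\<in>smooth_simplices T \<A>. AE \<omega> in P. (INF x\<in>K. \<xi> \<omega> x) = \<infinity>)"

definition log_ennreal :: "ennreal \<Rightarrow> ereal" where
  "log_ennreal z = (if z = 0 then - \<infinity> else if z = \<infinity> then \<infinity> else ereal (ln (enn2real z)))"

text \<open>\<open>E|T\<^sub>xF\<^sub>t|\<^sup>p\<close>, the expectation being taken over \<open>{t < \<xi>(x)}\<close>, where \<open>T\<^sub>xF\<^sub>t\<close> is defined.\<close>

definition derivative_moment ::
  "'w measure \<Rightarrow> ('a, 'e::euclidean_space) chart set \<Rightarrow>
   ('a \<Rightarrow> ('a, 'e) tangent \<Rightarrow> ('a, 'e) tangent \<Rightarrow> real) \<Rightarrow>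
   ('w \<Rightarrow> 'a \<Rightarrow> ereal) \<Rightarrow> (real \<Rightarrow> 'w \<Rightarrow> 'a \<Rightarrow> 'a) \<Rightarrow> nat \<Rightarrow> real \<Rightarrow> 'a \<Rightarrow> ennreal" where
  "derivative_moment P \<A> g \<xi> F p t x =
     (\<integral>\<^sup>+\<omega>. (if ereal t < \<xi> \<omega> x then ennreal (tangent_map_norm \<A> g (F t \<omega>) x ^ p) else 0) \<partial>P)"

definition strongly_moment_stable ::
  "'w measure \<Rightarrow> ('a::topological_space, 'e::euclidean_space) chart set \<Rightarrow>
   ('a \<Rightarrow> ('a, 'e) tangent \<Rightarrow> ('a, 'e) tangent \<Rightarrow> real) \<Rightarrow>
   ('w \<Rightarrow> 'a \<Rightarrow> ereal) \<Rightarrow> (real \<Rightarrow> 'w \<Rightarrow> 'a \<Rightarrow> 'a) \<Rightarrow> nat \<Rightarrow> bool" where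
  "strongly_moment_stable P \<A> g \<xi> F p \<longleftrightarrow>
     (\<forall>K. compact K \<longrightarrow>
        Limsup at_top (\<lambda>t::real. SUP x\<in>K. ereal (1 / t) * log_ennreal (derivative_moment P \<A> g \<xi> F p t x)) < 0)"

end

(* A closed p-form phi integrates to a number over every finite cycle of small smooth p-simplices.
   The flow F_t moves a cycle without changing this number: for t near s the maps F_t and F_s are
   close, so the cycle can be moved from one to the other chart by chart, and in a chart phi is exact.
   Since the flow does not explode on simplices, the integral over the moved cycle is defined for all
   t, and its absolute value is at most a constant times the integral over the cycle of |T_x F_t|^p
   because phi is bounded. Its expectation tends to 0 by moment stability, so all these integrals
   vanish. By linear algebra the integral of phi is then the coboundary of a cochain on small
   simplices, and a Cech argument on a cover all of whose intersections are convex in a chart makes phi exact: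
   the columns of the double complex are cones of the integration map from forms to cochains, which
   are exact by the Poincare lemma, and the rows split by means of a partition of unity.
   Simplices are parametrised by cubes. Stokes' theorem is needed for maps of class C1 only, since
   F_t is no better; it follows from the smooth case by Steklov averages. *)
theory Submission
  imports Defs "HOL-Library.Function_Algebras"
begin

section \<open>Differential calculus and smooth cut-off functions\<close>

section \<open>Calculus of \<^const>\<open>Ck_on\<close>\<close>

text \<open>The coboundary equation for the integrals of \<phi> is an infinite linear system. It is
  solvable as soon as its finite linear relations hold, and these relations are the finite cycles;
  each involves finitely many simplices, so almost sure statements about the flow are combined
  finitely often. The integral over a cycle is not random, hence one null set per cycle does no harm
  although there are uncountably many cycles. The flow is C1 in space but merely continuous in time,
  so there is no homotopy formula along it; invariance is obtained as local constancy in t, by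
  interpolating in one chart after another. Cubes turn integrals into iterated integrals over
  coordinates, and a smooth step function extends every parametrisation to the whole Euclidean
  space, so that derivatives never have to be taken at a boundary. The p-th power of the derivative
  appears because a p-form has p arguments, each of which contributes one factor of the operator
  norm. Passing to the cone of integration replaces a comparison of two cohomology theories by plain
  exactness statements.\<close>

abbreviation FD :: "('x::real_normed_vector => 'y::real_normed_vector) => 'x => 'x => 'y" where
 "FD f x \<equiv> frechet_derivative f (at x)"

lemma FD_eqI: "(f has_derivative f') (at x) ==> FD f x = f'"
 by (rule frechet_derivative_at[symmetric])

lemma has_FD: "f differentiable (at x) ==> (f has_derivative FD f x) (at x)"
 by (simp add: frechet_derivative_works)

lemma linear_FD: "f differentiable (at x) ==> linear (FD f x)"
 using has_FD has_derivative_linear by blast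

text \<open>The predicate \<open>has_derivative\<close> cannot distinguish the two functions, so the
  choice made by \<open>frechet_derivative\<close> coincides, even at a point where neither function
  is differentiable.\<close>

lemma FD_cong_open:
 assumes "open S" "x \<in> S" "\<And>y. y \<in> S ==> f y = g y"
 shows "FD f x = FD g x"
proof -
 have "(f has_derivative h) (at x) \<longleftrightarrow> (g has_derivative h) (at x)" for h
  using has_derivative_transform_within_open[OF _ assms(1,2)] assms(3) by metis
 thus ?thesis unfolding frechet_derivative_def by simp
qed

lemma differentiable_cong_open:
 assumes "open S" "x \<in> S" "\<And>y. y \<in> S ==> f y = g y" "f differentiable (at x)"
 shows "g differentiable (at x)"
 using has_derivative_transform_within_open[OF _ assms(1,2)] assms(3,4)
 unfolding differentiable_def by metis

lemma Ck_on_cong: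
 assumes "open S" "\<And>x. x \<in> S ==> f x = g x" "Ck_on k S f"
 shows "Ck_on k S g"
 using assms(2,3)
proof (induction k arbitrary: f g)
 case 0
 thus ?case using continuous_on_cong by force
next
 case (Suc k)
 have "Ck_on k S (%x. FD g x u)" for u
 proof (rule Suc.IH[of "%x. FD f x u"])
  show "FD f x u = FD g x u" if "x \<in> S" for x
   using FD_cong_open[OF assms(1) that Suc.prems(1)] by simp
 qed (use Suc.prems(2) in simp)
 moreover have "\<forall>x\<in>S. g differentiable (at x)"
  using Suc.prems differentiable_cong_open[OF assms(1)] by (metis Ck_on.simps(2))
 ultimately show ?case by simp
qed

lemma Ck_on_subset: "Ck_on k S f ==> T \<subseteq> S ==> Ck_on k T f"
 by (induction k arbitrary: f) (auto intro: continuous_on_subset)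

lemma Ck_on_SucD: "Ck_on (Suc k) S f ==> Ck_on k S f"
proof (induction k arbitrary: f)
 case 0
 thus ?case by (metis Ck_on.simps continuous_at_imp_continuous_on differentiable_imp_continuous_within)
qed auto

lemma Ck_on_mono: "Ck_on k S f ==> j \<le> k ==> Ck_on j S f"
proof (induction k)
 case (Suc k)
 thus ?case using Ck_on_SucD le_Suc_eq by metis
qed auto

lemma Ck_on_continuous: "Ck_on k S f ==> continuous_on S f"
 using Ck_on_mono[of k S f 0] by simp

lemma Ck_on_const: "Ck_on k S (%x. c)"
 by (induction k arbitrary: c) simp_all

lemma Ck_on_bounded_linear: "bounded_linear f ==> Ck_on k S f"
 by (cases k) (auto simp: linear_continuous_on bounded_linear_imp_differentiable Ck_on_const
   FD_eqI[OF bounded_linear_imp_has_derivative])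

lemma Ck_on_bounded_linear_compose:
 assumes "bounded_linear L" "open S" "Ck_on k S f"
 shows "Ck_on k S (%x. L (f x))"
 using assms(3)
proof (induction k arbitrary: f)
 case 0
 thus ?case using bounded_linear.continuous_on[OF assms(1)] by simp
next
 case (Suc k)
 have d: "((%x. L (f x)) has_derivative (%u. L (FD f x u))) (at x)" if "x \<in> S" for x
  using Suc.prems that by (auto intro!: bounded_linear.has_derivative[OF assms(1)] has_FD)
 have "Ck_on k S (%x. FD (%x. L (f x)) x u)" for u
 proof (rule Ck_on_cong[OF assms(2)])
  show "Ck_on k S (%x. L (FD f x u))" using Suc by simp
 qed (simp add: FD_eqI[OF d])
 with d show ?case by (auto simp: differentiable_def)
qed

lemma Ck_on_add:
 assumes "open S" "Ck_on k S f" "Ck_on k S g"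
 shows "Ck_on k S (%x. f x + g x)"
 using assms(2,3)
proof (induction k arbitrary: f g)
 case (Suc k)
 have d: "((%x. f x + g x) has_derivative (%u. FD f x u + FD g x u)) (at x)" if "x \<in> S" for x
  using Suc.prems that by (intro has_derivative_add) (auto intro: has_FD)
 have "Ck_on k S (%x. FD (%x. f x + g x) x u)" for u
  by (rule Ck_on_cong[OF assms(1) _ Suc.IH[of "%x. FD f x u" "%x. FD g x u"]])
   (use Suc.prems FD_eqI[OF d] in auto)
 with d show ?case by (auto simp: differentiable_def)
qed (auto intro: continuous_on_add)

lemma Ck_on_bilinear:
 assumes "bounded_bilinear pr" "open S" "Ck_on k S f" "Ck_on k S g"
 shows "Ck_on k S (%x. pr (f x) (g x))"
 using assms(3,4)
proof (induction k arbitrary: f g)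
 case 0
 thus ?case using bounded_bilinear.continuous_on[OF assms(1)] by auto
next
 case (Suc k)
 have d: "((%x. pr (f x) (g x)) has_derivative (%u. pr (f x) (FD g x u) + pr (FD f x u) (g x))) (at x)"
  if "x \<in> S" for x
  using Suc.prems that by (auto intro!: bounded_bilinear.FDERIV[OF assms(1)] has_FD)
 have e: "Ck_on k S (%x. pr (f x) (FD g x u) + pr (FD f x u) (g x))" for u
  using Suc.prems Ck_on_SucD[OF Suc.prems(1)] Ck_on_SucD[OF Suc.prems(2)]
  by (intro Ck_on_add[OF assms(2)] Suc.IH) auto
 have "Ck_on k S (%x. FD (%x. pr (f x) (g x)) x u)" for u
  by (rule Ck_on_cong[OF assms(2) _ e[of u]]) (simp add: FD_eqI[OF d])
 with d show ?case by (auto simp: differentiable_def)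
qed

lemmas Ck_on_scaleR = Ck_on_bilinear[OF bounded_bilinear_scaleR]
lemmas Ck_on_inner = Ck_on_bilinear[OF bounded_bilinear_inner]
lemmas Ck_on_mult = Ck_on_bilinear[OF bounded_bilinear_mult]

lemma Ck_on_minus: "open S ==> Ck_on k S f ==> Ck_on k S (%x. - f x)"
 by (rule Ck_on_bounded_linear_compose[OF bounded_linear_minus[OF bounded_linear_ident]])

lemma Ck_on_diff: "open S ==> Ck_on k S f ==> Ck_on k S g ==> Ck_on k S (%x. f x - g x)"
 using Ck_on_add[of S k f "%x. - g x"] Ck_on_minus[of S k g] by simp

lemma Ck_on_sum:
 assumes "open S" "\<And>i. i \<in> I ==> Ck_on k S (f i)"
 shows "Ck_on k S (%x. \<Sum>i\<in>I. f i x)"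
 using assms(2)
 by (induction I rule: infinite_finite_induct) (auto simp: Ck_on_const intro: Ck_on_add[OF assms(1)])

text \<open>Derivatives of \<open>h\<close> are controlled in fixed directions only, whereas the
  chain rule produces the moving direction \<open>FD f x u\<close>. Expanding it in a basis of the
  Euclidean middle space reduces the claim to sums of products with fixed directions, to which the
  induction applies.\<close>

lemma Ck_on_compose:
 fixes f :: "'x::real_normed_vector => 'y::euclidean_space" and h :: "'y => 'z::real_normed_vector"
 assumes "open S" "open T" "f ` S \<subseteq> T" "Ck_on k S f" "Ck_on k T h"
 shows "Ck_on k S (%x. h (f x))"
 using assms(4,5)
proof (induction k arbitrary: h)
 case 0
 thus ?case using continuous_on_compose2[of T h S f] assms(3) by simp
next
 case (Suc k)
 have d: "((%x. h (f x)) has_derivative (%u. FD h (f x) (FD f x u))) (at x)" if "x \<in> S" for x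
  using has_derivative_compose[OF has_FD has_FD, of f x h] Suc.prems that assms(3) by auto
 have e: "Ck_on k S (%x. \<Sum>b\<in>Basis. (FD f x u \<bullet> b) *\<^sub>R FD h (f x) b)" for u
 proof (intro Ck_on_sum Ck_on_scaleR Ck_on_inner Ck_on_const assms(1))
  show "Ck_on k S (%x. FD f x u)" using Suc.prems by simp
  show "Ck_on k S (%x. FD h (f x) b)" if "b \<in> Basis" for b
   using Suc.IH[of "%y. FD h y b"] Suc.prems Ck_on_SucD by auto
 qed
 have l: "linear (FD h (f x))" if "x \<in> S" for x using linear_FD[of h] that assms(3) Suc.prems by auto
 have "Ck_on k S (%x. FD (%x. h (f x)) x u)" for u
 proof (rule Ck_on_cong[OF assms(1) _ e[of u]])
  fix x assume x: "x \<in> S"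
  have "FD h (f x) (FD f x u) = FD h (f x) (\<Sum>b\<in>Basis. (FD f x u \<bullet> b) *\<^sub>R b)"
   by (simp add: euclidean_representation)
  also have "\<dots> = (\<Sum>b\<in>Basis. (FD f x u \<bullet> b) *\<^sub>R FD h (f x) b)"
   using l[OF x] by (simp add: linear_sum linear_scale)
  finally show "(\<Sum>b\<in>Basis. (FD f x u \<bullet> b) *\<^sub>R FD h (f x) b) = FD (%x. h (f x)) x u"
   by (simp add: FD_eqI[OF d[OF x]])
 qed
 with d show ?case by (auto simp: differentiable_def)
qed

lemma Ck_on_inverse: "Ck_on k {x::real. x \<noteq> 0} (%x. inverse x)"
proof (induction k)
 case 0
 thus ?case by (auto intro!: continuous_intros)
next
 case (Suc k)
 have o: "open {x::real. x \<noteq> 0}" by (simp add: open_Collect_neq)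
 have d: "(inverse has_derivative (%u. - (inverse x * u * inverse x))) (at x)" if "x \<noteq> 0" for x :: real
  using has_derivative_inverse'[OF that] .
 have e: "Ck_on k {x::real. x \<noteq> 0} (%x. - (inverse x * u * inverse x))" for u
  by (intro Ck_on_minus Ck_on_mult o Suc Ck_on_const)
 have "Ck_on k {x::real. x \<noteq> 0} (%x. FD inverse x u)" for u
  by (rule Ck_on_cong[OF o _ e[of u]]) (simp add: FD_eqI[OF d])
 with d show ?case by (auto simp: differentiable_def)
qed

lemma Ck_on_UN:
 assumes "\<And>S. S \<in> F ==> open S" "\<And>S. S \<in> F ==> Ck_on k S f"
 shows "Ck_on k (\<Union>F) f"
 using assms(2)
proof (induction k arbitrary: f)
 case 0
 thus ?case using continuous_on_open_Union[of F f] assms(1) by simp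
qed auto

lemma Ck_on_local:
 assumes "\<And>x. x \<in> S ==> \<exists>T. open T \<and> x \<in> T \<and> Ck_on k T f"
 shows "Ck_on k S f"
proof -
 have "Ck_on k (\<Union>{T. open T \<and> Ck_on k T f}) f" by (rule Ck_on_UN) auto
 moreover have "S \<subseteq> \<Union>{T. open T \<and> Ck_on k T f}" using assms by blast
 ultimately show ?thesis by (rule Ck_on_subset)
qed

lemma smooth_onI: "(\<And>k. Ck_on k S f) ==> smooth_on S f"
 and smooth_onD: "smooth_on S f ==> Ck_on k S f"
 by (auto simp: smooth_on_def)

lemma smooth_on_continuous: "smooth_on S f ==> continuous_on S f"
 by (rule Ck_on_continuous[OF smooth_onD[of S f 0]])

lemma smooth_on_differentiable: "smooth_on S f ==> x \<in> S ==> f differentiable (at x)"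
 using smooth_onD[of S f "Suc 0"] by auto

lemma smooth_on_FD: "smooth_on S f ==> smooth_on S (%x. FD f x u)"
 using smooth_onD[of S f "Suc _"] by (intro smooth_onI) auto

lemma smooth_on_subset: "smooth_on S f ==> T \<subseteq> S ==> smooth_on T f"
 by (auto simp: smooth_on_def intro: Ck_on_subset[of _ S])

lemma smooth_on_cong: "open S ==> (\<And>x. x \<in> S ==> f x = g x) ==> smooth_on S f ==> smooth_on S g"
 by (auto simp: smooth_on_def intro: Ck_on_cong[of S f])

lemma smooth_on_const: "smooth_on S (%x. c)"
 by (simp add: smooth_on_def Ck_on_const)

lemma smooth_on_bounded_linear: "bounded_linear f ==> smooth_on S f"
 by (simp add: smooth_on_def Ck_on_bounded_linear)

lemma smooth_on_id: "smooth_on S (%x. x)"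
 by (simp add: smooth_on_bounded_linear)

lemma smooth_on_arith:
 assumes "open S" "smooth_on S f" "smooth_on S g"
 shows "smooth_on S (%x. f x + g x)" and "smooth_on S (%x. f x - g x)"
 using assms by (auto simp: smooth_on_def intro: Ck_on_add Ck_on_diff)

lemma smooth_on_bilinear:
 assumes "open S" "smooth_on S f" "smooth_on S g" "bounded_bilinear pr"
 shows "smooth_on S (%x. pr (f x) (g x))"
 using assms by (auto simp: smooth_on_def intro: Ck_on_bilinear)

lemmas smooth_on_scaleR = smooth_on_bilinear[OF _ _ _ bounded_bilinear_scaleR]
lemmas smooth_on_inner = smooth_on_bilinear[OF _ _ _ bounded_bilinear_inner]
lemmas smooth_on_mult = smooth_on_bilinear[OF _ _ _ bounded_bilinear_mult]

lemma smooth_on_sum: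
 "open S ==> (\<And>i. i \<in> I ==> smooth_on S (f i)) ==> smooth_on S (%x. \<Sum>i\<in>I. f i x)"
 by (auto simp: smooth_on_def intro: Ck_on_sum)

lemma smooth_on_compose:
 fixes f :: "'x::real_normed_vector => 'y::euclidean_space"
 assumes "open S" "open T" "f ` S \<subseteq> T" "smooth_on S f" "smooth_on T h"
 shows "smooth_on S (%x. h (f x))"
 using assms(4,5) by (auto simp: smooth_on_def intro: Ck_on_compose[OF assms(1-3)])

lemma smooth_on_local:
 assumes "\<And>x. x \<in> S ==> \<exists>T. open T \<and> x \<in> T \<and> smooth_on T f"
 shows "smooth_on S f"
 by (intro smooth_onI Ck_on_local) (use assms in "meson smooth_onD")

lemma line_derivative:
 assumes "f differentiable (at (x + s *\<^sub>R u))"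
 shows "((%s. f (x + s *\<^sub>R u)) has_vector_derivative FD f (x + s *\<^sub>R u) u) (at s within T)"
proof -
 have "((%s. f (x + s *\<^sub>R u)) has_derivative (%r. FD f (x + s *\<^sub>R u) (r *\<^sub>R u))) (at s)"
  by (rule has_derivative_compose[where f = "%s. x + s *\<^sub>R u" and g = f, OF _ has_FD[OF assms]]) (auto intro!: derivative_eq_intros)
 from has_derivative_at_withinI[OF this] show ?thesis
  by (simp add: has_vector_derivative_def linear_scale[OF linear_FD[OF assms]])
qed

lemma line_derivative_real:
 fixes f :: "'x::real_normed_vector => real"
 shows "f differentiable (at (x + s *\<^sub>R u)) ==> ((%s. f (x + s *\<^sub>R u)) has_real_derivative FD f (x + s *\<^sub>R u) u) (at s within T)"
 unfolding has_real_derivative_iff_has_vector_derivative by (rule line_derivative)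

text \<open>Two applications of the mean value theorem: along \<open>u\<close> to the difference in
  direction \<open>v\<close>, then along \<open>v\<close> to the resulting derivative. The left side
  is symmetric in \<open>u\<close> and \<open>v\<close>, which is what the symmetry of second
  derivatives exploits.\<close>

lemma second_difference_mean_value:
 fixes f :: "'x::real_normed_vector => real"
 assumes "Ck_on 2 (ball x d) f" "h > 0" "h * (norm u + norm v) < d"
 shows "\<exists>y\<in>ball x d. f (x + h *\<^sub>R v + h *\<^sub>R u) - f (x + h *\<^sub>R u) - f (x + h *\<^sub>R v) + f x
  = h * h * FD (%y. FD f y u) y v"
proof -
 have C: "\<forall>y\<in>ball x d. f differentiable (at y)" "\<forall>y\<in>ball x d. (%y. FD f y u) differentiable (at y)"
  using assms(1) by (auto simp: numeral_2_eq_2)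
 have b: "x + t *\<^sub>R v + s *\<^sub>R u \<in> ball x d" if "0 \<le> s" "s \<le> h" "0 \<le> t" "t \<le> h" for s t
 proof -
  have "norm (s *\<^sub>R u + t *\<^sub>R v) \<le> s * norm u + t * norm v"
   using that norm_triangle_ineq[of "s *\<^sub>R u" "t *\<^sub>R v"] by simp
  also have "\<dots> \<le> h * norm u + h * norm v" using that by (intro add_mono mult_right_mono) auto
  finally have "norm (s *\<^sub>R u + t *\<^sub>R v) < d" using assms(3) by (simp add: algebra_simps)
  moreover have "dist (x + t *\<^sub>R v + s *\<^sub>R u) x = norm (s *\<^sub>R u + t *\<^sub>R v)" by (simp add: dist_norm algebra_simps)
  ultimately show ?thesis by (simp add: dist_commute)
 qed
 define p where "p s = f (x + h *\<^sub>R v + s *\<^sub>R u) - f (x + s *\<^sub>R u)" for s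
 have "(p has_real_derivative FD f (x + h *\<^sub>R v + s *\<^sub>R u) u - FD f (x + s *\<^sub>R u) u) (at s)"
  if "0 \<le> s" "s \<le> h" for s
  unfolding p_def
  by (intro DERIV_diff line_derivative_real C(1)[rule_format]) (use b[OF that, of h] b[OF that, of 0] assms(2) in auto)
 from MVT2[OF assms(2) this] obtain s where s: "0 < s" "s < h"
  "p h - p 0 = h * (FD f (x + h *\<^sub>R v + s *\<^sub>R u) u - FD f (x + s *\<^sub>R u) u)" by auto
 define q where "q t = FD f (x + s *\<^sub>R u + t *\<^sub>R v) u" for t
 have "(q has_real_derivative FD (%y. FD f y u) (x + s *\<^sub>R u + t *\<^sub>R v) v) (at t)" if "0 \<le> t" "t \<le> h" for t
  unfolding q_def
  by (rule line_derivative_real, rule C(2)[rule_format]) (use b[of s t] that s in "simp add: add_ac")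
 from MVT2[OF assms(2) this] obtain t where t: "0 < t" "t < h"
  "q h - q 0 = h * FD (%y. FD f y u) (x + s *\<^sub>R u + t *\<^sub>R v) v" by auto
 have "p h - p 0 = h * (q h - q 0)" using s by (simp add: q_def add_ac)
 hence "p h - p 0 = h * h * FD (%y. FD f y u) (x + s *\<^sub>R u + t *\<^sub>R v) v" using t(3) by simp
 moreover have "x + s *\<^sub>R u + t *\<^sub>R v \<in> ball x d" using b[of s t] s t by (simp add: add_ac)
 ultimately show ?thesis unfolding p_def by (intro bexI) auto
qed

text \<open>One second difference equals h^2 times either mixed derivative, each at some point of a
  ball on which both mixed derivatives vary by less than half of their supposed gap.\<close>

lemma FD_symmetric_real:
 fixes f :: "'x::real_normed_vector => real"
 assumes "open S" "x \<in> S" "Ck_on 2 S f"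
 shows "FD (%y. FD f y u) x v = FD (%y. FD f y v) x u"
proof (rule ccontr)
 define A where "A = (%y. FD (%y. FD f y u) y v)"
 define B where "B = (%y. FD (%y. FD f y v) y u)"
 assume "\<not> ?thesis"
 hence e: "\<bar>A x - B x\<bar> > 0" by (simp add: A_def B_def)
 define e where "e = \<bar>A x - B x\<bar> / 2"
 have "continuous_on S A" "continuous_on S B" using assms(3) by (auto simp: A_def B_def numeral_2_eq_2)
 hence "isCont A x" "isCont B x" using assms(1,2) continuous_on_eq_continuous_at by blast+
 hence "(A \<longlongrightarrow> A x) (nhds x)" "(B \<longlongrightarrow> B x) (nhds x)"
  by (auto simp: isCont_def tendsto_at_iff_tendsto_nhds)
 moreover have "e > 0" using e by (simp add: e_def)
 ultimately have "\<forall>\<^sub>F y in nhds x. dist (A y) (A x) < e" "\<forall>\<^sub>F y in nhds x. dist (B y) (B x) < e"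
  unfolding tendsto_iff by blast+
 moreover have "\<forall>\<^sub>F y in nhds x. y \<in> S" using assms(1,2) eventually_nhds_in_open by blast
 ultimately have "\<forall>\<^sub>F y in nhds x. dist (A y) (A x) < e \<and> dist (B y) (B x) < e \<and> y \<in> S"
  by eventually_elim auto
 then obtain d where d: "d > 0" "\<And>y. dist y x < d ==> dist (A y) (A x) < e \<and> dist (B y) (B x) < e \<and> y \<in> S"
  unfolding eventually_nhds_metric by auto
 have C: "Ck_on 2 (ball x d) f" by (rule Ck_on_subset[OF assms(3)]) (use d in "auto simp: dist_commute")
 \<comment> \<open>The summand 1 keeps the denominator positive when \<open>u\<close> and
   \<open>v\<close> vanish; halving \<open>d\<close> makes the bound on \<open>h\<close>
   strict.\<close>
 define h where "h = d / 2 / (norm u + norm v + 1)"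
 have np: "norm u + norm v + 1 > 0" by (simp add: add_nonneg_pos)
 have h: "h > 0" using d(1) np by (simp add: h_def)
 have "h * (norm u + norm v) \<le> h * (norm u + norm v + 1)" using h by simp
 also have "\<dots> = d / 2" unfolding h_def using np by (metis nonzero_eq_divide_eq order_less_irrefl)
 also have "\<dots> < d" using d by simp
 finally have h2: "h * (norm u + norm v) < d" .
 obtain y where y: "y \<in> ball x d" 
  "f (x + h *\<^sub>R v + h *\<^sub>R u) - f (x + h *\<^sub>R u) - f (x + h *\<^sub>R v) + f x = h * h * A y"
  using second_difference_mean_value[OF C h h2] unfolding A_def by blast
 obtain z where z: "z \<in> ball x d"
  "f (x + h *\<^sub>R u + h *\<^sub>R v) - f (x + h *\<^sub>R v) - f (x + h *\<^sub>R u) + f x = h * h * B z"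
  using second_difference_mean_value[OF C h, of v u] h2 unfolding B_def add.commute[of "norm v"] by blast
 have "h * h * A y = h * h * B z" unfolding y(2)[symmetric] z(2)[symmetric] by (simp add: algebra_simps)
 hence "A y = B z" using h by simp
 moreover have "dist (A y) (A x) < e" "dist (B z) (B x) < e"
  using d(2) y(1) z(1) by (metis dist_commute mem_ball)+
 ultimately show False unfolding e_def dist_real_def by (smt (verit) field_sum_of_halves)
qed

lemma FD_symmetric:
 fixes f :: "'x::real_normed_vector => 'y::euclidean_space"
 assumes "open S" "x \<in> S" "Ck_on 2 S f"
 shows "FD (%y. FD f y u) x v = FD (%y. FD f y v) x u"
proof (rule euclidean_eqI)
 fix b :: 'y assume "b \<in> Basis"
 have L: "bounded_linear (%y::'y. y \<bullet> b)" by (rule bounded_linear_inner_left)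
 have 1: "FD (%y. f y \<bullet> b) y u = FD f y u \<bullet> b" if "y \<in> S" for y u
  using assms(3) that by (intro fun_cong[OF FD_eqI]) (auto simp: numeral_2_eq_2 intro!: bounded_linear.has_derivative[OF L] has_FD)
 have 2: "FD (%y. FD (%y. f y \<bullet> b) y u) x v = FD (%y. FD f y u) x v \<bullet> b" for u v
 proof -
  have "FD (%y. FD (%y. f y \<bullet> b) y u) x = FD (%y. FD f y u \<bullet> b) x"
   by (rule FD_cong_open[OF assms(1,2)]) (rule 1)
  also have "\<dots> = (%v. FD (%y. FD f y u) x v \<bullet> b)"
   using assms(2,3) by (intro FD_eqI) (auto simp: numeral_2_eq_2 intro!: bounded_linear.has_derivative[OF L] has_FD)
  finally show ?thesis by simp
 qed
 show "FD (%y. FD f y u) x v \<bullet> b = FD (%y. FD f y v) x u \<bullet> b"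
  using FD_symmetric_real[OF assms(1,2) Ck_on_bounded_linear_compose[OF L assms(1,3)], of u v] by (simp add: 2)
qed

section \<open>A smooth step function\<close>

text \<open>The functions t^(-n) exp(-1/t), extended by 0, form a family that differentiation maps
  into its own linear combinations; smoothness of all members is then one induction over the order
  with \<open>n\<close> arbitrary.\<close>

definition exp_inv :: "nat => real => real" where
 "exp_inv n t = (if t > 0 then (1 / t) ^ n * exp (- (1 / t)) else 0)"

lemma exp_inv_tendsto: "(exp_inv n \<longlongrightarrow> 0) (at_right 0)"
proof -
 have "((%x::real. x ^ n / exp x) \<longlongrightarrow> 0) at_top" by (rule tendsto_power_div_exp_0)
 hence "((%t::real. (1/t) ^ n / exp (1/t)) \<longlongrightarrow> 0) (at_right 0)"
  using filterlim_compose[OF _ filterlim_inverse_at_top_right] by (fastforce simp: inverse_eq_divide)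
 thus ?thesis
  by (rule Lim_transform_eventually) (auto simp: eventually_at_filter exp_inv_def exp_minus field_simps)
qed

lemma exp_inv_derivative:
 "(exp_inv n has_derivative (%u. u * (exp_inv (n + 2) t - real n * exp_inv (n + 1) t))) (at t)"
proof -
 consider "t > 0" | "t < 0" | "t = 0" by linarith
 thus ?thesis
 proof cases
  case 1
  have "((%t. (1 / t) ^ n * exp (- (1 / t))) has_real_derivative 
   (exp_inv (n + 2) t - real n * exp_inv (n + 1) t)) (at t)"
  proof -
   have d1: "((%t. 1 / t) has_real_derivative - ((1 / t) ^ 2)) (at t)"
    using 1 by (auto intro!: derivative_eq_intros simp: power2_eq_square)
   have d2: "((%t. exp (- (1 / t))) has_real_derivative exp (- (1 / t)) * (1 / t) ^ 2) (at t)"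
    using DERIV_fun_exp[OF DERIV_minus[OF d1]] by simp
   have n: "real n * (1 / t) ^ (n - Suc 0) * (1 / t) ^ 2 = real n * (1 / t) ^ (n + 1)"
    by (cases n) (auto simp: power2_eq_square)
   show ?thesis by (rule DERIV_cong[OF DERIV_mult[OF DERIV_power[OF d1, of n] d2]])
     (use 1 n in "simp add: exp_inv_def algebra_simps power_add power2_eq_square")
  qed
  hence "(exp_inv n has_real_derivative (exp_inv (n + 2) t - real n * exp_inv (n + 1) t)) (at t)"
   by (rule DERIV_cong_ev[THEN iffD1, OF refl _ refl, rotated])
    (use 1 in \<open>auto simp: exp_inv_def intro: eventually_mono[OF eventually_nhds_in_open[of "{0<..}"]]\<close>)
  thus ?thesis by (simp add: has_field_derivative_def mult_commute_abs)
 next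
  case 2
  have "(exp_inv n has_derivative (%u. 0)) (at t)"
   by (rule has_derivative_transform_within_open[of "%_. 0" _ _ _ "{..<0}"]) (use 2 in "auto simp: exp_inv_def")
  thus ?thesis using 2 by (simp add: exp_inv_def)
 next
  case 3
  have "((%h. exp_inv n h / h) \<longlongrightarrow> 0) (at 0)"
  proof (rule filterlim_split_at)
   show "((%h. exp_inv n h / h) \<longlongrightarrow> 0) (at_left 0)"
    by (rule Lim_transform_eventually[of "%_. 0"]) (auto simp: eventually_at_filter exp_inv_def)
   show "((%h. exp_inv n h / h) \<longlongrightarrow> 0) (at_right 0)"
    by (rule Lim_transform_eventually[OF exp_inv_tendsto[of "Suc n"]]) 
     (auto simp: eventually_at_filter exp_inv_def)
  qed
  hence "(exp_inv n has_real_derivative 0) (at 0)" by (simp add: DERIV_def exp_inv_def)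
  hence "(exp_inv n has_derivative (%u. 0 * u)) (at 0)" by (simp only: has_field_derivative_def)
  thus ?thesis using 3 by (simp add: exp_inv_def)
 qed
qed

lemma smooth_on_exp_inv: "smooth_on UNIV (exp_inv n)"
proof (rule smooth_onI)
 show "Ck_on k UNIV (exp_inv n)" for k
 proof (induction k arbitrary: n)
  case 0
  thus ?case
   using has_derivative_continuous[OF exp_inv_derivative] by (simp add: continuous_on_eq_continuous_at)
 next
  case (Suc k)
  have "Ck_on k UNIV (%t. FD (exp_inv n) t u)" for u unfolding FD_eqI[OF exp_inv_derivative]
   by (intro Ck_on_mult Ck_on_diff Ck_on_const Suc) auto
  thus ?case using exp_inv_derivative by (auto simp: differentiable_def)
 qed
qed

definition smooth_step :: "real => real" where
 "smooth_step t = exp_inv 0 t * inverse (exp_inv 0 t + exp_inv 0 (1 - t))"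

text \<open>At least one of \<open>t\<close> and \<open>1 - t\<close> is positive, so the
  denominator of \<open>smooth_step\<close> never vanishes.\<close>

lemma exp_inv_sum_pos: "exp_inv 0 t + exp_inv 0 (1 - t) > 0"
 by (auto simp: exp_inv_def add_pos_pos)

lemma smooth_step_0: "t \<le> 0 ==> smooth_step t = 0"
 and smooth_step_1: "t \<ge> 1 ==> smooth_step t = 1"
 and smooth_step_bounds: "0 \<le> smooth_step t" "smooth_step t \<le> 1"
proof -
 show "t \<le> 0 ==> smooth_step t = 0" "t \<ge> 1 ==> smooth_step t = 1"
  using exp_inv_sum_pos[of t] by (auto simp: smooth_step_def exp_inv_def)
 have "exp_inv 0 t \<ge> 0" "exp_inv 0 (1 - t) \<ge> 0" by (auto simp: exp_inv_def)
 thus "0 \<le> smooth_step t" "smooth_step t \<le> 1"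
  using exp_inv_sum_pos[of t] by (simp_all add: smooth_step_def divide_inverse[symmetric])
qed

lemma smooth_on_smooth_step: "smooth_on UNIV smooth_step"
proof -
 have 1: "smooth_on UNIV (%t. exp_inv 0 (1 - t))"
  by (rule smooth_on_compose[where T=UNIV and h="exp_inv 0"])
   (auto intro!: smooth_on_exp_inv smooth_on_arith smooth_on_const smooth_on_id)
 have o: "open {x::real. x \<noteq> 0}" by (simp add: open_Collect_neq)
 have 2: "smooth_on UNIV (%t. inverse (exp_inv 0 t + exp_inv 0 (1 - t)))"
  by (rule smooth_on_compose[where T="{x. x \<noteq> 0}" and h=inverse, OF _ o])
   (use exp_inv_sum_pos in "auto intro!: smooth_on_arith 1 smooth_on_exp_inv smooth_onI[OF Ck_on_inverse] 
    simp: less_imp_neq[symmetric]")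
 show ?thesis unfolding smooth_step_def[abs_def] by (rule smooth_on_mult[OF _ smooth_on_exp_inv 2]) simp
qed

section \<open>Exterior calculus in Euclidean space\<close>

section \<open>Alternating forms on Euclidean spaces\<close>

definition del_nth :: "nat => 'b list => 'b list" where
 "del_nth i xs = take i xs @ drop (Suc i) xs"

lemma del_nth_simps [simp]:
 "del_nth 0 (x # xs) = xs" "del_nth (Suc i) (x # xs) = x # del_nth i xs"
 by (auto simp: del_nth_def)

lemma length_del_nth [simp]: "i < length xs ==> length (del_nth i xs) = length xs - 1"
 by (auto simp: del_nth_def)

lemma set_del_nth: "set (del_nth i xs) \<subseteq> set xs"
 unfolding del_nth_def using set_take_subset[of i xs] set_drop_subset[of "Suc i" xs] by auto

lemma map_del_nth: "map f (del_nth i xs) = del_nth i (map f xs)"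
 by (simp add: del_nth_def take_map drop_map)

definition multilin :: "nat => ('w::real_vector list => real) => bool" where
 "multilin k a \<longleftrightarrow> (\<forall>xs ys. length xs + length ys + 1 = k --> linear (%w. a (xs @ w # ys)))"

text \<open>Only repetitions in adjacent places are excluded, a condition that survives fixing the
  first argument; arbitrary repetitions follow in \<open>alt_form_repeat\<close>.\<close>

definition alt_form :: "nat => ('w::real_vector list => real) => bool" where
 "alt_form k a \<longleftrightarrow> multilin k a \<and> (\<forall>xs w ys. length xs + length ys + 2 = k --> a (xs @ w # w # ys) = 0)"

lemma alt_form_multilin: "alt_form k a ==> multilin k a"
 by (simp add: alt_form_def)

lemma multilin_append:
 fixes a :: "'w::real_vector list => real"
 shows "multilin (length xs + k) a ==> multilin k (%ws. a (xs @ ws))"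
 unfolding multilin_def
proof (intro allI impI)
 fix ys zs :: "'w list" assume *: "\<forall>us vs. length us + length vs + 1 = length xs + k --> linear (%w. a (us @ w # vs))"
  and l: "length ys + length zs + 1 = k"
 show "linear (%w. a (xs @ ys @ w # zs))" using *[rule_format, of "xs @ ys" zs] l by simp
qed

lemma alt_form_append:
 fixes a :: "'w::real_vector list => real"
 shows "alt_form (length xs + k) a ==> alt_form k (%ws. a (xs @ ws))"
 unfolding alt_form_def
proof (intro conjI allI impI)
 fix ys zs :: "'w list" and w assume *: "multilin (length xs + k) a \<and> 
   (\<forall>us w vs. length us + length vs + 2 = length xs + k --> a (us @ w # w # vs) = 0)"
  and l: "length ys + length zs + 2 = k"
 show "a (xs @ ys @ w # w # zs) = 0" using *[THEN conjunct2, rule_format, of "xs @ ys" zs w] l by simp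
qed (simp add: multilin_append)

lemma multilin_Cons: "multilin (Suc k) a ==> multilin k (%ws. a (w # ws))"
 using multilin_append[of "[w]" k a] by simp

lemma alt_form_Cons: "alt_form (Suc k) a ==> alt_form k (%ws. a (w # ws))"
 using alt_form_append[of "[w]" k a] by simp

lemma multilin_linear: "multilin k a ==> length xs + length ys + 1 = k ==> linear (%w. a (xs @ w # ys))"
 by (simp add: multilin_def)

lemma multilin_linear_Cons: "multilin (Suc k) a ==> length ws = k ==> linear (%w. a (w # ws))"
 using multilin_linear[of "Suc k" a "[]" ws] by simp

text \<open>Polarisation: expand the vanishing value with \<open>x + y\<close> in both
  places.\<close>

lemma alt_form_swap:
 assumes "alt_form k a" "length xs + length ys + 2 = k"
 shows "a (xs @ x # y # ys) = - a (xs @ y # x # ys)"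
proof -
 have z: "a (xs @ w # w # ys) = 0" for w using assms by (simp add: alt_form_def)
 have 1: "linear (%w. a (xs @ w # v # ys))" for v
  using multilin_linear[OF alt_form_multilin[OF assms(1)], of xs "v # ys"] assms(2) by simp
 have 2: "linear (%w. a (xs @ v # w # ys))" for v
  using multilin_linear[OF alt_form_multilin[OF assms(1)], of "xs @ [v]" "ys"] assms(2) by simp
 have "0 = a (xs @ (x + y) # (x + y) # ys)" by (simp add: z)
 also have "\<dots> = a (xs @ x # x # ys) + a (xs @ x # y # ys) + (a (xs @ y # x # ys) + a (xs @ y # y # ys))"
  by (simp add: linear_add[OF 1] linear_add[OF 2])
 finally show ?thesis by (simp add: z)
qed

lemma alt_form_move_front:
 assumes "alt_form k a" "length xs + length ys + 1 = k"
 shows "a (xs @ c # ys) = (-1) ^ length xs * a (c # xs @ ys)"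
 using assms(2)
proof (induction xs arbitrary: ys rule: rev_induct)
 case (snoc x xs)
 have "a ((xs @ [x]) @ c # ys) = - a (xs @ c # x # ys)"
  using alt_form_swap[OF assms(1), of xs ys x c] snoc.prems by simp
 thus ?case using snoc.IH[of "x # ys"] snoc.prems by simp
qed simp

lemma alt_form_repeat:
 assumes "alt_form k a" "length xs + length zs + length ys + 2 = k"
 shows "a (xs @ w # zs @ w # ys) = 0"
proof -
 have A: "alt_form (k - length xs - 1) (%l. a ((xs @ [w]) @ l))"
  by (rule alt_form_append) (use assms in simp)
 have "a ((xs @ [w]) @ zs @ w # ys) = (-1) ^ length zs * a ((xs @ [w]) @ w # zs @ ys)"
  by (rule alt_form_move_front[OF A]) (use assms(2) in simp)
 thus ?thesis using assms unfolding alt_form_def by simp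
qed

lemma alt_form_nth_eq_0:
 assumes "alt_form k a" "length ws = k" "i < k" "j < k" "i \<noteq> j" "ws ! i = ws ! j"
 shows "a ws = 0"
proof -
 have *: "a ws = 0" if "i < j" "j < k" "ws ! i = ws ! j" for i j
 proof -
  have 1: "ws = take i ws @ ws ! i # drop (Suc i) ws"
   by (rule id_take_nth_drop) (use that assms(2) in simp)
  have "drop (Suc i) ws = take (j - Suc i) (drop (Suc i) ws) @ drop (Suc i) ws ! (j - Suc i)
    # drop (Suc (j - Suc i)) (drop (Suc i) ws)"
   by (rule id_take_nth_drop) (use that assms(2) in simp)
  hence 2: "drop (Suc i) ws = take (j - Suc i) (drop (Suc i) ws) @ ws ! i # drop (Suc j) ws"
   using that assms(2) by (simp del: append_take_drop_id)
  have "a ws = a (take i ws @ ws ! i # take (j - Suc i) (drop (Suc i) ws) @ ws ! i # drop (Suc j) ws)"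
   by (subst 2[symmetric]) (rule arg_cong[OF 1])
  also have "\<dots> = 0" by (rule alt_form_repeat[OF assms(1)]) (use that assms(2) in simp)
  finally show ?thesis .
 qed
 show ?thesis using *[of i j] *[of j i] assms by (cases "i < j") auto
qed

text \<open>This sign rule is the bookkeeping behind both the cancellation of second derivatives in
  pull-backs and the count of terms in the homotopy formula.\<close>

lemma alt_form_update_move:
 assumes "alt_form k a" "length ws = k" "j < k"
 shows "a (ws[j := c]) = (-1) ^ j * a (c # del_nth j ws)"
 using alt_form_move_front[OF assms(1), of "take j ws" "drop (Suc j) ws" c] assms(2,3)
 by (simp add: upd_conv_take_nth_drop del_nth_def)

lemma multilin_zero: "multilin k a ==> length ws = k ==> 0 \<in> set ws ==> a ws = 0"
proof -
 assume a: "multilin k a" "length ws = k" "0 \<in> set ws"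
 obtain xs ys where ws: "ws = xs @ 0 # ys" using split_list[OF a(3)] by blast
 have "linear (%w. a (xs @ w # ys))" by (rule multilin_linear[OF a(1)]) (use ws a(2) in simp)
 hence "a (xs @ 0 # ys) = 0" by (rule linear_0)
 thus "a ws = 0" unfolding ws .
qed

lemma linear_euclidean_sum:
 fixes f :: "'w::euclidean_space => real"
 assumes "linear f"
 shows "f w = (\<Sum>b\<in>Basis. (w \<bullet> b) * f b)"
proof -
 have "f w = f (\<Sum>b\<in>Basis. (w \<bullet> b) *\<^sub>R b)" by (simp add: euclidean_representation)
 also have "\<dots> = (\<Sum>b\<in>Basis. (w \<bullet> b) * f b)"
  unfolding linear_sum[OF assms] linear_scale[OF assms] by simp
 finally show ?thesis .
qed

lemma multilin_expand:
 fixes a :: "'w::euclidean_space list => real"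
 assumes "multilin (Suc k) a" "length ws = k"
 shows "a (w # ws) = (\<Sum>b\<in>Basis. (w \<bullet> b) * a (b # ws))"
 by (rule linear_euclidean_sum[OF multilin_linear_Cons[OF assms]])

text \<open>Expanding every argument in the basis gives a finite sum of products of coordinates and
  values on basis vectors. The predicate \<open>Q\<close> stands for continuity,
  \<open>Ck_on\<close> or measurability; \<open>cong\<close> enters because the expansion is an
  identity on \<open>S\<close> only.\<close>

lemma multilin_regularity:
 fixes a :: "'w::euclidean_space list => 's => real"
 assumes mult: "\<And>f g. Q f ==> Q g ==> Q (%s. f s * g s)"
  and sum: "\<And>F. (\<And>b::'w. b \<in> Basis ==> Q (F b)) ==> Q (%s. \<Sum>b\<in>Basis. F b s)"
  and cong: "\<And>f g. Q f ==> (\<And>s. s \<in> S ==> f s = g s) ==> Q g"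
  and "\<And>s. s \<in> S ==> multilin (length Ws) (%ws. a ws s)"
  and "\<And>W b. W \<in> set Ws ==> b \<in> Basis ==> Q (%s. W s \<bullet> b)"
  and "\<And>ws. length ws = length Ws ==> set ws \<subseteq> Basis ==> Q (a ws)"
 shows "Q (%s. a (map (%W. W s) Ws) s)"
 using assms(4-6)
proof (induction Ws arbitrary: a)
 case (Cons W Ws)
 have "Q (%s. \<Sum>b\<in>Basis. (W s \<bullet> b) * a (b # map (%W. W s) Ws) s)"
 proof (intro sum mult)
  fix b :: 'w assume b: "b \<in> Basis"
  show "Q (%s. W s \<bullet> b)" using Cons.prems(2)[of W b] b by simp
  show "Q (%s. a (b # map (%W. W s) Ws) s)"
  proof (rule Cons.IH[of "%ws. a (b # ws)"])
   show "multilin (length Ws) (%ws. a (b # ws) s)" if "s \<in> S" for s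
    using multilin_Cons[of "length Ws" "%ws. a ws s"] Cons.prems(1)[OF that] by simp
  qed (use Cons.prems b in auto)
 qed
 thus ?case
 proof (rule cong)
  fix s assume "s \<in> S"
  thus "(\<Sum>b\<in>Basis. (W s \<bullet> b) * a (b # map (%W. W s) Ws) s) = a (map (%W. W s) (W # Ws)) s"
   using multilin_expand[of "length Ws" "%ws. a ws s" "map (%W. W s) Ws" "W s"] Cons.prems(1)[of s] by simp
 qed
qed simp

lemma multilin_continuous_on:
 fixes a :: "'w::euclidean_space list => 's::topological_space => real"
 assumes "\<And>s. s \<in> S ==> multilin (length Ws) (%ws. a ws s)"
  and "\<And>W. W \<in> set Ws ==> continuous_on S W"
  and "\<And>ws. length ws = length Ws ==> set ws \<subseteq> Basis ==> continuous_on S (a ws)"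
 shows "continuous_on S (%s. a (map (%W. W s) Ws) s)"
 by (rule multilin_regularity[where Q="continuous_on S" and S=S])
  (use assms in "auto intro: continuous_on_mult continuous_on_sum continuous_on_inner cong: continuous_on_cong")

lemma multilin_Ck_on:
 fixes a :: "'w::euclidean_space list => 's::real_normed_vector => real"
 assumes "open S" "\<And>s. s \<in> S ==> multilin (length Ws) (%ws. a ws s)"
  and "\<And>W. W \<in> set Ws ==> Ck_on k S W"
  and "\<And>ws. length ws = length Ws ==> set ws \<subseteq> Basis ==> Ck_on k S (a ws)"
 shows "Ck_on k S (%s. a (map (%W. W s) Ws) s)"
proof (rule multilin_regularity[where Q="Ck_on k S" and S=S])
 show "Ck_on k S g" if "Ck_on k S f" "\<And>s. s \<in> S ==> f s = g s" for f g :: "'s => real"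
  using Ck_on_cong[OF assms(1)] that by blast
qed (use assms in "auto intro: Ck_on_mult Ck_on_sum Ck_on_inner Ck_on_const")

section \<open>The exterior derivative on Euclidean spaces\<close>

text \<open>The invariant formula for the exterior derivative on constant vector fields, whose Lie
  brackets vanish. In a chart it agrees with \<open>ext_deriv\<close>.\<close>

definition ed :: "('v::real_normed_vector list => 'v => real) => 'v list => 'v => real" where
 "ed a us y = (\<Sum>i<length us. (-1) ^ i * FD (a (del_nth i us)) y (us ! i))"

lemma ed_Nil [simp]: "ed a [] y = 0"
 by (simp add: ed_def)

text \<open>Cartan's formula for the constant vector field \<^term>\<open>v\<close>.\<close>

lemma ed_Cons: "ed a (v # us) y = FD (a us) y v - ed (%l. a (v # l)) us y"
 by (simp add: ed_def sum.lessThan_Suc_shift sum_negf del: sum.lessThan_Suc)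

lemma FD_minus: "f differentiable (at x) ==> g differentiable (at x) ==>
  FD (%y. f y - g y) x u = FD f x u - FD g x u"
 by (subst FD_eqI[OF has_derivative_diff[OF has_FD has_FD]]) auto

lemma FD_sum_scale:
 fixes f :: "'i => 'v::real_normed_vector => real"
 assumes "\<And>i. i \<in> I ==> f i differentiable (at x)"
 shows "(%y. \<Sum>i\<in>I. c i * f i y) differentiable (at x)"
  "FD (%y. \<Sum>i\<in>I. c i * f i y) x u = (\<Sum>i\<in>I. c i * FD (f i) x u)"
proof -
 have d: "((%y. \<Sum>i\<in>I. c i * f i y) has_derivative (%u. \<Sum>i\<in>I. c i * FD (f i) x u)) (at x)"
  by (intro has_derivative_sum has_derivative_mult_right has_FD assms)
 thus "(%y. \<Sum>i\<in>I. c i * f i y) differentiable (at x)" by (auto simp: differentiable_def)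
 show "FD (%y. \<Sum>i\<in>I. c i * f i y) x u = (\<Sum>i\<in>I. c i * FD (f i) x u)" by (simp add: FD_eqI[OF d])
qed

lemma ed_cong_open:
 assumes "open S" "x \<in> S" "\<And>l y. y \<in> S ==> Suc (length l) = length us ==> a l y = b l y"
 shows "ed a us x = ed b us x"
 unfolding ed_def
proof (rule sum.cong)
 fix i assume "i \<in> {..<length us}"
 hence "FD (a (del_nth i us)) x = FD (b (del_nth i us)) x"
  by (intro FD_cong_open[OF assms(1,2)] assms(3)) auto
 thus "(-1) ^ i * FD (a (del_nth i us)) x (us ! i) = (-1) ^ i * FD (b (del_nth i us)) x (us ! i)" by simp
qed simp

text \<open>Induction along Cartan's formula: splitting off the first vector \<open>v\<close>
  produces \<open>ed\<close> of the derivative along \<open>v\<close> twice with opposite signs,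
  because derivatives along constant vectors commute with \<open>ed\<close>. The remaining term is
  covered by the induction hypothesis.\<close>

lemma ed_ed:
 fixes a :: "'v::real_normed_vector list => 'v => real"
 assumes "open S" "x \<in> S" "\<And>l. length l + 2 = length us ==> Ck_on 2 S (a l)"
 shows "ed (ed a) us x = 0"
 using assms(3)
proof (induction us arbitrary: a)
 case (Cons v us)
 have C1: "a l differentiable (at y)" if "Suc (length l) = length us" "y \<in> S" for l y
  using Cons.prems[of l] that by (simp add: numeral_2_eq_2)
 have C2: "(%z. FD (a l) z u) differentiable (at y)" if "Suc (length l) = length us" "y \<in> S" for l y u
  using Cons.prems[of l] that by (simp add: numeral_2_eq_2)
 have e1: "FD (ed a us) x v = ed (%l y. FD (a l) y v) us x"
 proof -
  have "FD (ed a us) x v = FD (%y. \<Sum>i<length us. (-1) ^ i * FD (a (del_nth i us)) y (us ! i)) x v"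
   unfolding ed_def[abs_def] ..
  also have "\<dots> = (\<Sum>i<length us. (-1) ^ i * FD (%y. FD (a (del_nth i us)) y (us ! i)) x v)"
   by (rule FD_sum_scale(2)) (use C2 assms(2) in auto)
  also have "\<dots> = (\<Sum>i<length us. (-1) ^ i * FD (%y. FD (a (del_nth i us)) y v) x (us ! i))"
  proof (rule sum.cong)
   fix i assume "i \<in> {..<length us}"
   hence "Ck_on 2 S (a (del_nth i us))" by (intro Cons.prems) auto
   thus "(-1) ^ i * FD (%y. FD (a (del_nth i us)) y (us ! i)) x v
     = (-1) ^ i * FD (%y. FD (a (del_nth i us)) y v) x (us ! i)"
    using FD_symmetric_real[OF assms(1,2)] by simp
  qed simp
  finally show ?thesis by (simp add: ed_def)
 qed
 have e2: "ed (%l. ed a (v # l)) us x = ed (%l y. FD (a l) y v) us x - ed (ed (%l. a (v # l))) us x"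
 proof -
  have "FD (ed a (v # l)) x u = FD (%y. FD (a l) y v) x u - FD (ed (%l. a (v # l)) l) x u"
   if l: "Suc (length l) = length us" for l u
  proof -
   have "ed (%l. a (v # l)) l = (%y. \<Sum>i<length l. (-1) ^ i * FD (a (v # del_nth i l)) y (l ! i))"
    by (rule ext) (simp add: ed_def)
   moreover have "(%y. \<Sum>i<length l. (-1) ^ i * FD (a (v # del_nth i l)) y (l ! i)) differentiable (at x)"
   proof (rule FD_sum_scale(1))
    fix i assume "i \<in> {..<length l}"
    hence "length (v # del_nth i l) + 1 = length us" using l by auto
    thus "(%y. FD (a (v # del_nth i l)) y (l ! i)) differentiable at x" using C2 assms(2) by simp
   qed
   ultimately have "ed (%l. a (v # l)) l differentiable (at x)" by simp
   moreover have "ed a (v # l) = (%y. FD (a l) y v - ed (%l. a (v # l)) l y)"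
    by (rule ext) (rule ed_Cons)
   ultimately show ?thesis using FD_minus[OF C2[OF l assms(2)]] by simp
  qed
  thus ?thesis unfolding ed_def[of _ us] by (simp add: sum_subtractf[symmetric] right_diff_distrib)
 qed
 have "ed (ed (%l. a (v # l))) us x = 0" by (rule Cons.IH) (use Cons.prems in simp)
 thus ?case by (simp add: ed_Cons[of "ed a"] e1 e2)
qed simp

text \<open>Cartan's formula splits off the first argument: linearity in it comes from linearity of
  the derivative and of the coefficients, linearity in the others from the induction hypothesis for
  the form with the first argument fixed.\<close>

lemma alt_form_ed:
 fixes a :: "'v::real_normed_vector list => 'v => real"
 assumes "open S" "x \<in> S" "\<And>y. y \<in> S ==> alt_form k (%us. a us y)"
  and "\<And>us. length us = k ==> a us differentiable (at x)"
 shows "alt_form (Suc k) (%us. ed a us x)"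
proof -
 have "multilin (Suc k) (%us. ed a us x) \<and> 
  (\<forall>xs w ys. length xs + length ys + 2 = Suc k --> ed a (xs @ w # w # ys) x = 0)"
  if "\<forall>y\<in>S. alt_form k (%us. a us y)" "\<forall>us. length us = k --> a us differentiable (at x)" for k and a :: "'v list => 'v => real"
  using that
 proof (induction k arbitrary: a)
  case 0
  thus ?case using linear_FD[of "a []" x] by (auto simp: multilin_def ed_Cons)
 next
  case (Suc k)
  have IH: "multilin (Suc k) (%us. ed (%l. a (v # l)) us x)"
   "\<forall>xs w ys. length xs + length ys + 2 = Suc k --> ed (%l. a (v # l)) (xs @ w # w # ys) x = 0" for v
  proof -
   have "\<forall>y\<in>S. alt_form k (%us. a (v # us) y)"
    using Suc.prems(1) alt_form_Cons[of k "%us. a us _" v] by blast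
   moreover have "\<forall>us. length us = k --> a (v # us) differentiable (at x)"
    using Suc.prems(2) by simp
   ultimately show "multilin (Suc k) (%us. ed (%l. a (v # l)) us x)"
    "\<forall>xs w ys. length xs + length ys + 2 = Suc k --> ed (%l. a (v # l)) (xs @ w # w # ys) x = 0"
    using Suc.IH[of "%l. a (v # l)"] by blast+
  qed
  have lin1: "linear (%w. FD (a (xs @ w # ys)) x v)" if l: "length xs + length ys + 1 = Suc k" for xs ys v
  proof (rule linearI)
   have L: "linear (%w. a (xs @ w # ys) y)" if "y \<in> S" for y
    using Suc.prems(1) that l alt_form_multilin multilin_linear[of "Suc k" "%us. a us y" xs ys] by blast
   have D: "a (xs @ w # ys) differentiable (at x)" for w using Suc.prems(2) l by simp
   show "FD (a (xs @ (w + w') # ys)) x v = FD (a (xs @ w # ys)) x v + FD (a (xs @ w' # ys)) x v" for w w'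
   proof -
    have "FD (a (xs @ (w + w') # ys)) x = FD (%y. a (xs @ w # ys) y + a (xs @ w' # ys) y) x"
     by (rule FD_cong_open[OF assms(1,2)]) (simp add: linear_add[OF L])
    also have "\<dots> = (%v. FD (a (xs @ w # ys)) x v + FD (a (xs @ w' # ys)) x v)"
     by (intro FD_eqI has_derivative_add has_FD D)
    finally show ?thesis by simp
   qed
   show "FD (a (xs @ (c *\<^sub>R w) # ys)) x v = c *\<^sub>R FD (a (xs @ w # ys)) x v" for c w
   proof -
    have "FD (a (xs @ (c *\<^sub>R w) # ys)) x = FD (%y. c * a (xs @ w # ys) y) x"
     by (rule FD_cong_open[OF assms(1,2)]) (simp add: linear_scale[OF L])
    also have "\<dots> = (%v. c * FD (a (xs @ w # ys)) x v)"
     by (intro FD_eqI has_derivative_mult_right has_FD D)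
    finally show ?thesis by simp
   qed
  qed
  have lin2: "linear (%w. ed (%l. a (w # l)) us x)" if l: "length us = Suc k" for us
  proof -
   have "linear (%w. FD (a (w # del_nth i us)) x (us ! i))" if "i < length us" for i
    using lin1[of "[]" "del_nth i us"] l that by simp
   hence "linear (%w. \<Sum>i<length us. (-1) ^ i *\<^sub>R FD (a (w # del_nth i us)) x (us ! i))"
    by (intro linear_compose_sum ballI linear_compose_scale_right) auto
   thus ?thesis by (simp add: ed_def)
  qed
  have m: "multilin (Suc (Suc k)) (%us. ed a us x)" unfolding multilin_def
  proof (intro allI impI)
   fix xs ys :: "'v list" assume l: "length xs + length ys + 1 = Suc (Suc k)"
   show "linear (%w. ed a (xs @ w # ys) x)"
   proof (cases xs)
    case Nil
    have "linear (%w. FD (a ys) x w - ed (%l. a (w # l)) ys x)"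
     using l Nil Suc.prems(2) by (intro linear_compose_sub lin2 linear_FD) auto
    thus ?thesis by (simp add: Nil ed_Cons)
   next
    case (Cons v xs')
    have "linear (%w. FD (a (xs' @ w # ys)) x v - ed (%l. a (v # l)) (xs' @ w # ys) x)"
     using l Cons by (intro linear_compose_sub lin1 multilin_linear[OF IH(1)]) auto
    thus ?thesis by (simp add: Cons ed_Cons)
   qed
  qed
  have "ed a (xs @ w # w # ys) x = 0" if l: "length xs + length ys + 2 = Suc (Suc k)" for xs w ys
  proof (cases xs)
   case Nil
   \<comment> \<open>For equal first two vectors, two applications of Cartan's formula cancel the
     derivative terms and leave \<open>ed\<close> of a form with \<open>w\<close> inserted twice,
     whose coefficients vanish.\<close>
   have "ed (%l. a (w # w # l)) ys x = ed (%l y. 0) ys x"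
   proof (rule ed_cong_open[OF assms(1,2)])
    fix z :: "'v list" and y assume "y \<in> S" "Suc (length z) = length ys"
    hence "alt_form (Suc k) (%us. a us y)" "Suc (length z) = k" using Suc.prems(1) l Nil by auto
    thus "a (w # w # z) y = 0" using alt_form_nth_eq_0[of "Suc k" "%us. a us y" "w # w # z" 0 1] by auto
   qed
   thus ?thesis by (simp add: Nil ed_Cons) (simp add: ed_def)
  next
   case (Cons v xs')
   have "FD (a (xs' @ w # w # ys)) x = FD (%y. 0) x"
    by (rule FD_cong_open[OF assms(1,2)]) (use Suc.prems(1) l Cons in "auto simp: alt_form_def")
   thus ?thesis using IH(2)[of v] l Cons by (simp add: ed_Cons)
  qed
  with m show ?case by blast
 qed
 thus ?thesis unfolding alt_form_def[of "Suc k"] using assms(3,4) by blast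
qed

section \<open>Pull-back by maps of class C2\<close>

text \<open>Expanding the first argument in the basis leaves products of real functions, so the
  ordinary product rule and induction over the arguments suffice.\<close>

lemma multilin_has_derivative:
 fixes a :: "'w::euclidean_space list => 'v::real_normed_vector => real"
 assumes "open S" "x \<in> S" "\<And>s. s \<in> S ==> multilin (length Ws) (%ws. a ws s)"
  and "\<And>W. W \<in> set Ws ==> W differentiable (at x)"
  and "\<And>ws. length ws = length Ws ==> a ws differentiable (at x)"
 shows "((%s. a (map (%W. W s) Ws) s) has_derivative
  (%u. FD (a (map (%W. W x) Ws)) x u +
   (\<Sum>j<length Ws. a ((map (%W. W x) Ws)[j := FD (Ws ! j) x u]) x))) (at x)"
 using assms(3-5)
proof (induction Ws arbitrary: a)
 case Nil
 thus ?case using has_FD[of "a []" x] by simp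
next
 case (Cons W Ws)
 let ?ws = "map (%W. W x) Ws"
 have ml: "multilin (length Ws) (%ws. a (b # ws) s)" if "s \<in> S" for b s
  using multilin_Cons[of "length Ws" "%ws. a ws s"] Cons.prems(1)[OF that] by simp
 have ex: "a (w # ws) s = (\<Sum>b\<in>Basis. (w \<bullet> b) * a (b # ws) s)" if "s \<in> S" "length ws = length Ws" for w ws s
  using multilin_expand[of "length Ws" "%ws. a ws s"] Cons.prems(1)[OF that(1)] that(2) by simp
 have IH: "((%s. a (b # map (%W. W s) Ws) s) has_derivative
  (%u. FD (a (b # ?ws)) x u + (\<Sum>j<length Ws. a (b # ?ws[j := FD (Ws ! j) x u]) x))) (at x)" for b
  by (rule Cons.IH[of "%ws. a (b # ws)"]) (use Cons.prems ml in auto)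
 have W: "((%s. W s \<bullet> b) has_derivative (%u. FD W x u \<bullet> b)) (at x)" for b
  using has_FD[of W x] Cons.prems(2) by (intro has_derivative_inner_left) auto
 have d: "((%s. \<Sum>b\<in>Basis. (W s \<bullet> b) * a (b # map (%W. W s) Ws) s) has_derivative
  (%u. \<Sum>b\<in>Basis. (W x \<bullet> b) * (FD (a (b # ?ws)) x u + (\<Sum>j<length Ws. a (b # ?ws[j := FD (Ws ! j) x u]) x))
   + (FD W x u \<bullet> b) * a (b # ?ws) x)) (at x)"
  by (intro has_derivative_sum has_derivative_mult W IH)
 have eq: "(\<Sum>b\<in>Basis. (W x \<bullet> b) * (FD (a (b # ?ws)) x u + (\<Sum>j<length Ws. a (b # ?ws[j := FD (Ws ! j) x u]) x))
   + (FD W x u \<bullet> b) * a (b # ?ws) x)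
  = FD (a (W x # ?ws)) x u + (\<Sum>j<length (W # Ws). a ((W x # ?ws)[j := FD ((W # Ws) ! j) x u]) x)" for u
 proof -
  have "FD (a (W x # ?ws)) x = FD (%s. \<Sum>b\<in>Basis. (W x \<bullet> b) * a (b # ?ws) s) x"
   by (rule FD_cong_open[OF assms(1,2)]) (simp add: ex)
  hence 1: "FD (a (W x # ?ws)) x u = (\<Sum>b\<in>Basis. (W x \<bullet> b) * FD (a (b # ?ws)) x u)"
   using FD_sum_scale(2)[of Basis "%b. a (b # ?ws)" x "%b. W x \<bullet> b" u] Cons.prems(3) by simp
  have 2: "a (FD W x u # ?ws) x = (\<Sum>b\<in>Basis. (FD W x u \<bullet> b) * a (b # ?ws) x)"
   by (rule ex[OF assms(2)]) simp
  have 3: "a (W x # ?ws[j := c]) x = (\<Sum>b\<in>Basis. (W x \<bullet> b) * a (b # ?ws[j := c]) x)" for j c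
   by (rule ex[OF assms(2)]) simp
  have 4: "(\<Sum>j<length Ws. \<Sum>b\<in>Basis. (W x \<bullet> b) * a (b # ?ws[j := FD (Ws ! j) x u]) x)
   = (\<Sum>b\<in>Basis. (W x \<bullet> b) * (\<Sum>j<length Ws. a (b # ?ws[j := FD (Ws ! j) x u]) x))"
   by (subst sum.swap) (simp add: sum_distrib_left)
  show ?thesis
   by (simp add: sum.lessThan_Suc_shift 1 2 3 4 sum.distrib distrib_left del: sum.lessThan_Suc)
 qed
 show ?case
 proof (rule has_derivative_transform_within_open[OF _ assms(1,2)])
  show "((%s. \<Sum>b\<in>Basis. (W s \<bullet> b) * a (b # map (%W. W s) Ws) s) has_derivative
   (%u. FD (a (map (%W. W x) (W # Ws))) x u + 
    (\<Sum>j<length (W # Ws). a ((map (%W. W x) (W # Ws))[j := FD ((W # Ws) ! j) x u]) x))) (at x)"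
   using d unfolding eq by simp
 qed (simp add: ex)
qed

text \<open>Second derivatives of a map are symmetric in their two directions and are paired here
  with an alternating form. In the induction, the terms with the first vector as direction of
  differentiation cancel those in which the slot of the first vector has been replaced.\<close>

lemma alt_form_symmetric_cancel:
 assumes "alt_form k b" "length us = Suc k" "\<And>u v. C u v = C v u"
 shows "(\<Sum>i<length us. (-1) ^ i * (\<Sum>j<k. b ((map L (del_nth i us))[j := C (us ! i) (del_nth i us ! j)]))) = 0"
 using assms(1,2)
proof (induction us arbitrary: k b)
 case (Cons v us)
 let ?F = "%i. \<Sum>j<k. b ((map L (del_nth i (v # us)))[j := C ((v # us) ! i) (del_nth i (v # us) ! j)])"
 let ?G = "%i. b (C (us ! i) v # map L (del_nth i us))"
 have l: "length us = k" using Cons.prems by simp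
 have "?F 0 = (\<Sum>j<k. (-1) ^ j * ?G j)"
 proof (rule sum.cong)
  fix j assume "j \<in> {..<k}"
  thus "b ((map L (del_nth 0 (v # us)))[j := C ((v # us) ! 0) (del_nth 0 (v # us) ! j)]) = (-1) ^ j * ?G j"
   using alt_form_update_move[OF Cons.prems(1), of "map L us" j] l assms(3)[of v] by (simp add: map_del_nth)
 qed simp
 show ?case
 proof (cases k)
  case 0
  thus ?thesis by simp
 next
  case (Suc m)
  have A: "alt_form m (%ws. b (L v # ws))" using Cons.prems(1) Suc alt_form_Cons by blast
  have "?F (Suc i) = ?G i + (\<Sum>j<m. b (L v # (map L (del_nth i us))[j := C (us ! i) (del_nth i us ! j)]))" for i
   by (simp add: Suc sum.lessThan_Suc_shift del: sum.lessThan_Suc)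
  hence "(\<Sum>i<length us. (-1) ^ i * ?F (Suc i)) = (\<Sum>j<k. (-1) ^ j * ?G j) 
   + (\<Sum>i<length us. (-1) ^ i * (\<Sum>j<m. b (L v # (map L (del_nth i us))[j := C (us ! i) (del_nth i us ! j)])))"
   by (simp add: distrib_left sum.distrib l)
  also have "(\<Sum>i<length us. (-1) ^ i * (\<Sum>j<m. b (L v # (map L (del_nth i us))[j := C (us ! i) (del_nth i us ! j)]))) = 0"
   by (rule Cons.IH[OF A]) (use l Suc in simp)
  finally have "(\<Sum>i<length us. (-1) ^ i * ?F (Suc i)) = ?F 0"  using \<open>?F 0 = _\<close> by simp
  thus ?thesis by (simp add: sum.lessThan_Suc_shift sum_negf del: sum.lessThan_Suc)
 qed
qed simp

text \<open>The product rule yields derivatives of the coefficients and second derivatives of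
  \<open>w\<close>, and the latter cancel. The coefficients \<open>a\<close> are functions of the
  parameter point and are not tied to \<open>w\<close>: this lets \<open>a\<close> and
  \<open>w\<close> be mollified independently.\<close>

lemma ed_pullback:
 fixes a :: "'w::euclidean_space list => 'v::real_normed_vector => real"
 assumes "open S" "x \<in> S" "Ck_on 2 S w" "\<And>s. s \<in> S ==> alt_form k (%ws. a ws s)"
  and "\<And>ws. length ws = k ==> a ws differentiable (at x)" "length us = Suc k"
 shows "ed (%us s. a (map (FD w s) us) s) us x =
  (\<Sum>i<length us. (-1) ^ i * FD (a (map (FD w x) (del_nth i us))) x (us ! i))"
proof -
 have dw: "(%s. FD w s u) differentiable (at x)" for u using assms(2,3) by (simp add: numeral_2_eq_2)
 have D: "FD (%s. a (map (FD w s) us') s) x u = FD (a (map (FD w x) us')) x u +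
   (\<Sum>j<k. a ((map (FD w x) us')[j := FD (%s. FD w s (us' ! j)) x u]) x)" if l: "length us' = k" for us' u
 proof -
  have "((%s. a (map (%W. W s) (map (%u s. FD w s u) us')) s) has_derivative
   (%u. FD (a (map (%W. W x) (map (%u s. FD w s u) us'))) x u +
    (\<Sum>j<length (map (%u s. FD w s u) us'). a ((map (%W. W x) (map (%u s. FD w s u) us'))
     [j := FD (map (%u s. FD w s u) us' ! j) x u]) x))) (at x)"
   by (rule multilin_has_derivative[OF assms(1,2)]) (use assms(4,5) l dw in "auto intro: alt_form_multilin")
  hence "((%s. a (map (FD w s) us') s) has_derivative
   (%u. FD (a (map (FD w x) us')) x u +
    (\<Sum>j<k. a ((map (FD w x) us')[j := FD (map (%u s. FD w s u) us' ! j) x u]) x))) (at x)"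
   using l by (simp add: comp_def)
  from FD_eqI[OF this] show ?thesis using l by simp
 qed
 have "(\<Sum>i<length us. (-1) ^ i * (\<Sum>j<k. a ((map (FD w x) (del_nth i us))
   [j := FD (%s. FD w s (del_nth i us ! j)) x (us ! i)]) x)) = 0"
  using FD_symmetric[OF assms(1-3)]
  by (intro alt_form_symmetric_cancel[where C="%u v. FD (%s. FD w s v) x u"] assms(4)[OF assms(2)] assms(6))
 thus ?thesis
  using assms(6) by (simp add: ed_def[of _ us] D distrib_left sum.distrib del: sum.lessThan_Suc)
qed

section \<open>The Poincare lemma on convex sets\<close>

lemma has_derivative_integral_param:
 fixes f :: "'x::euclidean_space => real => 'z::euclidean_space"
 assumes "open U" "convex U" "x \<in> U"
  and d: "\<And>y t. y \<in> U ==> t \<in> {0..1} ==> ((%y. f y t) has_derivative f' y t) (at y)"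
  and c: "\<And>u. continuous_on (U \<times> {0..1}) (%(y, t). f' y t u)"
  and i: "\<And>y. y \<in> U ==> continuous_on {0..1} (f y)"
 shows "((%y. integral {0..1} (f y)) has_derivative (%u. integral {0..1} (%t. f' x t u))) (at x)"
proof -
 \<comment> \<open>\<open>Blinfun\<close> turns the derivatives into points of a normed space; in
   finite dimension their continuity follows from continuity in each fixed direction.\<close>
 define F where "F y t = Blinfun (f' y t)" for y t
 have F: "blinfun_apply (F y t) = f' y t" if "y \<in> U" "t \<in> {0..1}" for y t
  unfolding F_def by (rule bounded_linear_Blinfun_apply) (rule has_derivative_bounded_linear[OF d[OF that]])
 have cF: "continuous_on (U \<times> cbox 0 1) (%(y, t). F y t)"
 proof (rule continuous_on_blinfun_componentwise)
  fix b :: 'x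
  show "continuous_on (U \<times> cbox 0 1) (%x. blinfun_apply (case x of (y, t) => F y t) b)"
   by (rule continuous_on_cong[THEN iffD1, OF refl _ c[of b, folded cbox_interval]])
    (auto simp: F)
 qed
 have "((%y. integral (cbox 0 1) (f y)) has_derivative integral (cbox 0 1) (F x)) (at x within U)"
 proof (rule leibniz_rule[OF _ _ cF assms(3,2)])
  show "((%x. f x t) has_derivative blinfun_apply (F y t)) (at y within U)"
   if "y \<in> U" "t \<in> cbox 0 1" for y t
   using d[of y t] that F[of y t] by (auto intro: has_derivative_at_withinI)
  show "f y integrable_on cbox 0 1" if "y \<in> U" for y
   using i[OF that] by (intro integrable_continuous) auto
 qed
 hence 1: "((%y. integral {0..1} (f y)) has_derivative blinfun_apply (integral {0..1} (F x))) (at x)"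
  using at_within_open[OF assms(3,1)] by simp
 have "F x integrable_on {0..1}"
 proof -
  have "continuous_on (cbox 0 1) (%t. case (x, t) of (y, t) => F y t)"
   by (rule continuous_on_compose2[OF cF]) (use assms(3) in "auto intro!: continuous_intros")
  thus ?thesis using integrable_continuous[of 0 1 "F x"] by simp
 qed
 hence "blinfun_apply (integral {0..1} (F x)) u = integral {0..1} (%t. f' x t u)" for u
  using blinfun_apply_integral[of "F x" "{0..1}" u] F[OF assms(3)]
  by (auto intro!: Henstock_Kurzweil_Integration.integral_cong)
 hence "blinfun_apply (integral {0..1} (F x)) = (%u. integral {0..1} (%t. f' x t u))" by (rule ext)
 with 1 show ?thesis by (simp only:)
qed

lemma ray_in_convex: "convex S ==> x0 \<in> S ==> y \<in> S ==> t \<in> {0..1} ==> x0 + t *\<^sub>R (y - x0) \<in> S"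
 using convexD_alt[of S x0 y t] by (simp add: algebra_simps)

text \<open>A weighted integral along the segment from \<open>x0\<close> to \<open>y\<close>.
  Differentiation in \<open>y\<close> raises the exponent of the weight by one.\<close>

definition ray_int :: "'v::euclidean_space => nat => ('v => real) => 'v => real" where
 "ray_int x0 n f y = integral {0..1} (%t. t ^ n * f (x0 + t *\<^sub>R (y - x0)))"

lemma continuous_on_ray:
 fixes f :: "'v::euclidean_space => real"
 assumes "convex S" "x0 \<in> S" "continuous_on S f"
 shows "continuous_on (S \<times> {0..1}) (%(y, t). t ^ n * f (x0 + t *\<^sub>R (y - x0)))"
  and "y \<in> S ==> continuous_on {0..1} (%t. t ^ n * f (x0 + t *\<^sub>R (y - x0)))"
proof -
 have "continuous_on (S \<times> {0..1}) (%z. f (x0 + snd z *\<^sub>R (fst z - x0)))"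
  by (rule continuous_on_compose2[OF assms(3)])
   (auto intro!: continuous_intros ray_in_convex[OF assms(1,2)])
 thus "continuous_on (S \<times> {0..1}) (%(y, t). t ^ n * f (x0 + t *\<^sub>R (y - x0)))"
  unfolding split_beta by (intro continuous_intros)
 assume y: "y \<in> S"
 have "continuous_on {0..1} (%t. f (x0 + t *\<^sub>R (y - x0)))"
  by (rule continuous_on_compose2[OF assms(3)])
   (auto intro!: continuous_intros ray_in_convex[OF assms(1,2) y])
 thus "continuous_on {0..1} (%t. t ^ n * f (x0 + t *\<^sub>R (y - x0)))" by (intro continuous_intros)
qed

lemma ray_int_has_derivative:
 assumes "open S" "convex S" "x0 \<in> S" "Ck_on (Suc 0) S f" "y \<in> S"
 shows "(ray_int x0 n f has_derivative (%u. ray_int x0 (Suc n) (%z. FD f z u) y)) (at y)"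
proof -
 have c: "continuous_on S (%z. FD f z u)" for u using assms(4) by simp
 have "((%y. integral {0..1} (%t. t ^ n * f (x0 + t *\<^sub>R (y - x0)))) has_derivative
  (%u. integral {0..1} (%t. t ^ Suc n * FD f (x0 + t *\<^sub>R (y - x0)) u))) (at y)"
 proof (rule has_derivative_integral_param[OF assms(1,2,5), where f'="%y t u. t ^ Suc n * FD f (x0 + t *\<^sub>R (y - x0)) u"])
  fix y t assume yt: "y \<in> S" "t \<in> {0..1::real}"
  have 1: "(f has_derivative FD f (x0 + t *\<^sub>R (y - x0))) (at (x0 + t *\<^sub>R (y - x0)))"
   using assms(4) ray_in_convex[OF assms(2,3) yt] by (intro has_FD) simp
  have 2: "((%y. x0 + t *\<^sub>R (y - x0)) has_derivative (%u. t *\<^sub>R u)) (at y)"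
   by (auto intro!: derivative_eq_intros)
  have "((%y. t ^ n * f (x0 + t *\<^sub>R (y - x0))) has_derivative (%u. t ^ n * FD f (x0 + t *\<^sub>R (y - x0)) (t *\<^sub>R u))) (at y)"
   by (rule has_derivative_mult_right) (rule has_derivative_compose[OF 2 1])
  thus "((%y. t ^ n * f (x0 + t *\<^sub>R (y - x0))) has_derivative (%u. t ^ Suc n * FD f (x0 + t *\<^sub>R (y - x0)) u)) (at y)"
   by (rule has_derivative_eq_rhs) (simp add: linear_scale[OF has_derivative_linear[OF 1]] mult_ac)
 qed (rule continuous_on_ray[OF assms(2,3)], (rule c | rule Ck_on_continuous[OF assms(4)] | assumption)+)+
 thus ?thesis unfolding ray_int_def[abs_def] .
qed

lemma Ck_on_ray_int:
 assumes "open S" "convex S" "x0 \<in> S" "Ck_on k S f"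
 shows "Ck_on k S (ray_int x0 n f)"
 using assms(4)
proof (induction k arbitrary: n f)
 case 0
 hence "continuous_on (S \<times> cbox 0 1) (%(y, t). t ^ n * f (x0 + t *\<^sub>R (y - x0)))"
  using continuous_on_ray(1)[OF assms(2,3)] by simp
 from integral_continuous_on_param[OF this] show ?case by (simp add: ray_int_def[abs_def])
next
 case (Suc k)
 have "Ck_on (Suc 0) S f" using Ck_on_mono[OF Suc.prems, of "Suc 0"] by simp
 note d = ray_int_has_derivative[OF assms(1-3) this]
 have "Ck_on k S (%y. FD (ray_int x0 n f) y u)" for u
 proof (rule Ck_on_cong[OF assms(1)])
  show "Ck_on k S (ray_int x0 (Suc n) (%z. FD f z u))" using Suc by simp
 qed (simp add: FD_eqI[OF d])
 with d show ?case by (auto simp: differentiable_def)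
qed

text \<open>The homotopy operator of the contraction to \<open>x0\<close>. The radial vector
  \<open>y - x0\<close> is expanded in the basis so that the arguments inside each
  \<open>ray_int\<close> are constant.\<close>

definition poincare :: "'v::euclidean_space => nat => ('v list => 'v => real) => 'v list => 'v => real" where
 "poincare x0 k a us y = (\<Sum>b\<in>Basis. ((y - x0) \<bullet> b) * ray_int x0 k (a (b # us)) y)"

lemma smooth_on_poincare:
 assumes "open S" "convex S" "x0 \<in> S" "\<And>us. length us = Suc k ==> smooth_on S (a us)" "length us = k"
 shows "smooth_on S (poincare x0 k a us)"
proof -
 have "Ck_on j S (ray_int x0 k (a (b # us)))" for j b
  by (rule Ck_on_ray_int[OF assms(1-3)]) (use assms(4)[of "b # us"] assms(5) in "simp add: smooth_on_def")
 thus ?thesis unfolding poincare_def[abs_def]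
  by (intro smooth_on_sum smooth_on_mult smooth_on_inner smooth_on_arith assms(1) smooth_on_const smooth_on_id)
   (simp add: smooth_on_def)
qed

lemma ray_int_linear:
 assumes "open S" "convex S" "x0 \<in> S" "y \<in> S" "continuous_on S f" "continuous_on S g"
 shows "ray_int x0 n (%z. f z + g z) y = ray_int x0 n f y + ray_int x0 n g y"
  and "ray_int x0 n (%z. c * f z) y = c * ray_int x0 n f y"
proof -
 have i: "(%t. t ^ n * f (x0 + t *\<^sub>R (y - x0))) integrable_on {0..1}"
  "(%t. t ^ n * g (x0 + t *\<^sub>R (y - x0))) integrable_on {0..1}"
  by (rule integrable_continuous_real, rule continuous_on_ray(2)[OF assms(2,3)], (rule assms)+)+
 show "ray_int x0 n (%z. f z + g z) y = ray_int x0 n f y + ray_int x0 n g y"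
  unfolding ray_int_def using integral_add[OF i] by (simp add: distrib_left)
 have "integral {0..1} (%t. c * (t ^ n * f (x0 + t *\<^sub>R (y - x0)))) = c * integral {0..1} (%t. t ^ n * f (x0 + t *\<^sub>R (y - x0)))"
  by simp
 thus "ray_int x0 n (%z. c * f z) y = c * ray_int x0 n f y"
  unfolding ray_int_def by (simp add: mult.left_commute)
qed

lemma ray_int_cong:
 assumes "convex S" "x0 \<in> S" "y \<in> S" "\<And>z. z \<in> S ==> f z = g z"
 shows "ray_int x0 n f y = ray_int x0 n g y"
 unfolding ray_int_def
 by (rule Henstock_Kurzweil_Integration.integral_cong) (simp add: assms(4) ray_in_convex[OF assms(1-3)])

lemma alt_form_poincare:
 assumes "open S" "convex S" "x0 \<in> S" "y \<in> S" "\<And>us. length us = Suc k ==> continuous_on S (a us)"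
  and "\<And>z. z \<in> S ==> alt_form (Suc k) (%us. a us z)"
 shows "alt_form k (%us. poincare x0 k a us y)"
proof -
 have lin: "linear (%w. ray_int x0 k (a (b # xs @ w # ys)) y)" if "length xs + length ys + 1 = k" for b xs ys
 proof (rule linearI)
  have L: "linear (%w. a (b # xs @ w # ys) z)" if "z \<in> S" for z
   using multilin_linear[OF alt_form_multilin[OF assms(6)[OF that]], of "b # xs" ys] \<open>_ = k\<close> by simp
  have C: "continuous_on S (a (b # xs @ w # ys))" for w using assms(5) that by simp
  show "ray_int x0 k (a (b # xs @ (w + w') # ys)) y
   = ray_int x0 k (a (b # xs @ w # ys)) y + ray_int x0 k (a (b # xs @ w' # ys)) y" for w w'
   by (subst ray_int_linear(1)[OF assms(1-4) C C, symmetric], rule ray_int_cong[OF assms(2-4)])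
    (simp add: linear_add[OF L])
  show "ray_int x0 k (a (b # xs @ (c *\<^sub>R w) # ys)) y = c *\<^sub>R ray_int x0 k (a (b # xs @ w # ys)) y" for c w
   unfolding real_scaleR_def
   by (subst ray_int_linear(2)[OF assms(1-4) C C, symmetric], rule ray_int_cong[OF assms(2-4)])
    (simp add: linear_scale[OF L])
 qed
 have z: "ray_int x0 k (a (b # xs @ w # w # ys)) y = 0" if "length xs + length ys + 2 = k" for b xs ys w
 proof -
  have "a (b # xs @ w # w # ys) z = 0" if "z \<in> S" for z
   using alt_form_repeat[OF assms(6)[OF that], of "b # xs" "[]" ys w] \<open>_ = k\<close> by simp
  hence "ray_int x0 k (a (b # xs @ w # w # ys)) y = ray_int x0 k (%z. 0) y"
   by (intro ray_int_cong[OF assms(2-4)])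
  thus ?thesis by (simp add: ray_int_def)
 qed
 have "linear (%w. \<Sum>b\<in>Basis. ((y - x0) \<bullet> b) *\<^sub>R ray_int x0 k (a (b # xs @ w # ys)) y)"
  if "length xs + length ys + 1 = k" for xs ys
  by (intro linear_compose_sum ballI linear_compose_scale_right lin that)
 thus ?thesis unfolding alt_form_def multilin_def poincare_def by (simp add: z)
qed

text \<open>Moving an entry back into its place cancels the sign, so all \<open>k\<close> terms are
  equal.\<close>

lemma alt_form_sum_move:
 assumes "alt_form k b" "length us = k"
 shows "(\<Sum>i<k. (-1) ^ i * b (us ! i # del_nth i us)) = real k * b us"
proof -
 have "(-1) ^ i * b (us ! i # del_nth i us) = b us" if "i < k" for i
  using alt_form_update_move[OF assms that, of "us ! i"] by simp
 thus ?thesis by simp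
qed

text \<open>Alternation contributes the factor \<open>Suc k\<close>, and closedness replaces the
  alternating sum of derivatives by the radial derivative. The integrand becomes the t-derivative of
  t^(k+1) a(x0 + t (y - x0)), whose integral is the value of the form at \<open>y\<close>.\<close>

lemma ed_poincare:
 assumes "open S" "convex S" "x0 \<in> S" "y \<in> S" "\<And>us. length us = Suc k ==> Ck_on (Suc 0) S (a us)"
  and "\<And>z. z \<in> S ==> alt_form (Suc k) (%us. a us z)"
  and closed: "\<And>us z. z \<in> S ==> length us = Suc (Suc k) ==> ed a us z = 0" and len: "length us = Suc k"
 shows "ed (poincare x0 k a) us y = a us y"
proof -
 let ?z = "%t. x0 + t *\<^sub>R (y - x0)"
 have D: "FD (poincare x0 k a us') y u = ray_int x0 k (a (u # us')) y
   + (\<Sum>b\<in>Basis. ((y - x0) \<bullet> b) * ray_int x0 (Suc k) (%z. FD (a (b # us')) z u) y)" 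
  if l: "length us' = k" for us' u
 proof -
  have 1: "((%y. (y - x0) \<bullet> b) has_derivative (%u. u \<bullet> b)) (at y)" for b
   by (auto intro!: derivative_eq_intros)
  have 2: "Ck_on (Suc 0) S (a (b # us'))" for b using assms(5) l by simp
  have "FD (poincare x0 k a us') y = (%u. \<Sum>b\<in>Basis. ((y - x0) \<bullet> b) * ray_int x0 (Suc k) (%z. FD (a (b # us')) z u) y
   + (u \<bullet> b) * ray_int x0 k (a (b # us')) y)"
   unfolding poincare_def[abs_def]
   by (intro FD_eqI has_derivative_sum has_derivative_mult 1 ray_int_has_derivative[OF assms(1-3)] 2 assms(4))
  moreover have "ray_int x0 k (a (u # us')) y = (\<Sum>b\<in>Basis. (u \<bullet> b) * ray_int x0 k (a (b # us')) y)"
  proof -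
   have "ray_int x0 k (a (u # us')) y = ray_int x0 k (%z. \<Sum>b\<in>Basis. (u \<bullet> b) * a (b # us') z) y"
    by (rule ray_int_cong[OF assms(2-4)])
     (use multilin_expand[OF alt_form_multilin[OF assms(6)] l] in simp)
   also have "\<dots> = (\<Sum>b\<in>Basis. (u \<bullet> b) * ray_int x0 k (a (b # us')) y)"
   proof -
    have C: "continuous_on S (a (b # us'))" for b using Ck_on_continuous[OF 2] .
    have "ray_int x0 k (%z. \<Sum>b\<in>B. (u \<bullet> b) * a (b # us') z) y = (\<Sum>b\<in>B. (u \<bullet> b) * ray_int x0 k (a (b # us')) y)"
     if "finite B" for B using that
    proof induction
     case empty
     thus ?case by (simp add: ray_int_def)
    next
     case (insert b B)
     have "continuous_on S (%z. (u \<bullet> b) * a (b # us') z)" "continuous_on S (%z. \<Sum>b\<in>B. (u \<bullet> b) * a (b # us') z)"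
      by (intro continuous_intros C)+
     thus ?case
      using insert ray_int_linear(1)[OF assms(1-4), of "%z. (u \<bullet> b) * a (b # us') z" "%z. \<Sum>b\<in>B. (u \<bullet> b) * a (b # us') z"]
       ray_int_linear(2)[OF assms(1-4) C C] by simp
    qed
    thus ?thesis by simp
   qed
   finally show ?thesis .
  qed
  ultimately show ?thesis by (simp add: sum.distrib)
 qed
 have ci: "(%t. t ^ n * f (?z t)) integrable_on {0..1}" if "continuous_on S f" for f n
  by (rule integrable_continuous_real, rule continuous_on_ray(2)[OF assms(2,3) that assms(4)])
 have hi: "((%t. t ^ n * f (?z t)) has_integral ray_int x0 n f y) {0..1}" if "continuous_on S f" for f n
  unfolding ray_int_def by (rule integrable_integral[OF ci[OF that]])
 have C1: "continuous_on S (a l)" "continuous_on S (%z. FD (a l) z u)" if "length l = Suc k" for l u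
  using assms(5)[OF that] Ck_on_continuous[OF assms(5)[OF that]] by auto
 have "((%t. \<Sum>i<Suc k. (-1) ^ i * (t ^ k * a (us ! i # del_nth i us) (?z t) + 
   (\<Sum>b\<in>Basis. ((y - x0) \<bullet> b) * (t ^ Suc k * FD (a (b # del_nth i us)) (?z t) (us ! i))))) has_integral
  (\<Sum>i<Suc k. (-1) ^ i * (ray_int x0 k (a (us ! i # del_nth i us)) y
   + (\<Sum>b\<in>Basis. ((y - x0) \<bullet> b) * ray_int x0 (Suc k) (%z. FD (a (b # del_nth i us)) z (us ! i)) y)))) {0..1}"
  by (intro has_integral_sum has_integral_mult_right has_integral_add hi C1) (use len in auto)
 also have "(\<Sum>i<Suc k. (-1) ^ i * (ray_int x0 k (a (us ! i # del_nth i us)) y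
   + (\<Sum>b\<in>Basis. ((y - x0) \<bullet> b) * ray_int x0 (Suc k) (%z. FD (a (b # del_nth i us)) z (us ! i)) y)))
   = ed (poincare x0 k a) us y"
  unfolding ed_def len by (rule sum.cong[OF refl]) (subst D, use len in auto)
 finally have I1: "((%t. \<Sum>i<Suc k. (-1) ^ i * (t ^ k * a (us ! i # del_nth i us) (?z t) + 
   (\<Sum>b\<in>Basis. ((y - x0) \<bullet> b) * (t ^ Suc k * FD (a (b # del_nth i us)) (?z t) (us ! i))))) has_integral
   ed (poincare x0 k a) us y) {0..1}" .
 have eq: "(\<Sum>i<Suc k. (-1) ^ i * (t ^ k * a (us ! i # del_nth i us) (?z t) + 
   (\<Sum>b\<in>Basis. ((y - x0) \<bullet> b) * (t ^ Suc k * FD (a (b # del_nth i us)) (?z t) (us ! i)))))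
  = real (Suc k) * t ^ k * a us (?z t) + t ^ Suc k * FD (a us) (?z t) (y - x0)" if "t \<in> {0..1}" for t
 proof -
  have zS: "?z t \<in> S" by (rule ray_in_convex[OF assms(2-4) that])
  have A: "(\<Sum>i<Suc k. (-1) ^ i * (t ^ k * a (us ! i # del_nth i us) (?z t))) = t ^ k * (real (Suc k) * a us (?z t))"
   unfolding alt_form_sum_move[OF assms(6)[OF zS] len, symmetric]
   by (simp add: sum_distrib_left mult.left_commute del: sum.lessThan_Suc)
  have "(\<Sum>i<Suc k. (-1) ^ i * (\<Sum>b\<in>Basis. ((y - x0) \<bullet> b) * (t ^ Suc k * FD (a (b # del_nth i us)) (?z t) (us ! i))))
   = (\<Sum>b\<in>Basis. ((y - x0) \<bullet> b) * (t ^ Suc k * ed (%l. a (b # l)) us (?z t)))"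
   unfolding ed_def len sum_distrib_left
   by (subst sum.swap) (simp add: mult_ac del: sum.lessThan_Suc power_Suc)
  also have "\<dots> = (\<Sum>b\<in>Basis. ((y - x0) \<bullet> b) * (t ^ Suc k * FD (a us) (?z t) b))"
  proof (rule sum.cong)
   fix b :: 'a
   show "((y - x0) \<bullet> b) * (t ^ Suc k * ed (%l. a (b # l)) us (?z t)) = ((y - x0) \<bullet> b) * (t ^ Suc k * FD (a us) (?z t) b)"
    using closed[OF zS, of "b # us"] len by (simp add: ed_Cons)
  qed simp
  also have "\<dots> = t ^ Suc k * FD (a us) (?z t) (y - x0)"
  proof -
   have "linear (FD (a us) (?z t))" by (rule linear_FD) (use assms(5)[OF len] zS in simp)
   from linear_euclidean_sum[OF this, of "y - x0"] show ?thesis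
    by (simp add: sum_distrib_left mult.left_commute)
  qed
  finally show ?thesis using A by (simp add: distrib_left sum.distrib mult_ac del: sum.lessThan_Suc power_Suc of_nat_Suc)
 qed
 have "((%t. real (Suc k) * t ^ k * a us (?z t) + t ^ Suc k * FD (a us) (?z t) (y - x0)) has_integral
   (1 ^ Suc k * a us (?z 1) - 0 ^ Suc k * a us (?z 0))) {0..1}"
 proof (rule fundamental_theorem_of_calculus)
  fix t assume t: "t \<in> {0..1::real}"
  have "((%t. a us (?z t)) has_real_derivative FD (a us) (?z t) (y - x0)) (at t)"
   by (rule line_derivative_real) (use assms(5)[OF len] ray_in_convex[OF assms(2-4) t] in simp)
  hence "((%t. t ^ Suc k * a us (?z t)) has_real_derivative 
   (real (Suc k) * t ^ k * a us (?z t) + t ^ Suc k * FD (a us) (?z t) (y - x0))) (at t)"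
   by (rule DERIV_cong[OF DERIV_mult[OF DERIV_pow[of "Suc k"]]]) simp
  thus "((%t. t ^ Suc k * a us (?z t)) has_vector_derivative 
   (real (Suc k) * t ^ k * a us (?z t) + t ^ Suc k * FD (a us) (?z t) (y - x0))) (at t within {0..1})"
   by (simp add: has_field_derivative_at_within has_real_derivative_iff_has_vector_derivative[symmetric])
 qed simp
 hence "((%t. real (Suc k) * t ^ k * a us (?z t) + t ^ Suc k * FD (a us) (?z t) (y - x0)) has_integral a us y) {0..1}"
  by simp
 hence "((%t. \<Sum>i<Suc k. (-1) ^ i * (t ^ k * a (us ! i # del_nth i us) (?z t) + 
   (\<Sum>b\<in>Basis. ((y - x0) \<bullet> b) * (t ^ Suc k * FD (a (b # del_nth i us)) (?z t) (us ! i))))) has_integral a us y) {0..1}"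
  by (rule has_integral_cong[THEN iffD2, rotated]) (rule eq)
 thus ?thesis by (rule has_integral_unique[OF I1])
qed

section \<open>Iterated integrals over cubes and Stokes' theorem in Euclidean space\<close>

section \<open>Integration over cubes\<close>

text \<open>Numbering the basis by all naturals, with \<open>0\<close> beyond the dimension, lets
  cubes of every dimension up to \<open>DIM('v)\<close> be parametrised by the same space: a k-cube
  uses the first k coordinates.\<close>

definition eb :: "nat => 'v::euclidean_space" where
 "eb = (SOME e. bij_betw e {..<DIM('v)} Basis \<and> (\<forall>i\<ge>DIM('v). e i = 0))"

lemma eb_bij: "bij_betw (eb :: nat => 'v::euclidean_space) {..<DIM('v)} Basis"
 and eb_zero: "i \<ge> DIM('v) ==> (eb i :: 'v) = 0"
proof -
 obtain h :: "nat => 'v" where h: "bij_betw h {0..<DIM('v)} Basis"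
  using ex_bij_betw_nat_finite[OF finite_Basis] by blast
 have "bij_betw (%i. if i < DIM('v) then h i else 0) {..<DIM('v)} Basis"
  by (rule bij_betw_cong[THEN iffD1, OF _ h[unfolded atLeast0LessThan]]) simp
 hence "\<exists>e::nat => 'v. bij_betw e {..<DIM('v)} Basis \<and> (\<forall>i\<ge>DIM('v). e i = 0)"
  by (intro exI[of _ "%i. if i < DIM('v) then h i else 0"]) auto
 from someI_ex[OF this] show "bij_betw (eb :: nat => 'v) {..<DIM('v)} Basis" "i \<ge> DIM('v) ==> (eb i :: 'v) = 0"
  unfolding eb_def by auto
qed

definition co :: "'v::euclidean_space => nat => real" where
 "co s i = s \<bullet> eb i"

lemma eb_Basis: "i < DIM('v) ==> (eb i :: 'v::euclidean_space) \<in> Basis"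
 using bij_betwE[OF eb_bij] by auto

lemma co_eb: "co (eb j :: 'v::euclidean_space) i = (if i = j \<and> i < DIM('v) then 1 else 0)"
proof (cases "i < DIM('v) \<and> j < DIM('v)")
 case True
 thus ?thesis
  using inner_Basis[OF eb_Basis[where 'v='v] eb_Basis[where 'v='v]] bij_betw_imp_inj_on[OF eb_bij[where 'v='v]]
  by (auto simp: co_def inj_on_eq_iff)
next
 case False
 thus ?thesis using eb_zero[where 'v='v] by (auto simp: co_def not_less)
qed

lemma co_ge: "i \<ge> DIM('v) ==> co (s :: 'v::euclidean_space) i = 0"
 by (simp add: co_def eb_zero)

lemma co_linear [simp]: "co (s + t) i = co s i + co t i" "co (s - t) i = co s i - co t i"
  "co (r *\<^sub>R s) i = r * co s i" "co 0 i = 0"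
 by (auto simp: co_def inner_add_left inner_diff_left)

lemma co_sum [simp]: "co (\<Sum>x\<in>X. f x) i = (\<Sum>x\<in>X. co (f x) i)"
 by (simp add: co_def inner_sum_left)

lemma continuous_on_co [continuous_intros]: "continuous_on S f ==> continuous_on S (%x. co (f x) i)"
 unfolding co_def by (intro continuous_intros)

lemma co_expand: "(s :: 'v::euclidean_space) = (\<Sum>i<DIM('v). co s i *\<^sub>R eb i)"
proof -
 have "s = (\<Sum>b\<in>Basis. (s \<bullet> b) *\<^sub>R b)" by (simp add: euclidean_representation)
 also have "\<dots> = (\<Sum>i<DIM('v). co s i *\<^sub>R eb i)"
  unfolding co_def by (rule sum.reindex_bij_betw[OF eb_bij, symmetric])
 finally show ?thesis .
qed

lemma co_eqI:
 assumes "\<And>i. i < DIM('v) ==> co s i = co t i"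
 shows "(s :: 'v::euclidean_space) = t"
 using assms co_expand[of s] co_expand[of t] by (metis (no_types, lifting) lessThan_iff sum.cong)

lemma sum_co_delta: "co (\<Sum>i<DIM('v). c i *\<^sub>R (eb i :: 'v::euclidean_space)) j = (if j < DIM('v) then c j else 0)"
proof -
 have "co (\<Sum>i<DIM('v). c i *\<^sub>R (eb i :: 'v)) j = (\<Sum>i<DIM('v). if i = j then c i else 0)"
  unfolding co_sum by (rule sum.cong) (auto simp: co_eb)
 thus ?thesis by simp
qed

definition upd :: "nat => real => 'v::euclidean_space => 'v" where
 "upd j r s = s + (r - co s j) *\<^sub>R eb j"

lemma co_upd: "co (upd j r s :: 'v::euclidean_space) i = (if i = j \<and> j < DIM('v) then r else co s i)"
 by (auto simp: upd_def co_eb co_ge)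

text \<open>The linear part of the inclusion of a face: coordinates from \<open>j\<close> on move up
  by one and the last one is lost. It is kept apart from \<open>ins\<close> because it is the
  derivative of \<open>ins\<close>.\<close>

definition insL :: "nat => 'v::euclidean_space => 'v" where
 "insL j s = (\<Sum>i<DIM('v). (if i < j then co s i else if i = j then 0 else co s (i - 1)) *\<^sub>R eb i)"

definition ins :: "nat => real => 'v::euclidean_space => 'v" where
 "ins j r s = insL j s + r *\<^sub>R eb j"

lemma co_insL: "co (insL j s :: 'v::euclidean_space) i =
 (if i \<ge> DIM('v) then 0 else if i < j then co s i else if i = j then 0 else co s (i - 1))"
 unfolding insL_def sum_co_delta by auto

lemma co_ins: "co (ins j r s :: 'v::euclidean_space) i =
 (if i \<ge> DIM('v) then 0 else if i < j then co s i else if i = j then r else co s (i - 1))"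
 by (auto simp: ins_def co_insL co_eb co_ge)

lemma linear_insL: "linear (insL j)"
 by (rule linearI; rule co_eqI) (auto simp: co_insL)

lemma insL_eb: "insL j (eb i) = eb (if i < j then i else Suc i)"
 by (rule co_eqI) (auto simp: co_insL co_eb)

lemma ins_has_derivative: "(ins j r has_derivative insL j) (at s)"
proof -
 have "(insL j has_derivative insL j) (at s)" by (rule linear_imp_has_derivative[OF linear_insL])
 from has_derivative_add[OF this has_derivative_const[of "r *\<^sub>R eb j"]]
 show ?thesis by (simp add: ins_def[abs_def])
qed

lemma continuous_on_ins: "continuous_on S (ins j r)"
 by (rule continuous_at_imp_continuous_on) (rule ballI, rule has_derivative_continuous[OF ins_has_derivative])

lemma ins_eq_upd: "ins j r 0 = upd j r 0"
 by (rule co_eqI) (auto simp: co_ins co_upd)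

lemma upd_commute: "i \<noteq> j ==> upd i r (upd j q s) = upd j q (upd i r s)"
 by (rule co_eqI) (auto simp: co_upd)

lemma ins_upd: "ins j q (upd i r s) = upd (if i < j then i else Suc i) r (ins j q s)"
 by (rule co_eqI) (auto simp: co_ins co_upd)

lemma continuous_on_upd [continuous_intros]:
 "continuous_on S f ==> continuous_on S r ==> continuous_on S (%x. upd j (r x) (f x))"
 unfolding upd_def by (intro continuous_intros)

text \<open>The average is again a function on the whole space, constant in coordinate
  \<open>j\<close>; hence averages can be iterated and permuted without changing the type of the
  function.\<close>

definition avg :: "nat => ('v::euclidean_space => real) => 'v => real" where
 "avg j f s = integral {0..1} (%r. f (upd j r s))"

primrec avgs :: "nat list => ('v::euclidean_space => real) => 'v => real" where
 "avgs [] f = f"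
| "avgs (j # js) f = avg j (avgs js f)"

definition cint :: "nat => ('v::euclidean_space => real) => real" where
 "cint k f = avgs [0..<k] f 0"

lemma avgs_append: "avgs (js @ ks) f = avgs js (avgs ks f)"
 by (induction js) auto

lemma continuous_on_avg_param:
 fixes f :: "'z::topological_space => 'v::euclidean_space => real"
 assumes "continuous_on (U \<times> UNIV) (%(z, s). f z s)"
 shows "continuous_on (U \<times> UNIV) (%(z, s). avg j (f z) s)"
proof -
 have "continuous_on ((U \<times> UNIV) \<times> cbox 0 1) (%x. f (fst (fst x)) (upd j (snd x) (snd (fst x))))"
  by (rule continuous_on_compose2[OF assms, where f="%x. (fst (fst x), upd j (snd x) (snd (fst x)))", simplified])
   (auto intro!: continuous_intros)
 hence "continuous_on ((U \<times> UNIV) \<times> cbox 0 1) (%(p, r). f (fst p) (upd j r (snd p)))"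
  by (simp add: split_beta)
 from integral_continuous_on_param[OF this] show ?thesis by (simp add: avg_def split_beta)
qed

lemma continuous_on_avgs_param:
 fixes f :: "'z::topological_space => 'v::euclidean_space => real"
 assumes "continuous_on (U \<times> UNIV) (%(z, s). f z s)"
 shows "continuous_on (U \<times> UNIV) (%(z, s). avgs js (f z) s)"
 by (induction js) (use assms continuous_on_avg_param in auto)

lemma continuous_on_avgs:
 assumes "continuous_on UNIV f"
 shows "continuous_on UNIV (avgs js f)"
proof -
 have "continuous_on ({0::real} \<times> UNIV) (%(z, s). f s)"
  unfolding split_beta by (rule continuous_on_compose2[OF assms]) (auto intro!: continuous_intros)
 from continuous_on_avgs_param[OF this, of js]
 have "continuous_on ({0::real} \<times> UNIV) (%x. avgs js f (snd x))" by (simp add: split_beta)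
 hence "continuous_on UNIV (%s. avgs js f (snd (0::real, s)))"
  by (rule continuous_on_compose2) (auto intro!: continuous_intros)
 thus ?thesis by simp
qed

lemma continuous_on_cint_param:
 fixes f :: "'z::topological_space => 'v::euclidean_space => real"
 assumes "continuous_on (U \<times> UNIV) (%(z, s). f z s)"
 shows "continuous_on U (%z. cint k (f z))"
proof -
 have "continuous_on U (%z. case (z, 0) of (z, s) => avgs [0..<k] (f z) s)"
  by (rule continuous_on_compose2[OF continuous_on_avgs_param[OF assms]]) (auto intro!: continuous_intros)
 thus ?thesis by (simp add: cint_def)
qed

lemma avg_integrable:
 fixes f :: "'v::euclidean_space => real"
 assumes "continuous_on UNIV f"
 shows "(%r. f (upd j r s)) integrable_on {0..1}"
 by (rule integrable_continuous_real, rule continuous_on_compose2[OF assms])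
  (auto intro!: continuous_intros)

lemma avg_add:
 "continuous_on UNIV f ==> continuous_on UNIV g ==> avg j (%s. f s + g s) = (%s. avg j f s + avg j g s)"
 unfolding avg_def by (rule ext) (rule integral_add; rule avg_integrable)

lemma avg_scale: "avg j (%s. c * f s) = (%s. c * avg j f s)"
 unfolding avg_def by simp

lemma avgs_add:
 assumes "continuous_on UNIV f" "continuous_on UNIV g"
 shows "avgs js (%s. f s + g s) = (%s. avgs js f s + avgs js g s)"
 by (induction js) (simp_all add: avg_add continuous_on_avgs assms)

lemma avgs_scale: "avgs js (%s. c * f s) = (%s. c * avgs js f s)"
 by (induction js) (simp_all add: avg_scale)

lemma cint_add: "continuous_on UNIV f ==> continuous_on UNIV g ==> cint k (%s. f s + g s) = cint k f + cint k g"
 by (simp add: cint_def avgs_add)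

lemma cint_scale: "cint k (%s. c * f s) = c * cint k f"
 by (simp add: cint_def avgs_scale)

lemma cint_minus: "cint k (%s. - f s) = - cint k f"
 using cint_scale[of k "-1" f] by simp

lemma cint_diff: "continuous_on UNIV f ==> continuous_on UNIV g ==> cint k (%s. f s - g s) = cint k f - cint k g"
 using cint_add[of f "%s. - g s" k] by (simp add: cint_minus continuous_on_minus)

lemma cint_zero: "cint k (%s. 0) = 0"
 using cint_scale[of k 0 "%_. 0"] by simp

lemma cint_sum:
 assumes "\<And>i. i \<in> I ==> continuous_on UNIV (f i)"
 shows "cint k (%s. \<Sum>i\<in>I. f i s) = (\<Sum>i\<in>I. cint k (f i))"
 using assms
 by (induction I rule: infinite_finite_induct) (auto simp: cint_zero cint_add continuous_on_sum)

lemma avgs_mono: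
 assumes "continuous_on UNIV f" "continuous_on UNIV g" "\<And>s. f s \<le> g s"
 shows "avgs js f s \<le> avgs js g s"
proof (induction js arbitrary: s)
 case (Cons j js)
 thus ?case unfolding avgs.simps avg_def
  by (intro integral_le avg_integrable continuous_on_avgs assms) auto
qed (simp add: assms)

lemma abs_cint_le: 
 assumes "continuous_on UNIV f" 
 shows "\<bar>cint k f\<bar> \<le> cint k (%s. \<bar>f s\<bar>)"
proof -
 have c: "continuous_on UNIV (%s. \<bar>f s\<bar>)" "continuous_on UNIV (%s. - f s)" 
  by (intro continuous_intros assms)+
 have "cint k f \<le> cint k (%s. \<bar>f s\<bar>)" "cint k (%s. - f s) \<le> cint k (%s. \<bar>f s\<bar>)"
  unfolding cint_def by (rule avgs_mono; use assms c in simp)+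
 thus ?thesis by (simp add: cint_minus)
qed

text \<open>Fubini's theorem for a continuous function on a square.\<close>

lemma avg_commute:
 assumes "continuous_on UNIV f"
 shows "avg i (avg j f) = avg j (avg i f)"
proof (cases "i = j")
 case False
 show ?thesis
 proof
  fix s
  have "continuous_on (cbox (0, 0) (1, 1)) (%p. f (upd j (snd p) (upd i (fst p) s)))"
   by (rule continuous_on_compose2[OF assms]) (auto intro!: continuous_intros)
  hence "integral (cbox 0 1) (%r. integral (cbox 0 1) (%q. f (upd j q (upd i r s)))) =
   integral (cbox 0 1) (%q. integral (cbox 0 1) (%r. f (upd j q (upd i r s))))"
   by (intro integral_swap_continuous) (simp add: split_beta)
  thus "avg i (avg j f) s = avg j (avg i f) s"
   unfolding avg_def by (simp add: upd_commute[OF False, of _ _ s])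
 qed
qed simp

lemma avg_avgs_commute: "continuous_on UNIV f ==> avg j (avgs js f) = avgs js (avg j f)"
 by (induction js) (auto simp: avg_commute continuous_on_avgs)

lemma avgs_upd: "j \<notin> set js ==> avgs js (%s. f (upd j r s)) = (%s. avgs js f (upd j r s))"
 by (induction js) (auto simp: avg_def upd_commute[of j])

lemma avgs_ins: "avgs js (%s. f (ins j r s)) = (%s. avgs (map (%i. if i < j then i else Suc i) js) f (ins j r s))"
 by (induction js) (auto simp: avg_def ins_upd)

text \<open>Composition with the face inclusion renumbers the averaged coordinates so that exactly
  coordinate \<open>j\<close> is omitted.\<close>

lemma cint_ins: "j \<le> k ==> cint k (%s. f (ins j r s)) = avgs ([0..<j] @ [Suc j..<Suc k]) (%s. f (upd j r s)) 0"
proof -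
 assume j: "j \<le> k"
 have "map (%i. if i < j then i else Suc i) [0..<k] = [0..<j] @ [Suc j..<Suc k]"
  by (rule nth_equalityI) (use j in "auto simp: nth_append")
 hence "cint k (%s. f (ins j r s)) = avgs ([0..<j] @ [Suc j..<Suc k]) f (upd j r 0)"
  by (simp add: cint_def avgs_ins ins_eq_upd)
 also have "\<dots> = avgs ([0..<j] @ [Suc j..<Suc k]) (%s. f (upd j r s)) 0" by (subst avgs_upd) auto
 finally show ?thesis .
qed

text \<open>The fundamental theorem of calculus in coordinate \<open>j\<close>, after the average
  over this coordinate has been moved to the innermost place.\<close>

lemma cint_partial_derivative:
 fixes f :: "'v::euclidean_space => real"
 assumes "Ck_on (Suc 0) UNIV f" "j \<le> k" "k < DIM('v)"
 shows "cint (Suc k) (%s. FD f s (eb j)) = cint k (%s. f (ins j 1 s)) - cint k (%s. f (ins j 0 s))"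
proof -
 have cf: "continuous_on UNIV f" and cD: "continuous_on UNIV (%s. FD f s (eb j))"
  using assms(1) Ck_on_continuous[OF assms(1)] by auto
 have av: "avg j (%s. FD f s (eb j)) s = f (upd j 1 s) - f (upd j 0 s)" for s
 proof -
  have "((%r. FD f (upd j r s) (eb j)) has_integral (f (upd j 1 s) - f (upd j 0 s))) {0..1}"
  proof (rule fundamental_theorem_of_calculus)
   fix r :: real
   have "upd j q s = (s - co s j *\<^sub>R eb j) + q *\<^sub>R eb j" for q by (simp add: upd_def algebra_simps)
   thus "((%r. f (upd j r s)) has_vector_derivative FD f (upd j r s) (eb j)) (at r within {0..1})"
    using line_derivative[of f "s - co s j *\<^sub>R eb j" r "eb j"] assms(1) by simp
  qed simp
  thus ?thesis unfolding avg_def by (rule integral_unique)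
 qed
 have l: "[0..<Suc k] = [0..<j] @ j # [Suc j..<Suc k]"
  using assms(2) by (metis le_Suc_eq le_imp_less_Suc upt_add_eq_append upt_conv_Cons le0 le_add_diff_inverse)
 have cu: "continuous_on UNIV (%s. f (upd j r s))" for r
  by (rule continuous_on_compose2[OF cf]) (auto intro!: continuous_intros)
 have "cint (Suc k) (%s. FD f s (eb j)) = avgs ([0..<j] @ [Suc j..<Suc k]) (avg j (%s. FD f s (eb j))) 0"
  unfolding cint_def l avgs_append by (simp add: avg_avgs_commute[OF cD])
 also have "avg j (%s. FD f s (eb j)) = (%s. f (upd j 1 s) + (- 1) * f (upd j 0 s))"
  by (rule ext) (simp add: av)
 also have "avgs ([0..<j] @ [Suc j..<Suc k]) (%s. f (upd j 1 s) + (- 1) * f (upd j 0 s)) 0 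
   = avgs ([0..<j] @ [Suc j..<Suc k]) (%s. f (upd j 1 s)) 0 - avgs ([0..<j] @ [Suc j..<Suc k]) (%s. f (upd j 0 s)) 0"
  by (subst avgs_add) (auto simp: avgs_scale[where c="-1", simplified] intro!: cu continuous_intros simp del: upt_Suc)
 also have "\<dots> = cint k (%s. f (ins j 1 s)) - cint k (%s. f (ins j 0 s))"
  unfolding cint_ins[OF assms(2)] ..
 finally show ?thesis .
qed

section \<open>Steklov averages and Stokes' theorem for maps of class C1\<close>

definition stek :: "real => nat => ('v::euclidean_space => 'z::euclidean_space) => 'v => 'z" where
 "stek e j f s = integral {0..1} (%r. f (s + (e * r) *\<^sub>R eb j))"

primrec steks :: "real => nat list => ('v::euclidean_space => 'z::euclidean_space) => 'v => 'z" where
 "steks e [] f = f"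
| "steks e (j # js) f = stek e j (steks e js f)"

definition mollify :: "real => ('v::euclidean_space => 'z::euclidean_space) => 'v => 'z" where
 "mollify e (f :: 'v => 'z) = steks e [0..<DIM('v)] f"

lemma steks_append: "steks e (js @ ks) f = steks e js (steks e ks f)"
 by (induction js) auto

lemma continuous_on_stek_param:
 assumes "continuous_on UNIV (%(e, s). f e s)"
 shows "continuous_on UNIV (%(e, s). stek e j (f e) s)"
proof -
 have g: "continuous_on (UNIV \<times> cbox 0 1) 
   (%x::(real \<times> 'a) \<times> real. (fst (fst x), snd (fst x) + (fst (fst x) * snd x) *\<^sub>R (eb j :: 'a)))"
  by (intro continuous_intros)
 have "continuous_on (UNIV \<times> cbox 0 1) (%x. f (fst (fst x)) (snd (fst x) + (fst (fst x) * snd x) *\<^sub>R eb j))"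
  using continuous_on_compose2[OF assms g subset_UNIV] by simp
 hence "continuous_on (UNIV \<times> cbox 0 1) (%(p, r). f (fst p) (snd p + (fst p * r) *\<^sub>R eb j))"
  by (simp add: split_beta)
 from integral_continuous_on_param[OF this] show ?thesis by (simp add: stek_def split_beta)
qed

lemma continuous_on_steks_param:
 assumes "continuous_on UNIV f"
 shows "continuous_on UNIV (%(e, s). steks e js f s)"
proof (induction js)
 case Nil
 have "continuous_on UNIV (%x::real \<times> 'a. f (snd x))"
  by (rule continuous_on_compose2[OF assms continuous_on_snd[OF continuous_on_id] subset_UNIV])
 thus ?case by (simp add: split_beta)
next
 case (Cons j js)
 from continuous_on_stek_param[OF Cons, of j] show ?case by simp
qed

lemma continuous_on_steks:
 assumes "continuous_on UNIV f"
 shows "continuous_on UNIV (steks e js f)"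
proof -
 have "continuous_on UNIV (%s. case (e, s) of (e, s) => steks e js f s)"
  by (rule continuous_on_compose2[OF continuous_on_steks_param[OF assms]]) (auto intro!: continuous_intros)
 thus ?thesis by simp
qed

lemma steks_0: "steks 0 js f = f"
 by (induction js) (auto simp: stek_def)

lemma stek_integrable:
 fixes f :: "'v::euclidean_space => 'z::euclidean_space"
 assumes "continuous_on UNIV f"
 shows "(%r. f (s + (e * r) *\<^sub>R eb j)) integrable_on {0..1}"
 by (rule integrable_continuous_real, rule continuous_on_compose2[OF assms])
  (auto intro!: continuous_intros)

lemma steks_add:
 assumes "continuous_on UNIV f" "continuous_on UNIV g"
 shows "steks e js (%s. f s + g s) = (%s. steks e js f s + steks e js g s)"
proof (induction js)
 case (Cons j js)
 thus ?case unfolding steks.simps Cons stek_def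
  by (intro ext integral_add stek_integrable continuous_on_steks assms)
qed simp

lemma steks_scale: "steks e js (%s. c *\<^sub>R f s) = (%s. c *\<^sub>R steks e js f s)"
 by (induction js) (simp_all add: stek_def)

lemma stek_has_derivative:
 assumes "Ck_on (Suc 0) UNIV f"
 shows "(stek e j f has_derivative (%u. stek e j (%s. FD f s u) s)) (at s)"
 unfolding stek_def
proof (rule has_derivative_integral_param[OF open_UNIV convex_UNIV UNIV_I, where f'="%s t u. FD f (s + (e * t) *\<^sub>R eb j) u"])
 fix s t
 have 1: "(f has_derivative FD f (s + (e * t) *\<^sub>R eb j)) (at (s + (e * t) *\<^sub>R eb j))"
  using assms by (intro has_FD) simp
 have 2: "((%s. s + (e * t) *\<^sub>R eb j) has_derivative (%u. u)) (at s)"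
  by (auto intro!: derivative_eq_intros)
 show "((%y. f (y + (e * t) *\<^sub>R eb j)) has_derivative FD f (s + (e * t) *\<^sub>R eb j)) (at s)"
  using has_derivative_compose[OF 2 1] .
next
 fix u
 have "continuous_on UNIV (%s. FD f s u)" using assms by simp
 thus "continuous_on (UNIV \<times> {0..1}) (%(y, t). FD f (y + (e * t) *\<^sub>R eb j) u)"
  unfolding split_beta by (rule continuous_on_compose2) (auto intro!: continuous_intros)
next
 fix s
 show "continuous_on {0..1} (%r. f (s + (e * r) *\<^sub>R eb j))"
  by (rule continuous_on_compose2[OF Ck_on_continuous[OF assms]]) (auto intro!: continuous_intros)
qed

lemma steks_C1:
 assumes "Ck_on (Suc 0) UNIV f"
 shows "Ck_on (Suc 0) UNIV (steks e js f)" and "FD (steks e js f) s u = steks e js (%s. FD f s u) s"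
proof -
 have "Ck_on (Suc 0) UNIV (steks e js f) \<and> (\<forall>s u. FD (steks e js f) s u = steks e js (%s. FD f s u) s)"
 proof (induction js)
  case (Cons j js)
  note d = stek_has_derivative[OF Cons[THEN conjunct1], of e j]
  have F: "FD (steks e (j # js) f) s u = steks e (j # js) (%s. FD f s u) s" for s u
   using Cons by (simp add: FD_eqI[OF d])
  have "continuous_on UNIV (%s. steks e (j # js) (%s. FD f s u) s)" for u
   using assms by (intro continuous_on_steks) simp
  moreover have "steks e (j # js) f differentiable (at s)" for s
   using d[of s] unfolding differentiable_def steks.simps by blast
  ultimately show ?case unfolding Ck_on.simps F by blast
 qed (use assms in auto)
 thus "Ck_on (Suc 0) UNIV (steks e js f)" "FD (steks e js f) s u = steks e js (%s. FD f s u) s" by auto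
qed

text \<open>The mean of a directional derivative along its own direction is a difference quotient;
  this is how averaging gains one order of differentiability.\<close>

lemma stek_FD:
 assumes "Ck_on (Suc 0) UNIV f" "e \<noteq> 0"
 shows "stek e j (%s. FD f s (eb j)) s = (1 / e) *\<^sub>R (f (s + e *\<^sub>R eb j) - f s)"
proof -
 have "((%r. e *\<^sub>R FD f (s + (e * r) *\<^sub>R eb j) (eb j)) has_integral
   (f (s + (e * 1) *\<^sub>R eb j) - f (s + (e * 0) *\<^sub>R eb j))) {0..1}"
 proof (rule fundamental_theorem_of_calculus)
  fix r :: real
  have d: "f differentiable (at z)" for z using assms(1) by simp
  show "((%r. f (s + (e * r) *\<^sub>R eb j)) has_vector_derivative e *\<^sub>R FD f (s + (e * r) *\<^sub>R eb j) (eb j)) (at r within {0..1})"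
   using line_derivative[OF d, where x = s and s = r and u = "e *\<^sub>R eb j"] by (simp add: linear_scale[OF linear_FD[OF d]] mult.commute)
 qed simp
 from integral_unique[OF this] have "e *\<^sub>R stek e j (%s. FD f s (eb j)) s = f (s + e *\<^sub>R eb j) - f s"
  by (simp add: stek_def)
 thus ?thesis using assms(2) by (simp flip: \<open>_ = f (s + e *\<^sub>R eb j) - f s\<close>)
qed

lemma mollify_C1:
 assumes "Ck_on (Suc 0) UNIV f"
 shows "Ck_on (Suc 0) UNIV (mollify e f)" and "FD (mollify e f) s u = mollify e (%s. FD f s u) s"
 unfolding mollify_def by (rule steks_C1[OF assms])+

text \<open>The average in direction \<open>eb j\<close> turns the j-th partial derivative into a
  difference quotient of a C1 map, while the other averages commute with differentiation and
  preserve C1. So every partial derivative is again C1.\<close>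

lemma mollify_C2:
 fixes f :: "'v::euclidean_space => 'z::euclidean_space"
 assumes "Ck_on (Suc 0) UNIV f" "e \<noteq> 0"
 shows "Ck_on 2 UNIV (mollify e f)"
proof -
 have *: "Ck_on (Suc 0) UNIV (%s. FD (mollify e f) s (eb j))" if j: "j < DIM('v)" for j
 proof -
  have l: "[0..<DIM('v)] = [0..<j] @ j # [Suc j..<DIM('v)]"
   using j by (metis le0 less_imp_le_nat upt_add_eq_append upt_conv_Cons le_add_diff_inverse)
  let ?g = "steks e [Suc j..<DIM('v)] f"
  have g: "Ck_on (Suc 0) UNIV ?g" by (rule steks_C1(1)[OF assms(1)])
  have sh: "Ck_on (Suc 0) UNIV (%s. ?g (s + e *\<^sub>R eb j))"
   by (rule Ck_on_compose[OF open_UNIV open_UNIV _ _ g])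
    (rule subset_UNIV, rule Ck_on_add[OF open_UNIV Ck_on_bounded_linear[OF bounded_linear_ident] Ck_on_const])
  have "(%s. FD (mollify e f) s (eb j)) = steks e [0..<j] (stek e j (%s. FD ?g s (eb j)))"
   unfolding mollify_C1(2)[OF assms(1)] unfolding mollify_def l steks_append
   by (simp add: steks_C1(2)[OF assms(1)])
  also have "stek e j (%s. FD ?g s (eb j)) = (%s. (1 / e) *\<^sub>R (?g (s + e *\<^sub>R eb j) - ?g s))"
   by (rule ext) (rule stek_FD[OF g assms(2)])
  finally show ?thesis
   by (simp only:) (intro steks_C1(1) Ck_on_scaleR Ck_on_const Ck_on_diff sh g open_UNIV)
 qed
 have d: "mollify e f differentiable (at s)" for s using mollify_C1(1)[OF assms(1), of e] by simp
 have "Ck_on (Suc 0) UNIV (%s. FD (mollify e f) s u)" for u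
 proof -
  have "(%s. FD (mollify e f) s u) = (%s. \<Sum>i<DIM('v). co u i *\<^sub>R FD (mollify e f) s (eb i))"
  proof
   fix s
   have "FD (mollify e f) s (\<Sum>i<DIM('v). co u i *\<^sub>R eb i) = (\<Sum>i<DIM('v). co u i *\<^sub>R FD (mollify e f) s (eb i))"
    by (simp add: linear_sum[OF linear_FD[OF d]] linear_scale[OF linear_FD[OF d]])
   thus "FD (mollify e f) s u = (\<Sum>i<DIM('v). co u i *\<^sub>R FD (mollify e f) s (eb i))"
    using co_expand[of u] by simp
  qed
  moreover have "Ck_on (Suc 0) UNIV (%s. \<Sum>i<DIM('v). co u i *\<^sub>R FD (mollify e f) s (eb i))"
   by (intro Ck_on_sum Ck_on_scaleR Ck_on_const open_UNIV *) auto
  ultimately show ?thesis by simp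
 qed
 thus ?thesis using d unfolding numeral_2_eq_2 Ck_on.simps(2)[of "Suc 0"] by blast
qed

text \<open>Joint continuity in scale and point, with scale 0 included, is what permits the limit in
  \<open>stokes_C1\<close>.\<close>

lemma continuous_on_mollify_param:
 assumes "continuous_on UNIV f" "continuous_on S e" "continuous_on S s"
 shows "continuous_on S (%x. mollify (e x) f (s x))"
 unfolding mollify_def
 by (rule continuous_on_compose2[OF continuous_on_steks_param[OF assms(1)], where f="%x. (e x, s x)", simplified])
  (auto intro!: continuous_intros assms)

lemma mollify_0: "mollify 0 f = f"
 by (simp add: mollify_def steks_0)

lemma alt_form_mollify:
 fixes a :: "'w::euclidean_space list => 'v::euclidean_space => real"
 assumes "\<And>s. alt_form k (%ws. a ws s)" "\<And>ws. length ws = k ==> continuous_on UNIV (a ws)"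
 shows "alt_form k (%ws. mollify e (a ws) s)"
 unfolding alt_form_def multilin_def
proof (intro conjI allI impI)
 fix xs ys :: "'w list" assume l: "length xs + length ys + 1 = k"
 have L: "linear (%w. a (xs @ w # ys) s)" for s
  by (rule multilin_linear[OF alt_form_multilin[OF assms(1)] l])
 have C: "continuous_on UNIV (a (xs @ w # ys))" for w using assms(2) l by simp
 show "linear (%w. mollify e (a (xs @ w # ys)) s)"
 proof (rule linearI)
  fix w w' c
  have "a (xs @ (w + w') # ys) = (%s. a (xs @ w # ys) s + a (xs @ w' # ys) s)"
   by (rule ext) (rule linear_add[OF L])
  thus "mollify e (a (xs @ (w + w') # ys)) s = mollify e (a (xs @ w # ys)) s + mollify e (a (xs @ w' # ys)) s"
   by (simp add: mollify_def steks_add[OF C C])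
  have "a (xs @ (c *\<^sub>R w) # ys) = (%s. c *\<^sub>R a (xs @ w # ys) s)"
   by (rule ext) (rule linear_scale[OF L])
  thus "mollify e (a (xs @ (c *\<^sub>R w) # ys)) s = c *\<^sub>R mollify e (a (xs @ w # ys)) s"
   by (simp only: mollify_def steks_scale)
 qed
next
 fix xs ys :: "'w list" and w assume l: "length xs + length ys + 2 = k"
 have "a (xs @ w # w # ys) = (%s. 0 *\<^sub>R (0::real))"
  by (rule ext) (use assms(1) l in "simp add: alt_form_def")
 thus "mollify e (a (xs @ w # w # ys)) s = 0" by (simp only: mollify_def steks_scale) simp
qed

lemma multilin_FD:
 fixes a :: "'w::euclidean_space list => 'v::euclidean_space => real"
 assumes "\<And>s. multilin k (%ws. a ws s)" "\<And>ws. length ws = k ==> a ws differentiable (at s)"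
 shows "multilin k (%ws. FD (a ws) s u)"
 unfolding multilin_def
proof (intro allI impI)
 fix xs ys :: "'w list" assume l: "length xs + length ys + 1 = k"
 have L: "linear (%w. a (xs @ w # ys) s)" for s by (rule multilin_linear[OF assms(1) l])
 have D: "(a (xs @ w # ys) has_derivative FD (a (xs @ w # ys)) s) (at s)" for w
  using assms(2) l by (intro has_FD) simp
 show "linear (%w. FD (a (xs @ w # ys)) s u)"
 proof (rule linearI)
  fix w w' c
  have "a (xs @ (w + w') # ys) = (%s. a (xs @ w # ys) s + a (xs @ w' # ys) s)"
   by (rule ext) (rule linear_add[OF L])
  thus "FD (a (xs @ (w + w') # ys)) s u = FD (a (xs @ w # ys)) s u + FD (a (xs @ w' # ys)) s u"
   by (simp add: FD_eqI[OF has_derivative_add[OF D D]])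
  have "a (xs @ (c *\<^sub>R w) # ys) = (%s. c *\<^sub>R a (xs @ w # ys) s)"
   by (rule ext) (rule linear_scale[OF L])
  thus "FD (a (xs @ (c *\<^sub>R w) # ys)) s u = c *\<^sub>R FD (a (xs @ w # ys)) s u"
   by (simp only: FD_eqI[OF has_derivative_scaleR_right[OF D]])
 qed
qed

text \<open>For nonzero scale the mollified map is C2, and the claim is \<open>ed_pullback\<close>
  followed by the fundamental theorem in each coordinate. The left side contains no second
  derivative of \<open>w\<close>, so it keeps its meaning for C1 maps, and both sides are continuous
  in the scale down to 0.\<close>

theorem stokes_C1:
 fixes a :: "'w::euclidean_space list => 'v::euclidean_space => real" and w :: "'v => 'w"
 assumes alt: "\<And>s. alt_form k (%ws. a ws s)" and aC1: "\<And>ws. length ws = k ==> Ck_on (Suc 0) UNIV (a ws)"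
  and wC1: "Ck_on (Suc 0) UNIV w" and k: "k < DIM('v)"
 defines "es \<equiv> map eb [0..<Suc k]"
 shows "cint (Suc k) (%s. \<Sum>i<Suc k. (-1) ^ i * FD (a (map (FD w s) (del_nth i es))) s (eb i)) =
  (\<Sum>i<Suc k. (-1) ^ i *
   (cint k (%s. a (map (FD w (ins i 1 s)) (del_nth i es)) (ins i 1 s)) -
   cint k (%s. a (map (FD w (ins i 0 s)) (del_nth i es)) (ins i 0 s))))"
  (is "?L = ?R")
proof -
 define ae where "ae e ws = mollify e (a ws)" for e ws
 define we where "we e = mollify e w" for e
 define L where "L e = cint (Suc k) (%s. \<Sum>i<Suc k. (-1) ^ i * FD (ae e (map (FD (we e) s) (del_nth i es))) s (eb i))" for e
 define R where "R e = (\<Sum>i<Suc k. (-1) ^ i *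
   (cint k (%s. ae e (map (FD (we e) (ins i 1 s)) (del_nth i es)) (ins i 1 s)) -
   cint k (%s. ae e (map (FD (we e) (ins i 0 s)) (del_nth i es)) (ins i 0 s))))" for e
 have les: "length es = Suc k" "\<And>i. i < Suc k ==> es ! i = eb i" 
  unfolding es_def by (auto simp del: upt_Suc)
 have ac: "continuous_on UNIV (a ws)" if "length ws = k" for ws using Ck_on_continuous[OF aC1[OF that]] .
 have altae: "alt_form k (%ws. ae e ws s)" for e s unfolding ae_def by (rule alt_form_mollify[OF alt ac])
 have aeC1: "Ck_on (Suc 0) UNIV (ae e ws)" if "length ws = k" for e ws
  unfolding ae_def by (rule mollify_C1(1)[OF aC1[OF that]])
 have FDae: "FD (ae e ws) s u = mollify e (%s. FD (a ws) s u) s" if "length ws = k" for e ws s u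
  unfolding ae_def by (rule mollify_C1(2)[OF aC1[OF that]])
 have FDwe: "FD (we e) s u = mollify e (%s. FD w s u) s" for e s u
  unfolding we_def by (rule mollify_C1(2)[OF wC1])
 have cFDw: "continuous_on UNIV (%s. FD w s u)" for u using wC1 by simp
 have cFDa: "continuous_on UNIV (%s. FD (a ws) s u)" if "length ws = k" for ws u
  using aC1[OF that] by simp
 have cA: "continuous_on UNIV (%x. ae (e x) (map (FD (we (e x)) (s x)) us) (s x))"
  if "length us = k" "continuous_on UNIV e" "continuous_on UNIV s" for us and e :: "'z::topological_space => real" and s
 proof -
  have "continuous_on UNIV (%x. (%ws x. ae (e x) ws (s x)) (map (%W. W x) (map (%u x. FD (we (e x)) (s x) u) us)) x)"
  proof (rule multilin_continuous_on)
   show "continuous_on UNIV (%x. ae (e x) ws (s x))" if "length ws = length (map (%u x. FD (we (e x)) (s x) u) us)" for ws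
    unfolding ae_def by (rule continuous_on_mollify_param) (use that \<open>length us = k\<close> \<open>continuous_on UNIV e\<close> \<open>continuous_on UNIV s\<close> ac in auto)
  qed (use that alt_form_multilin[OF altae] in "auto simp: FDwe intro!: continuous_on_mollify_param cFDw")
  thus ?thesis by (simp add: comp_def)
 qed
 have cB: "continuous_on UNIV (%x. FD (ae (e x) (map (FD (we (e x)) (s x)) us)) (s x) u)"
  if "length us = k" "continuous_on UNIV e" "continuous_on UNIV s" for us u and e :: "'z::topological_space => real" and s
 proof -
  have m: "multilin k (%ws. FD (ae e ws) s u)" for e s
   by (rule multilin_FD[OF alt_form_multilin[OF altae]]) (use aeC1 in simp)
  have "continuous_on UNIV (%x. (%ws x. FD (ae (e x) ws) (s x) u) (map (%W. W x) (map (%u x. FD (we (e x)) (s x) u) us)) x)"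
   by (rule multilin_continuous_on)
    (use that m in "auto simp: FDwe FDae intro!: continuous_on_mollify_param cFDw cFDa")
  thus ?thesis by (simp add: comp_def)
 qed
 have eq: "L e = R e" if e: "e \<noteq> 0" for e
 proof -
  let ?om = "%us s. ae e (map (FD (we e) s) us) s"
  have w2: "Ck_on 2 UNIV (we e)" unfolding we_def by (rule mollify_C2[OF wC1 e])
  have om1: "Ck_on (Suc 0) UNIV (?om us)" if "length us = k" for us
  proof -
   have "Ck_on (Suc 0) UNIV (%s. ae e (map (%W. W s) (map (%u s. FD (we e) s u) us)) s)"
   proof (rule multilin_Ck_on[OF open_UNIV])
    show "Ck_on (Suc 0) UNIV W" if "W \<in> set (map (%u s. FD (we e) s u) us)" for W
     using that w2 unfolding numeral_2_eq_2 Ck_on.simps(2)[of "Suc 0"] by auto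
    show "Ck_on (Suc 0) UNIV (ae e ws)" if "length ws = length (map (%u s. FD (we e) s u) us)" for ws
     using that \<open>length us = k\<close> by (intro aeC1) simp
   qed (use alt_form_multilin[OF altae] that in auto)
   thus ?thesis by (simp add: comp_def)
  qed
  have "L e = cint (Suc k) (%s. ed ?om es s)"
  proof -
   have "(\<Sum>i<Suc k. (-1) ^ i * FD (ae e (map (FD (we e) s) (del_nth i es))) s (eb i)) = ed ?om es s" for s
    by (subst ed_pullback[OF open_UNIV UNIV_I w2 altae])
     (use aeC1 les in "auto intro!: sum.cong simp del: sum.lessThan_Suc")
   thus ?thesis by (simp only: L_def)
  qed
  also have "\<dots> = (\<Sum>i<Suc k. cint (Suc k) (%s. (-1) ^ i * FD (?om (del_nth i es)) s (eb i)))"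
  proof -
   have "ed ?om es = (%s. \<Sum>i<Suc k. (-1) ^ i * FD (?om (del_nth i es)) s (eb i))"
    unfolding ed_def les(1) by (rule ext) (auto intro!: sum.cong simp: les(2))
   moreover have "cint (Suc k) (%s. \<Sum>i<Suc k. (-1) ^ i * FD (?om (del_nth i es)) s (eb i)) = 
    (\<Sum>i<Suc k. cint (Suc k) (%s. (-1) ^ i * FD (?om (del_nth i es)) s (eb i)))"
   proof (rule cint_sum)
    fix i assume "i \<in> {..<Suc k}"
    hence "Ck_on (Suc 0) UNIV (?om (del_nth i es))" using les by (intro om1) auto
    thus "continuous_on UNIV (%s. (-1) ^ i * FD (?om (del_nth i es)) s (eb i))"
     by (intro continuous_intros) simp
   qed
   ultimately show ?thesis by simp
  qed
  also have "\<dots> = R e" unfolding R_def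
  proof (rule sum.cong)
   fix i assume i: "i \<in> {..<Suc k}"
   hence "Ck_on (Suc 0) UNIV (?om (del_nth i es))" using les by (intro om1) auto
   from cint_partial_derivative[OF this _ k, of i] i
   show "cint (Suc k) (%s. (-1) ^ i * FD (?om (del_nth i es)) s (eb i)) =
    (-1) ^ i * (cint k (%s. ?om (del_nth i es) (ins i 1 s)) - cint k (%s. ?om (del_nth i es) (ins i 0 s)))"
    by (simp add: cint_scale)
  qed simp
  finally show ?thesis .
 qed
 have cL: "continuous_on UNIV L" unfolding L_def
 proof (rule continuous_on_cint_param)
  show "continuous_on (UNIV \<times> UNIV) (%(e, s). \<Sum>i<Suc k. (- 1) ^ i * FD (ae e (map (FD (we e) s) (del_nth i es))) s (eb i))"
   unfolding split_beta UNIV_Times_UNIV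
   by (intro continuous_intros cB) (use les in auto)
 qed
 have cR: "continuous_on UNIV R" unfolding R_def
 proof (intro continuous_on_sum continuous_on_mult_left continuous_on_diff; rule continuous_on_cint_param)
  fix i assume "i \<in> {..<Suc k}"
  thus "continuous_on (UNIV \<times> UNIV) (%(e, s). ae e (map (FD (we e) (ins i 1 s)) (del_nth i es)) (ins i 1 s))"
    "continuous_on (UNIV \<times> UNIV) (%(e, s). ae e (map (FD (we e) (ins i 0 s)) (del_nth i es)) (ins i 0 s))"
   unfolding split_beta UNIV_Times_UNIV using les
   by (auto intro!: cA continuous_intros continuous_on_compose2[OF continuous_on_ins])
 qed
 have "L 0 = R 0"
 proof -
  have "(L \<longlongrightarrow> L 0) (at 0)" "(R \<longlongrightarrow> R 0) (at 0)"
   using cL cR by (auto simp: continuous_on_def)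
  moreover have "(L \<longlongrightarrow> R 0) (at 0)"
   by (rule Lim_transform_eventually[OF \<open>(R \<longlongrightarrow> R 0) (at 0)\<close>])
    (auto simp: eventually_at_filter eq)
  ultimately show ?thesis using LIM_unique by blast
 qed
 thus ?thesis by (simp add: L_def R_def ae_def we_def mollify_0 del: sum.lessThan_Suc)
qed

section \<open>Tangent vectors and differential forms on the manifold\<close>

section \<open>Charts and tangent vectors\<close>

locale manifold =
 fixes \<A> :: "('a::{second_countable_topology,t2_space}, 'e::euclidean_space) chart set"
 assumes atlas: "smooth_atlas \<A>"
begin

abbreviation "TS \<equiv> tangent_space \<A>"
abbreviation "tgt \<equiv> tangent_of \<A>"
abbreviation "loc \<equiv> local_form \<A>"

lemma chart_open: "c \<in> \<A> ==> open (fst c)" "c \<in> \<A> ==> open (snd c ` fst c)"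
 and chart_homeo: "c \<in> \<A> ==> homeomorphism (fst c) (snd c ` fst c) (snd c) (chart_inv c)"
 using atlas by (auto simp: smooth_atlas_def)

lemma chart_inv_snd [simp]: "c \<in> \<A> ==> x \<in> fst c ==> chart_inv c (snd c x) = x"
 using homeomorphism_apply1[OF chart_homeo] .

lemma snd_chart_inv [simp]: "c \<in> \<A> ==> y \<in> snd c ` fst c ==> snd c (chart_inv c y) = y"
 using homeomorphism_apply2[OF chart_homeo] .

lemma chart_inv_in: "c \<in> \<A> ==> y \<in> snd c ` fst c ==> chart_inv c y \<in> fst c"
 by (metis chart_homeo homeomorphism_image2 imageI)

lemma continuous_on_chart: "c \<in> \<A> ==> continuous_on (fst c) (snd c)"
 and continuous_on_chart_inv: "c \<in> \<A> ==> continuous_on (snd c ` fst c) (chart_inv c)"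
 using homeomorphism_cont1[OF chart_homeo] homeomorphism_cont2[OF chart_homeo] by auto

lemma open_chart_image:
 assumes "c \<in> \<A>" "open U"
 shows "open (snd c ` (fst c \<inter> U))"
proof -
 have "snd c ` (fst c \<inter> U) = snd c ` fst c \<inter> chart_inv c -` U"
 proof (intro Set.set_eqI iffI)
  fix y assume y: "y \<in> snd c ` fst c \<inter> chart_inv c -` U"
  hence "snd c (chart_inv c y) = y" "chart_inv c y \<in> fst c \<inter> U" using assms(1) chart_inv_in by auto
  thus "y \<in> snd c ` (fst c \<inter> U)" by (metis imageI)
 qed (use assms(1) in auto)
 thus ?thesis
  using continuous_open_preimage[OF continuous_on_chart_inv[OF assms(1)] chart_open(2)[OF assms(1)] assms(2)] by simp
qed

lemma chart_at: "chart_at \<A> x \<in> \<A>" "x \<in> fst (chart_at \<A> x)"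
proof -
 have "x \<in> (\<Union>c\<in>\<A>. fst c)" using atlas by (simp add: smooth_atlas_def)
 hence "\<exists>c. c \<in> \<A> \<and> x \<in> fst c" by blast
 from someI_ex[OF this] show "chart_at \<A> x \<in> \<A>" "x \<in> fst (chart_at \<A> x)"
  by (auto simp: chart_at_def)
qed

lemma transition_smooth:
 "c \<in> \<A> ==> d \<in> \<A> ==> smooth_on (snd c ` (fst c \<inter> fst d)) (snd d \<circ> chart_inv c)"
 using atlas by (auto simp: smooth_atlas_def)

lemma transition_has_derivative:
 assumes "c \<in> \<A>" "d \<in> \<A>" "x \<in> fst c" "x \<in> fst d"
 shows "((snd d \<circ> chart_inv c) has_derivative coord_change c d x) (at (snd c x))"
 unfolding coord_change_def
 by (rule has_FD, rule smooth_on_differentiable[OF transition_smooth[OF assms(1,2)]]) (use assms in auto)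

lemma linear_coord_change:
 assumes "c \<in> \<A>" "d \<in> \<A>" "x \<in> fst c" "x \<in> fst d"
 shows "linear (coord_change c d x)"
 using has_derivative_linear[OF transition_has_derivative[OF assms]] .

lemma coord_change_compose:
 assumes "c \<in> \<A>" "d \<in> \<A>" "e \<in> \<A>" "x \<in> fst c" "x \<in> fst d" "x \<in> fst e"
 shows "coord_change d e x (coord_change c d x u) = coord_change c e x u"
proof -
 have 1: "((snd d \<circ> chart_inv c) has_derivative coord_change c d x) (at (snd c x))"
  by (rule transition_has_derivative[OF assms(1,2,4,5)])
 have 2: "((snd e \<circ> chart_inv d) has_derivative coord_change d e x) (at ((snd d \<circ> chart_inv c) (snd c x)))"
  using transition_has_derivative[OF assms(2,3,5,6)] assms(1,4) by simp
 have "((%y. (snd e \<circ> chart_inv d) ((snd d \<circ> chart_inv c) y)) has_derivative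
  (%u. coord_change d e x (coord_change c d x u))) (at (snd c x))"
  by (rule has_derivative_compose[OF 1 2])
 hence "((snd e \<circ> chart_inv c) has_derivative (%u. coord_change d e x (coord_change c d x u))) (at (snd c x))"
  by (rule has_derivative_transform_within_open[OF _ open_chart_image[OF assms(1) chart_open(1)[OF assms(2)]]])
   (use assms in "auto simp: chart_inv_in")
 from fun_cong[OF has_derivative_unique[OF this transition_has_derivative[OF assms(1,3,4,6)]]] show ?thesis .
qed

lemma coord_change_self: "c \<in> \<A> ==> x \<in> fst c ==> coord_change c c x u = u"
proof -
 assume c: "c \<in> \<A>" "x \<in> fst c"
 have "((snd c \<circ> chart_inv c) has_derivative (%u. u)) (at (snd c x))"
  by (rule has_derivative_transform_within_open[OF has_derivative_ident chart_open(2)[OF c(1)]])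
   (use c in auto)
 from FD_eqI[OF this] show ?thesis by (simp add: coord_change_def)
qed

lemma tgt_in_TS: 
 assumes "c \<in> \<A>" "x \<in> fst c"
 shows "tgt c x u \<in> TS x"
 unfolding tangent_space_def mem_Collect_eq
proof (intro conjI allI impI)
 fix d e assume "d \<in> \<A> \<and> e \<in> \<A> \<and> x \<in> fst d \<inter> fst e"
 thus "tgt c x u e = coord_change d e x (tgt c x u d)"
  using coord_change_compose[of c d e x u] assms by (simp add: tangent_of_def)
qed (auto simp: tangent_of_def)

lemma tgt_apply: "d \<in> \<A> ==> x \<in> fst d ==> tgt c x u d = coord_change c d x u"
 by (simp add: tangent_of_def)

lemma tgt_self: "c \<in> \<A> ==> x \<in> fst c ==> tgt c x u c = u"
 by (simp add: tgt_apply coord_change_self)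

lemma TS_coord: "v \<in> TS x ==> c \<in> \<A> ==> d \<in> \<A> ==> x \<in> fst c ==> x \<in> fst d ==> v d = coord_change c d x (v c)"
 unfolding tangent_space_def by blast

lemma tgt_of_TS: "v \<in> TS x ==> c \<in> \<A> ==> x \<in> fst c ==> tgt c x (v c) = v"
proof
 assume v: "v \<in> TS x" and c: "c \<in> \<A>" "x \<in> fst c"
 fix d
 have "v d = 0" if "\<not> (d \<in> \<A> \<and> x \<in> fst d)"
  using v that unfolding tangent_space_def mem_Collect_eq by blast
 thus "tgt c x (v c) d = v d" using TS_coord[OF v c(1) _ c(2), of d] by (simp add: tangent_of_def)
qed

lemma tgt_change: "c \<in> \<A> ==> d \<in> \<A> ==> x \<in> fst c ==> x \<in> fst d ==> tgt d x (coord_change c d x u) = tgt c x u"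
 by (rule ext) (simp add: tangent_of_def coord_change_compose)

lemma tgt_linear:
 assumes "c \<in> \<A>" "x \<in> fst c"
 shows "tgt c x (u + w) = (%d. tgt c x u d + tgt c x w d)" "tgt c x (r *\<^sub>R u) = (%d. r *\<^sub>R tgt c x u d)"
 by (rule ext; simp add: tangent_of_def linear_add[OF linear_coord_change] linear_scale[OF linear_coord_change] assms)+

lemma tgt_lin_comb:
 assumes "c \<in> \<A>" "x \<in> fst c"
 shows "tgt c x (r *\<^sub>R u + q *\<^sub>R w) = lin_comb r (tgt c x u) q (tgt c x w)"
 by (simp add: tgt_linear[OF assms] lin_comb_def)

lemma lin_comb_TS: 
 assumes "v \<in> TS x" "w \<in> TS x"
 shows "lin_comb r v q w \<in> TS x"
proof -
 let ?c = "chart_at \<A> x"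
 have "lin_comb r v q w = tgt ?c x (r *\<^sub>R v ?c + q *\<^sub>R w ?c)"
  using tgt_lin_comb[OF chart_at, of x] tgt_of_TS[OF assms(1) chart_at] tgt_of_TS[OF assms(2) chart_at] by simp
 thus ?thesis by (simp add: tgt_in_TS[OF chart_at])
qed

section \<open>Differential forms on open subsets\<close>

text \<open>Forms vanish off \<open>U\<close> by convention, which makes equality on
  \<open>U\<close> an equality of functions. Alternation is required in coordinates, where
  \<open>alt_form\<close> applies; \<open>forms_on_UNIV\<close> identifies the global case with
  \<open>forms\<close>.\<close>

definition forms_on :: "'a set => nat => ('a, 'e) form set" where
 "forms_on U k = {\<phi>.
  (\<forall>x vs. \<phi> x vs \<noteq> 0 --> x \<in> U \<and> length vs = k \<and> set vs \<subseteq> TS x) \<and>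
  (\<forall>c\<in>\<A>. \<forall>x\<in>fst c. alt_form k (%us. \<phi> x (map (tgt c x) us))) \<and>
  (\<forall>c\<in>\<A>. \<forall>us. length us = k --> smooth_on (snd c ` (fst c \<inter> U)) (loc c \<phi> us))}"

lemma forms_onD:
 assumes "\<phi> \<in> forms_on U k"
 shows "x \<notin> U ==> \<phi> x vs = 0" "length vs \<noteq> k ==> \<phi> x vs = 0" "\<not> set vs \<subseteq> TS x ==> \<phi> x vs = 0"
  and "c \<in> \<A> ==> x \<in> fst c ==> alt_form k (%us. \<phi> x (map (tgt c x) us))"
  and "c \<in> \<A> ==> length us = k ==> smooth_on (snd c ` (fst c \<inter> U)) (loc c \<phi> us)"
proof -
 note p = assms[unfolded forms_on_def mem_Collect_eq]
 show "x \<notin> U ==> \<phi> x vs = 0" "length vs \<noteq> k ==> \<phi> x vs = 0" "\<not> set vs \<subseteq> TS x ==> \<phi> x vs = 0"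
  using p[THEN conjunct1, rule_format, of x vs] by argo+
 show "c \<in> \<A> ==> x \<in> fst c ==> alt_form k (%us. \<phi> x (map (tgt c x) us))"
  using p[THEN conjunct2, THEN conjunct1] by simp
 show "c \<in> \<A> ==> length us = k ==> smooth_on (snd c ` (fst c \<inter> U)) (loc c \<phi> us)"
  using p[THEN conjunct2, THEN conjunct2] by simp
qed

lemma forms_on_nz:
 assumes "\<phi> \<in> forms_on U k" "\<phi> x vs \<noteq> 0"
 shows "x \<in> U \<and> length vs = k \<and> set vs \<subseteq> TS x"
 using assms(1)[unfolded forms_on_def mem_Collect_eq, THEN conjunct1, rule_format, OF assms(2)] .

lemma loc_eq: "c \<in> \<A> ==> x \<in> fst c ==> loc c \<phi> us (snd c x) = \<phi> x (map (tgt c x) us)"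
 by (simp add: local_form_def)

lemma form_eq_loc:
 assumes "c \<in> \<A>" "x \<in> fst c" "set vs \<subseteq> TS x"
 shows "\<phi> x vs = loc c \<phi> (map (%v. v c) vs) (snd c x)"
proof -
 have "map (%v. tgt c x (v c)) vs = vs"
  by (rule map_idI) (rule tgt_of_TS[OF _ assms(1,2)], use assms(3) in blast)
 thus ?thesis using assms(1,2) by (simp add: loc_eq comp_def)
qed

lemma alt_form_loc:
 assumes "\<phi> \<in> forms_on U k" "c \<in> \<A>" "y \<in> snd c ` fst c"
 shows "alt_form k (%us. loc c \<phi> us y)"
 using forms_onD(4)[OF assms(1,2) chart_inv_in[OF assms(2,3)]] by (simp add: local_form_def)

lemma loc_change:
 assumes "c \<in> \<A>" "d \<in> \<A>" "y \<in> snd c ` (fst c \<inter> fst d)"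
 shows "loc c \<phi> us y = loc d \<phi> (map (FD (snd d \<circ> chart_inv c) y) us) ((snd d \<circ> chart_inv c) y)"
proof -
 obtain x where x: "y = snd c x" "x \<in> fst c" "x \<in> fst d" using assms(3) by auto
 have "map (tgt d x) (map (FD (snd d \<circ> chart_inv c) y) us) = map (tgt c x) us"
  using tgt_change[OF assms(1,2) x(2,3)] x(1) by (simp add: coord_change_def)
 thus ?thesis using assms(1,2) x by (simp add: local_form_def del: map_map)
qed

lemma forms_on_vector:
 assumes "\<phi> \<in> forms_on U k" "\<psi> \<in> forms_on U k" "open U"
 shows "(%x vs. \<phi> x vs + \<psi> x vs) \<in> forms_on U k" and "(%x vs. r * \<phi> x vs) \<in> forms_on U k"
  and "(%x vs. \<phi> x vs - \<psi> x vs) \<in> forms_on U k"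
proof -
 have l: "loc c (%x vs. \<phi> x vs + \<psi> x vs) us = (%y. loc c \<phi> us y + loc c \<psi> us y)"
  "loc c (%x vs. r * \<phi> x vs) us = (%y. r * loc c \<phi> us y)"
  "loc c (%x vs. \<phi> x vs - \<psi> x vs) us = (%y. loc c \<phi> us y - loc c \<psi> us y)" for c us r
  by (auto simp: local_form_def)
 have al: "alt_form k (%ws. a ws + b ws)" "alt_form k (%ws. r * a ws)" "alt_form k (%ws. a ws - b ws)"
  if "alt_form k a" "alt_form k b" for a b :: "'e list => real" and r
 proof -
  have "linear (%w. r * f w)" if "linear f" for f :: "'e => real"
   using linear_compose_scale_right[OF that, of r] by simp
  thus "alt_form k (%ws. a ws + b ws)" "alt_form k (%ws. r * a ws)" "alt_form k (%ws. a ws - b ws)"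
   using that unfolding alt_form_def multilin_def
   by (auto intro: linear_compose_add linear_compose_sub)
 qed
 note o = open_chart_image[OF _ assms(3)]
 note p = assms(1,2)[unfolded forms_on_def mem_Collect_eq]
 show "(%x vs. \<phi> x vs + \<psi> x vs) \<in> forms_on U k" unfolding forms_on_def mem_Collect_eq l
 proof (intro conjI ballI allI impI)
  fix x vs assume "\<phi> x vs + \<psi> x vs \<noteq> 0"
  hence "\<phi> x vs \<noteq> 0 \<or> \<psi> x vs \<noteq> 0" by auto
  thus "x \<in> U" "length vs = k" "set vs \<subseteq> TS x"
   using forms_on_nz[OF assms(1), of x vs] forms_on_nz[OF assms(2), of x vs] by argo+
 qed (use p in "auto intro!: al smooth_on_arith o")
 show "(%x vs. r * \<phi> x vs) \<in> forms_on U k" unfolding forms_on_def mem_Collect_eq l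
 proof (intro conjI ballI allI impI)
  fix x vs assume "r * \<phi> x vs \<noteq> 0"
  hence "\<phi> x vs \<noteq> 0" by auto
  thus "x \<in> U" "length vs = k" "set vs \<subseteq> TS x"
   using forms_on_nz[OF assms(1), of x vs] by argo+
 qed (use p in "auto intro!: al smooth_on_mult o smooth_on_const")
 show "(%x vs. \<phi> x vs - \<psi> x vs) \<in> forms_on U k" unfolding forms_on_def mem_Collect_eq l
 proof (intro conjI ballI allI impI)
  fix x vs assume "\<phi> x vs - \<psi> x vs \<noteq> 0"
  hence "\<phi> x vs \<noteq> 0 \<or> \<psi> x vs \<noteq> 0" by auto
  thus "x \<in> U" "length vs = k" "set vs \<subseteq> TS x"
   using forms_on_nz[OF assms(1), of x vs] forms_on_nz[OF assms(2), of x vs] by argo+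
 qed (use p in "auto intro!: al smooth_on_arith o")
qed

lemma zero_forms_on: "(%x vs. 0) \<in> forms_on U k"
 by (auto simp: forms_on_def alt_form_def multilin_def local_form_def[abs_def] smooth_on_const linear_zero)

definition smooth_fun_on :: "'a set => ('a => 'z::euclidean_space) => bool" where
 "smooth_fun_on U f \<longleftrightarrow> (\<forall>c\<in>\<A>. smooth_on (snd c ` (fst c \<inter> U)) (%y. f (chart_inv c y)))"

lemma alt_form_scale: "alt_form k a ==> alt_form k (%ws. r * a ws)"
proof -
 assume a: "alt_form k a"
 have "linear (%w. r * f w)" if "linear f" for f :: "'b => real"
  using linear_compose_scale_right[OF that, of r] by simp
 thus ?thesis using a unfolding alt_form_def multilin_def by auto
qed

text \<open>Extension by zero: near a point of \<open>V\<close> the product of a smooth function and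
  a form is smooth, and near a point of \<open>U\<close> outside \<open>V\<close> it vanishes
  identically.\<close>

lemma forms_on_extend:
 assumes "open U" "open V" "smooth_fun_on (U \<inter> V) f" "\<phi> \<in> forms_on (U \<inter> V) k"
  and "\<And>x. x \<in> U ==> x \<notin> V ==> \<exists>N. open N \<and> x \<in> N \<and> (\<forall>y\<in>N. f y = 0)"
 shows "(%x vs. f x * \<phi> x vs) \<in> forms_on U k"
 unfolding forms_on_def mem_Collect_eq
proof (intro conjI ballI allI impI)
 fix x vs assume "f x * \<phi> x vs \<noteq> 0"
 hence "\<phi> x vs \<noteq> 0" by auto
 thus "x \<in> U" "length vs = k" "set vs \<subseteq> TS x" using forms_on_nz[OF assms(4), of x vs] by blast+
next
 fix c x assume "c \<in> \<A>" "x \<in> fst c"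
 thus "alt_form k (%us. f x * \<phi> x (map (tgt c x) us))"
  using forms_onD(4)[OF assms(4)] by (intro alt_form_scale)
next
 fix c and us :: "'e list" assume c: "c \<in> \<A>" "length us = k"
 let ?F = "%x vs. f x * \<phi> x vs"
 show "smooth_on (snd c ` (fst c \<inter> U)) (loc c ?F us)"
 proof (rule smooth_on_local)
  fix y assume "y \<in> snd c ` (fst c \<inter> U)"
  then obtain x where x: "y = snd c x" "x \<in> fst c" "x \<in> U" by auto
  show "\<exists>T. open T \<and> y \<in> T \<and> smooth_on T (loc c ?F us)"
  proof (cases "x \<in> V")
   case True
   let ?T = "snd c ` (fst c \<inter> (U \<inter> V))"
   have T: "open ?T" using open_chart_image[OF c(1)] assms(1,2) by blast
   have "smooth_on ?T (%y. f (chart_inv c y) * loc c \<phi> us y)"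
    by (rule smooth_on_mult[OF T]) (use assms(3) c forms_onD(5)[OF assms(4)] in "auto simp: smooth_fun_on_def")
   hence "smooth_on ?T (loc c ?F us)" by (simp add: local_form_def[abs_def])
   thus ?thesis using T x True by blast
  next
   case False
   then obtain N where N: "open N" "x \<in> N" "\<forall>y\<in>N. f y = 0" using assms(5) x by blast
   let ?T = "snd c ` (fst c \<inter> N)"
   have T: "open ?T" using open_chart_image[OF c(1) N(1)] .
   have "smooth_on ?T (loc c ?F us)"
    by (rule smooth_on_cong[OF T _ smooth_on_const[of _ 0]]) (use N c in "auto simp: local_form_def")
   thus ?thesis using T x N by blast
  qed
 qed
qed

definition res :: "'a set => ('a, 'e) form => ('a, 'e) form" where
 "res V \<phi> = (%x vs. if x \<in> V then \<phi> x vs else 0)"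

lemma res_forms_on:
 assumes "\<phi> \<in> forms_on U k" "V \<subseteq> U" "open V"
 shows "res V \<phi> \<in> forms_on V k"
 unfolding forms_on_def mem_Collect_eq
proof (intro conjI ballI allI impI)
 fix x vs assume "res V \<phi> x vs \<noteq> 0"
 hence "x \<in> V \<and> \<phi> x vs \<noteq> 0" by (auto simp: res_def split: if_splits)
 thus "x \<in> V" "length vs = k" "set vs \<subseteq> TS x" using forms_on_nz[OF assms(1), of x vs] by blast+
next
 fix c x assume "c \<in> \<A>" "x \<in> fst c"
 thus "alt_form k (%us. res V \<phi> x (map (tgt c x) us))"
  using alt_form_scale[OF forms_onD(4)[OF assms(1)], of c x "if x \<in> V then 1 else 0"]
  by (cases "x \<in> V") (simp_all add: res_def)
next
 fix c and us :: "'e list" assume c: "c \<in> \<A>" "length us = k"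
 show "smooth_on (snd c ` (fst c \<inter> V)) (loc c (res V \<phi>) us)"
 proof (rule smooth_on_cong[OF open_chart_image[OF c(1) assms(3)]])
  show "smooth_on (snd c ` (fst c \<inter> V)) (loc c \<phi> us)"
   by (rule smooth_on_subset[OF forms_onD(5)[OF assms(1) c]]) (use assms(2) in auto)
 qed (use c in "auto simp: local_form_def res_def")
qed

lemma alt_form_congI:
 fixes a b :: "'w::real_vector list => real"
 assumes "alt_form k a" "\<And>ws. length ws = k ==> a ws = b ws"
 shows "alt_form k b"
proof -
 have "a (xs @ w # ys) = b (xs @ w # ys)" if "length xs + length ys + 1 = k" for xs w ys
  using assms(2) that by simp
 moreover have "a (xs @ w # w # ys) = b (xs @ w # w # ys)" if "length xs + length ys + 2 = k" for xs w ys
  using assms(2) that by simp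
 ultimately show ?thesis using assms(1) unfolding alt_form_def multilin_def by simp
qed

definition chart_form :: "('a, 'e) chart => 'a set => nat => ('e list => 'e => real) => ('a, 'e) form" where
 "chart_form c W k a = (%x vs. if x \<in> W \<and> length vs = k \<and> set vs \<subseteq> TS x then a (map (%v. v c) vs) (snd c x) else 0)"

lemma loc_chart_form:
 assumes "c \<in> \<A>" "W \<subseteq> fst c" "y \<in> snd c ` W" "length us = k"
 shows "loc c (chart_form c W k a) us y = a us y"
proof -
 obtain x where x: "x \<in> W" "y = snd c x" using assms(3) by auto
 hence "x \<in> fst c" using assms(2) by auto
 thus ?thesis using x assms tgt_in_TS[OF assms(1)]
  by (auto simp: loc_eq chart_form_def comp_def tgt_self)
qed

text \<open>In another chart the coefficients are those of \<open>a\<close>, evaluated on vectors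
  transported by the derivative of the transition map; \<open>multilin_Ck_on\<close> gives their
  smoothness.\<close>

lemma chart_form_forms_on:
 assumes "c \<in> \<A>" "W \<subseteq> fst c" "open W" "\<And>y. y \<in> snd c ` W ==> alt_form k (%us. a us y)"
  and "\<And>us. length us = k ==> smooth_on (snd c ` W) (a us)"
 shows "chart_form c W k a \<in> forms_on W k"
proof -
 let ?\<phi> = "chart_form c W k a"
 have W: "open (snd c ` W)" using open_chart_image[OF assms(1,3)] assms(2) by (simp add: Int_absorb1)
 have tg: "?\<phi> x (map (tgt d x) us) = a (map (coord_change d c x) us) (snd c x)"
  if "d \<in> \<A>" "x \<in> fst d" "x \<in> W" "length us = k" for d x us
  using that assms(1,2) tgt_in_TS[OF that(1,2)] by (auto simp: chart_form_def comp_def tgt_apply)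
 show ?thesis unfolding forms_on_def mem_Collect_eq
 proof (intro conjI ballI allI impI)
  fix x vs assume "?\<phi> x vs \<noteq> 0"
  thus "x \<in> W" "length vs = k" "set vs \<subseteq> TS x" by (auto simp: chart_form_def split: if_splits)
 next
  fix d x assume d: "d \<in> \<A>" "x \<in> fst d"
  show "alt_form k (%us. ?\<phi> x (map (tgt d x) us))"
  proof (cases "x \<in> W")
   case True
   have A: "alt_form k (%us. a us (snd c x))" using assms(4) True by blast
   have L: "linear (coord_change d c x)"
    using linear_coord_change[OF d(1) assms(1) d(2)] True assms(2) by blast
   have "alt_form k (%us. a (map (coord_change d c x) us) (snd c x))" unfolding alt_form_def multilin_def
   proof (intro conjI allI impI)
    fix xs ys :: "'e list" assume l: "length xs + length ys + 1 = k"
    have "linear (%w. a (map (coord_change d c x) xs @ w # map (coord_change d c x) ys) (snd c x))"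
     by (rule multilin_linear[OF alt_form_multilin[OF A]]) (use l in simp)
    from linear_compose[OF L this] show "linear (%w. a (map (coord_change d c x) (xs @ w # ys)) (snd c x))"
     by (simp add: comp_def)
   next
    fix xs ys :: "'e list" and w assume l: "length xs + length ys + 2 = k"
    show "a (map (coord_change d c x) (xs @ w # w # ys)) (snd c x) = 0"
     using alt_form_repeat[OF A, of "map (coord_change d c x) xs" "[]" "map (coord_change d c x) ys" "coord_change d c x w"] l
     by simp
   qed
   thus ?thesis by (rule alt_form_congI) (use tg[OF d True] in simp)
  next
   case False
   thus ?thesis by (auto simp: chart_form_def alt_form_def multilin_def linear_zero)
  qed
 next
  fix d and us :: "'e list" assume d: "d \<in> \<A>" "length us = k"
  let ?S = "snd d ` (fst d \<inter> W)" and ?t = "snd c \<circ> chart_inv d"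
  have S: "open ?S" using open_chart_image[OF d(1) assms(3)] .
  have t: "smooth_on ?S ?t"
   by (rule smooth_on_subset[OF transition_smooth[OF d(1) assms(1)]]) (use assms(2) in auto)
  have tS: "?t ` ?S \<subseteq> snd c ` W" using d(1) by auto
  have "smooth_on ?S (%y. a (map (%W. W y) (map (%u y. FD ?t y u) us)) (?t y))"
  proof (rule smooth_onI, rule multilin_Ck_on[OF S])
   fix j
   show "multilin (length (map (%u y. FD ?t y u) us)) (%ws. a ws (?t s))" if "s \<in> ?S" for s
    using assms(4)[of "?t s"] that tS d(2) by (auto intro!: alt_form_multilin)
   show "Ck_on j ?S W" if "W \<in> set (map (%u y. FD ?t y u) us)" for W
    using that smooth_on_FD[OF t] by (auto simp: smooth_on_def)
   show "Ck_on j ?S (%s. a ws (?t s))" if "length ws = length (map (%u y. FD ?t y u) us)" for ws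
    by (rule Ck_on_compose[OF S W tS]) (use t assms(5) that d(2) in "auto simp: smooth_on_def")
  qed
  hence "smooth_on ?S (%y. a (map (FD ?t y) us) (?t y))" by (simp add: comp_def)
  thus "smooth_on ?S (loc d ?\<phi> us)"
  proof (rule smooth_on_cong[OF S, rotated])
   fix y assume y: "y \<in> ?S"
   then obtain x where x: "x \<in> fst d" "x \<in> W" "y = snd d x" by auto
   show "a (map (FD ?t y) us) (?t y) = loc d ?\<phi> us y"
    using tg[OF d(1) x(1,2) d(2)] x d(1) by (simp add: loc_eq coord_change_def)
  qed
 qed
qed

section \<open>The exterior derivative on the manifold\<close>

lemma ext_deriv_def': "set vs \<subseteq> TS x ==>
  ext_deriv \<A> \<phi> x vs = ed (loc (chart_at \<A> x) \<phi>) (map (%v. v (chart_at \<A> x)) vs) (snd (chart_at \<A> x) x)"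
 by (simp add: ext_deriv_def ed_def Let_def del_nth_def)

lemma loc_smooth_at:
 assumes "\<phi> \<in> forms_on U k" "open U" "c \<in> \<A>" "x \<in> fst c" "x \<in> U" "length us = k"
 shows "loc c \<phi> us differentiable (at (snd c x))"
 by (rule smooth_on_differentiable[OF forms_onD(5)[OF assms(1,3,6)]]) (use assms in auto)

text \<open>The coordinate expressions in two charts are pull-backs of one another along the
  transition map, and \<open>ed_pullback\<close> shows that \<open>ed\<close> respects this
  relation.\<close>

lemma ext_deriv_chart:
 assumes "\<phi> \<in> forms_on U k" "open U" "c \<in> \<A>" "x \<in> fst c" "x \<in> U" "set vs \<subseteq> TS x" "length vs = Suc k"
 shows "ext_deriv \<A> \<phi> x vs = ed (loc c \<phi>) (map (%v. v c) vs) (snd c x)"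
proof -
 let ?d = "chart_at \<A> x" and ?us = "map (%v. v c) vs"
 let ?t = "snd ?d \<circ> chart_inv c"
 let ?S = "snd c ` (fst c \<inter> (fst ?d \<inter> U))" and ?y = "snd c x"
 note d = chart_at[of x]
 have S: "open ?S" by (rule open_chart_image[OF assms(3)]) (use chart_open(1)[OF d(1)] assms(2) in auto)
 have yS: "?y \<in> ?S" using assms(4,5) d by auto
 have t: "smooth_on ?S ?t" by (rule smooth_on_subset[OF transition_smooth[OF assms(3) d(1)]]) auto
 have ty: "?t ?y = snd ?d x" using assms(3,4) by simp
 have us: "map (%v. v ?d) vs = map (FD ?t ?y) ?us"
  using assms(6) TS_coord[OF _ assms(3) d(1) assms(4) d(2)] by (auto simp: coord_change_def)
 have dt: "(?t has_derivative FD ?t ?y) (at ?y)" by (rule has_FD[OF smooth_on_differentiable[OF t yS]])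
 have D: "(loc ?d \<phi> ws has_derivative FD (loc ?d \<phi> ws) (?t ?y)) (at (?t ?y))" if "length ws = k" for ws
  unfolding ty by (rule has_FD[OF loc_smooth_at[OF assms(1,2) d assms(5) that]])
 have comp: "((%s. loc ?d \<phi> ws (?t s)) has_derivative (%u. FD (loc ?d \<phi> ws) (?t ?y) (FD ?t ?y u))) (at ?y)"
  if "length ws = k" for ws
  by (rule has_derivative_compose[OF dt D[OF that]])
 have "ed (loc c \<phi>) ?us ?y = ed (%us s. loc ?d \<phi> (map (FD ?t s) us) (?t s)) ?us ?y"
  by (rule ed_cong_open[OF S yS]) (rule loc_change[OF assms(3) d(1)], auto)
 also have "\<dots> = (\<Sum>i<length ?us. (-1) ^ i * FD (%s. loc ?d \<phi> (map (FD ?t ?y) (del_nth i ?us)) (?t s)) ?y (?us ! i))"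
 proof (rule ed_pullback[OF S yS])
  show "Ck_on 2 ?S ?t" by (rule smooth_onD[OF t])
  show "alt_form k (%ws. loc ?d \<phi> ws (?t s))" if "s \<in> ?S" for s
   by (rule alt_form_loc[OF assms(1) d(1)]) (use that assms(3) in auto)
  show "(%s. loc ?d \<phi> ws (?t s)) differentiable at ?y" if "length ws = k" for ws
   using comp[OF that] by (auto simp: differentiable_def)
 qed (use assms(7) in simp)
 also have "\<dots> = (\<Sum>i<length ?us. (-1) ^ i * FD (loc ?d \<phi> (del_nth i (map (FD ?t ?y) ?us))) (?t ?y) (map (FD ?t ?y) ?us ! i))"
 proof (rule sum.cong)
  fix i assume "i \<in> {..<length ?us}"
  hence "i < length vs" "length (map (FD ?t ?y) (del_nth i ?us)) = k" using assms(7) by auto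
  thus "(-1) ^ i * FD (%s. loc ?d \<phi> (map (FD ?t ?y) (del_nth i ?us)) (?t s)) ?y (?us ! i)
   = (-1) ^ i * FD (loc ?d \<phi> (del_nth i (map (FD ?t ?y) ?us))) (?t ?y) (map (FD ?t ?y) ?us ! i)"
   using FD_eqI[OF comp] by (simp add: map_del_nth)
 qed simp
 also have "\<dots> = ed (loc ?d \<phi>) (map (%v. v ?d) vs) (snd ?d x)"
  unfolding us ty by (simp add: ed_def)
 finally show ?thesis using ext_deriv_def'[OF assms(6)] by simp
qed

lemma ext_deriv_not_TS: "\<not> set vs \<subseteq> TS x ==> ext_deriv \<A> \<phi> x vs = 0"
 by (simp add: ext_deriv_def)

lemma ext_deriv_wrong_length:
 assumes "\<phi> \<in> forms_on U k" "length vs \<noteq> Suc k"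
 shows "ext_deriv \<A> \<phi> x vs = 0"
proof (cases "set vs \<subseteq> TS x")
 case True
 have "loc c \<phi> us = (%y. 0)" if "length us \<noteq> k" for c us
  using forms_onD(2)[OF assms(1)] that by (auto simp: local_form_def)
 hence "FD (loc c \<phi> (del_nth i us)) y u = 0" if "i < length us" "length us \<noteq> Suc k" for c us i y u
  using that by (cases us) auto
 thus ?thesis using assms(2) unfolding ext_deriv_def'[OF True] ed_def by (intro sum.neutral) auto
qed (simp add: ext_deriv_def)

definition ext_on :: "'a set => ('a, 'e) form => ('a, 'e) form" where
 "ext_on U \<phi> = res U (ext_deriv \<A> \<phi>)"

lemma ext_on_UNIV: "ext_on UNIV \<phi> = ext_deriv \<A> \<phi>"
 by (simp add: ext_on_def res_def)

lemma loc_ext_on: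
 assumes "\<phi> \<in> forms_on U k" "open U" "c \<in> \<A>" "y \<in> snd c ` (fst c \<inter> U)" "length us = Suc k"
 shows "loc c (ext_on U \<phi>) us y = ed (loc c \<phi>) us y"
proof -
 obtain x where x: "x \<in> fst c" "x \<in> U" "y = snd c x" using assms(4) by auto
 have "set (map (tgt c x) us) \<subseteq> TS x" using tgt_in_TS[OF assms(3) x(1)] by auto
 moreover have "map (%v. v c) (map (tgt c x) us) = us"
  using tgt_self[OF assms(3) x(1)] by (simp add: comp_def)
 ultimately show ?thesis using ext_deriv_chart[OF assms(1-3) x(1,2), of "map (tgt c x) us"] assms(3,5) x
  by (simp add: loc_eq ext_on_def res_def)
qed

lemma ext_on_forms_on:
 assumes "\<phi> \<in> forms_on U k" "open U"
 shows "ext_on U \<phi> \<in> forms_on U (Suc k)"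
proof -
 have d: "loc c \<phi> us differentiable (at y)" if "c \<in> \<A>" "y \<in> snd c ` (fst c \<inter> U)" "length us = k" for c us y
  using smooth_on_differentiable[OF forms_onD(5)[OF assms(1)]] that by blast
 have sm: "smooth_on (snd c ` (fst c \<inter> U)) (ed (loc c \<phi>) us)" if c: "c \<in> \<A>" "length us = Suc k" for c us
 proof -
  have o: "open (snd c ` (fst c \<inter> U))" by (rule open_chart_image[OF c(1) assms(2)])
  show ?thesis unfolding ed_def[abs_def]
  proof (intro smooth_on_sum smooth_on_mult smooth_on_const smooth_on_FD o)
   fix i assume "i \<in> {..<length us}"
   thus "smooth_on (snd c ` (fst c \<inter> U)) (loc c \<phi> (del_nth i us))"
    using c by (intro forms_onD(5)[OF assms(1)]) auto
  qed
 qed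
 show ?thesis unfolding forms_on_def mem_Collect_eq
 proof (intro conjI ballI allI impI)
  fix x vs assume "ext_on U \<phi> x vs \<noteq> 0"
  hence "x \<in> U \<and> ext_deriv \<A> \<phi> x vs \<noteq> 0" by (auto simp: ext_on_def res_def split: if_splits)
  thus "x \<in> U" "length vs = Suc k" "set vs \<subseteq> TS x"
   using ext_deriv_wrong_length[OF assms(1)] ext_deriv_not_TS by blast+
 next
  fix c x assume c: "c \<in> \<A>" "x \<in> fst c"
  show "alt_form (Suc k) (%us. ext_on U \<phi> x (map (tgt c x) us))"
  proof (cases "x \<in> U")
   case True
   let ?S = "snd c ` (fst c \<inter> U)"
   have "alt_form (Suc k) (%us. ed (loc c \<phi>) us (snd c x))"
    by (rule alt_form_ed[OF open_chart_image[OF c(1) assms(2)]])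
     (use True c in "auto intro!: alt_form_loc[OF assms(1)] d")
   thus ?thesis
    by (rule alt_form_congI) (use loc_ext_on[OF assms c(1), of "snd c x"] c True in "simp add: loc_eq")
  next
   case False
   thus ?thesis by (auto simp: ext_on_def res_def alt_form_def multilin_def linear_zero)
  qed
 next
  fix c and us :: "'e list" assume c: "c \<in> \<A>" "length us = Suc k"
  show "smooth_on (snd c ` (fst c \<inter> U)) (loc c (ext_on U \<phi>) us)"
   by (rule smooth_on_cong[OF open_chart_image[OF c(1) assms(2)] _ sm[OF c]])
    (use loc_ext_on[OF assms c(1) _ c(2)] in simp)
 qed
qed

lemma form_eqI:
 assumes "\<phi> \<in> forms_on U k" "\<psi> \<in> forms_on U k"
  and "\<And>x. x \<in> U ==> \<exists>c\<in>\<A>. x \<in> fst c \<and> (\<forall>us. length us = k --> loc c \<phi> us (snd c x) = loc c \<psi> us (snd c x))"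
 shows "\<phi> = \<psi>"
proof (rule ext, rule ext)
 fix x :: 'a and vs :: "('a, 'e) tangent list"
 show "\<phi> x vs = \<psi> x vs"
 proof (cases "x \<in> U \<and> length vs = k \<and> set vs \<subseteq> TS x")
  case True
  then obtain c where c: "c \<in> \<A>" "x \<in> fst c" "\<forall>us. length us = k --> loc c \<phi> us (snd c x) = loc c \<psi> us (snd c x)"
   using assms(3) by blast
  have "\<phi> x vs = loc c \<phi> (map (%v. v c) vs) (snd c x)" by (rule form_eq_loc[OF c(1,2)]) (use True in simp)
  also have "\<dots> = loc c \<psi> (map (%v. v c) vs) (snd c x)" using c(3) True by simp
  also have "\<dots> = \<psi> x vs" by (rule form_eq_loc[OF c(1,2), symmetric]) (use True in simp)
  finally show ?thesis .
 next
  case False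
  then consider "x \<notin> U" | "\<not> set vs \<subseteq> TS x" | "length vs \<noteq> k" by blast
  thus ?thesis
   by cases (simp_all add: forms_onD(1)[OF assms(1)] forms_onD(2)[OF assms(1)] forms_onD(3)[OF assms(1)]
     forms_onD(1)[OF assms(2)] forms_onD(2)[OF assms(2)] forms_onD(3)[OF assms(2)])
 qed
qed

lemma ext_on_ext_on:
 assumes "\<phi> \<in> forms_on U k" "open U"
 shows "ext_on U (ext_on U \<phi>) = (%x vs. 0)"
proof (rule form_eqI[OF _ zero_forms_on])
 note f = ext_on_forms_on[OF assms]
 show "ext_on U (ext_on U \<phi>) \<in> forms_on U (Suc (Suc k))" by (rule ext_on_forms_on[OF f assms(2)])
 fix x assume x: "x \<in> U"
 let ?c = "chart_at \<A> x"
 note c = chart_at[of x]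
 have o: "open (snd ?c ` (fst ?c \<inter> U))" by (rule open_chart_image[OF c(1) assms(2)])
 have "loc ?c (ext_on U (ext_on U \<phi>)) us (snd ?c x) = 0" if l: "length us = Suc (Suc k)" for us
 proof -
  have "loc ?c (ext_on U (ext_on U \<phi>)) us (snd ?c x) = ed (loc ?c (ext_on U \<phi>)) us (snd ?c x)"
   by (rule loc_ext_on[OF f assms(2) c(1) _ l]) (use x c in auto)
  also have "\<dots> = ed (ed (loc ?c \<phi>)) us (snd ?c x)"
   by (rule ed_cong_open[OF o]) (use x c l loc_ext_on[OF assms c(1)] in auto)
  also have "\<dots> = 0"
   by (rule ed_ed[OF o]) (use x c l smooth_onD[OF forms_onD(5)[OF assms(1) c(1)]] in auto)
  finally show ?thesis .
 qed
 thus "\<exists>c\<in>\<A>. x \<in> fst c \<and> (\<forall>us. length us = Suc (Suc k) -->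
   loc c (ext_on U (ext_on U \<phi>)) us (snd c x) = loc c (%x vs. 0) us (snd c x))"
  using c by (intro bexI[of _ ?c]) (auto simp: local_form_def)
qed

text \<open>Locality of the exterior derivative: cut-off factors may be dropped wherever they are
  identically 1.\<close>

lemma ext_deriv_cong_open:
 assumes "open N" "x \<in> N" "\<And>y vs. y \<in> N ==> \<phi> y vs = \<psi> y vs"
 shows "ext_deriv \<A> \<phi> x vs = ext_deriv \<A> \<psi> x vs"
proof (cases "set vs \<subseteq> TS x")
 case True
 let ?c = "chart_at \<A> x"
 note c = chart_at[of x]
 have "ed (loc ?c \<phi>) us (snd ?c x) = ed (loc ?c \<psi>) us (snd ?c x)" for us
  by (rule ed_cong_open[OF open_chart_image[OF c(1) assms(1)]]) (use c assms in "auto simp: local_form_def")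
 thus ?thesis by (simp add: ext_deriv_def'[OF True])
qed (simp add: ext_deriv_def)

lemma ext_on_diff:
 assumes "\<phi> \<in> forms_on U k" "\<psi> \<in> forms_on U k" "open U"
 shows "ext_on U (%x vs. \<phi> x vs - \<psi> x vs) = (%x vs. ext_on U \<phi> x vs - ext_on U \<psi> x vs)"
proof (intro ext)
 fix x vs
 show "ext_on U (%x vs. \<phi> x vs - \<psi> x vs) x vs = ext_on U \<phi> x vs - ext_on U \<psi> x vs"
 proof (cases "x \<in> U \<and> set vs \<subseteq> TS x \<and> length vs = Suc k")
  case True
  let ?c = "chart_at \<A> x" and ?us = "map (%v. v (chart_at \<A> x)) vs"
  note c = chart_at[of x]
  have l: "loc ?c (%x vs. \<phi> x vs - \<psi> x vs) us = (%y. loc ?c \<phi> us y - loc ?c \<psi> us y)" for us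
   by (auto simp: local_form_def)
  have "FD (loc ?c (%x vs. \<phi> x vs - \<psi> x vs) (del_nth i ?us)) (snd ?c x) u =
   FD (loc ?c \<phi> (del_nth i ?us)) (snd ?c x) u - FD (loc ?c \<psi> (del_nth i ?us)) (snd ?c x) u" if "i < length vs" for i u
   unfolding l
   by (rule FD_minus; rule loc_smooth_at[OF _ assms(3) c]) (use assms True that in auto)
  hence "ed (loc ?c (%x vs. \<phi> x vs - \<psi> x vs)) ?us (snd ?c x) = 
    ed (loc ?c \<phi>) ?us (snd ?c x) - ed (loc ?c \<psi>) ?us (snd ?c x)"
   unfolding ed_def by (simp add: right_diff_distrib sum_subtractf)
  thus ?thesis using True by (simp add: ext_on_def res_def ext_deriv_def')
 next
  case False
  then consider "x \<notin> U" | "\<not> set vs \<subseteq> TS x" | "length vs \<noteq> Suc k" by blast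
  thus ?thesis
  proof cases
   case 3
   thus ?thesis using ext_deriv_wrong_length[OF assms(1)] ext_deriv_wrong_length[OF assms(2)]
     ext_deriv_wrong_length[OF forms_on_vector(3)[OF assms]] by (simp add: ext_on_def res_def)
  qed (simp_all add: ext_on_def res_def ext_deriv_not_TS)
 qed
qed

text \<open>The homotopy operator acts on the convex coordinate image, and its result is carried
  back by \<open>chart_form\<close>.\<close>

lemma poincare_lemma:
 assumes "c \<in> \<A>" "W \<subseteq> fst c" "open W" "convex (snd c ` W)" "\<phi> \<in> forms_on W (Suc k)" "ext_on W \<phi> = (%x vs. 0)"
 shows "\<exists>\<psi>\<in>forms_on W k. ext_on W \<psi> = \<phi>"
\<comment> \<open>An empty set has no centre for the contraction; all forms on it are zero.\<close>
proof (cases "W = {}")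
 case True
 have "\<phi> = (%x vs. 0)" "ext_on W (%x vs. 0) = (%x vs. 0)" 
  using forms_onD(1)[OF assms(5)] True by (auto simp: ext_on_def res_def)
 thus ?thesis by (intro bexI[OF _ zero_forms_on]) simp
next
 case False
 then obtain x0 where x0: "x0 \<in> W" by auto
 let ?S = "snd c ` W" and ?y0 = "snd c x0" and ?a = "loc c \<phi>"
 have Wc: "fst c \<inter> W = W" using assms(2) by auto
 have S: "open ?S" using open_chart_image[OF assms(1,3)] by (simp add: Wc)
 have y0: "?y0 \<in> ?S" using x0 by simp
 have sm: "smooth_on ?S (?a us)" if "length us = Suc k" for us
  using forms_onD(5)[OF assms(5,1) that] by (simp add: Wc)
 have al: "alt_form (Suc k) (%us. ?a us y)" if "y \<in> ?S" for y
  by (rule alt_form_loc[OF assms(5,1)]) (use that assms(2) in auto)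
 let ?K = "poincare ?y0 k ?a"
 define \<psi> where "\<psi> = chart_form c W k ?K"
 have K: "smooth_on ?S (?K us)" if "length us = k" for us
  by (rule smooth_on_poincare[OF S assms(4) y0 sm that])
 have Kal: "alt_form k (%us. ?K us y)" if "y \<in> ?S" for y
  by (rule alt_form_poincare[OF S assms(4) y0 that smooth_on_continuous[OF sm] al])
 have \<psi>: "\<psi> \<in> forms_on W k"
  unfolding \<psi>_def by (rule chart_form_forms_on[OF assms(1-3) Kal K])
 have cl: "ed ?a us z = 0" if "z \<in> ?S" "length us = Suc (Suc k)" for us z
  using loc_ext_on[OF assms(5,3,1), of z us] that by (simp add: Wc assms(6) local_form_def)
 have "ext_on W \<psi> = \<phi>"
 proof (rule form_eqI[OF ext_on_forms_on[OF \<psi> assms(3)] assms(5)])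
  fix x assume x: "x \<in> W"
  have "loc c (ext_on W \<psi>) us (snd c x) = loc c \<phi> us (snd c x)" if l: "length us = Suc k" for us
  proof -
   have "loc c (ext_on W \<psi>) us (snd c x) = ed (loc c \<psi>) us (snd c x)"
    by (rule loc_ext_on[OF \<psi> assms(3,1) _ l]) (use x Wc in auto)
   also have "\<dots> = ed ?K us (snd c x)"
    by (rule ed_cong_open[OF S]) (use x l in "auto simp: \<psi>_def loc_chart_form[OF assms(1,2)]")
   also have "\<dots> = ?a us (snd c x)"
    by (rule ed_poincare[OF S assms(4) y0 _ smooth_onD[OF sm] al cl l]) (use x in auto)
   finally show ?thesis .
  qed
  thus "\<exists>c\<in>\<A>. x \<in> fst c \<and> (\<forall>us. length us = Suc k --> loc c (ext_on W \<psi>) us (snd c x) = loc c \<phi> us (snd c x))"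
   using assms(1,2) x by blast
 qed
 with \<psi> show ?thesis by blast
qed

lemma forms_on_UNIV: "forms_on UNIV k = forms \<A> k"
proof (rule subset_antisym; rule subsetI)
 fix \<phi> assume \<phi>: "\<phi> \<in> forms_on UNIV k"
 show "\<phi> \<in> forms \<A> k" unfolding forms_def mem_Collect_eq
 proof (intro conjI allI impI ballI)
  fix x vs assume "\<not> (length vs = k \<and> set vs \<subseteq> TS x)"
  then consider "length vs \<noteq> k" | "\<not> set vs \<subseteq> TS x" by blast
  thus "\<phi> x vs = 0"
  proof cases
   case 1
   thus ?thesis by (rule forms_onD(2)[OF \<phi>])
  next
   case 2
   thus ?thesis by (rule forms_onD(3)[OF \<phi>])
  qed
 next
  fix x vs i v w a b assume vs: "length vs = k \<and> set vs \<subseteq> TS x" and i: "i < k" and vw: "v \<in> TS x" "w \<in> TS x"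
  let ?c = "chart_at \<A> x"
  note c = chart_at[of x]
  have up: "\<phi> x (vs[i := z]) = loc ?c \<phi> (take i (map (%v. v ?c) vs) @ z ?c # drop (Suc i) (map (%v. v ?c) vs)) (snd ?c x)"
   if "z \<in> TS x" for z
  proof -
   have "set (vs[i := z]) \<subseteq> TS x" using set_update_subset_insert[of vs i z] vs that by auto
   thus ?thesis
    using form_eq_loc[OF c, of "vs[i := z]"] i vs by (simp add: upd_conv_take_nth_drop take_map drop_map)
  qed
  have L: "linear (%u. loc ?c \<phi> (take i (map (%v. v ?c) vs) @ u # drop (Suc i) (map (%v. v ?c) vs)) (snd ?c x))"
   by (rule multilin_linear[OF alt_form_multilin[OF alt_form_loc[OF \<phi> c(1)]]]) (use c vs i in auto)
  show "\<phi> x (vs[i := lin_comb a v b w]) = a * \<phi> x (vs[i := v]) + b * \<phi> x (vs[i := w])"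
   unfolding up[OF vw(1)] up[OF vw(2)] up[OF lin_comb_TS[OF vw]]
   by (simp add: lin_comb_def linear_add[OF L] linear_scale[OF L])
 next
  fix x vs i j assume vs: "length vs = k \<and> set vs \<subseteq> TS x" and ij: "i < k" "j < k" "i \<noteq> j \<and> vs ! i = vs ! j"
  let ?c = "chart_at \<A> x"
  note c = chart_at[of x]
  have "loc ?c \<phi> (map (%v. v ?c) vs) (snd ?c x) = 0"
   by (rule alt_form_nth_eq_0[OF alt_form_loc[OF \<phi> c(1)], of _ _ i j]) (use c vs ij in auto)
  thus "\<phi> x vs = 0" using form_eq_loc[OF c, of vs] vs by simp
 next
  fix c and us :: "'e list" assume "c \<in> \<A>" "length us = k"
  thus "smooth_on (snd c ` fst c) (loc c \<phi> us)" using forms_onD(5)[OF \<phi>] by simp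
 qed
next
 fix \<phi> assume \<phi>: "\<phi> \<in> forms \<A> k"
 note F = \<phi>[unfolded forms_def mem_Collect_eq]
 have z: "\<phi> x vs = 0" if "\<not> (length vs = k \<and> set vs \<subseteq> TS x)" for x vs
  using F[THEN conjunct1, rule_format, OF that] .
 have lin: "\<phi> x (vs[i := lin_comb a v b w]) = a * \<phi> x (vs[i := v]) + b * \<phi> x (vs[i := w])"
  if "length vs = k" "set vs \<subseteq> TS x" "i < k" "v \<in> TS x" "w \<in> TS x" for x vs i v w a b
  using F[THEN conjunct2, THEN conjunct1, rule_format, OF conjI[OF that(1,2)], THEN conjunct1] that(3-5) by blast
 have alt: "\<phi> x vs = 0" if "length vs = k" "set vs \<subseteq> TS x" "i < k" "j < k" "i \<noteq> j" "vs ! i = vs ! j" for x vs i j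
  using F[THEN conjunct2, THEN conjunct1, rule_format, OF conjI[OF that(1,2)], THEN conjunct2] that(3-6) by blast
 show "\<phi> \<in> forms_on UNIV k" unfolding forms_on_def mem_Collect_eq
 proof (intro conjI ballI allI impI)
  fix x vs assume "\<phi> x vs \<noteq> 0"
  thus "x \<in> UNIV" "length vs = k" "set vs \<subseteq> TS x" using z[of vs x] by auto
 next
  fix c x assume c: "c \<in> \<A>" "x \<in> fst c"
  show "alt_form k (%us. \<phi> x (map (tgt c x) us))" unfolding alt_form_def multilin_def
  proof (intro conjI allI impI)
   fix xs ys :: "'e list" assume l: "length xs + length ys + 1 = k"
   have e: "map (tgt c x) (xs @ w # ys) = (map (tgt c x) (xs @ 0 # ys))[length xs := tgt c x w]" for w
    by (simp add: list_update_append)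
   let ?vs = "map (tgt c x) (xs @ 0 # ys)"
   have *: "\<phi> x (?vs[length xs := lin_comb a (tgt c x v) b (tgt c x w)]) =
    a * \<phi> x (?vs[length xs := tgt c x v]) + b * \<phi> x (?vs[length xs := tgt c x w])" for a b v w
    by (rule lin) (use l tgt_in_TS[OF c] in auto)
   show "linear (%w. \<phi> x (map (tgt c x) (xs @ w # ys)))"
   proof (rule linearI)
    fix v w a
    show "\<phi> x (map (tgt c x) (xs @ (v + w) # ys)) = \<phi> x (map (tgt c x) (xs @ v # ys)) + \<phi> x (map (tgt c x) (xs @ w # ys))"
     unfolding e[of "v + w"] e[of v] e[of w] using *[of 1 v 1 w] tgt_lin_comb[OF c, of 1 v 1 w] by simp
    show "\<phi> x (map (tgt c x) (xs @ (a *\<^sub>R v) # ys)) = a *\<^sub>R \<phi> x (map (tgt c x) (xs @ v # ys))"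
     unfolding e[of "a *\<^sub>R v"] e[of v] using *[of a v 0 v] tgt_lin_comb[OF c, of a v 0 v] by simp
   qed
  next
   fix xs ys :: "'e list" and w assume l: "length xs + length ys + 2 = k"
   show "\<phi> x (map (tgt c x) (xs @ w # w # ys)) = 0"
    by (rule alt[of _ _ "length xs" "Suc (length xs)"]) (use l tgt_in_TS[OF c] in "auto simp: nth_append")
  qed
 next
  fix c and us :: "'e list" assume "c \<in> \<A>" "length us = k"
  thus "smooth_on (snd c ` (fst c \<inter> UNIV)) (loc c \<phi> us)" using F by simp
 qed
qed

end

context manifold
begin

section \<open>Smooth functions and bump functions\<close>

lemma smooth_fun_on_subset: "smooth_fun_on U f ==> V \<subseteq> U ==> smooth_fun_on V f"
 unfolding smooth_fun_on_def
proof
 fix c assume "\<forall>c\<in>\<A>. smooth_on (snd c ` (fst c \<inter> U)) (%y. f (chart_inv c y))" "V \<subseteq> U" "c \<in> \<A>"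
 thus "smooth_on (snd c ` (fst c \<inter> V)) (%y. f (chart_inv c y))"
  by - (rule smooth_on_subset[of "snd c ` (fst c \<inter> U)"], auto)
qed

lemma smooth_fun_on_cong:
 assumes "open U" "\<And>x. x \<in> U ==> f x = g x" "smooth_fun_on U f"
 shows "smooth_fun_on U g"
 unfolding smooth_fun_on_def
proof
 fix c assume c: "c \<in> \<A>"
 show "smooth_on (snd c ` (fst c \<inter> U)) (%y. g (chart_inv c y))"
  by (rule smooth_on_cong[OF open_chart_image[OF c assms(1)], of "%y. f (chart_inv c y)"])
   (use assms(2,3) c in "auto simp: smooth_fun_on_def")
qed

lemma smooth_fun_on_local:
 assumes "\<And>x. x \<in> U ==> \<exists>N. open N \<and> x \<in> N \<and> smooth_fun_on N f"
 shows "smooth_fun_on U f"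
 unfolding smooth_fun_on_def
proof (intro ballI smooth_on_local)
 fix c y assume c: "c \<in> \<A>" and "y \<in> snd c ` (fst c \<inter> U)"
 then obtain x where x: "x \<in> fst c" "x \<in> U" "y = snd c x" by auto
 then obtain N where N: "open N" "x \<in> N" "smooth_fun_on N f" using assms by blast
 show "\<exists>T. open T \<and> y \<in> T \<and> smooth_on T (%y. f (chart_inv c y))"
  by (rule exI[of _ "snd c ` (fst c \<inter> N)"])
   (use x N c open_chart_image[OF c N(1)] in "auto simp: smooth_fun_on_def")
qed

lemma smooth_fun_on_const: "smooth_fun_on U (%x. r)"
 by (simp add: smooth_fun_on_def smooth_on_const)

lemma smooth_fun_on_scaleR:
 "open U ==> smooth_fun_on U f ==> smooth_fun_on U g ==> smooth_fun_on U (%x. f x *\<^sub>R g x)"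
 unfolding smooth_fun_on_def by (intro ballI smooth_on_scaleR open_chart_image) simp_all

lemma smooth_fun_on_mult:
 fixes f g :: "'a => real"
 shows "open U ==> smooth_fun_on U f ==> smooth_fun_on U g ==> smooth_fun_on U (%x. f x * g x)"
 unfolding smooth_fun_on_def by (intro ballI smooth_on_mult open_chart_image) simp_all

lemma smooth_fun_on_diff:
 "open U ==> smooth_fun_on U f ==> smooth_fun_on U g ==> smooth_fun_on U (%x. f x - g x)"
 unfolding smooth_fun_on_def by (intro ballI smooth_on_arith open_chart_image) simp_all

lemma smooth_fun_on_prod:
 fixes f :: "'i => 'a => real"
 assumes "open U" "\<And>i. i \<in> I ==> smooth_fun_on U (f i)"
 shows "smooth_fun_on U (%x. \<Prod>i\<in>I. f i x)"
 using assms(2)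
 by (induction I rule: infinite_finite_induct) (simp_all add: smooth_fun_on_const smooth_fun_on_mult[OF assms(1)])

lemma smooth_fun_on_chart:
 assumes "c \<in> \<A>" "W \<subseteq> fst c" "open W" "smooth_on (snd c ` W) g"
 shows "smooth_fun_on W (%x. g (snd c x))"
 unfolding smooth_fun_on_def
proof
 fix d assume d: "d \<in> \<A>"
 have W: "open (snd c ` W)" using open_chart_image[OF assms(1,3)] assms(2) by (simp add: Int_absorb1)
 have "smooth_on (snd d ` (fst d \<inter> W)) (%y. g ((snd c \<circ> chart_inv d) y))"
 proof (rule smooth_on_compose[OF open_chart_image[OF d assms(3)] W _ _ assms(4)])
  show "smooth_on (snd d ` (fst d \<inter> W)) (snd c \<circ> chart_inv d)"
   by (rule smooth_on_subset[OF transition_smooth[OF d assms(1)]]) (use assms(2) in auto)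
 qed (use d in auto)
 thus "smooth_on (snd d ` (fst d \<inter> W)) (%y. g (snd c (chart_inv d y)))" by simp
qed

lemma smooth_fun_on_continuous:
 assumes "smooth_fun_on UNIV f"
 shows "continuous_on UNIV f"
proof -
 have "continuous_on (\<Union>c\<in>\<A>. fst c) f"
 proof (rule continuous_on_open_UN)
  fix c assume c: "c \<in> \<A>"
  show "open (fst c)" by (rule chart_open(1)[OF c])
  have 1: "continuous_on (snd c ` fst c) (%y. f (chart_inv c y))"
   using assms c smooth_on_continuous by (auto simp: smooth_fun_on_def)
  have "continuous_on (fst c) (%x. f (chart_inv c (snd c x)))"
   by (rule continuous_on_compose2[OF 1 continuous_on_chart[OF c]]) auto
  thus "continuous_on (fst c) f"
   by (rule continuous_on_cong[THEN iffD1, OF refl, rotated]) (use c in simp)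
 qed
 moreover have "(\<Union>c\<in>\<A>. fst c) = UNIV" using atlas by (simp add: smooth_atlas_def)
 ultimately show ?thesis by simp
qed

lemma compact_chart_preimage:
 assumes "c \<in> \<A>" "compact K" "K \<subseteq> snd c ` fst c"
 shows "compact (chart_inv c ` K)" "chart_inv c ` K \<subseteq> fst c" "snd c ` chart_inv c ` K = K"
proof -
 show "compact (chart_inv c ` K)"
  by (rule compact_continuous_image[OF continuous_on_subset[OF continuous_on_chart_inv[OF assms(1)] assms(3)] assms(2)])
 show "chart_inv c ` K \<subseteq> fst c" using chart_inv_in[OF assms(1)] assms(3) by auto
 have "snd c (chart_inv c y) = y" if "y \<in> K" for y
  by (rule snd_chart_inv[OF assms(1)]) (use assms(3) that in auto)
 thus "snd c ` chart_inv c ` K = K" by (simp add: image_image)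
qed

lemma bump_point:
 assumes "open U" "x0 \<in> U"
 obtains f :: "'a => real" and C N where "smooth_fun_on UNIV f" "\<And>x. 0 \<le> f x \<and> f x \<le> 1" "open N" "x0 \<in> N"
  "\<And>x. x \<in> N ==> f x = 1" "compact C" "C \<subseteq> U" "\<And>x. x \<notin> C ==> f x = 0"
proof -
 let ?c = "chart_at \<A> x0"
 note c = chart_at[of x0]
 let ?y0 = "snd ?c x0"
 have "open (snd ?c ` (fst ?c \<inter> U))" "?y0 \<in> snd ?c ` (fst ?c \<inter> U)"
  using open_chart_image[OF c(1) assms(1)] c(2) assms(2) by auto
 then obtain e where e: "e > 0" "cball ?y0 e \<subseteq> snd ?c ` (fst ?c \<inter> U)"
  using open_contains_cball_eq by blast
 \<comment> \<open>The squared distance is smooth at the centre. The argument of the step is at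
   least 1 up to distance e / sqrt 2 and at most 0 from distance e on.\<close>
 define g where "g y = smooth_step (2 - 2 / e^2 * ((y - ?y0) \<bullet> (y - ?y0)))" for y :: 'e
 have sg: "smooth_on S g" if "open S" for S unfolding g_def[abs_def]
  by (rule smooth_on_compose[OF that open_UNIV subset_UNIV _ smooth_on_smooth_step])
   (intro smooth_on_arith smooth_on_mult smooth_on_inner smooth_on_const smooth_on_id that)
 have ge: "(y - ?y0) \<bullet> (y - ?y0) = (dist ?y0 y)^2" for y
  by (simp add: dist_norm norm_minus_commute power2_norm_eq_inner)
 define C where "C = chart_inv ?c ` cball ?y0 e"
 define f where "f x = (if x \<in> fst ?c then g (snd ?c x) else 0)" for x
 have K: "cball ?y0 e \<subseteq> snd ?c ` fst ?c" using e by auto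
 note C = compact_chart_preimage[OF c(1) compact_cball K, folded C_def]
 have f0: "f x = 0" if "x \<notin> C" for x
 proof (cases "x \<in> fst ?c")
  case True
  have "snd ?c x \<notin> cball ?y0 e"
  proof
   assume "snd ?c x \<in> cball ?y0 e"
   hence "chart_inv ?c (snd ?c x) \<in> C" unfolding C_def by blast
   thus False using that True c by simp
  qed
  hence "e < dist ?y0 (snd ?c x)" by simp
  hence "e^2 \<le> (dist ?y0 (snd ?c x))^2" using e(1) by (intro power_mono) auto
  hence "2 - 2 / e^2 * (dist ?y0 (snd ?c x))^2 \<le> 0" using e(1) by (simp add: field_simps)
  thus ?thesis using True by (simp add: f_def g_def ge smooth_step_0)
 qed (simp add: f_def)
 define N where "N = fst ?c \<inter> snd ?c -` ball ?y0 (e / 2)"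
 have N: "open N" unfolding N_def
  by (rule continuous_open_preimage[OF continuous_on_chart[OF c(1)] chart_open(1)[OF c(1)] open_ball])
 have f1: "f x = 1" if "x \<in> N" for x
 proof -
  have "dist ?y0 (snd ?c x) \<le> e / 2" using that by (simp add: N_def)
  hence "(dist ?y0 (snd ?c x))^2 \<le> (e / 2)^2" by (intro power_mono) auto
  also have "(e / 2)^2 \<le> e^2 / 2" by (simp add: power2_eq_square)
  finally have "2 - 2 / e^2 * (dist ?y0 (snd ?c x))^2 \<ge> 1" using e(1) by (simp add: field_simps)
  thus ?thesis using that by (simp add: f_def g_def ge smooth_step_1 N_def)
 qed
 have "smooth_fun_on UNIV f"
 proof (rule smooth_fun_on_local)
  fix x
  show "\<exists>N. open N \<and> x \<in> N \<and> smooth_fun_on N f"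
  proof (cases "x \<in> fst ?c")
   case True
   have "smooth_fun_on (fst ?c) (%x. g (snd ?c x))"
    by (rule smooth_fun_on_chart[OF c(1) subset_refl chart_open(1)[OF c(1)] sg[OF chart_open(2)[OF c(1)]]])
   hence "smooth_fun_on (fst ?c) f"
    by (rule smooth_fun_on_cong[OF chart_open(1)[OF c(1)], rotated]) (simp add: f_def)
   thus ?thesis using True chart_open(1)[OF c(1)] by blast
  next
   case False
   have "open (- C)" using compact_imp_closed[OF C(1)] by auto
   moreover have "smooth_fun_on (- C) f"
    by (rule smooth_fun_on_cong[OF \<open>open (- C)\<close> _ smooth_fun_on_const[of _ 0]]) (use f0 in auto)
   ultimately show ?thesis using False C(2) by blast
  qed
 qed
 moreover have "C \<subseteq> U"
 proof
  fix x assume "x \<in> C"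
  hence "x \<in> fst ?c" "snd ?c x \<in> snd ?c ` (fst ?c \<inter> U)" using C e(2) by auto
  then obtain z where "z \<in> fst ?c \<inter> U" "snd ?c x = snd ?c z" by auto
  thus "x \<in> U" using c \<open>x \<in> fst ?c\<close> by (metis IntD1 IntD2 chart_inv_snd)
 qed
 ultimately show thesis
  using that[of f N C] N f0 f1 C(1) c(2) e(1) by (simp add: f_def g_def smooth_step_bounds N_def)
qed

lemma bump_compact:
 assumes "open U" "compact K" "K \<subseteq> U"
 obtains f :: "'a => real" and C N where "smooth_fun_on UNIV f" "\<And>x. 0 \<le> f x \<and> f x \<le> 1" "open N" "K \<subseteq> N"
  "\<And>x. x \<in> N ==> f x = 1" "compact C" "C \<subseteq> U" "\<And>x. x \<notin> C ==> f x = 0"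
proof -
 have "\<exists>f C N. smooth_fun_on UNIV f \<and> (\<forall>x. 0 \<le> f x \<and> f x \<le> (1::real)) \<and> open N \<and> z \<in> N \<and>
   (\<forall>x\<in>N. f x = 1) \<and> compact C \<and> C \<subseteq> U \<and> (\<forall>x. x \<notin> C --> f x = 0)" if z: "z \<in> K" for z
 proof -
  have zU: "z \<in> U" using assms(3) z by blast
  obtain f :: "'a => real" and C N where "smooth_fun_on UNIV f" "\<And>x. 0 \<le> f x \<and> f x \<le> 1" "open N" "z \<in> N"
   "\<And>x. x \<in> N ==> f x = 1" "compact C" "C \<subseteq> U" "\<And>x. x \<notin> C ==> f x = 0"
   by (rule bump_point[OF assms(1) zU]) (rule that; assumption)
  thus ?thesis by (intro exI[of _ f] exI[of _ C] exI[of _ N]) auto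
 qed
 then obtain F C N where F: "\<And>z. z \<in> K ==> smooth_fun_on UNIV (F z) \<and> (\<forall>x. 0 \<le> F z x \<and> F z x \<le> (1::real)) \<and> open (N z) \<and> z \<in> N z \<and>
   (\<forall>x\<in>N z. F z x = 1) \<and> compact (C z) \<and> C z \<subseteq> U \<and> (\<forall>x. x \<notin> C z --> F z x = 0)"
  by metis
 obtain T where T: "T \<subseteq> K" "finite T" "K \<subseteq> (\<Union>z\<in>T. N z)"
  by (rule compactE_image[OF assms(2), of K N]) (use F in auto)
 \<comment> \<open>One minus the product equals 1 where any of the bumps is 1, and 0 where all of
   them vanish.\<close>
 define f where "f x = 1 - (\<Prod>z\<in>T. 1 - F z x)" for x
 have b: "0 \<le> (\<Prod>z\<in>T. 1 - F z x) \<and> (\<Prod>z\<in>T. 1 - F z x) \<le> 1" for x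
  using F T(1) by (auto intro!: prod_nonneg prod_le_1)
 show thesis
 proof (rule that[of f "\<Union>z\<in>T. N z" "\<Union>z\<in>T. C z"])
  show "smooth_fun_on UNIV f" unfolding f_def[abs_def]
   by (intro smooth_fun_on_diff smooth_fun_on_const smooth_fun_on_prod open_UNIV) (use F T(1) in auto)
  show "0 \<le> f x \<and> f x \<le> 1" for x using b[of x] by (simp add: f_def)
  show "f x = 1" if "x \<in> (\<Union>z\<in>T. N z)" for x
  proof -
   obtain z where z: "z \<in> T" "x \<in> N z" using \<open>x \<in> (\<Union>z\<in>T. N z)\<close> by blast
   hence "F z x = 1" using F[of z] T(1) by blast
   hence "(\<Prod>z\<in>T. 1 - F z x) = 0" using z T(2) by (intro prod_zero) auto
   thus ?thesis by (simp add: f_def)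
  qed
  show "f x = 0" if "x \<notin> (\<Union>z\<in>T. C z)" for x
  proof -
   have "(\<Prod>z\<in>T. 1 - F z x) = 1" using that F T(1) by (intro prod.neutral) auto
   thus ?thesis by (simp add: f_def)
  qed
  show "compact (\<Union>z\<in>T. C z)" using F T by (intro compact_UN) auto
 qed (use F T in auto)
qed

section \<open>Pull-backs by C1 maps and Stokes' theorem in the manifold\<close>

section \<open>Maps of class C1 into the manifold\<close>

text \<open>The domain is the whole Euclidean space, so full derivatives exist at every point, also
  on the boundary of the unit cube.\<close>

definition C1M :: "('v::euclidean_space => 'a) => bool" where
 "C1M h \<longleftrightarrow> continuous_on UNIV h \<and> (\<forall>c\<in>\<A>. Ck_on (Suc 0) (h -` fst c) (%s. snd c (h s)))"

definition Tm :: "('v::euclidean_space => 'a) => 'v => 'v => ('a, 'e) tangent" where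
 "Tm h s u = tgt (chart_at \<A> (h s)) (h s) (FD (%r. snd (chart_at \<A> (h s)) (h r)) s u)"

definition pb :: "('a, 'e) form => ('v::euclidean_space => 'a) => 'v list => 'v => real" where
 "pb \<phi> h us s = \<phi> (h s) (map (Tm h s) us)"

lemma C1M_vimage: "C1M h ==> open W ==> open (h -` W)"
 unfolding C1M_def by (auto intro: open_vimage)

lemma C1M_Ck: "C1M h ==> c \<in> \<A> ==> Ck_on (Suc 0) (h -` fst c) (%s. snd c (h s))"
 unfolding C1M_def by blast

lemma C1M_has_derivative: 
 assumes "C1M h" "c \<in> \<A>" "h s \<in> fst c"
 shows "((%r. snd c (h r)) has_derivative FD (%r. snd c (h r)) s) (at s)"
 using C1M_Ck[OF assms(1,2)] assms(3) by (intro has_FD) simp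

lemma Tm_TS: "Tm h s u \<in> TS (h s)"
 unfolding Tm_def by (rule tgt_in_TS[OF chart_at])

lemma Tm_apply:
 assumes "C1M h" "c \<in> \<A>" "h s \<in> fst c"
 shows "Tm h s u c = FD (%r. snd c (h r)) s u"
proof -
 let ?d = "chart_at \<A> (h s)"
 note d = chart_at[of "h s"]
 have 1: "((%r. snd ?d (h r)) has_derivative FD (%r. snd ?d (h r)) s) (at s)"
  by (rule C1M_has_derivative[OF assms(1) d])
 have 2: "((snd c \<circ> chart_inv ?d) has_derivative coord_change ?d c (h s)) (at (snd ?d (h s)))"
  by (rule transition_has_derivative[OF d(1) assms(2) d(2) assms(3)])
 have "((%r. (snd c \<circ> chart_inv ?d) (snd ?d (h r))) has_derivative
   (%u. coord_change ?d c (h s) (FD (%r. snd ?d (h r)) s u))) (at s)"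
  by (rule has_derivative_compose[OF 1 2])
 hence "((%r. snd c (h r)) has_derivative
   (%u. coord_change ?d c (h s) (FD (%r. snd ?d (h r)) s u))) (at s)"
  by (rule has_derivative_transform_within_open[OF _ C1M_vimage[OF assms(1) chart_open(1)[OF d(1)]]])
   (use d in auto)
 from FD_eqI[OF this] show ?thesis by (simp add: Tm_def tgt_apply[OF assms(2,3)])
qed

lemma pb_chart:
 assumes "C1M h" "c \<in> \<A>" "h s \<in> fst c"
 shows "pb \<phi> h us s = loc c \<phi> (map (FD (%r. snd c (h r)) s) us) (snd c (h s))"
proof -
 have "set (map (Tm h s) us) \<subseteq> TS (h s)" using Tm_TS by auto
 from form_eq_loc[OF assms(2,3) this] show ?thesis by (simp add: pb_def comp_def Tm_apply[OF assms])
qed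

lemma Tm_cong_open:
 assumes "open N" "s \<in> N" "\<And>r. r \<in> N ==> h r = h' r"
 shows "Tm h s = Tm h' s"
proof -
 have "FD (%r. snd c (h r)) s = FD (%r. snd c (h' r)) s" for c :: "('a, 'e) chart"
  by (rule FD_cong_open[OF assms(1,2)]) (simp add: assms(3))
 thus ?thesis using assms(2,3) by (simp add: Tm_def[abs_def])
qed

lemma Ck_on_ins: "Ck_on k S (ins j r)"
proof -
 have "Ck_on k UNIV (%s. insL j s + r *\<^sub>R eb j)"
  by (intro Ck_on_add Ck_on_const Ck_on_bounded_linear open_UNIV)
   (rule linear_insL[unfolded linear_conv_bounded_linear])
 thus ?thesis using Ck_on_subset[of k UNIV] by (simp add: ins_def[abs_def])
qed

lemma C1M_ins:
 assumes "C1M h"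
 shows "C1M (%s. h (ins j r s))" and "Tm (%s. h (ins j r s)) s u = Tm h (ins j r s) (insL j u)"
proof -
 show "C1M (%s. h (ins j r s))" unfolding C1M_def
 proof (intro conjI ballI)
  show "continuous_on UNIV (%s. h (ins j r s))"
   using assms by (auto simp: C1M_def intro!: continuous_on_compose2[of UNIV h] continuous_on_ins)
  fix c assume c: "c \<in> \<A>"
  have e: "(%s. h (ins j r s)) -` fst c = ins j r -` (h -` fst c)" by auto
  have o: "open (h -` fst c)" by (rule C1M_vimage[OF assms chart_open(1)[OF c]])
  show "Ck_on (Suc 0) ((%s. h (ins j r s)) -` fst c) (%s. snd c (h (ins j r s)))" unfolding e
   by (rule Ck_on_compose[OF open_vimage[OF o continuous_on_ins] o _ Ck_on_ins C1M_Ck[OF assms c]]) auto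
 qed
 let ?c = "chart_at \<A> (h (ins j r s))"
 have "((%s. snd ?c (h (ins j r s))) has_derivative (%u. FD (%s. snd ?c (h s)) (ins j r s) (insL j u))) (at s)"
  by (rule has_derivative_compose[OF ins_has_derivative, where g="%s. snd ?c (h s)"])
   (rule C1M_has_derivative[OF assms chart_at])
 from FD_eqI[OF this] show "Tm (%s. h (ins j r s)) s u = Tm h (ins j r s) (insL j u)"
  by (simp add: Tm_def)
qed

definition ebs :: "nat => 'v::euclidean_space list" where
 "ebs k = map eb [0..<k]"

lemma length_ebs [simp]: "length (ebs k) = k"
 by (simp add: ebs_def)

lemma nth_ebs [simp]: "i < k ==> ebs k ! i = eb i"
 by (simp add: ebs_def)

lemma map_insL_ebs:
 assumes "i \<le> k"
 shows "map (insL i) (ebs k) = del_nth i (ebs (Suc k) :: 'v::euclidean_space list)"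
 by (rule nth_equalityI)
  (use assms in "auto simp: del_nth_def nth_append insL_eb min_def")

lemma pb_ins:
 assumes "C1M h" "i \<le> k"
 shows "pb \<theta> (%s. h (ins i r s)) (ebs k) s = pb \<theta> h (del_nth i (ebs (Suc k))) (ins i r s)"
proof -
 have "Tm (%s. h (ins i r s)) s = (%u. Tm h (ins i r s) (insL i u))"
  by (rule ext) (rule C1M_ins(2)[OF assms(1)])
 thus ?thesis unfolding pb_def map_insL_ebs[OF assms(2), symmetric] by (simp add: comp_def)
qed

lemma C1M_smooth_fun:
 assumes "C1M h" "smooth_fun_on UNIV b"
 shows "Ck_on (Suc 0) UNIV (%s. b (h s))"
proof (rule Ck_on_local)
 fix s
 let ?c = "chart_at \<A> (h s)"
 note c = chart_at[of "h s"]
 have o: "open (h -` fst ?c)" by (rule C1M_vimage[OF assms(1) chart_open(1)[OF c(1)]])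
 have "Ck_on (Suc 0) (h -` fst ?c) (%r. b (chart_inv ?c (snd ?c (h r))))"
  by (rule Ck_on_compose[OF o chart_open(2)[OF c(1)] _ C1M_Ck[OF assms(1) c(1)]])
   (use assms(2) c(1) in "auto simp: smooth_fun_on_def smooth_on_def simp del: Ck_on.simps")
 hence "Ck_on (Suc 0) (h -` fst ?c) (%r. b (h r))" by (rule Ck_on_cong[OF o, rotated]) (use c in auto)
 thus "\<exists>T. open T \<and> s \<in> T \<and> Ck_on (Suc 0) T (%s. b (h s))" using o c by blast
qed

lemma continuous_on_pb:
 assumes "C1M h" "\<phi> \<in> forms_on U k" "open U" "h ` UNIV \<subseteq> U" "length us = k"
 shows "continuous_on UNIV (pb \<phi> h us)"
proof -
 let ?Ws = "%c. map (%u s. FD (%r. snd c (h r)) s u) us"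
 have "continuous_on (\<Union>c\<in>\<A>. h -` fst c) (pb \<phi> h us)"
 proof (rule continuous_on_open_UN)
  fix c assume c: "c \<in> \<A>"
  show o: "open (h -` fst c)" by (rule C1M_vimage[OF assms(1) chart_open(1)[OF c]])
  note C = C1M_Ck[OF assms(1) c]
  have "continuous_on (h -` fst c) (%s. loc c \<phi> (map (%W. W s) (?Ws c)) (snd c (h s)))"
  proof (rule multilin_continuous_on)
   show "multilin (length (?Ws c)) (%ws. loc c \<phi> ws (snd c (h s)))" if "s \<in> h -` fst c" for s
    using alt_form_multilin[OF alt_form_loc[OF assms(2) c, of "snd c (h s)"]] that assms(5) by simp
   show "continuous_on (h -` fst c) W" if "W \<in> set (?Ws c)" for W using that C by auto
   show "continuous_on (h -` fst c) (%s. loc c \<phi> ws (snd c (h s)))"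
    if "length ws = length (?Ws c)" for ws
    by (rule continuous_on_compose2[OF smooth_on_continuous[OF forms_onD(5)[OF assms(2) c]] Ck_on_continuous[OF C]])
     (use that assms(4,5) in auto)
  qed
  thus "continuous_on (h -` fst c) (pb \<phi> h us)"
   by (rule continuous_on_cong[THEN iffD1, OF refl, rotated])
    (simp add: pb_chart[OF assms(1) c] comp_def)
 qed
 moreover have "(\<Union>c\<in>\<A>. h -` fst c) = UNIV" using chart_at by blast
 ultimately show ?thesis by simp
qed

text \<open>A map that is constant along \<open>eb j\<close> has a derivative that kills
  \<open>eb j\<close>, and a multilinear form vanishes on a zero argument.\<close>

lemma pb_degenerate:
 assumes "C1M h" "\<phi> \<in> forms_on U k" "\<And>r s. h (upd j r s) = h s" "length us = k" "eb j \<in> set us"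
 shows "pb \<phi> h us s = 0"
proof -
 let ?c = "chart_at \<A> (h s)"
 note c = chart_at[of "h s"]
 have D: "((%r. snd ?c (h r)) has_derivative FD (%r. snd ?c (h r)) s) (at s)"
  by (rule C1M_has_derivative[OF assms(1) c])
 have "((%t. s + t *\<^sub>R eb j) has_derivative (%t. t *\<^sub>R eb j)) (at 0)"
  by (auto intro!: derivative_eq_intros)
 hence "((%t. snd ?c (h (s + t *\<^sub>R eb j))) has_derivative (%t. FD (%r. snd ?c (h r)) s (t *\<^sub>R eb j))) (at 0)"
  by (rule has_derivative_compose) (use D in simp)
 moreover have "h (s + t *\<^sub>R eb j) = h s" for t
 proof -
  have "s + t *\<^sub>R eb j = upd j (t + co s j) s" by (simp add: upd_def)
  thus ?thesis using assms(3) by simp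
 qed
 ultimately have "((%t::real. snd ?c (h s)) has_derivative (%t. FD (%r. snd ?c (h r)) s (t *\<^sub>R eb j))) (at 0)"
  by simp
 from fun_cong[OF has_derivative_unique[OF this has_derivative_const], of 1]
 have "FD (%r. snd ?c (h r)) s (eb j) = 0" by simp
 hence "0 \<in> set (map (FD (%r. snd ?c (h r)) s) us)" using assms(5) by force
 thus ?thesis unfolding pb_chart[OF assms(1) c]
  by (intro multilin_zero[OF alt_form_multilin[OF alt_form_loc[OF assms(2) c(1)]]]) (use assms(4) c in auto)
qed

section \<open>Stokes' theorem for cubes in the manifold\<close>

text \<open>The map \<open>h\<close> may leave the chart, so its coordinate expression is only
  partially defined. As \<theta> lives on a compact part of the chart, the chart map times a cut-off
  function gives a global C1 map which is correct wherever the coefficients are nonzero, and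
  \<open>stokes_C1\<close> applies to it.\<close>

lemma stokes_chart:
 fixes h :: "'v::euclidean_space => 'a"
 assumes "C1M h" "\<theta> \<in> forms_on UNIV k" "c \<in> \<A>" "compact C" "C \<subseteq> fst c"
  and supp: "\<And>x vs. x \<notin> C ==> \<theta> x vs = 0" and k: "k < DIM('v)"
 shows "cint (Suc k) (pb (ext_deriv \<A> \<theta>) h (ebs (Suc k))) =
  (\<Sum>i<Suc k. (-1) ^ i * (cint k (pb \<theta> (%s. h (ins i 1 s)) (ebs k)) - cint k (pb \<theta> (%s. h (ins i 0 s)) (ebs k))))"
proof -
 obtain \<beta> :: "'a => real" and C' N where \<beta>: "smooth_fun_on UNIV \<beta>" "\<And>x. 0 \<le> \<beta> x \<and> \<beta> x \<le> 1" "open N" "C \<subseteq> N"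
  "\<And>x. x \<in> N ==> \<beta> x = 1" "compact C'" "C' \<subseteq> fst c" "\<And>x. x \<notin> C' ==> \<beta> x = 0"
  by (rule bump_compact[OF chart_open(1)[OF assms(3)] assms(4,5)]) (rule that; assumption)
 have oc: "open (fst c)" by (rule chart_open(1)[OF assms(3)])
 have oC: "open (- C)" and oC': "open (- C')" using compact_imp_closed[OF assms(4)] compact_imp_closed[OF \<beta>(6)] by auto
 define b where "b x = (if x \<in> fst c then \<beta> x *\<^sub>R snd c x else 0)" for x
 have "smooth_fun_on UNIV b"
 proof (rule smooth_fun_on_local)
  fix x
  show "\<exists>N. open N \<and> x \<in> N \<and> smooth_fun_on N b"
  proof (cases "x \<in> fst c")
   case True
   have "smooth_fun_on (fst c) (%x. \<beta> x *\<^sub>R snd c x)"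
    by (intro smooth_fun_on_scaleR[OF oc] smooth_fun_on_subset[OF \<beta>(1)]
      smooth_fun_on_chart[OF assms(3) subset_refl oc, of "%y. y"] smooth_on_id) auto
   hence "smooth_fun_on (fst c) b" by (rule smooth_fun_on_cong[OF oc, rotated]) (simp add: b_def)
   thus ?thesis using True oc by blast
  next
   case False
   have "smooth_fun_on (- C') b"
    by (rule smooth_fun_on_cong[OF oC' _ smooth_fun_on_const[of _ 0]]) (use \<beta>(8) in "auto simp: b_def")
   thus ?thesis using False oC' \<beta>(7) by blast
  qed
 qed
 define w where "w s = b (h s)" for s
 have wC1: "Ck_on (Suc 0) UNIV w"
  unfolding w_def[abs_def] by (rule C1M_smooth_fun[OF assms(1) \<open>smooth_fun_on UNIV b\<close>])
 define a where "a ws s = (if h s \<in> fst c then loc c \<theta> ws (snd c (h s)) else 0)" for ws s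
 have oh: "open (h -` fst c)" "open (h -` (- C))" "open (h -` (N \<inter> fst c))"
  using C1M_vimage[OF assms(1)] oc oC \<beta>(3) by auto
 have a0: "a ws s = 0" if "h s \<notin> C" for ws s using that supp assms(3) by (auto simp: a_def loc_eq)
 have alt: "alt_form k (%ws. a ws s)" for s
 proof (cases "h s \<in> fst c")
  case True
  thus ?thesis using alt_form_loc[OF assms(2,3), of "snd c (h s)"] by (simp add: a_def)
 next
  case False
  thus ?thesis by (simp add: a_def alt_form_def multilin_def linear_zero)
 qed
 have aC: "Ck_on (Suc 0) (h -` fst c) (%s. loc c \<theta> ws (snd c (h s)))" if "length ws = k" for ws
  by (rule Ck_on_compose[OF oh(1) chart_open(2)[OF assms(3)] _ C1M_Ck[OF assms(1,3)]])
   (use smooth_onD[OF forms_onD(5)[OF assms(2,3) that]] in "auto simp del: Ck_on.simps")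
 have aC1: "Ck_on (Suc 0) UNIV (a ws)" if "length ws = k" for ws
 proof (rule Ck_on_local)
  fix s
  show "\<exists>T. open T \<and> s \<in> T \<and> Ck_on (Suc 0) T (a ws)"
  proof (cases "h s \<in> fst c")
   case True
   have "Ck_on (Suc 0) (h -` fst c) (a ws)"
    by (rule Ck_on_cong[OF oh(1) _ aC[OF that]]) (simp add: a_def)
   thus ?thesis using True oh(1) by blast
  next
   case False
   have "Ck_on (Suc 0) (h -` (- C)) (a ws)"
    by (rule Ck_on_cong[OF oh(2) _ Ck_on_const[of _ _ 0]]) (use a0 in auto)
   thus ?thesis using False oh(2) assms(5) by (intro exI[of _ "h -` (- C)"]) auto
  qed
 qed
 have FDw: "FD w s = FD (%r. snd c (h r)) s" if "h s \<in> C" for s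
  by (rule FD_cong_open[OF oh(3)]) (use that \<beta>(4,5) assms(5) in "auto simp: w_def b_def")
 have eq1: "a (map (FD w s) us) s = pb \<theta> h us s" for us s
 proof (cases "h s \<in> C")
  case True
  hence "h s \<in> fst c" using assms(5) by blast
  thus ?thesis using pb_chart[OF assms(1,3)] FDw[OF True] by (simp add: a_def)
 next
  case False
  thus ?thesis by (simp add: a0 pb_def supp)
 qed
 have eq2: "(\<Sum>i<Suc k. (-1) ^ i * FD (a (map (FD w s) (del_nth i (ebs (Suc k))))) s (eb i)) =
   pb (ext_deriv \<A> \<theta>) h (ebs (Suc k)) s" for s
 proof (cases "h s \<in> C")
  case True
  hence hs: "h s \<in> fst c" using assms(5) by blast
  let ?L = "FD (%r. snd c (h r)) s"
  have "FD (a ws) s u = FD (loc c \<theta> ws) (snd c (h s)) (?L u)" if "length ws = k" for ws u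
  proof -
   have "FD (a ws) s = FD (%s. loc c \<theta> ws (snd c (h s))) s"
    by (rule FD_cong_open[OF oh(1)]) (use hs in "auto simp: a_def")
   moreover have "((%s. loc c \<theta> ws (snd c (h s))) has_derivative (%u. FD (loc c \<theta> ws) (snd c (h s)) (?L u))) (at s)"
    by (rule has_derivative_compose[OF C1M_has_derivative[OF assms(1,3) hs]])
     (rule has_FD[OF loc_smooth_at[OF assms(2) open_UNIV assms(3) hs UNIV_I that]])
   ultimately show ?thesis by (simp add: FD_eqI)
  qed
  hence "(\<Sum>i<Suc k. (-1) ^ i * FD (a (map (FD w s) (del_nth i (ebs (Suc k))))) s (eb i)) =
   ed (loc c \<theta>) (map ?L (ebs (Suc k))) (snd c (h s))"
   unfolding ed_def FDw[OF True] by (auto simp: map_del_nth intro!: sum.cong simp del: sum.lessThan_Suc)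
  also have "\<dots> = loc c (ext_on UNIV \<theta>) (map ?L (ebs (Suc k))) (snd c (h s))"
   by (rule loc_ext_on[OF assms(2) open_UNIV assms(3), symmetric]) (use hs in auto)
  also have "\<dots> = pb (ext_deriv \<A> \<theta>) h (ebs (Suc k)) s"
   by (simp add: ext_on_UNIV pb_chart[OF assms(1,3) hs])
  finally show ?thesis .
 next
  case False
  have "FD (a ws) s = FD (%s. 0) s" for ws by (rule FD_cong_open[OF oh(2)]) (use False a0 in auto)
  moreover have "ext_deriv \<A> \<theta> (h s) vs = ext_deriv \<A> (%x vs. 0) (h s) vs" for vs
   by (rule ext_deriv_cong_open[OF oC]) (use False supp in auto)
  moreover have "ext_deriv \<A> (%x vs. 0) x vs = 0" for x vs
  proof -
   have "loc d (%x vs. 0) us = (%y. 0)" for d us by (auto simp: local_form_def)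
   thus ?thesis by (cases "set vs \<subseteq> TS x") (auto simp: ext_deriv_def' ext_deriv_not_TS ed_def)
  qed
  ultimately show ?thesis by (simp add: pb_def)
 qed
 have "cint (Suc k) (%s. \<Sum>i<Suc k. (-1) ^ i * FD (a (map (FD w s) (del_nth i (map eb [0..<Suc k])))) s (eb i)) =
  (\<Sum>i<Suc k. (-1) ^ i *
   (cint k (%s. a (map (FD w (ins i 1 s)) (del_nth i (map eb [0..<Suc k]))) (ins i 1 s)) -
   cint k (%s. a (map (FD w (ins i 0 s)) (del_nth i (map eb [0..<Suc k]))) (ins i 0 s))))"
  by (rule stokes_C1[OF alt aC1 wC1 k])
 hence "cint (Suc k) (pb (ext_deriv \<A> \<theta>) h (ebs (Suc k))) = (\<Sum>i<Suc k. (-1) ^ i *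
   (cint k (%s. pb \<theta> h (del_nth i (ebs (Suc k))) (ins i 1 s)) -
   cint k (%s. pb \<theta> h (del_nth i (ebs (Suc k))) (ins i 0 s))))"
  unfolding ebs_def[symmetric] eq1 eq2 .
 also have "\<dots> = (\<Sum>i<Suc k. (-1) ^ i * (cint k (pb \<theta> (%s. h (ins i 1 s)) (ebs k)) - cint k (pb \<theta> (%s. h (ins i 0 s)) (ebs k))))"
 proof (rule sum.cong)
  fix i assume "i \<in> {..<Suc k}"
  hence "pb \<theta> (%s. h (ins i r s)) (ebs k) = (%s. pb \<theta> h (del_nth i (ebs (Suc k))) (ins i r s))" for r
   using pb_ins[OF assms(1), of i k] by (intro ext) auto
  thus "(-1) ^ i * (cint k (%s. pb \<theta> h (del_nth i (ebs (Suc k))) (ins i 1 s)) -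
   cint k (%s. pb \<theta> h (del_nth i (ebs (Suc k))) (ins i 0 s))) =
   (-1) ^ i * (cint k (pb \<theta> (%s. h (ins i 1 s)) (ebs k)) - cint k (pb \<theta> (%s. h (ins i 0 s)) (ebs k)))"
   by simp
 qed simp
 finally show ?thesis .
qed

text \<open>A form given on \<open>U\<close> only is cut off outside a neighbourhood of the compact
  set \<open>C\<close>. Nothing changes along \<open>h\<close>, whose range lies in
  \<open>C\<close>, and the version for globally defined forms applies.\<close>

lemma stokes_image:
 fixes h :: "'v::euclidean_space => 'a"
 assumes "C1M h" "\<theta> \<in> forms_on U k" "open U" "c \<in> \<A>" "compact C" "C \<subseteq> U \<inter> fst c" "range h \<subseteq> C" "k < DIM('v)"
 shows "cint (Suc k) (pb (ext_on U \<theta>) h (ebs (Suc k))) =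
  (\<Sum>i<Suc k. (-1) ^ i * (cint k (pb \<theta> (%s. h (ins i 1 s)) (ebs k)) - cint k (pb \<theta> (%s. h (ins i 0 s)) (ebs k))))"
proof -
 have o: "open (U \<inter> fst c)" using assms(3) chart_open(1)[OF assms(4)] by auto
 obtain \<beta> :: "'a => real" and C' N where \<beta>: "smooth_fun_on UNIV \<beta>" "\<And>x. 0 \<le> \<beta> x \<and> \<beta> x \<le> 1" "open N" "C \<subseteq> N"
  "\<And>x. x \<in> N ==> \<beta> x = 1" "compact C'" "C' \<subseteq> U \<inter> fst c" "\<And>x. x \<notin> C' ==> \<beta> x = 0"
  by (rule bump_compact[OF o assms(5,6)]) (rule that; assumption)
 define \<theta>' where "\<theta>' = (%x vs. \<beta> x * \<theta> x vs)"
 have \<theta>': "\<theta>' \<in> forms_on UNIV k" unfolding \<theta>'_def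
 proof (rule forms_on_extend[OF open_UNIV assms(3)])
  show "\<exists>N. open N \<and> x \<in> N \<and> (\<forall>y\<in>N. \<beta> y = 0)" if "x \<notin> U" for x
   using that \<beta>(7,8) compact_imp_closed[OF \<beta>(6)] by (intro exI[of _ "- C'"]) auto
 qed (use assms(2) smooth_fun_on_subset[OF \<beta>(1)] in auto)
 have "pb \<theta>' (%s. h (f s)) us s = pb \<theta> (%s. h (f s)) us s" for f :: "'v => 'v" and us s
  using assms(7) \<beta>(4,5) by (auto simp: pb_def \<theta>'_def)
 hence 1: "pb \<theta>' (%s. h (f s)) us = pb \<theta> (%s. h (f s)) us" for f :: "'v => 'v" and us by (rule ext)
 have 2: "pb (ext_deriv \<A> \<theta>') h us = pb (ext_on U \<theta>) h us" for us
 proof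
  fix s
  have hs: "h s \<in> N" "h s \<in> U" using assms(6,7) \<beta>(4) by auto
  have "ext_deriv \<A> \<theta>' (h s) vs = ext_deriv \<A> \<theta> (h s) vs" for vs
   by (rule ext_deriv_cong_open[OF \<beta>(3) hs(1)]) (simp add: \<theta>'_def \<beta>(5))
  thus "pb (ext_deriv \<A> \<theta>') h us s = pb (ext_on U \<theta>) h us s"
   using hs by (simp add: pb_def ext_on_def res_def)
 qed
 have "C' \<subseteq> fst c" using \<beta>(7) by auto
 thus ?thesis
  using stokes_chart[OF assms(1) \<theta>' assms(4) \<beta>(6) _ _ assms(8)] \<beta>(8) unfolding 1 2
  by (simp add: \<theta>'_def)
qed

end

section \<open>Covers with convex intersections and a partition of unity\<close>

section \<open>Good covers\<close>

text \<open>By compactness of the unit sphere the Hessian at \<open>b\<close> is bounded below by a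
  positive constant \<open>m\<close>. On a small ball it changes by at most \<open>m / 2\<close> in
  unit directions, so it stays nonnegative there, and \<open>f\<close> is convex along
  segments.\<close>

lemma local_convex_on:
 fixes f :: "'v::euclidean_space => real"
 assumes "open T" "b \<in> T" "Ck_on 2 T f" "\<And>u. u \<noteq> 0 ==> FD (%z. FD f z u) b u > 0"
 shows "\<exists>R>0. ball b R \<subseteq> T \<and> convex_on (ball b R) f"
proof -
 define G where "G z u = FD (%z. FD f z u) z u" for z u
 define F where "F i j z = FD (%z. FD f z i) z j" for i j z
 have d1: "f differentiable (at z)" and d2: "(%z. FD f z u) differentiable (at z)" if "z \<in> T" for z u
  using assms(3) that by (auto simp: numeral_2_eq_2)
 have cF: "continuous_on T (F i j)" for i j using assms(3) unfolding F_def by (simp add: numeral_2_eq_2)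
 have GF: "G z u = (\<Sum>i\<in>Basis. \<Sum>j\<in>Basis. (u \<bullet> i) * ((u \<bullet> j) * F i j z))" if z: "z \<in> T" for z u
 proof -
  have "FD (%z. FD f z u) z = FD (%z. \<Sum>i\<in>Basis. (u \<bullet> i) * FD f z i) z"
   by (rule FD_cong_open[OF assms(1) z]) (rule linear_euclidean_sum[OF linear_FD[OF d1]])
  hence "G z u = (\<Sum>i\<in>Basis. (u \<bullet> i) * FD (%z. FD f z i) z u)"
   unfolding G_def using FD_sum_scale(2)[of Basis "%i z. FD f z i" z "%i. u \<bullet> i" u] d2[OF z] by simp
  also have "\<dots> = (\<Sum>i\<in>Basis. (u \<bullet> i) * (\<Sum>j\<in>Basis. (u \<bullet> j) * F i j z))"
   unfolding F_def by (simp flip: linear_euclidean_sum[OF linear_FD[OF d2[OF z]]])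
  finally show ?thesis by (simp add: sum_distrib_left)
 qed
 have cG: "continuous_on (T \<times> sphere 0 1) (%p. G (fst p) (snd p))"
 proof (rule continuous_on_cong[THEN iffD1, OF refl])
  show "(\<Sum>i\<in>Basis. \<Sum>j\<in>Basis. (snd p \<bullet> i) * ((snd p \<bullet> j) * F i j (fst p))) = G (fst p) (snd p)"
   if "p \<in> T \<times> sphere 0 1" for p using GF that by auto
  show "continuous_on (T \<times> sphere 0 1) (%p. \<Sum>i\<in>Basis. \<Sum>j\<in>Basis. (snd p \<bullet> i) * ((snd p \<bullet> j) * F i j (fst p)))"
   by (intro continuous_intros continuous_on_compose2[OF cF]) auto
 qed
 have "\<exists>m>0. \<forall>u\<in>sphere 0 1. m \<le> G b u"
 proof -
  have "continuous_on (sphere 0 1) (%u. G (fst (b, u)) (snd (b, u)))"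
   by (rule continuous_on_compose2[OF cG]) (use assms(2) in "auto intro!: continuous_intros")
  moreover have "sphere (0::'v) 1 \<noteq> {}"
  proof -
   obtain i :: 'v where "i \<in> Basis" using nonempty_Basis by blast
   hence "i \<in> sphere 0 1" by simp
   thus ?thesis by blast
  qed
  ultimately obtain u where u: "u \<in> sphere 0 1" "\<forall>v\<in>sphere 0 1. G b u \<le> G b v"
   using continuous_attains_inf[OF compact_sphere, of "0::'v" 1 "G b"] by auto
  hence "G b u > 0" using assms(4)[of u] by (cases "u = 0") (auto simp: G_def)
  with u show ?thesis by blast
 qed
 then obtain m where m: "m > 0" "\<And>u. u \<in> sphere 0 1 ==> m \<le> G b u" by blast
 obtain X0 where X0: "b \<in> X0" "open X0"
  "\<forall>z\<in>X0 \<inter> T. \<forall>u\<in>sphere 0 1. dist (G (fst (z, u)) (snd (z, u))) (G (fst (b, u)) (snd (b, u))) \<le> m / 2"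
  by (rule continuous_on_prod_compactE[OF cG compact_sphere assms(2), of "m / 2"]) (use m in auto)
 obtain R where R: "R > 0" "ball b R \<subseteq> X0 \<inter> T"
  using open_contains_ball_eq[of "X0 \<inter> T"] X0 assms(1,2) by blast
 have pos: "G z u \<ge> 0" if z: "z \<in> ball b R" for z u
 proof (cases "u = 0")
  case True
  have "G z 0 = 0" using GF[of z 0] z R by auto
  thus ?thesis using True by simp
 next
  case False
  define w where "w = (1 / norm u) *\<^sub>R u"
  have w: "w \<in> sphere 0 1" "u = norm u *\<^sub>R w" using False by (auto simp: w_def)
  have zT: "z \<in> X0 \<inter> T" using z R(2) by blast
  have "dist (G z w) (G b w) \<le> m / 2" using X0(3) zT w(1) by auto
  hence "G z w \<ge> 0" using m(2)[OF w(1)] m(1) by (simp add: dist_real_def abs_if split: if_splits)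
  moreover have "G z u = (norm u)^2 * G z w"
  proof -
   have "u \<bullet> i = norm u * (w \<bullet> i)" for i by (subst w(2)) simp
   thus ?thesis using GF[of z u] GF[of z w] zT by (simp add: sum_distrib_left power2_eq_square mult_ac)
  qed
  ultimately show ?thesis by simp
 qed
 have "convex_on (ball b R) f"
 proof (rule convex_onI)
  fix t :: real and x y :: 'v assume t: "0 < t" "t < 1" and xy: "x \<in> ball b R" "y \<in> ball b R"
  let ?z = "%s. x + s *\<^sub>R (y - x)"
  have zb: "?z s \<in> ball b R" if "s \<in> {0..1}" for s using ray_in_convex[OF convex_ball xy that] .
  have cg: "convex_on {0..1} (%s. f (?z s))"
  proof (rule f''_ge0_imp_convex[where f'="%s. FD f (?z s) (y - x)" and f''="%s. G (?z s) (y - x)"])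
   fix s :: real assume s: "s \<in> {0..1}"
   have zT: "?z s \<in> T" using zb[OF s] R(2) by blast
   show "((%s. f (?z s)) has_real_derivative FD f (?z s) (y - x)) (at s)"
    "((%s. FD f (?z s) (y - x)) has_real_derivative G (?z s) (y - x)) (at s)"
    unfolding G_def by (rule line_derivative_real d1[OF zT] d2[OF zT])+
   show "0 \<le> G (?z s) (y - x)" by (rule pos[OF zb[OF s]])
  qed simp
  have "f (?z ((1 - t) *\<^sub>R 0 + t *\<^sub>R 1)) \<le> (1 - t) * f (?z 0) + t * f (?z 1)"
   by (rule convex_onD[OF cg]) (use t in auto)
  thus "f ((1 - t) *\<^sub>R x + t *\<^sub>R y) \<le> (1 - t) * f x + t * f y"
   by (simp add: algebra_simps)
 qed simp
 with R show ?thesis by blast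
qed

context manifold
begin

text \<open>In the coordinates of a second chart, the squared distance to the centre of a coordinate ball has
 positive definite Hessian at the centre, so small coordinate balls are convex in both charts.\<close>

lemma convex_chart_ball:
 assumes "c \<in> \<A>" "d \<in> \<A>" "x \<in> fst c" "x \<in> fst d"
 shows "\<exists>r0>0. \<forall>r. 0 < r \<and> r \<le> r0 --> ball (snd c x) r \<subseteq> snd c ` (fst c \<inter> fst d) \<and>
  convex (snd d ` chart_inv c ` ball (snd c x) r)"
proof -
 let ?a = "snd c x" and ?b = "snd d x" and ?Psi = "snd c \<circ> chart_inv d" and ?Phi = "snd d \<circ> chart_inv c"
 let ?T = "snd d ` (fst d \<inter> fst c)" and ?S = "snd c ` (fst c \<inter> fst d)"
 have T: "open ?T" "?b \<in> ?T" and S: "open ?S" "?a \<in> ?S"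
  using open_chart_image[OF assms(2) chart_open(1)[OF assms(1)]]
   open_chart_image[OF assms(1) chart_open(1)[OF assms(2)]] assms by auto
 have Psi: "smooth_on ?T ?Psi" and Phi: "smooth_on ?S ?Phi" using transition_smooth assms by auto
 define q where "q z = (?Psi z - ?a) \<bullet> (?Psi z - ?a)" for z
 have q: "smooth_on ?T q" unfolding q_def[abs_def]
  by (intro smooth_on_inner smooth_on_arith T Psi smooth_on_const)
 have dPsi: "(?Psi has_derivative FD ?Psi z) (at z)" if "z \<in> ?T" for z
  by (rule has_FD[OF smooth_on_differentiable[OF Psi that]])
 have Dq: "FD q z u = 2 * ((?Psi z - ?a) \<bullet> FD ?Psi z u)" if "z \<in> ?T" for z u
 proof -
  have "((%z. ?Psi z - ?a) has_derivative FD ?Psi z) (at z)"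
   using has_derivative_diff[OF dPsi[OF that] has_derivative_const] by simp
  from has_derivative_inner[OF this this] 
  have "(q has_derivative (%u. (?Psi z - ?a) \<bullet> FD ?Psi z u + FD ?Psi z u \<bullet> (?Psi z - ?a))) (at z)"
   unfolding q_def[abs_def] .
  from FD_eqI[OF this] show ?thesis by (simp add: inner_commute)
 qed
 have Psib: "?Psi ?b = ?a" using assms by simp
 \<comment> \<open>The second derivative of the transition map is paired with its deviation from
   \<open>?a\<close>, which is 0 at \<open>?b\<close>. What remains is the squared first derivative,
   positive because the transition map is invertible.\<close>
 have "FD (%z. FD q z u) ?b u = 2 * (FD ?Psi ?b u \<bullet> FD ?Psi ?b u)" for u
 proof -
  have "FD (%z. FD q z u) ?b = FD (%z. 2 * ((?Psi z - ?a) \<bullet> FD ?Psi z u)) ?b"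
   by (rule FD_cong_open[OF T]) (rule Dq)
  also have "((%z. 2 * ((?Psi z - ?a) \<bullet> FD ?Psi z u)) has_derivative 
   (%v. 2 * ((?Psi ?b - ?a) \<bullet> FD (%z. FD ?Psi z u) ?b v + FD ?Psi ?b v \<bullet> FD ?Psi ?b u))) (at ?b)"
  proof (intro has_derivative_mult_right has_derivative_inner)
   show "((%z. ?Psi z - ?a) has_derivative FD ?Psi ?b) (at ?b)"
    using has_derivative_diff[OF dPsi[OF T(2)] has_derivative_const] by simp
   show "((%z. FD ?Psi z u) has_derivative FD (%z. FD ?Psi z u) ?b) (at ?b)"
    by (rule has_FD[OF smooth_on_differentiable[OF smooth_on_FD[OF Psi] T(2)]])
  qed
  hence "FD (%z. 2 * ((?Psi z - ?a) \<bullet> FD ?Psi z u)) ?b =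
   (%v. 2 * ((?Psi ?b - ?a) \<bullet> FD (%z. FD ?Psi z u) ?b v + FD ?Psi ?b v \<bullet> FD ?Psi ?b u))"
   by (rule FD_eqI)
  finally show ?thesis by (simp add: Psib[unfolded comp_def])
 qed
 moreover have "FD ?Psi ?b u \<noteq> 0" if "u \<noteq> 0" for u
 proof
  assume "FD ?Psi ?b u = 0"
  hence "coord_change d c x u = 0" by (simp add: coord_change_def)
  hence "coord_change d d x u = 0"
   using coord_change_compose[OF assms(2,1,2,4,3,4), of u] linear_0[OF linear_coord_change[OF assms]] by simp
  thus False using coord_change_self[OF assms(2,4)] that by simp
 qed
 ultimately have "\<exists>R>0. ball ?b R \<subseteq> ?T \<and> convex_on (ball ?b R) q"
  by (intro local_convex_on[OF T smooth_onD[OF q]]) simp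
 then obtain R where R: "R > 0" "ball ?b R \<subseteq> ?T" "convex_on (ball ?b R) q" by blast
 have "open (?S \<inter> ?Phi -` ball ?b R)"
  by (rule continuous_open_preimage[OF smooth_on_continuous[OF Phi] S(1) open_ball])
 moreover have "?a \<in> ?S \<inter> ?Phi -` ball ?b R" using S(2) R(1) assms by simp
 ultimately obtain r0 where r0: "r0 > 0" "ball ?a r0 \<subseteq> ?S \<inter> ?Phi -` ball ?b R"
  using open_contains_ball_eq by metis
 have "convex (snd d ` chart_inv c ` ball ?a r)" if r: "0 < r" "r \<le> r0" for r
 proof -
  \<comment> \<open>In the second chart the coordinate ball is a sublevel set, within a ball, of the
    convex function \<open>q\<close>.\<close>
  have e: "snd d ` chart_inv c ` ball ?a r = {z \<in> ball ?b R. q z < r^2}"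
  proof (rule subset_antisym; rule subsetI)
   fix z assume "z \<in> snd d ` chart_inv c ` ball ?a r"
   then obtain y where y: "y \<in> ball ?a r" "z = ?Phi y" by auto
   hence "y \<in> ball ?a r0" using r(2) by simp
   hence y': "y \<in> ?S" "z \<in> ball ?b R" using r0(2) y(2) by blast+
   hence "?Psi z = y" using y(2) assms by auto
   hence "q z = (dist ?a y)^2" by (simp add: q_def dist_norm norm_minus_commute power2_norm_eq_inner)
   thus "z \<in> {z \<in> ball ?b R. q z < r^2}" using y(1) y'(2) by (simp add: power_strict_mono)
  next
   fix z assume z: "z \<in> {z \<in> ball ?b R. q z < r^2}"
   hence "z \<in> ?T" using R(2) by auto
   then obtain w where w: "w \<in> fst d" "w \<in> fst c" "z = snd d w" by auto
   have "q z = (dist ?a (snd c w))^2"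
    using w assms by (simp add: q_def dist_norm norm_minus_commute power2_norm_eq_inner)
   hence "dist ?a (snd c w) < r" using z r(1) power2_less_imp_less[of "dist ?a (snd c w)" r] by auto
   thus "z \<in> snd d ` chart_inv c ` ball ?a r"
    using w assms by (intro image_eqI[of _ _ w] image_eqI[of _ _ "snd c w"]) auto
  qed
  show ?thesis unfolding e
  proof (rule convexI)
   fix y z and u v :: real
   assume yz: "y \<in> {z \<in> ball ?b R. q z < r^2}" "z \<in> {z \<in> ball ?b R. q z < r^2}" and uv: "0 \<le> u" "0 \<le> v" "u + v = 1"
   have "q (u *\<^sub>R y + v *\<^sub>R z) \<le> u * q y + v * q z"
    using R(3) yz uv by (auto simp: convex_on_def)
   also have "\<dots> < r^2" by (rule convex_bound_lt) (use yz uv in auto)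
   finally show "u *\<^sub>R y + v *\<^sub>R z \<in> {z \<in> ball ?b R. q z < r^2}"
    using convexD[OF convex_ball, of y ?b R z u v] yz uv by auto
  qed
 qed
 moreover have "ball ?a r \<subseteq> ?S" if "r \<le> r0" for r using r0(2) that subset_ball[of r r0 ?a] by auto
 ultimately show ?thesis using r0(1) by blast
qed

lemma lindelof_nat:
 fixes O' :: "'a => 'a set"
 assumes "\<And>x. open (O' x)" "\<And>x. x \<in> O' x"
 obtains f :: "nat => 'a" where "(\<Union>n. O' (f n)) = UNIV"
proof -
 obtain F where F: "F \<subseteq> range O'" "countable F" "\<Union>F = \<Union>(range O')"
  using Lindelof[of "range O'"] assms(1) by (metis imageE)
 have U: "\<Union>F = UNIV" using F(3) assms(2) by blast
 hence ne: "F \<noteq> {}" by auto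
 have "\<forall>n. \<exists>x. from_nat_into F n = O' x" using from_nat_into[OF ne] F(1) by blast
 then obtain f where f: "\<And>n. from_nat_into F n = O' (f n)" by metis
 have "(\<Union>n. O' (f n)) = \<Union>F" unfolding f[symmetric] using range_from_nat_into[OF ne F(2)] by auto
 with U that show thesis by simp
qed

lemma chart_ball_nhd:
 obtains e where "e > 0" "cball (snd (chart_at \<A> x) x) e \<subseteq> snd (chart_at \<A> x) ` fst (chart_at \<A> x)"
proof -
 have "\<exists>e>0. cball (snd (chart_at \<A> x) x) e \<subseteq> snd (chart_at \<A> x) ` fst (chart_at \<A> x)"
  using open_contains_cball_eq[OF chart_open(2)[OF chart_at(1)]] chart_at(2) by blast
 with that show thesis by blast
qed

lemma open_chart_inv_image:
 assumes "c \<in> \<A>" "open W" "W \<subseteq> snd c ` fst c"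
 shows "open (chart_inv c ` W)"
proof -
 have "chart_inv c ` W = fst c \<inter> snd c -` W"
 proof (rule subset_antisym; rule subsetI)
  fix x assume "x \<in> fst c \<inter> snd c -` W"
  thus "x \<in> chart_inv c ` W" using assms(1) by (intro image_eqI[of _ _ "snd c x"]) auto
 qed (use assms(1,3) chart_inv_in in auto)
 thus ?thesis
  using continuous_open_preimage[OF continuous_on_chart[OF assms(1)] chart_open(1)[OF assms(1)] assms(2)] by simp
qed

text \<open>Convexity in infinitely many charts at once could force the radii to 0. Countably many
  compact coordinate balls \<open>K'\<close> are fixed, and a point x receives the chart of the
  first one whose open part \<open>O'\<close> contains x. A neighbourhood of x then has to respect
  only the charts of index at most \<open>nn x\<close>: it is convex in such a chart if the
  corresponding \<open>K'\<close> contains x, and misses this \<open>K'\<close> otherwise.\<close>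

theorem good_cover_exists:
 obtains B :: "nat => 'a set" and cc :: "'a => ('a, 'e) chart" and \<rho> :: "nat => 'a => real"
 where "\<And>j. open (B j)" "(\<Union>j. B j) = UNIV" "\<And>x. cc x \<in> \<A>"
  "\<And>x j. x \<in> B j ==> B j \<subseteq> fst (cc x) \<and> convex (snd (cc x) ` B j)"
  "\<And>j. smooth_fun_on UNIV (\<rho> j)" "\<And>j. \<exists>C. compact C \<and> C \<subseteq> B j \<and> (\<forall>x. x \<notin> C --> \<rho> j x = 0)"
  "\<And>x. \<exists>W n. open W \<and> x \<in> W \<and> (\<forall>y\<in>W. (\<forall>j\<ge>n. \<rho> j y = 0) \<and> (\<Sum>j<n. \<rho> j y) = 1)"
proof -
 have "\<exists>e>0. cball (snd (chart_at \<A> x) x) e \<subseteq> snd (chart_at \<A> x) ` fst (chart_at \<A> x)" for x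
  by (rule chart_ball_nhd[of x]) blast
 then obtain e where e: "\<And>x. e x > 0" "\<And>x. cball (snd (chart_at \<A> x) x) (e x) \<subseteq> snd (chart_at \<A> x) ` fst (chart_at \<A> x)"
  by metis
 define O' where "O' x = chart_inv (chart_at \<A> x) ` ball (snd (chart_at \<A> x) x) (e x)" for x
 define K' where "K' x = chart_inv (chart_at \<A> x) ` cball (snd (chart_at \<A> x) x) (e x)" for x
 have O': "open (O' x)" "x \<in> O' x" "O' x \<subseteq> K' x" "K' x \<subseteq> fst (chart_at \<A> x)" "closed (K' x)" for x
 proof -
  show "open (O' x)" unfolding O'_def
   by (rule open_chart_inv_image[OF chart_at(1) open_ball]) (use e(2)[of x] ball_subset_cball in blast)
  have "chart_inv (chart_at \<A> x) (snd (chart_at \<A> x) x) = x" using chart_at by simp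
  thus "x \<in> O' x" unfolding O'_def using e(1)[of x]
   by (intro image_eqI[of _ _ "snd (chart_at \<A> x) x"]) auto
  show "O' x \<subseteq> K' x" unfolding O'_def K'_def by (intro image_mono ball_subset_cball)
  show "K' x \<subseteq> fst (chart_at \<A> x)" unfolding K'_def
   using compact_chart_preimage(2)[OF chart_at(1) compact_cball e(2)] .
  show "closed (K' x)" unfolding K'_def
   using compact_chart_preimage(1)[OF chart_at(1) compact_cball e(2)] compact_imp_closed by blast
 qed
 obtain f :: "nat => 'a" where f: "(\<Union>n. O' (f n)) = UNIV"
  by (rule lindelof_nat[of O', OF O'(1,2)])
 define d where "d n = chart_at \<A> (f n)" for n
 define nn where "nn x = (LEAST n. x \<in> O' (f n))" for x
 have nn: "x \<in> O' (f (nn x))" for x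
 proof -
  have "\<exists>n. x \<in> O' (f n)" using f by blast
  thus ?thesis unfolding nn_def by (rule LeastI_ex)
 qed
 have d: "d n \<in> \<A>" "O' (f n) \<subseteq> K' (f n)" "K' (f n) \<subseteq> fst (d n)" for n
  using O' chart_at by (auto simp: d_def)
 have "\<exists>Bx. open Bx \<and> x \<in> Bx \<and> Bx \<subseteq> O' (f (nn x)) \<and> (\<forall>m\<le>nn x. (x \<notin> K' (f m) --> Bx \<inter> K' (f m) = {}) \<and>
  (x \<in> K' (f m) --> Bx \<subseteq> fst (d m) \<and> convex (snd (d m) ` Bx)))" for x
 proof -
  let ?c = "d (nn x)"
  have c: "?c \<in> \<A>" "x \<in> fst ?c" using nn d by blast+
  let ?B = "%r. chart_inv ?c ` ball (snd ?c x) r"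
  have ev: "\<exists>r0>0. \<forall>r. 0 < r \<and> r \<le> r0 --> ball (snd ?c x) r \<subseteq> snd ?c ` fst ?c \<and> ?B r \<subseteq> W" if W: "open W" "x \<in> W" for W
  proof -
   have "open (snd ?c ` (fst ?c \<inter> W))" "snd ?c x \<in> snd ?c ` (fst ?c \<inter> W)"
    using open_chart_image[OF c(1) W(1)] c(2) W(2) by auto
   then obtain r0 where r0: "r0 > 0" "ball (snd ?c x) r0 \<subseteq> snd ?c ` (fst ?c \<inter> W)"
    using open_contains_ball_eq by metis
   have "ball (snd ?c x) r \<subseteq> snd ?c ` fst ?c \<and> ?B r \<subseteq> W" if "r \<le> r0" for r
   proof -
    have b: "ball (snd ?c x) r \<subseteq> snd ?c ` (fst ?c \<inter> W)" using r0(2) subset_ball[OF that] by blast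
    hence "?B r \<subseteq> chart_inv ?c ` snd ?c ` (fst ?c \<inter> W)" by (rule image_mono)
    also have "\<dots> \<subseteq> W" using c(1) by auto
    finally show ?thesis using b by auto
   qed
   with r0(1) show ?thesis by blast
  qed
  have m: "\<exists>r0>0. \<forall>r. 0 < r \<and> r \<le> r0 --> (x \<notin> K' (f m) --> ?B r \<inter> K' (f m) = {}) \<and>
   (x \<in> K' (f m) --> ?B r \<subseteq> fst (d m) \<and> convex (snd (d m) ` ?B r))" for m
  proof (cases "x \<in> K' (f m)")
   case True
   hence xd: "x \<in> fst (d m)" using d by blast
   obtain r1 where r1: "r1 > 0" "\<forall>r. 0 < r \<and> r \<le> r1 --> convex (snd (d m) ` ?B r)"
    using convex_chart_ball[OF c(1) d(1) c(2) xd] by blast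
   obtain r2 where r2: "r2 > 0" "\<forall>r. 0 < r \<and> r \<le> r2 --> ?B r \<subseteq> fst (d m)"
    using ev[OF chart_open(1)[OF d(1)] xd] by blast
   show ?thesis by (rule exI[of _ "min r1 r2"]) (use r1 r2 True in auto)
  next
   case False
   then obtain r2 where r2: "r2 > 0" "\<forall>r. 0 < r \<and> r \<le> r2 --> ?B r \<subseteq> - K' (f m)"
    using ev[of "- K' (f m)"] O'(5) by blast
   thus ?thesis using False by (intro exI[of _ r2]) auto
  qed
  then obtain rm where rm: "\<And>m. rm m > 0" "\<And>m r. 0 < r ==> r \<le> rm m ==> (x \<notin> K' (f m) --> ?B r \<inter> K' (f m) = {}) \<and>
   (x \<in> K' (f m) --> ?B r \<subseteq> fst (d m) \<and> convex (snd (d m) ` ?B r))"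
   by metis
  obtain r2 where r2: "r2 > 0" "\<forall>r. 0 < r \<and> r \<le> r2 --> ball (snd ?c x) r \<subseteq> snd ?c ` fst ?c \<and> ?B r \<subseteq> O' (f (nn x))"
   using ev[OF O'(1) nn] by blast
  \<comment> \<open>Only the finitely many indices up to \<open>nn x\<close> restrict the radius, so
    the minimum is positive.\<close>
  define r where "r = Min (insert r2 (rm ` {..nn x}))"
  have r: "r > 0" "r \<le> r2" using rm(1) r2(1) by (auto simp: r_def)
  have r3: "r \<le> rm m" if "m \<le> nn x" for m unfolding r_def by (rule Min_le) (use that in auto)
  have "open (?B r)" by (rule open_chart_inv_image[OF c(1) open_ball]) (use r2 r in blast)
  moreover have "x \<in> ?B r" using c r(1) by (intro image_eqI[of _ _ "snd ?c x"]) auto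
  moreover have "?B r \<subseteq> O' (f (nn x))" using r2 r by blast
  moreover have "(x \<notin> K' (f m) --> ?B r \<inter> K' (f m) = {}) \<and>
   (x \<in> K' (f m) --> ?B r \<subseteq> fst (d m) \<and> convex (snd (d m) ` ?B r))" if "m \<le> nn x" for m
   by (rule rm(2)[OF r(1) r3[OF that]])
  ultimately show ?thesis by (intro exI[of _ "?B r"] conjI allI impI) simp_all
 qed
 then obtain B' where B': "\<And>x. open (B' x)" "\<And>x. x \<in> B' x" "\<And>x. B' x \<subseteq> O' (f (nn x))"
  "\<And>x m. m \<le> nn x ==> x \<notin> K' (f m) ==> B' x \<inter> K' (f m) = {}"
  "\<And>x m. m \<le> nn x ==> x \<in> K' (f m) ==> B' x \<subseteq> fst (d m) \<and> convex (snd (d m) ` B' x)"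
  by metis
 have "\<exists>g C N. smooth_fun_on UNIV g \<and> open N \<and> x \<in> N \<and> (\<forall>y\<in>N. g y = (1::real)) \<and> compact C \<and> C \<subseteq> B' x \<and> (\<forall>y. y \<notin> C --> g y = 0)" for x
 proof -
  obtain g :: "'a => real" and C N where "smooth_fun_on UNIV g" "\<And>y. 0 \<le> g y \<and> g y \<le> 1" "open N" "x \<in> N"
   "\<And>y. y \<in> N ==> g y = 1" "compact C" "C \<subseteq> B' x" "\<And>y. y \<notin> C ==> g y = 0"
   by (rule bump_point[OF B'(1,2)]) (rule that; assumption)
  thus ?thesis by (intro exI[of _ g] exI[of _ C] exI[of _ N]) auto
 qed
 then obtain g C N where g: "\<And>x. smooth_fun_on UNIV (g x)" "\<And>x. open (N x)" "\<And>x. x \<in> N x" "\<And>x y. y \<in> N x ==> g x y = (1::real)"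
  "\<And>x. compact (C x)" "\<And>x. C x \<subseteq> B' x" "\<And>x y. y \<notin> C x ==> g x y = 0"
  by metis
 obtain z :: "nat => 'a" where z: "(\<Union>n. N (z n)) = UNIV"
  by (rule lindelof_nat[of N, OF g(2,3)])
 \<comment> \<open>The sum telescopes: its partial sums are one minus a product. Where some bump
   equals 1 the product vanishes, so only finitely many terms survive near any point, although the
   sets of the cover need not be locally finite.\<close>
 define \<rho> where "\<rho> j x = g (z j) x * (\<Prod>i<j. 1 - g (z i) x)" for j x
 have sum: "(\<Sum>j<n. \<rho> j x) = 1 - (\<Prod>i<n. 1 - g (z i) x)" for n x
  by (induction n) (auto simp: \<rho>_def algebra_simps)
 show thesis
 proof (rule that[of "%j. B' (z j)" "%x. d (nn x)" \<rho>])
  show "open (B' (z j))" for j by (rule B'(1))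
  show "(\<Union>j. B' (z j)) = UNIV"
  proof -
   have "N (z j) \<subseteq> B' (z j)" for j
   proof
    fix y assume "y \<in> N (z j)"
    hence "g (z j) y = 1" by (rule g(4))
    hence "y \<in> C (z j)" using g(7)[of y "z j"] by (cases "y \<in> C (z j)") auto
    thus "y \<in> B' (z j)" using g(6)[of "z j"] by (rule rev_subsetD)
   qed
   hence "(\<Union>n. N (z n)) \<subseteq> (\<Union>j. B' (z j))" by (intro UN_mono) auto
   thus ?thesis unfolding z by (rule top.extremum_uniqueI)
  qed
  show "d (nn x) \<in> \<A>" for x by (rule d(1))
  show "B' (z j) \<subseteq> fst (d (nn x)) \<and> convex (snd (d (nn x)) ` B' (z j))" if x: "x \<in> B' (z j)" for x j
  proof -
   have "x \<in> O' (f (nn (z j)))" using B'(3) x by blast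
   \<comment> \<open>The chart of x is thus among those respected by the neighbourhood of
     \<open>z j\<close>. This neighbourhood meets \<open>K' (f (nn x))\<close> in x, hence its
     centre lies in that compact ball and convexity is available.\<close>
   hence le: "nn x \<le> nn (z j)" unfolding nn_def[of x] by (rule Least_le)
   have "x \<in> K' (f (nn x))" using nn d(2) by blast
   hence "z j \<in> K' (f (nn x))" using B'(4)[OF le] x by blast
   thus ?thesis by (rule B'(5)[OF le])
  qed
  show "smooth_fun_on UNIV (\<rho> j)" for j unfolding \<rho>_def[abs_def]
   by (intro smooth_fun_on_mult smooth_fun_on_prod smooth_fun_on_diff smooth_fun_on_const g(1) open_UNIV)
  show "\<exists>C. compact C \<and> C \<subseteq> B' (z j) \<and> (\<forall>x. x \<notin> C --> \<rho> j x = 0)" for j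
   using g(5-7) by (intro exI[of _ "C (z j)"]) (auto simp: \<rho>_def)
  show "\<exists>W n. open W \<and> x \<in> W \<and> (\<forall>y\<in>W. (\<forall>j\<ge>n. \<rho> j y = 0) \<and> (\<Sum>j<n. \<rho> j y) = 1)" for x
  proof -
   obtain k where k: "x \<in> N (z k)" using z by blast
   have p: "(\<Prod>i<j. 1 - g (z i) y) = 0" if "y \<in> N (z k)" "Suc k \<le> j" for y j
    using g(4)[OF that(1)] that(2) by (intro prod_zero) auto
   show ?thesis by (intro exI[of _ "N (z k)"] exI[of _ "Suc k"] conjI ballI allI impI)
     (use g(2) k p sum in "auto simp: \<rho>_def simp del: sum.lessThan_Suc prod.lessThan_Suc")
  qed
 qed
qed

end

section \<open>Alternating sums and simplices spanned by tuples of points\<close>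

section \<open>Alternating sums over lists\<close>

text \<open>The simplicial coboundary of a cochain, evaluated on one tuple of vertices.\<close>

definition altsum :: "('b list => real) => 'b list => real" where
 "altsum f l = (\<Sum>j<length l. (-1) ^ j * f (del_nth j l))"

lemma altsum_Nil [simp]: "altsum f [] = 0"
 by (simp add: altsum_def)

lemma altsum_Cons: "altsum f (x # l) = f l - altsum (%m. f (x # m)) l"
 by (simp add: altsum_def sum.lessThan_Suc_shift sum_negf del: sum.lessThan_Suc)

lemma altsum_diff: "altsum (%m. f m - g m) l = altsum f l - altsum g l"
 by (simp add: altsum_def right_diff_distrib sum_subtractf)

lemma altsum_altsum: "altsum (altsum f) l = 0"
proof (induction l arbitrary: f)
 case (Cons x l)
 have "altsum (%m. altsum f (x # m)) l = altsum f l" by (simp add: altsum_Cons altsum_diff Cons)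
 thus ?case by (simp add: altsum_Cons)
qed simp

lemma altsum_cong:
 assumes "\<And>m. Suc (length m) = length l ==> set m \<subseteq> set l ==> f m = g m"
 shows "altsum f l = altsum g l"
 unfolding altsum_def
proof (rule sum.cong)
 fix j assume "j \<in> {..<length l}"
 hence "f (del_nth j l) = g (del_nth j l)" by (intro assms set_del_nth) auto
 thus "(-1) ^ j * f (del_nth j l) = (-1) ^ j * g (del_nth j l)" by simp
qed simp

lemma altsum_sum: "altsum (%m. \<Sum>i\<in>A. c i * f i m) l = (\<Sum>i\<in>A. c i * altsum (f i) l)"
 unfolding altsum_def sum_distrib_left by (subst sum.swap) (simp add: mult.left_commute)

section \<open>Smooth cubes spanned by tuples of points\<close>

context manifold
begin

definition SM :: "('v::euclidean_space => 'a) => bool" where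
 "SM h \<longleftrightarrow> continuous_on UNIV h \<and> (\<forall>c\<in>\<A>. smooth_on (h -` fst c) (%s. snd c (h s)))"

lemma SM_C1M: "SM h ==> C1M h"
 unfolding SM_def C1M_def smooth_on_def by blast

lemma SM_chart_inv:
 assumes "c \<in> \<A>" "smooth_on UNIV g" "range g \<subseteq> snd c ` fst c"
 shows "SM (%s. chart_inv c (g s))"
 unfolding SM_def
proof (intro conjI ballI)
 have cg: "continuous_on UNIV g" by (rule smooth_on_continuous[OF assms(2)])
 show ch: "continuous_on UNIV (%s. chart_inv c (g s))"
  by (rule continuous_on_compose2[OF continuous_on_chart_inv[OF assms(1)] cg assms(3)])
 fix d assume d: "d \<in> \<A>"
 let ?S = "(%s. chart_inv c (g s)) -` fst d"
 have o: "open ?S" by (rule open_vimage[OF chart_open(1)[OF d] ch])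
 have im: "g ` ?S \<subseteq> snd c ` (fst c \<inter> fst d)"
 proof
  fix y assume "y \<in> g ` ?S"
  then obtain s where s: "y = g s" "chart_inv c (g s) \<in> fst d" by auto
  have gs: "g s \<in> snd c ` fst c" using assms(3) by auto
  show "y \<in> snd c ` (fst c \<inter> fst d)"
   using s gs snd_chart_inv[OF assms(1) gs] chart_inv_in[OF assms(1) gs]
   by (intro image_eqI[of _ _ "chart_inv c (g s)"]) auto
 qed
 have "smooth_on ?S (%s. (snd d \<circ> chart_inv c) (g s))"
  by (rule smooth_on_compose[OF o open_chart_image[OF assms(1) chart_open(1)[OF d]] im
    smooth_on_subset[OF assms(2)] transition_smooth[OF assms(1) d]]) simp
 thus "smooth_on ?S (%s. snd d (chart_inv c (g s)))" by simp
qed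

lemma SM_const: "SM (%s. x)"
 unfolding SM_def by (auto simp: smooth_on_const)

end

lemma smooth_on_co: "smooth_on S (%s. co s i)"
 unfolding co_def by (rule smooth_on_bounded_linear[OF bounded_linear_inner_left])

text \<open>The chart \<open>cc x\<close> belongs to the point and not to a member of the cover. A
  tuple of points therefore spans a simplex without further choices, and this simplex lies in every
  \<open>B j\<close> that contains the tuple.\<close>

locale good_cover = manifold \<A>
 for \<A> :: "('a::{second_countable_topology,t2_space}, 'e::euclidean_space) chart set" +
 fixes B :: "nat => 'a set" and cc :: "'a => ('a, 'e) chart" and \<rho> :: "nat => 'a => real"
 assumes B_open: "\<And>j. open (B j)" and B_cover: "(\<Union>j. B j) = UNIV" and cc_in: "\<And>x. cc x \<in> \<A>"
  and B_convex: "\<And>x j. x \<in> B j ==> B j \<subseteq> fst (cc x) \<and> convex (snd (cc x) ` B j)"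
  and rho_smooth: "\<And>j. smooth_fun_on UNIV (\<rho> j)"
  and rho_supp: "\<And>j. \<exists>C. compact C \<and> C \<subseteq> B j \<and> (\<forall>x. x \<notin> C --> \<rho> j x = 0)"
  and rho_sum: "\<And>x. \<exists>W n. open W \<and> x \<in> W \<and> (\<forall>y\<in>W. (\<forall>j\<ge>n. \<rho> j y = 0) \<and> (\<Sum>j<n. \<rho> j y) = 1)"
begin

text \<open>The first vertex is joined to the simplex spanned by the others along segments in its chart. The
 smooth step extends the parametrisation smoothly from the unit cube to the whole space without enlarging the image.\<close>

fun sg :: "'a list => (nat => real) => 'a" where
 "sg [] q = undefined"
| "sg [x] q = x"
| "sg (x # y # l) q = chart_inv (cc x) ((1 - smooth_step (q 0)) *\<^sub>R snd (cc x) x +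
  smooth_step (q 0) *\<^sub>R snd (cc x) (sg (y # l) (%i. q (Suc i))))"

lemma sg_Cons: "l \<noteq> [] ==> sg (x # l) q = chart_inv (cc x) ((1 - smooth_step (q 0)) *\<^sub>R snd (cc x) x +
  smooth_step (q 0) *\<^sub>R snd (cc x) (sg l (%i. q (Suc i))))"
 by (cases l) auto

lemma join_in:
 assumes "x \<in> B j" "y \<in> B j" "0 \<le> u" "u \<le> 1"
 shows "(1 - u) *\<^sub>R snd (cc x) x + u *\<^sub>R snd (cc x) y \<in> snd (cc x) ` B j"
  and "chart_inv (cc x) ((1 - u) *\<^sub>R snd (cc x) x + u *\<^sub>R snd (cc x) y) \<in> B j"
proof -
 show 1: "(1 - u) *\<^sub>R snd (cc x) x + u *\<^sub>R snd (cc x) y \<in> snd (cc x) ` B j"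
  using B_convex[OF assms(1)] assms by (intro convexD_alt) auto
 then obtain w where w: "w \<in> B j" "(1 - u) *\<^sub>R snd (cc x) x + u *\<^sub>R snd (cc x) y = snd (cc x) w" by auto
 thus "chart_inv (cc x) ((1 - u) *\<^sub>R snd (cc x) x + u *\<^sub>R snd (cc x) y) \<in> B j"
  using B_convex[OF assms(1)] chart_inv_snd[OF cc_in, of w x] by auto
qed

lemma sg_in: "l \<noteq> [] ==> set l \<subseteq> B j ==> sg l q \<in> B j"
proof (induction l arbitrary: q)
 case (Cons x l)
 show ?case
 proof (cases "l = []")
  case False
  thus ?thesis unfolding sg_Cons[OF False] using Cons by (intro join_in smooth_step_bounds) auto
 qed (use Cons in auto)
qed simp

lemma sg_cong: "(\<And>i. Suc i < length l ==> q i = q' i) ==> sg l q = sg l q'"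
proof (induction l arbitrary: q q')
 case (Cons x l)
 show ?case
 proof (cases "l = []")
  case False
  have "sg l (%i. q (Suc i)) = sg l (%i. q' (Suc i))" by (rule Cons.IH) (use Cons.prems in simp)
  moreover have "q 0 = q' 0" using Cons.prems[of 0] False by simp
  ultimately show ?thesis unfolding sg_Cons[OF False] by simp
 qed simp
qed simp

lemma chart_inv_cc: "x \<in> B j ==> y \<in> B j ==> chart_inv (cc x) (snd (cc x) y) = y"
 using B_convex[of x j] by (intro chart_inv_snd[OF cc_in]) auto

text \<open>At parameter 1 the join with vertex \<open>j\<close> has arrived at the simplex of the
  later vertices, so this vertex disappears.\<close>

lemma sg_face_1:
 "Suc j < length l ==> set l \<subseteq> B i ==> q j = 1 ==> sg l q = sg (del_nth j l) (%m. if m < j then q m else q (Suc m))"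
proof (induction l arbitrary: j q)
 case (Cons x l)
 hence l: "l \<noteq> []" by auto
 show ?case
 proof (cases j)
  case 0
  have "sg l (%i. q (Suc i)) \<in> B i" using Cons.prems l by (intro sg_in) auto
  thus ?thesis using 0 Cons.prems chart_inv_cc[of x i] by (simp add: sg_Cons[OF l] smooth_step_1)
 next
  case (Suc m)
  have "length (del_nth m l) > 0" using Cons.prems(1) Suc by simp
  hence d: "del_nth m l \<noteq> []" by auto
  have "sg l (%i. q (Suc i)) = sg (del_nth m l) (%i. if i < m then q (Suc i) else q (Suc (Suc i)))"
   by (rule Cons.IH) (use Cons.prems Suc in auto)
  thus ?thesis unfolding Suc del_nth_simps sg_Cons[OF l] sg_Cons[OF d] by simp
 qed
qed simp

text \<open>The last join connects only two vertices; at parameter 0 it stays at the first of them,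
  and the final vertex drops out.\<close>

lemma sg_face_0:
 "length l = Suc (Suc j) ==> set l \<subseteq> B i ==> q j = 0 ==> sg l q = sg (del_nth (Suc j) l) q"
proof (induction l arbitrary: j q)
 case (Cons x l)
 hence l: "l \<noteq> []" by auto
 show ?case
 proof (cases j)
  case 0
  then obtain y where "l = [y]" using Cons.prems(1) by (cases l) auto
  thus ?thesis using 0 Cons.prems chart_inv_cc[of x i x] by (simp add: smooth_step_0)
 next
  case (Suc m)
  have "length (del_nth (Suc m) l) > 0" using Cons.prems(1) Suc by simp
  hence d: "del_nth (Suc m) l \<noteq> []" by auto
  have "sg l (%i. q (Suc i)) = sg (del_nth (Suc m) l) (%i. q (Suc i))"
   by (rule Cons.IH) (use Cons.prems Suc in auto)
  thus ?thesis unfolding Suc del_nth_simps sg_Cons[OF l] sg_Cons[OF d] by simp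
 qed
qed simp

text \<open>At parameter 0 a join rests at its own vertex, whatever the later parameters
  are.\<close>

lemma sg_degenerate:
 "q j = 0 ==> (\<And>m. m \<le> j ==> q m = q' m) ==> sg l q = sg l q'"
proof (induction l arbitrary: j q q')
 case (Cons x l)
 show ?case
 proof (cases "l = []")
  case False
  show ?thesis
  proof (cases j)
   case 0
   hence "q 0 = 0" "q' 0 = 0" using Cons.prems(1) Cons.prems(2)[of 0] by auto
   thus ?thesis unfolding sg_Cons[OF False] by (simp add: smooth_step_0)
  next
   case (Suc m)
   have "sg l (%i. q (Suc i)) = sg l (%i. q' (Suc i))"
    by (rule Cons.IH[of _ m]) (use Cons.prems Suc in auto)
   thus ?thesis using Cons.prems(2)[of 0] unfolding sg_Cons[OF False] by simp
  qed
 qed simp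
qed simp

text \<open>The offset \<open>n\<close> is carried for the induction, since the simplex of the
  remaining vertices uses the coordinates from the next one on.\<close>

lemma SM_sg:
 "l \<noteq> [] ==> set l \<subseteq> B j ==> SM (%s::'v::euclidean_space. sg l (%i. co s (n + i)))"
proof (induction l arbitrary: n)
 case (Cons x l)
 show ?case
 proof (cases "l = []")
  case True
  thus ?thesis by (simp add: SM_const)
 next
  case False
  let ?h = "%s::'v. sg l (%i. co s (Suc n + i))"
  have IH: "SM ?h" by (rule Cons.IH) (use False Cons.prems in auto)
  have hB: "?h s \<in> B j" for s by (rule sg_in) (use False Cons.prems in auto)
  have x: "x \<in> B j" using Cons.prems by simp
  have "?h -` fst (cc x) = UNIV" using hB B_convex[OF x] by auto
  hence sh: "smooth_on UNIV (%s. snd (cc x) (?h s))" using IH cc_in[of x] by (auto simp: SM_def)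
  have st: "smooth_on UNIV (%s::'v. smooth_step (co s n))"
   by (rule smooth_on_compose[OF open_UNIV open_UNIV subset_UNIV smooth_on_co smooth_on_smooth_step])
  let ?g = "%s::'v. (1 - smooth_step (co s n)) *\<^sub>R snd (cc x) x + smooth_step (co s n) *\<^sub>R snd (cc x) (?h s)"
  have "SM (%s. chart_inv (cc x) (?g s))"
  proof (rule SM_chart_inv[OF cc_in])
   show "smooth_on UNIV ?g" by (intro smooth_on_arith smooth_on_scaleR smooth_on_const sh st open_UNIV)
   have "?g s \<in> snd (cc x) ` B j" for s by (intro join_in x hB smooth_step_bounds)
   thus "range ?g \<subseteq> snd (cc x) ` fst (cc x)" using B_convex[OF x] by blast
  qed
  thus ?thesis unfolding sg_Cons[OF False] by simp
 qed
qed simp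

definition cu :: "'a list => 'v::euclidean_space => 'a" where
 "cu l s = sg l (co s)"

lemma SM_cu: "l \<noteq> [] ==> set l \<subseteq> B j ==> SM (cu l)"
 using SM_sg[of l j 0] by (simp add: cu_def[abs_def])

text \<open>\<open>smooth_step\<close> is constant on either side of the unit interval, so the map
  factors through the unit cube; this yields compactness of its range.\<close>

lemma sg_clamp: "sg l q = sg l (%i. max 0 (min 1 (q i)))"
proof (induction l arbitrary: q)
 case (Cons x l)
 have s: "smooth_step (max 0 (min 1 t)) = smooth_step t" for t
  by (auto simp: max_def min_def smooth_step_0 smooth_step_1)
 show ?case
 proof (cases "l = []")
  case False
  show ?thesis unfolding sg_Cons[OF False] s using Cons.IH[of "%i. q (Suc i)"] by simp
 qed simp
qed simp

definition clampv :: "'v::euclidean_space => 'v" where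
 "clampv s = (\<Sum>i<DIM('v). max 0 (min 1 (co s i)) *\<^sub>R eb i)"

lemma cu_clamp: "cu l (clampv s) = cu l (s::'v::euclidean_space)"
 and clampv_cbox: "clampv s \<in> cbox 0 (One::'v)"
proof -
 have c: "co (clampv s) i = max 0 (min 1 (co s i))" for i
  unfolding clampv_def sum_co_delta by (auto simp: co_ge)
 hence "co (clampv s) = (%i. max 0 (min 1 (co s i)))" by (rule ext)
 thus "cu l (clampv s) = cu l s" unfolding cu_def using sg_clamp[of l "co s"] by simp
 have "0 \<le> clampv s \<bullet> b \<and> clampv s \<bullet> b \<le> 1" if "b \<in> Basis" for b
 proof -
  have "b \<in> eb ` {..<DIM('v)}" using that bij_betw_imp_surj_on[OF eb_bij[where 'v='v]] by simp
  then obtain i where "b = eb i" by auto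
  thus ?thesis using c[of i] by (simp add: co_def)
 qed
 thus "clampv s \<in> cbox 0 One" by (simp add: mem_box)
qed

lemma range_cu_cbox: "range (cu l :: 'v::euclidean_space => 'a) = (cu l :: 'v => 'a) ` cbox 0 One"
proof -
 have "cu l s \<in> (cu l :: 'v => 'a) ` cbox 0 One" for s :: 'v
  using imageI[OF clampv_cbox[of s], of "cu l :: 'v => 'a"] by (simp add: cu_clamp)
 thus ?thesis by blast
qed

lemma compact_range_cu:
 assumes "l \<noteq> []" "set l \<subseteq> B j"
 shows "compact (range (cu l :: 'v::euclidean_space => 'a))"
 unfolding range_cu_cbox
proof (rule compact_continuous_image[OF _ compact_cbox])
 have "SM (cu l :: 'v => 'a)" by (rule SM_cu[OF assms])
 thus "continuous_on (cbox 0 One) (cu l :: 'v => 'a)"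
  using continuous_on_subset[of UNIV "cu l :: 'v => 'a"] by (simp add: SM_def)
qed

lemma range_cu: "l \<noteq> [] ==> set l \<subseteq> B j ==> range (cu l) \<subseteq> B j"
 using sg_in by (auto simp: cu_def)

lemma cu_face_1:
 assumes "length l = Suc (Suc k)" "set l \<subseteq> B m" "i \<le> k" "k < DIM('v)"
 shows "cu l (ins i 1 (s::'v::euclidean_space)) = cu (del_nth i l) s"
proof -
 have "cu l (ins i 1 s) = sg (del_nth i l) (%m. if m < i then co (ins i 1 s) m else co (ins i 1 s) (Suc m))"
  unfolding cu_def by (rule sg_face_1[OF _ assms(2)]) (use assms in "auto simp: co_ins")
 also have "\<dots> = cu (del_nth i l) s"
  unfolding cu_def by (rule sg_cong) (use assms in "auto simp: co_ins")
 finally show ?thesis .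
qed

lemma cu_face_0:
 assumes "length l = Suc (Suc k)" "set l \<subseteq> B m" "k < DIM('v)"
 shows "cu l (ins k 0 (s::'v::euclidean_space)) = cu (del_nth (Suc k) l) s"
proof -
 have "cu l (ins k 0 s) = sg (del_nth (Suc k) l) (co (ins k 0 s))"
  unfolding cu_def by (rule sg_face_0[OF assms(1,2)]) (use assms in "auto simp: co_ins")
 also have "\<dots> = cu (del_nth (Suc k) l) s"
  unfolding cu_def by (rule sg_cong) (use assms in "auto simp: co_ins")
 finally show ?thesis .
qed

text \<open>Inserting 0 at place \<open>i\<close> pushes coordinate \<open>i\<close> of
  \<open>s\<close> to a later place, where it has no influence.\<close>

lemma cu_degenerate:
 assumes "i < DIM('v)"
 shows "cu l (ins i 0 (upd i r (s::'v::euclidean_space))) = cu l (ins i 0 s)"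
 unfolding cu_def
 by (rule sg_degenerate[of _ i]) (use assms in "auto simp: co_ins co_upd")

text \<open>The faces on which a coordinate other than the last one vanishes are degenerate.\<close>

lemma stokes_faces:
 fixes G :: "'a => 'a"
 assumes l: "length l = Suc (Suc k)" "set l \<subseteq> B m" and k: "k < DIM('v)"
  and G: "C1M (%s::'v::euclidean_space. G (cu l s))" and \<phi>: "\<phi> \<in> forms_on U k"
  and st: "cint (Suc k) (pb d\<phi> (%s::'v. G (cu l s)) (ebs (Suc k))) =
   (\<Sum>i<Suc k. (-1) ^ i * (cint k (pb \<phi> (%s::'v. G (cu l (ins i 1 s))) (ebs k)) -
    cint k (pb \<phi> (%s::'v. G (cu l (ins i 0 s))) (ebs k))))"
 shows "cint (Suc k) (pb d\<phi> (%s::'v. G (cu l s)) (ebs (Suc k))) =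
  altsum (%l. cint k (pb \<phi> (%s::'v. G (cu l s)) (ebs k))) l"
proof -
 let ?J = "%l. cint k (pb \<phi> (%s::'v. G (cu l s)) (ebs k))"
 have 1: "cint k (pb \<phi> (%s::'v. G (cu l (ins i 1 s))) (ebs k)) = ?J (del_nth i l)" if "i \<le> k" for i
  by (simp add: cu_face_1[OF l that k])
 have 2: "cint k (pb \<phi> (%s::'v. G (cu l (ins k 0 s))) (ebs k)) = ?J (del_nth (Suc k) l)"
  by (simp add: cu_face_0[OF l k])
 have 3: "cint k (pb \<phi> (%s::'v. G (cu l (ins i 0 s))) (ebs k)) = 0" if i: "i < k" for i
 proof -
  have "pb \<phi> (%s::'v. G (cu l (ins i 0 s))) (ebs k) s = 0" for s
  proof (rule pb_degenerate[OF C1M_ins(1)[OF G] \<phi>])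
   show "eb i \<in> set (ebs k :: 'v list)" using i by (simp add: ebs_def)
   show "G (cu l (ins i 0 (upd i r s))) = G (cu l (ins i 0 s))" for r and s :: 'v
    by (rule arg_cong[of _ _ G], rule cu_degenerate) (use i k in simp)
  qed simp
  hence "pb \<phi> (%s::'v. G (cu l (ins i 0 s))) (ebs k) = (%s. 0)" by (rule ext)
  thus ?thesis by (simp add: cint_zero)
 qed
 have "(\<Sum>i<Suc k. (-1) ^ i * (cint k (pb \<phi> (%s::'v. G (cu l (ins i 1 s))) (ebs k)) -
    cint k (pb \<phi> (%s::'v. G (cu l (ins i 0 s))) (ebs k)))) =
  (\<Sum>i<Suc k. (-1) ^ i * ?J (del_nth i l)) - (-1) ^ k * ?J (del_nth (Suc k) l)"
  by (simp add: 1 2 3 right_diff_distrib)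
 \<comment> \<open>The zero face of the last coordinate enters with the sign -(-1)^k, which is the
   sign \<open>altsum\<close> gives to the deletion of the last vertex.\<close>
 also have "\<dots> = altsum ?J l" by (simp add: altsum_def l(1))
 finally show ?thesis using st by simp
qed

text \<open>The de Rham cochain of a form on tuples of points. The type argument only fixes the
  parameter space of the cubes.\<close>

definition Iv :: "'v::euclidean_space itself => ('a, 'e) form => 'a list => real" where
 "Iv T \<phi> l = cint (length l - 1) (pb \<phi> (cu l :: 'v => 'a) (ebs (length l - 1)))"

text \<open>Stokes' theorem in the form that integration is a cochain map; the degenerate faces of
  the cube have dropped out.\<close>

lemma Iv_ext_on:
 fixes T :: "'v::euclidean_space itself"
 assumes "\<phi> \<in> forms_on U k" "open U" "range (cu l :: 'v => 'a) \<subseteq> U"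
  "length l = Suc (Suc k)" "set l \<subseteq> B m" "k < DIM('v)"
 shows "Iv T (ext_on U \<phi>) l = altsum (Iv T \<phi>) l"
proof -
 obtain x where x: "x \<in> set l" using assms(4) by (cases l) auto
 hence xB: "x \<in> B m" using assms(5) by blast
 have l: "l \<noteq> []" using x by auto
 have C1: "C1M (cu l :: 'v => 'a)" by (rule SM_C1M[OF SM_cu[OF l assms(5)]])
 have "range (cu l :: 'v => 'a) \<subseteq> U \<inter> fst (cc x)"
  using range_cu[OF l assms(5)] B_convex[OF xB] assms(3) by blast
 from stokes_image[OF C1 assms(1,2) cc_in compact_range_cu[OF l assms(5)] this subset_refl assms(6)]
 have "cint (Suc k) (pb (ext_on U \<phi>) (%s::'v. (%x. x) (cu l s)) (ebs (Suc k))) =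
  altsum (%l. cint k (pb \<phi> (%s::'v. (%x. x) (cu l s)) (ebs k))) l"
  by (intro stokes_faces[OF assms(4-6) _ assms(1)]) (use C1 in simp_all)
 moreover have "altsum (%l. cint k (pb \<phi> (%s::'v. (%x. x) (cu l s)) (ebs k))) l = altsum (Iv T \<phi>) l"
  by (rule altsum_cong) (use assms(4) in "simp add: Iv_def")
 ultimately show ?thesis by (simp add: Iv_def assms(4))
qed

end

section \<open>Exactness from cochains: double complex and cone of integration\<close>

section \<open>A double complex argument\<close>

text \<open>Staircase argument: a primitive \<open>y0\<close> need not be annihilated by
  \<open>\<delta>\<close>, but \<open>\<delta> y0\<close> is D-closed, one level higher and one
  degree lower than the given element. By recursion it has a primitive in the kernel of
  \<open>\<delta>\<close>, and a preimage of this primitive under \<open>\<delta>\<close> corrects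
  \<open>y0\<close>. The bound \<open>P\<close> reflects that only cubes of dimension up to
  \<open>DIM('v)\<close> are available.\<close>

lemma double_complex:
 fixes K :: "nat => nat => 'x::ab_group_add set" and D \<delta> :: "'x => 'x"
 assumes K_diff: "\<And>q k x y. x \<in> K q k ==> y \<in> K q k ==> x - y \<in> K q k"
  and D: "\<And>q k x. x \<in> K q k ==> D x \<in> K q (Suc k)"
  and dl: "\<And>q k x. x \<in> K q k ==> \<delta> x \<in> K (Suc q) k"
  and D_diff: "\<And>q k x y. x \<in> K q k ==> y \<in> K q k ==> D (x - y) = D x - D y"
  and dl_diff: "\<And>q k x y. x \<in> K q k ==> y \<in> K q k ==> \<delta> (x - y) = \<delta> x - \<delta> y"
  and DD: "\<And>q k x. k < P ==> x \<in> K q k ==> D (D x) = 0"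
  and dldl: "\<And>q k x. x \<in> K q k ==> \<delta> (\<delta> x) = 0"
  and comm: "\<And>q k x. x \<in> K q k ==> D (\<delta> x) = \<delta> (D x)"
  and row: "\<And>q k x. x \<in> K (Suc q) k ==> \<delta> x = 0 ==> \<exists>y\<in>K q k. \<delta> y = x"
  and inj: "\<And>k x. x \<in> K 0 k ==> \<delta> x = 0 ==> x = 0"
  and col: "\<And>q k x. k < P ==> x \<in> K (Suc q) (Suc k) ==> D x = 0 ==> \<exists>y\<in>K (Suc q) k. D y = x"
  and col0: "\<And>q x. x \<in> K (Suc q) 0 ==> D x = 0 ==> x = 0"
  and x: "x \<in> K 0 (Suc k)" "D x = 0" "k < P"
 shows "\<exists>y\<in>K 0 k. D y = x"
proof -
 have D0: "D 0 = 0" and dl0: "\<delta> 0 = 0" if "x \<in> K q k" for x q k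
  using D_diff[OF that that] dl_diff[OF that that] by auto
 have 0: "0 \<in> K q k" if "x \<in> K q k" for x q k using K_diff[OF that that] by simp
 \<comment> \<open>Degree 0 is part of the induction claim: there the failure is zero outright
   instead of having a primitive.\<close>
 have main: "(k = 0 --> x = 0) \<and> (\<forall>k'. k = Suc k' --> k' < P --> (\<exists>y\<in>K (Suc q) k'. \<delta> y = 0 \<and> D y = x))"
  if "x \<in> K (Suc q) k" "\<delta> x = 0" "D x = 0" for x q k
  using that
 proof (induction k arbitrary: x q)
  case 0
  thus ?case using col0 by simp
 next
  case (Suc k)
  have "\<exists>y\<in>K (Suc q) k. \<delta> y = 0 \<and> D y = x" if kP: "k < P"
  proof -
   obtain y0 where y0: "y0 \<in> K (Suc q) k" "D y0 = x" using col[OF kP Suc.prems(1,3)] by blast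
   have y1: "\<delta> y0 \<in> K (Suc (Suc q)) k" "\<delta> (\<delta> y0) = 0" "D (\<delta> y0) = 0"
    using dl[OF y0(1)] dldl[OF y0(1)] comm[OF y0(1)] y0(2) Suc.prems(2) by auto
   note IH = Suc.IH[OF y1]
   show ?thesis
   proof (cases k)
    case 0
    thus ?thesis using IH y0 by auto
   next
    case (Suc j)
    then obtain z where z: "z \<in> K (Suc (Suc q)) j" "\<delta> z = 0" "D z = \<delta> y0" using IH kP by auto
    obtain w where w: "w \<in> K (Suc q) j" "\<delta> w = z" using row[OF z(1,2)] by blast
    have Dw: "D w \<in> K (Suc q) k" using D[OF w(1)] Suc by simp
    have "\<delta> (y0 - D w) = 0" using dl_diff[OF y0(1) Dw] comm[OF w(1)] w(2) z(3) by simp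
    moreover have "D (y0 - D w) = x" using D_diff[OF y0(1) Dw] DD[OF _ w(1)] Suc kP y0(2) by simp
    ultimately show ?thesis using K_diff[OF y0(1) Dw] by blast
   qed
  qed
  thus ?case by simp
 qed
 \<comment> \<open>The same correction is made once more between levels 1 and 0, where injectivity
   of \<open>\<delta>\<close> ends the staircase.\<close>
 have "\<delta> x \<in> K 1 (Suc k)" "\<delta> (\<delta> x) = 0" "D (\<delta> x) = 0"
  using dl[OF x(1)] dldl[OF x(1)] comm[OF x(1)] x(2) dl0[OF D[OF x(1)]] by auto
 then obtain y where y: "y \<in> K 1 k" "\<delta> y = 0" "D y = \<delta> x"
  using main[of "\<delta> x" 0 "Suc k"] x(3) by auto
 obtain w where w: "w \<in> K 0 k" "\<delta> w = y" using row[of y 0 k] y by auto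
 have Dw: "D w \<in> K 0 (Suc k)" by (rule D[OF w(1)])
 have "\<delta> (x - D w) = 0" using dl_diff[OF x(1) Dw] comm[OF w(1)] w(2) y(3) by simp
 hence "x - D w = 0" by (rule inj[OF K_diff[OF x(1) Dw]])
 with w(1) show ?thesis by auto
qed

context manifold
begin

lemma forms_on_sum:
 assumes "finite A" "\<And>i. i \<in> A ==> \<phi> i \<in> forms_on U k" "open U"
 shows "(%x vs. \<Sum>i\<in>A. c i * \<phi> i x vs) \<in> forms_on U k"
 using assms(1,2)
proof (induction A)
 case (insert i A)
 have "(%x vs. c i * \<phi> i x vs + (\<Sum>i\<in>A. c i * \<phi> i x vs)) \<in> forms_on U k"
  by (rule forms_on_vector(1)[OF forms_on_vector(2) _ assms(3)]) (use insert assms(3) in auto)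
 thus ?case using insert.hyps by simp
qed (simp add: zero_forms_on)

lemma ext_on_sum:
 assumes "finite A" "\<And>i. i \<in> A ==> \<phi> i \<in> forms_on U k" "open U"
 shows "ext_on U (%x vs. \<Sum>i\<in>A. c i * \<phi> i x vs) x vs = (\<Sum>i\<in>A. c i * ext_on U (\<phi> i) x vs)"
proof -
 consider "x \<notin> U" | "\<not> set vs \<subseteq> TS x" | "length vs \<noteq> Suc k" | "x \<in> U" "set vs \<subseteq> TS x" "length vs = Suc k" by blast
 thus ?thesis
 proof cases
  case 3
  thus ?thesis
   using ext_deriv_wrong_length[OF forms_on_sum[OF assms]] ext_deriv_wrong_length[OF assms(2)]
   by (auto simp: ext_on_def res_def)
 next
  case 4
  let ?c = "chart_at \<A> x" and ?us = "map (%v. v (chart_at \<A> x)) vs"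
  note c = chart_at[of x]
  have l: "loc ?c (%x vs. \<Sum>i\<in>A. c i * \<phi> i x vs) us = (%y. \<Sum>i\<in>A. c i * loc ?c (\<phi> i) us y)" for us
   by (auto simp: local_form_def)
  have "FD (loc ?c (%x vs. \<Sum>i\<in>A. c i * \<phi> i x vs) (del_nth j ?us)) (snd ?c x) u =
   (\<Sum>i\<in>A. c i * FD (loc ?c (\<phi> i) (del_nth j ?us)) (snd ?c x) u)" if "j < length vs" for j u
   unfolding l
   by (rule FD_sum_scale(2), rule loc_smooth_at[OF assms(2,3) c]) (use 4 that in auto)
  hence "ed (loc ?c (%x vs. \<Sum>i\<in>A. c i * \<phi> i x vs)) ?us (snd ?c x) = (\<Sum>i\<in>A. c i * ed (loc ?c (\<phi> i)) ?us (snd ?c x))"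
   unfolding ed_def sum_distrib_left by (subst sum.swap) (simp add: sum_distrib_left mult.left_commute)
  thus ?thesis using 4 by (simp add: ext_on_def res_def ext_deriv_def')
 qed (simp_all add: ext_on_def res_def ext_deriv_not_TS)
qed

lemma ext_on_res:
 assumes "open V" "V \<subseteq> U"
 shows "ext_on V (res V \<phi>) = res V (ext_on U \<phi>)"
proof (intro ext)
 fix x vs
 show "ext_on V (res V \<phi>) x vs = res V (ext_on U \<phi>) x vs"
 proof (cases "x \<in> V")
  case True
  have "ext_deriv \<A> (res V \<phi>) x vs = ext_deriv \<A> \<phi> x vs"
   by (rule ext_deriv_cong_open[OF assms(1) True]) (simp add: res_def)
  thus ?thesis using True assms(2) by (auto simp: ext_on_def res_def)
 qed (simp add: ext_on_def res_def)
qed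

lemma forms_on_local:
 assumes "\<And>x vs. x \<notin> U ==> \<phi> x vs = 0" "open U"
  and "\<And>x. x \<in> U ==> \<exists>W \<psi>. open W \<and> x \<in> W \<and> \<psi> \<in> forms_on U k \<and> (\<forall>y\<in>W. \<forall>vs. \<phi> y vs = \<psi> y vs)"
 shows "\<phi> \<in> forms_on U k"
 unfolding forms_on_def mem_Collect_eq
proof (intro conjI ballI allI impI)
 fix x vs assume nz: "\<phi> x vs \<noteq> 0"
 hence x: "x \<in> U" using assms(1) by blast
 obtain W \<psi> where W: "x \<in> W" "\<psi> \<in> forms_on U k" "\<forall>y\<in>W. \<forall>vs. \<phi> y vs = \<psi> y vs"
  using assms(3)[OF x] by blast
 have "\<psi> x vs \<noteq> 0" using nz W by simp
 from forms_on_nz[OF W(2) this] show "x \<in> U" "length vs = k" "set vs \<subseteq> TS x" by auto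
next
 fix c x assume c: "c \<in> \<A>" "x \<in> fst c"
 show "alt_form k (%us. \<phi> x (map (tgt c x) us))"
 proof (cases "x \<in> U")
  case True
  obtain W \<psi> where W: "x \<in> W" "\<psi> \<in> forms_on U k" "\<forall>y\<in>W. \<forall>vs. \<phi> y vs = \<psi> y vs"
   using assms(3)[OF True] by blast
  thus ?thesis using forms_onD(4)[OF W(2) c] by simp
 next
  case False
  thus ?thesis by (simp add: assms(1) alt_form_def multilin_def linear_zero)
 qed
next
 fix c and us :: "'e list" assume c: "c \<in> \<A>" "length us = k"
 show "smooth_on (snd c ` (fst c \<inter> U)) (loc c \<phi> us)"
 proof (rule smooth_on_local)
  fix y assume "y \<in> snd c ` (fst c \<inter> U)"
  then obtain x where x: "x \<in> fst c" "x \<in> U" "y = snd c x" by auto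
  obtain W \<psi> where W: "open W" "x \<in> W" "\<psi> \<in> forms_on U k" "\<forall>y\<in>W. \<forall>vs. \<phi> y vs = \<psi> y vs"
   using assms(3)[OF x(2)] by blast
  let ?T = "snd c ` (fst c \<inter> (U \<inter> W))"
  have T: "open ?T" using open_chart_image[OF c(1)] assms(2) W(1) by blast
  have "smooth_on ?T (loc c \<psi> us)" by (rule smooth_on_subset[OF forms_onD(5)[OF W(3) c]]) auto
  hence "smooth_on ?T (loc c \<phi> us)"
   by (rule smooth_on_cong[OF T, rotated]) (use W c in "auto simp: local_form_def")
  thus "\<exists>T. open T \<and> y \<in> T \<and> smooth_on T (loc c \<phi> us)"
   using T x W(2) by (intro exI[of _ ?T]) auto
 qed
qed

end

section \<open>The Cech complex of the cone of the integration map\<close>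

text \<open>Form and cochain are stored in one real function on a disjoint sum: the group structure
  is then pointwise, and the Cech operators treat both parts alike.\<close>

type_synonym ('b, 'f) elem = "('b \<times> ('b, 'f) tangent list) + 'b list => real"

context good_cover
begin

text \<open>An element of degree \<^term>\<open>k\<close> consists of a \<^term>\<open>k\<close>-form and of a function of \<^term>\<open>k\<close>-tuples of points, that is,
 a simplicial cochain of degree \<^term>\<open>k - 1\<close>.\<close>

definition fm :: "('a, 'e) elem => ('a, 'e) form" where
 "fm e = (%x vs. e (Inl (x, vs)))"

definition ch :: "('a, 'e) elem => 'a list => real" where
 "ch e = (%l. e (Inr l))"

text \<open>The points to which an entry refers. The support condition for an element over
  \<open>V\<close> says that its nonzero entries refer to points of \<open>V\<close> only.\<close>

definition lc :: "('a \<times> ('a, 'e) tangent list) + 'a list => 'a set" where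
 "lc z = (case z of Inl p => {fst p} | Inr l => set l)"

definition UI :: "nat list => 'a set" where
 "UI I = (\<Inter>i\<in>set I. B i)"

definition small :: "'a list => bool" where
 "small l \<longleftrightarrow> l \<noteq> [] \<and> (\<exists>j. set l \<subseteq> B j)"

definition el :: "'a set => nat => ('a, 'e) elem set" where
 "el V k = {e. fm e \<in> forms_on V k \<and> (\<forall>l. ch e l \<noteq> 0 --> small l \<and> length l = k \<and> set l \<subseteq> V)}"

text \<open>Cech cochains on ordered index tuples with repetitions. The case \<open>q = 0\<close>
  has the empty tuple only, with \<open>UI [] = UNIV\<close>; it is the augmentation by global
  elements.\<close>

definition KK :: "nat => nat => (nat list => ('a, 'e) elem) set" where
 "KK q k = {x. \<forall>I. (length I = q --> x I \<in> el (UI I) k) \<and> (length I \<noteq> q --> x I = 0)}"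

text \<open>The differential of the mapping cone of the integration map; its square vanishes by
  Stokes' theorem.\<close>

definition dD :: "'v::euclidean_space itself => 'a set => ('a, 'e) elem => ('a, 'e) elem" where
 "dD T V e = (%z. case z of Inl p => ext_on V (fm e) (fst p) (snd p)
  | Inr l => if small l \<and> set l \<subseteq> V then Iv T (fm e) l - altsum (ch e) l else 0)"

definition DD :: "'v::euclidean_space itself => (nat list => ('a, 'e) elem) => nat list => ('a, 'e) elem" where
 "DD T x = (%I. dD T (UI I) (x I))"

definition cech :: "(nat list => ('a, 'e) elem) => nat list => ('a, 'e) elem" where
 "cech x = (%I z. if lc z \<subseteq> UI I then altsum (%J. x J z) I else 0)"

lemma open_UI: "open (UI I)"
 unfolding UI_def by (intro open_INT) (auto simp: B_open)

lemma UI_Cons: "UI (i # I) = B i \<inter> UI I"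
 by (simp add: UI_def)

lemma UI_mono: "set J \<subseteq> set I ==> UI I \<subseteq> UI J"
 by (auto simp: UI_def)

lemma small_subset: "small l ==> set m \<subseteq> set l ==> m \<noteq> [] ==> small m"
 by (auto simp: small_def)

lemma small_UI: "set l \<subseteq> UI I ==> I \<noteq> [] ==> l \<noteq> [] ==> small l"
 unfolding small_def UI_def by (cases I) auto

lemma range_cu_UI: "small l ==> set l \<subseteq> UI I ==> range (cu l) \<subseteq> UI I"
proof -
 assume l: "small l" "set l \<subseteq> UI I"
 have "range (cu l) \<subseteq> B i" if "i \<in> set I" for i
  by (rule range_cu) (use l that in "auto simp: small_def UI_def")
 thus ?thesis by (auto simp: UI_def)
qed

lemma el_simps: "e \<in> el V k ==> fm e \<in> forms_on V k"
 "e \<in> el V k ==> ch e l \<noteq> 0 ==> small l \<and> length l = k \<and> set l \<subseteq> V"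
 by (simp_all add: el_def)

lemma el_supp: "e \<in> el V k ==> e z \<noteq> 0 ==> lc z \<subseteq> V"
proof -
 assume e: "e \<in> el V k" and z: "e z \<noteq> 0"
 show ?thesis
 proof (cases z)
  case (Inl p)
  have "fm e (fst p) (snd p) \<noteq> 0" using z Inl by (simp add: fm_def)
  from forms_on_nz[OF el_simps(1)[OF e] this] show ?thesis using Inl by (simp add: lc_def)
 next
  case (Inr l)
  thus ?thesis using el_simps(2)[OF e, of l] z by (simp add: ch_def lc_def)
 qed
qed

lemma KK_el: "x \<in> KK q k ==> length I = q ==> x I \<in> el (UI I) k"
 and KK_zero: "x \<in> KK q k ==> length I \<noteq> q ==> x I z = 0"
 by (simp_all add: KK_def)

lemma KK_supp: "x \<in> KK q k ==> x I z \<noteq> 0 ==> length I = q \<and> lc z \<subseteq> UI I"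
 using KK_zero[of x q k I z] el_supp[OF KK_el[of x q k I], of z] by auto

lemma el_zero: "(%z. 0) \<in> el V k"
 by (simp add: el_def fm_def ch_def zero_forms_on)

lemma Iv_length:
 fixes T :: "'v::euclidean_space itself"
 assumes "\<phi> \<in> forms_on V k" "length l - 1 \<noteq> k"
 shows "Iv T \<phi> l = 0"
proof -
 have "pb \<phi> h us = (%s. 0)" if "length us \<noteq> k" for h :: "'v => 'a" and us
  by (rule ext) (simp add: pb_def forms_onD(2)[OF assms(1)] that)
 thus ?thesis using assms(2) by (simp add: Iv_def cint_zero)
qed

lemma ch_dD: "ch (dD T V e) l = (if small l \<and> set l \<subseteq> V then Iv T (fm e) l - altsum (ch e) l else 0)"
 by (simp add: ch_def[of "dD T V e"]) (simp add: dD_def)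

lemma dD_el:
 assumes "e \<in> el V k" "open V"
 shows "dD T V e \<in> el V (Suc k)"
 unfolding el_def mem_Collect_eq
proof (intro conjI allI impI)
 have "fm (dD T V e) = ext_on V (fm e)" by (simp add: fm_def dD_def)
 thus "fm (dD T V e) \<in> forms_on V (Suc k)"
  using ext_on_forms_on[OF el_simps(1)[OF assms(1)] assms(2)] by simp
 fix l assume nz: "ch (dD T V e) l \<noteq> 0"
 thus "small l" "set l \<subseteq> V" by (auto simp: ch_def dD_def split: if_splits)
 have "Iv T (fm e) l - altsum (ch e) l \<noteq> 0" using nz by (auto simp: ch_def dD_def split: if_splits)
 hence "Iv T (fm e) l \<noteq> 0 \<or> altsum (ch e) l \<noteq> 0" by auto
 moreover have "length l = Suc k" if "Iv T (fm e) l \<noteq> 0"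
  using Iv_length[OF el_simps(1)[OF assms(1)], of l T] that \<open>small l\<close> by (cases l) (auto simp: small_def)
 moreover have "length l = Suc k" if "altsum (ch e) l \<noteq> 0"
 proof (rule ccontr)
  assume n: "length l \<noteq> Suc k"
  have "ch e m = 0" if "Suc (length m) = length l" for m
   using el_simps(2)[OF assms(1), of m] that n by auto
  hence "altsum (ch e) l = altsum (%_. 0) l" by (intro altsum_cong)
  thus False using \<open>altsum (ch e) l \<noteq> 0\<close> by (simp add: altsum_def)
 qed
 ultimately show "length l = Suc k" by blast
qed

lemma fm_diff: "fm (a - b) = (%x vs. fm a x vs - fm b x vs)" and ch_diff: "ch (a - b) = (%l. ch a l - ch b l)"
 by (simp_all add: fm_def ch_def)

lemma el_diff:
 assumes "a \<in> el V k" "b \<in> el V k" "open V"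
 shows "a - b \<in> el V k"
 unfolding el_def mem_Collect_eq fm_diff ch_diff
proof (intro conjI allI impI)
 show "(%x vs. fm a x vs - fm b x vs) \<in> forms_on V k"
  by (rule forms_on_vector(3)[OF el_simps(1)[OF assms(1)] el_simps(1)[OF assms(2)] assms(3)])
 fix l assume "ch a l - ch b l \<noteq> 0"
 hence "ch a l \<noteq> 0 \<or> ch b l \<noteq> 0" by auto
 thus "small l" "length l = k" "set l \<subseteq> V"
  using el_simps(2)[OF assms(1), of l] el_simps(2)[OF assms(2), of l] by blast+
qed

lemma Iv_sum:
 fixes T :: "'v::euclidean_space itself"
 assumes "finite A" "\<And>i. i \<in> A ==> \<phi> i \<in> forms_on V k" "open V" "small l" "range (cu l :: 'v => 'a) \<subseteq> V" "length l = Suc k"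
 shows "Iv T (%x vs. \<Sum>i\<in>A. c i * \<phi> i x vs) l = (\<Sum>i\<in>A. c i * Iv T (\<phi> i) l)"
proof -
 have C: "C1M (cu l :: 'v => 'a)" using assms(4) SM_C1M[OF SM_cu] by (auto simp: small_def)
 have p: "pb (%x vs. \<Sum>i\<in>A. c i * \<phi> i x vs) (cu l :: 'v => 'a) (ebs k) = (%s. \<Sum>i\<in>A. c i * pb (\<phi> i) (cu l) (ebs k) s)"
  by (simp add: pb_def[abs_def])
 have "cint k (%s. \<Sum>i\<in>A. c i * pb (\<phi> i) (cu l :: 'v => 'a) (ebs k) s) = (\<Sum>i\<in>A. cint k (%s. c i * pb (\<phi> i) (cu l :: 'v => 'a) (ebs k) s))"
  by (rule cint_sum) (intro continuous_intros continuous_on_pb[OF C assms(2,3,5)], auto)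
 thus ?thesis by (simp add: Iv_def assms(6) p cint_scale)
qed

lemma dD_diff:
 assumes "a \<in> el V k" "b \<in> el V k" "open V" "V = UI I"
 shows "dD T V (a - b) = dD T V a - dD T V b"
proof
 fix z
 note f = el_simps(1)[OF assms(1)] el_simps(1)[OF assms(2)]
 show "dD T V (a - b) z = (dD T V a - dD T V b) z"
 proof (cases z)
  case (Inl p)
  thus ?thesis by (simp add: dD_def fm_diff ext_on_diff[OF f assms(3)])
 next
  case (Inr l)
  show ?thesis
  proof (cases "small l \<and> set l \<subseteq> V")
   case True
   \<comment> \<open>The difference is written as a sum over two indices with coefficients 1 and -1,
     the shape that \<open>Iv_sum\<close> handles.\<close>
   have e: "(%x vs. fm a x vs - fm b x vs) = (%x vs. \<Sum>i\<in>{0,1::nat}. (if i = 0 then 1 else - 1) * (if i = 0 then fm a else fm b) x vs)"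
    by (simp add: fun_eq_iff)
   have "Iv T (%x vs. fm a x vs - fm b x vs) l = Iv T (fm a) l - Iv T (fm b) l"
   proof (cases "length l = Suc k")
    case len: True
    show ?thesis unfolding e
     by (subst Iv_sum[OF _ _ assms(3) _ _ len]) (use f True range_cu_UI[of l I] assms(4) in auto)
   next
    case False
    hence "length l - 1 \<noteq> k" using True by (cases l) (auto simp: small_def)
    thus ?thesis
     using Iv_length[OF f(1), of l T] Iv_length[OF f(2), of l T] Iv_length[OF forms_on_vector(3)[OF f assms(3)], of l T]
     by simp
   qed
   thus ?thesis using True Inr by (simp add: dD_def fm_diff ch_diff altsum_diff)
  qed (use Inr in "auto simp: dD_def")
 qed
qed

lemma dD_dD:
 fixes T :: "'v::euclidean_space itself"
 assumes "e \<in> el V k" "V = UI I" "k < DIM('v)"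
 shows "dD T V (dD T V e) = 0"
proof
 fix z
 have o: "open V" using assms(2) open_UI by simp
 note f = el_simps(1)[OF assms(1)]
 have fe: "fm (dD T V e) = ext_on V (fm e)" by (simp add: fm_def dD_def)
 note d2 = dD_el[OF dD_el[OF assms(1) o] o]
 show "dD T V (dD T V e) z = 0 z"
 proof (cases z)
  case (Inl p)
  thus ?thesis by (simp add: dD_def[of T V "dD T V e"] fe ext_on_ext_on[OF f o])
 next
  case (Inr l)
  show ?thesis
  proof (rule ccontr)
   assume "\<not> ?thesis"
   hence nz: "ch (dD T V (dD T V e)) l \<noteq> 0" using Inr by (simp add: ch_def)
   from el_simps(2)[OF d2 nz] have l: "small l" "length l = Suc (Suc k)" "set l \<subseteq> V" by auto
   obtain m where m: "set l \<subseteq> B m" using l(1) by (auto simp: small_def)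
   have "altsum (ch (dD T V e)) l = altsum (%l. Iv T (fm e) l - altsum (ch e) l) l"
   proof (rule altsum_cong)
    fix n assume n: "Suc (length n) = length l" "set n \<subseteq> set l"
    hence "small n" using l by (intro small_subset[OF l(1)]) auto
    moreover have "set n \<subseteq> V" using n(2) l(3) by blast
    ultimately show "ch (dD T V e) n = Iv T (fm e) n - altsum (ch e) n" by (simp add: ch_def dD_def)
   qed
   also have "\<dots> = altsum (Iv T (fm e)) l" by (simp add: altsum_diff altsum_altsum)
   also have "\<dots> = Iv T (ext_on V (fm e)) l"
    by (rule Iv_ext_on[OF f o _ l(2) m assms(3), symmetric]) (use range_cu_UI l assms(2) in auto)
   finally have "ch (dD T V (dD T V e)) l = 0" using l unfolding ch_dD by (simp add: fe)
   with nz show False by simp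
  qed
 qed
qed

lemma cech_el:
 assumes "x \<in> KK q k" "length I = Suc q"
 shows "cech x I \<in> el (UI I) k"
 unfolding el_def mem_Collect_eq
proof (intro conjI allI impI)
 have s: "UI I \<subseteq> UI (del_nth j I)" for j by (rule UI_mono[OF set_del_nth])
 have "fm (cech x I) = (%p vs. \<Sum>j<length I. (-1) ^ j * res (UI I) (fm (x (del_nth j I))) p vs)"
  by (auto simp: fm_def cech_def lc_def altsum_def res_def fun_eq_iff)
 moreover have "(%p vs. \<Sum>j<length I. (-1) ^ j * res (UI I) (fm (x (del_nth j I))) p vs) \<in> forms_on (UI I) k"
 proof (rule forms_on_sum[OF _ _ open_UI])
  fix j assume "j \<in> {..<length I}"
  hence "x (del_nth j I) \<in> el (UI (del_nth j I)) k" using assms by (intro KK_el[of x q]) auto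
  from el_simps(1)[OF this] show "res (UI I) (fm (x (del_nth j I))) \<in> forms_on (UI I) k"
   by (rule res_forms_on[OF _ s open_UI])
 qed simp
 ultimately show "fm (cech x I) \<in> forms_on (UI I) k" by simp
next
 fix l assume nz: "ch (cech x I) l \<noteq> 0"
 thus "set l \<subseteq> UI I" by (auto simp: ch_def cech_def lc_def split: if_splits)
 have "altsum (%J. x J (Inr l)) I \<noteq> 0" using nz by (auto simp: ch_def cech_def split: if_splits)
 then obtain J where J: "Suc (length J) = length I" "x J (Inr l) \<noteq> 0"
  using altsum_cong[of I "%J. x J (Inr l)" "%_. 0"] by (auto simp: altsum_def)
 have "x J \<in> el (UI J) k" using J(1) assms by (intro KK_el[of x q]) auto
 from el_simps(2)[OF this, of l] J(2) show "small l" "length l = k" by (auto simp: ch_def)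
qed

lemma cech_KK: "x \<in> KK q k ==> cech x \<in> KK (Suc q) k"
 unfolding KK_def[of "Suc q"] mem_Collect_eq
proof (intro allI conjI impI)
 fix I assume x: "x \<in> KK q k"
 show "cech x I \<in> el (UI I) k" if "length I = Suc q" by (rule cech_el[OF x that])
 assume n: "length I \<noteq> Suc q"
 have "altsum (%J. x J z) I = altsum (%_. 0) I" for z by (rule altsum_cong) (use n KK_zero[OF x] in auto)
 thus "cech x I = 0" by (simp add: cech_def fun_eq_iff altsum_def)
qed

lemma dD_zero: "dD T V (%_. 0) = (%_. 0)"
proof -
 have "fm (%_. 0) = (%x vs. 0)" "ch (%_. 0) = (%l. 0)" by (simp_all add: fm_def ch_def)
 moreover have "ext_on V (%x vs. 0) x vs = 0" for x vs
  using ext_on_sum[of "{}" "%_ _ _. 0" UNIV 0 "%_. 0" x vs]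
  by (simp add: ext_on_def res_def)
 moreover have "Iv T (%x vs. 0) l = 0" for l by (simp add: Iv_def pb_def[abs_def] cint_zero)
 ultimately have "dD T V (%_. 0) z = 0" for z unfolding dD_def by (cases z) (simp_all add: altsum_def)
 thus ?thesis by (rule ext)
qed

lemma DD_KK: "x \<in> KK q k ==> DD T x \<in> KK q (Suc k)"
 unfolding KK_def[of q "Suc k"] mem_Collect_eq DD_def
proof (intro allI conjI impI)
 fix I assume x: "x \<in> KK q k"
 show "dD T (UI I) (x I) \<in> el (UI I) (Suc k)" if "length I = q"
  by (rule dD_el[OF KK_el[OF x that] open_UI])
 assume "length I \<noteq> q"
 hence "x I = (%_. 0)" using KK_zero[OF x] by auto
 thus "dD T (UI I) (x I) = 0" by (simp add: dD_zero zero_fun_def)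
qed

lemma DD_Inr: "DD T x I (Inr l) = (if small l \<and> set l \<subseteq> UI I then Iv T (fm (x I)) l - altsum (ch (x I)) l else 0)"
 by (simp add: DD_def dD_def)

text \<open>Exterior derivative, integration and coboundary are linear and compatible with
  restriction, and \<open>cech\<close> is a finite signed sum of restrictions. Entries that violate
  the support conditions are zero on both sides and are split off beforehand.\<close>

lemma DD_cech:
 fixes T :: "'v::euclidean_space itself"
 assumes x: "x \<in> KK q k"
 shows "DD T (cech x) = cech (DD T x)"
proof (intro ext)
 fix I z
 have K1: "DD T (cech x) \<in> KK (Suc q) (Suc k)" by (rule DD_KK[OF cech_KK[OF x]])
 have K2: "cech (DD T x) \<in> KK (Suc q) (Suc k)" by (rule cech_KK[OF DD_KK[OF x]])
 show "DD T (cech x) I z = cech (DD T x) I z"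
 proof (cases "length I = Suc q \<and> lc z \<subseteq> UI I")
  case False
  hence "DD T (cech x) I z = 0" "cech (DD T x) I z = 0"
   using KK_supp[OF K1, of I z] KK_supp[OF K2, of I z] by blast+
  thus ?thesis by simp
 next
  case True
  have s: "UI I \<subseteq> UI (del_nth j I)" for j by (rule UI_mono[OF set_del_nth])
  have xe: "x (del_nth j I) \<in> el (UI (del_nth j I)) k" if "j \<in> {..<length I}" for j
   using that True by (intro KK_el[OF x]) auto
  have fr: "res (UI I) (fm (x (del_nth j I))) \<in> forms_on (UI I) k" if "j \<in> {..<length I}" for j
   by (rule res_forms_on[OF el_simps(1)[OF xe[OF that]] s open_UI])
  have fc: "fm (cech x I) = (%p vs. \<Sum>j<length I. (-1) ^ j * res (UI I) (fm (x (del_nth j I))) p vs)"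
   by (auto simp: fm_def cech_def lc_def altsum_def res_def fun_eq_iff)
  show ?thesis
  proof (cases z)
   case (Inl p)
   hence p: "fst p \<in> UI I" using True by (simp add: lc_def)
   have "DD T (cech x) I z = (\<Sum>j<length I. (-1) ^ j * ext_on (UI I) (res (UI I) (fm (x (del_nth j I)))) (fst p) (snd p))"
    unfolding DD_def dD_def Inl sum.case fc by (rule ext_on_sum[OF _ fr open_UI]) auto
   also have "ext_on (UI I) (res (UI I) (fm (x (del_nth j I)))) (fst p) (snd p) =
     ext_on (UI (del_nth j I)) (fm (x (del_nth j I))) (fst p) (snd p)" for j
    unfolding ext_on_res[OF open_UI s[of j]] by (simp only: res_def p if_True)
   hence "(\<Sum>j<length I. (-1) ^ j * ext_on (UI I) (res (UI I) (fm (x (del_nth j I)))) (fst p) (snd p)) = cech (DD T x) I z"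
    using True Inl by (simp add: cech_def altsum_def DD_def dD_def del: sum.lessThan_Suc)
   finally show ?thesis .
  next
   case (Inr l)
   hence l: "set l \<subseteq> UI I" using True by (simp add: lc_def)
   show ?thesis
   proof (cases "small l \<and> length l = Suc k")
    case False
    have "ch (DD T (cech x) I) l = 0" "ch (cech (DD T x) I) l = 0"
     using el_simps(2)[OF KK_el[OF K1], of I l] el_simps(2)[OF KK_el[OF K2], of I l] True False by blast+
    thus ?thesis using Inr by (simp add: ch_def)
   next
    case sl: True
    have rl: "range (cu l :: 'v => 'a) \<subseteq> UI I" using range_cu_UI sl l by blast
    have "Iv T (fm (cech x I)) l = (\<Sum>j<length I. (-1) ^ j * Iv T (res (UI I) (fm (x (del_nth j I)))) l)"
     unfolding fc by (rule Iv_sum[OF _ fr open_UI _ rl]) (use sl in auto)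
    also have "\<dots> = (\<Sum>j<length I. (-1) ^ j * Iv T (fm (x (del_nth j I))) l)"
    proof -
     have "pb (res (UI I) \<phi>) (cu l :: 'v => 'a) us = pb \<phi> (cu l) us" for \<phi> us
      by (rule ext) (use rl in "auto simp: pb_def res_def image_subset_iff")
     thus ?thesis by (simp add: Iv_def)
    qed
    finally have 1: "Iv T (fm (cech x I)) l = (\<Sum>j<length I. (-1) ^ j * Iv T (fm (x (del_nth j I))) l)" .
    have "altsum (ch (cech x I)) l = altsum (%n. \<Sum>j<length I. (-1) ^ j * ch (x (del_nth j I)) n) l"
     by (rule altsum_cong) (use l in "auto simp: ch_def cech_def lc_def altsum_def")
    also have "\<dots> = (\<Sum>j<length I. (-1) ^ j * altsum (ch (x (del_nth j I))) l)" by (rule altsum_sum)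
    finally have 2: "altsum (ch (cech x I)) l = (\<Sum>j<length I. (-1) ^ j * altsum (ch (x (del_nth j I))) l)" .
    have "set l \<subseteq> UI (del_nth j I)" for j using l s by blast
    hence "DD T x (del_nth j I) (Inr l) = Iv T (fm (x (del_nth j I))) l - altsum (ch (x (del_nth j I))) l" for j
     using sl by (simp add: DD_Inr)
    hence "cech (DD T x) I z = (\<Sum>j<length I. (-1) ^ j * (Iv T (fm (x (del_nth j I))) l - altsum (ch (x (del_nth j I))) l))"
     using True Inr by (simp add: cech_def altsum_def[of _ I])
    moreover have "DD T (cech x) I z = Iv T (fm (cech x I)) l - altsum (ch (cech x I)) l"
     using sl l by (simp add: Inr DD_Inr)
    ultimately show ?thesis by (simp add: 1 2 right_diff_distrib sum_subtractf)
   qed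
  qed
 qed
qed

lemma cech_cech: "cech (cech x) = 0"
proof (intro ext)
 fix I z
 show "cech (cech x) I z = 0 I z"
 proof (cases "lc z \<subseteq> UI I")
  case True
  have "altsum (%J. cech x J z) I = altsum (altsum (%J. x J z)) I"
  proof (rule altsum_cong)
   fix m assume "set m \<subseteq> set I"
   hence "lc z \<subseteq> UI m" using UI_mono True by blast
   thus "cech x m z = altsum (%J. x J z) m" by (simp add: cech_def)
  qed
  thus ?thesis using True by (simp add: cech_def[of "cech x"] altsum_altsum)
 qed (simp add: cech_def)
qed

lemma cech_diff: "cech (x - y) = cech x - cech y"
 by (intro ext) (simp add: cech_def altsum_diff)

lemma KK_diff: "x \<in> KK q k ==> y \<in> KK q k ==> x - y \<in> KK q k"
 unfolding KK_def by (auto intro: el_diff open_UI)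

lemma DD_diff:
 assumes "x \<in> KK q k" "y \<in> KK q k"
 shows "DD T (x - y) = DD T x - DD T y"
proof
 fix I
 show "DD T (x - y) I = (DD T x - DD T y) I"
 proof (cases "length I = q")
  case True
  thus ?thesis using dD_diff[OF KK_el[OF assms(1) True] KK_el[OF assms(2) True] open_UI refl]
   by (simp add: DD_def)
 next
  case False
  hence xy: "x I = (%_. 0)" "y I = (%_. 0)" using KK_zero[OF assms(1)] KK_zero[OF assms(2)] by auto
  hence "(x - y) I = (%_. 0)" by (simp add: fun_eq_iff)
  thus ?thesis by (simp add: DD_def dD_zero[unfolded zero_fun_def[symmetric]] xy zero_fun_def[symmetric])
 qed
qed

lemma DD_DD:
 fixes T :: "'v::euclidean_space itself"
 assumes "x \<in> KK q k" "k < DIM('v)"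
 shows "DD T (DD T x) = 0"
proof
 fix I
 show "DD T (DD T x) I = 0 I"
 proof (cases "length I = q")
  case True
  thus ?thesis using dD_dD[OF KK_el[OF assms(1) True] refl assms(2)] by (simp add: DD_def)
 next
  case False
  hence "x I = (%_. 0)" using KK_zero[OF assms(1)] by auto
  thus ?thesis by (simp add: DD_def dD_zero zero_fun_def)
 qed
qed

text \<open>Forms need the smooth partition of unity. Cochains carry no regularity, so for them the
  least index of a cover set containing the tuple may take the whole weight.\<close>

definition wt :: "nat => ('a \<times> ('a, 'e) tangent list) + 'a list => real" where
 "wt j z = (case z of Inl p => \<rho> j (fst p) | Inr l => (if j = (LEAST j. set l \<subseteq> B j) then 1 else 0))"

lemma wt_sum: "\<exists>n. (\<forall>j\<ge>n. wt j z = 0) \<and> (\<Sum>j<n. wt j z) = 1"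
proof (cases z)
 case (Inl p)
 thus ?thesis using rho_sum[of "fst p"] by (auto simp: wt_def)
next
 case (Inr l)
 thus ?thesis by (intro exI[of _ "Suc (LEAST j. set l \<subseteq> B j)"]) (auto simp: wt_def)
qed

text \<open>A bound beyond which all weights vanish, chosen entry by entry; it turns the sum over
  the infinite cover into a finite one.\<close>

definition bd :: "('a \<times> ('a, 'e) tangent list) + 'a list => nat" where
 "bd z = (SOME n. (\<forall>j\<ge>n. wt j z = 0) \<and> (\<Sum>j<n. wt j z) = 1)"

lemma bd: "bd z \<le> j ==> wt j z = 0" "(\<Sum>j<bd z. wt j z) = 1"
proof -
 have b: "(\<forall>j\<ge>bd z. wt j z = 0) \<and> (\<Sum>j<bd z. wt j z) = 1"
  unfolding bd_def by (rule someI_ex[OF wt_sum])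
 show "bd z \<le> j ==> wt j z = 0" using b[THEN conjunct1] by simp
 show "(\<Sum>j<bd z. wt j z) = 1" by (rule b[THEN conjunct2])
qed

lemma wt_supp:
 assumes "wt j z \<noteq> 0" "\<And>l. z = Inr l ==> small l"
 shows "lc z \<subseteq> B j"
proof (cases z)
 case (Inl p)
 hence "\<rho> j (fst p) \<noteq> 0" using assms(1) by (simp add: wt_def)
 hence "fst p \<in> B j" using rho_supp[of j] by blast
 thus ?thesis using Inl by (simp add: lc_def)
next
 case (Inr l)
 have j: "j = (LEAST j. set l \<subseteq> B j)" by (rule ccontr) (use assms(1) Inr in "simp add: wt_def")
 have "\<exists>j. set l \<subseteq> B j" using assms(2)[OF Inr] by (simp add: small_def)
 hence "set l \<subseteq> B (LEAST j. set l \<subseteq> B j)" by (rule LeastI_ex)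
 hence "set l \<subseteq> B j" using j by simp
 thus ?thesis using Inr by (simp add: lc_def)
qed

text \<open>The contracting homotopy of the Cech complex that belongs to the weights.\<close>

definition glue :: "(nat list => ('a, 'e) elem) => nat list => ('a, 'e) elem" where
 "glue x = (%J z. \<Sum>j<bd z. wt j z * x (j # J) z)"

lemma glue_KK:
 assumes x: "x \<in> KK (Suc q) k"
 shows "glue x \<in> KK q k"
 unfolding KK_def mem_Collect_eq
proof (intro allI conjI impI)
 fix J
 show "glue x J = 0" if "length J \<noteq> q" using KK_zero[OF x] that by (simp add: glue_def fun_eq_iff)
 assume J: "length J = q"
 have xe: "x (j # J) \<in> el (B j \<inter> UI J) k" for j using KK_el[OF x, of "j # J"] J by (simp add: UI_Cons)
 show "glue x J \<in> el (UI J) k" unfolding el_def mem_Collect_eq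
 proof (intro conjI allI impI)
  show "fm (glue x J) \<in> forms_on (UI J) k"
  proof (rule forms_on_local[OF _ open_UI])
   have "fm (x (j # J)) p vs = 0" if "p \<notin> UI J" for j p vs
    by (rule forms_onD(1)[OF el_simps(1)[OF xe[of j]]]) (use that in blast)
   thus "fm (glue x J) p vs = 0" if "p \<notin> UI J" for p vs using that by (simp add: fm_def glue_def)
   fix p assume p: "p \<in> UI J"
   obtain W n where W: "open W" "p \<in> W" "\<forall>y\<in>W. (\<forall>j\<ge>n. \<rho> j y = 0) \<and> (\<Sum>j<n. \<rho> j y) = 1"
    using rho_sum[of p] by blast
   let ?\<psi> = "%y vs. \<Sum>j<n. 1 * (%y vs. \<rho> j y * fm (x (j # J)) y vs) y vs"
   have 1: "?\<psi> \<in> forms_on (UI J) k"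
   proof (rule forms_on_sum[OF _ _ open_UI])
    fix j
    show "(%y vs. \<rho> j y * fm (x (j # J)) y vs) \<in> forms_on (UI J) k"
    proof (rule forms_on_extend[OF open_UI B_open])
     show "smooth_fun_on (UI J \<inter> B j) (\<rho> j)" by (rule smooth_fun_on_subset[OF rho_smooth]) simp
     show "fm (x (j # J)) \<in> forms_on (UI J \<inter> B j) k"
      using el_simps(1)[OF xe[of j]] by (simp add: Int_commute)
     show "\<exists>N. open N \<and> y \<in> N \<and> (\<forall>y\<in>N. \<rho> j y = 0)" if "y \<notin> B j" for y
     proof -
      obtain C where C: "compact C" "C \<subseteq> B j" "\<forall>x. x \<notin> C --> \<rho> j x = 0" using rho_supp by blast
      thus ?thesis using that compact_imp_closed[OF C(1)] by (intro exI[of _ "- C"]) auto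
     qed
    qed
   qed simp
   \<comment> \<open>The number of terms may be taken constant near a point although
     \<open>bd\<close> varies with the entry; only this exhibits the sum as a smooth form.\<close>
   have 2: "fm (glue x J) y vs = ?\<psi> y vs" if y: "y \<in> W" for y vs
   proof -
    have wt: "wt j (Inl (y, vs)) = \<rho> j y" for j by (simp add: wt_def)
    have "fm (glue x J) y vs = (\<Sum>j<bd (Inl (y, vs)). \<rho> j y * fm (x (j # J)) y vs)"
     by (simp add: fm_def glue_def wt)
    also have "\<dots> = (\<Sum>j<max n (bd (Inl (y, vs))). \<rho> j y * fm (x (j # J)) y vs)"
     using bd(1)[of "Inl (y, vs)", unfolded wt] by (intro sum.mono_neutral_left) auto
    also have "\<dots> = (\<Sum>j<n. \<rho> j y * fm (x (j # J)) y vs)"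
     using W(3) y by (intro sum.mono_neutral_right) auto
    finally show ?thesis by simp
   qed
   show "\<exists>W \<psi>. open W \<and> p \<in> W \<and> \<psi> \<in> forms_on (UI J) k \<and> (\<forall>y\<in>W. \<forall>vs. fm (glue x J) y vs = \<psi> y vs)"
    by (rule exI[of _ W], rule exI[of _ ?\<psi>], intro conjI ballI allI, rule W(1), rule W(2), rule 1, rule 2)
  qed
 next
  fix l assume "ch (glue x J) l \<noteq> 0"
  moreover have "ch (glue x J) l = 0" if "\<forall>j. x (j # J) (Inr l) = 0"
   using that by (simp add: ch_def glue_def)
  ultimately have "\<not> (\<forall>j. x (j # J) (Inr l) = 0)" by blast
  then obtain j where "x (j # J) (Inr l) \<noteq> 0" by auto
  hence "small l \<and> length l = k \<and> set l \<subseteq> B j \<inter> UI J"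
   using el_simps(2)[OF xe[of j], of l] by (simp add: ch_def)
  thus "small l" "length l = k" "set l \<subseteq> UI J" by auto
 qed
qed

lemma cech_glue:
 assumes x: "x \<in> KK (Suc q) k" "cech x = 0"
 shows "cech (glue x) = x"
proof (intro ext)
 fix I z
 have sm: "small l" if "z = Inr l" "x J z \<noteq> 0" for J l
 proof -
  have J: "length J = Suc q" using KK_supp[OF x(1) that(2)] by (rule conjunct1)
  have "ch (x J) l \<noteq> 0" using that by (simp add: ch_def)
  from el_simps(2)[OF KK_el[OF x(1) J] this] show ?thesis by (rule conjunct1)
 qed
 consider l where "z = Inr l" "\<not> small l" | "\<not> lc z \<subseteq> UI I" | "lc z \<subseteq> UI I" "\<And>l. z = Inr l ==> small l"
  by metis
 thus "cech (glue x) I z = x I z"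
 proof cases
  case (1 l)
  have 0: "x J z = 0" for J by (rule ccontr) (use sm[OF 1(1), of J] 1(2) in simp)
  hence "glue x J z = 0" for J by (simp add: glue_def)
  thus ?thesis by (simp add: cech_def altsum_def 0)
 next
  case 2
  hence "x I z = 0" using KK_supp[OF x(1), of I z] by argo
  thus ?thesis using 2 by (simp add: cech_def)
 next
  case True: 3
  \<comment> \<open>Where the weight of \<open>j\<close> is nonzero, the entry lies in
    \<open>B j\<close>, and the cocycle condition for the tuple \<open>j # I\<close> expresses
    \<open>x I\<close> by entries whose first index is \<open>j\<close>.\<close>
  have pt: "wt j z * altsum (%J. x (j # J) z) I = wt j z * x I z" for j
  proof (cases "wt j z = 0")
   case False
   have "lc z \<subseteq> B j" by (rule wt_supp[OF False]) (rule True(2))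
   hence "lc z \<subseteq> UI (j # I)" using True(1) by (simp add: UI_Cons)
   hence "altsum (%J. x J z) (j # I) = cech x (j # I) z" by (simp add: cech_def)
   thus ?thesis by (simp add: x(2) altsum_Cons)
  qed simp
  have "cech (glue x) I z = altsum (%J. \<Sum>j<bd z. wt j z * x (j # J) z) I"
   using True(1) by (simp add: cech_def glue_def)
  also have "\<dots> = (\<Sum>j<bd z. wt j z * altsum (%J. x (j # J) z) I)" by (rule altsum_sum)
  also have "\<dots> = (\<Sum>j<bd z. wt j z) * x I z" unfolding pt sum_distrib_right ..
  also have "\<dots> = x I z" by (simp add: bd(2))
  finally show ?thesis .
 qed
qed

text \<open>Some weight at the entry is nonzero, so the entry lies in one \<open>B j\<close>; there
  \<open>cech\<close> records its value unchanged.\<close>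

lemma cech_inj:
 assumes x: "x \<in> KK 0 k" "cech x = 0"
 shows "x = 0"
proof (intro ext)
 fix I z
 show "x I z = 0 I z"
 proof (rule ccontr)
  assume nz: "x I z \<noteq> 0 I z"
  hence I: "I = []" using KK_supp[OF x(1), of I z] by auto
  have sm: "small l" if "z = Inr l" for l
   using el_simps(2)[OF KK_el[OF x(1), of "[]"], of l] nz that I by (simp add: ch_def)
  have "\<exists>j. wt j z \<noteq> 0" by (rule ccontr) (use bd(2)[of z] in simp)
  then obtain j where "wt j z \<noteq> 0" by (rule exE)
  hence "lc z \<subseteq> B j" by (rule wt_supp) (rule sm)
  hence "cech x [j] z = x [] z" by (simp add: cech_def UI_def altsum_def del_nth_def)
  thus False using nz I x(2) by simp
 qed
qed

text \<open>The chart of any single point of the intersection serves all members containing it at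
  once, because \<open>cc\<close> depends on the point only. Injectivity of the chart then reduces
  convexity of the image to an intersection of convex sets.\<close>

lemma UI_chart:
 assumes "x \<in> UI I" "I \<noteq> []"
 shows "UI I \<subseteq> fst (cc x)" "convex (snd (cc x) ` UI I)"
proof -
 have x: "x \<in> B i" if "i \<in> set I" for i using assms(1) that by (auto simp: UI_def)
 obtain i0 where i0: "i0 \<in> set I" using assms(2) by (cases I) auto
 show "UI I \<subseteq> fst (cc x)" using B_convex[OF x[OF i0]] i0 by (auto simp: UI_def)
 show "convex (snd (cc x) ` UI I)"
 proof (rule convexI)
  fix y z and u v :: real
  assume yz: "y \<in> snd (cc x) ` UI I" "z \<in> snd (cc x) ` UI I" and uv: "0 \<le> u" "0 \<le> v" "u + v = 1"
  let ?w = "u *\<^sub>R y + v *\<^sub>R z"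
  have "chart_inv (cc x) ?w \<in> B i \<and> ?w = snd (cc x) (chart_inv (cc x) ?w)" if i: "i \<in> set I" for i
  proof -
   have "y \<in> snd (cc x) ` B i" "z \<in> snd (cc x) ` B i" using yz i by (auto simp: UI_def)
   hence "?w \<in> snd (cc x) ` B i" using B_convex[OF x[OF i]] uv by (auto intro: convexD)
   then obtain b where b: "b \<in> B i" "?w = snd (cc x) b" by auto
   thus ?thesis using chart_inv_cc[OF x[OF i] b(1)] by simp
  qed
  hence "chart_inv (cc x) ?w \<in> UI I" "?w = snd (cc x) (chart_inv (cc x) ?w)"
   using i0 unfolding UI_def by blast+
  thus "?w \<in> snd (cc x) ` UI I" by blast
 qed
qed

lemma const_form_on:
 assumes "open V"
 shows "(%x vs. if x \<in> V \<and> vs = [] then r else 0) \<in> forms_on V 0" (is "?c \<in> _")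
  and "ext_on V (%x vs. if x \<in> V \<and> vs = [] then r else 0) = (%x vs. 0)"
proof -
 show 1: "?c \<in> forms_on V 0" unfolding forms_on_def mem_Collect_eq
 proof (intro conjI ballI allI impI)
  fix c and us :: "'e list" assume c: "c \<in> \<A>" "length us = 0"
  show "smooth_on (snd c ` (fst c \<inter> V)) (loc c ?c us)"
   by (rule smooth_on_cong[OF open_chart_image[OF c(1) assms] _ smooth_on_const[of _ r]])
    (use c in "auto simp: local_form_def")
 qed (auto simp: alt_form_def multilin_def split: if_splits)
 show "ext_on V ?c = (%x vs. 0)"
 proof (rule form_eqI[OF ext_on_forms_on[OF 1 assms] zero_forms_on])
  fix x assume x: "x \<in> V"
  let ?d = "chart_at \<A> x"
  note d = chart_at[of x]
  have "loc ?d (ext_on V ?c) us (snd ?d x) = 0" if l: "length us = Suc 0" for us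
  proof -
   obtain u where u: "us = [u]" using l by (cases us) auto
   have "loc ?d (ext_on V ?c) us (snd ?d x) = ed (loc ?d ?c) us (snd ?d x)"
    by (rule loc_ext_on[OF 1 assms d(1) _ l]) (use x d in auto)
   also have "\<dots> = ed (%us y. if us = [] then r else 0) us (snd ?d x)"
    by (rule ed_cong_open[OF open_chart_image[OF d(1) assms]]) (use x d l in "auto simp: local_form_def")
   also have "\<dots> = 0" by (simp add: u ed_Cons)
   finally show ?thesis .
  qed
  thus "\<exists>c\<in>\<A>. x \<in> fst c \<and> (\<forall>us. length us = Suc 0 --> loc c (ext_on V ?c) us (snd c x) = loc c (%x vs. 0) us (snd c x))"
   using d by (intro bexI[of _ ?d]) (auto simp: local_form_def)
 qed
qed

lemma el_ch_zero: "e \<in> el V k ==> \<not> (small l \<and> set l \<subseteq> V \<and> length l = k) ==> ch e l = 0"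
 unfolding el_def by blast

text \<open>The Poincare lemma supplies a primitive \<psi> of the form part. What is left is a
  cocycle \<open>g\<close> on tuples in \<open>UI I\<close>. All such tuples are small, as
  \<open>I\<close> is nonempty, so prefixing one fixed point \<open>x0\<close> gives a primitive of
  \<open>g\<close>.\<close>

lemma column_exact:
 fixes T :: "'v::euclidean_space itself"
 assumes e: "e \<in> el (UI I) (Suc k)" "I \<noteq> []" "dD T (UI I) e = 0" "k < DIM('v)"
 shows "\<exists>e'\<in>el (UI I) k. dD T (UI I) e' = e"
proof (cases "UI I = {}")
 case True
 have "e z = 0" for z
 proof (rule ccontr)
  assume nz: "e z \<noteq> 0"
  hence "lc z = {}" using el_supp[OF e(1) nz] True by auto
  hence "z = Inr []" by (cases z) (auto simp: lc_def)
  thus False using el_simps(2)[OF e(1), of "[]"] nz by (simp add: ch_def)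
 qed
 hence "e = (%_. 0)" by auto
 thus ?thesis using dD_zero by (intro bexI[of _ "%_. 0"]) (auto simp: el_zero)
next
 case False
 then obtain x0 where x0: "x0 \<in> UI I" by auto
 let ?V = "UI I"
 note f = el_simps(1)[OF e(1)]
 have "ext_on ?V (fm e) x vs = 0" for x vs
  using fun_cong[OF e(3), of "Inl (x, vs)"] by (simp add: dD_def)
 hence "ext_on ?V (fm e) = (%x vs. 0)" by (intro ext)
 from poincare_lemma[OF cc_in UI_chart(1)[OF x0 e(2)] open_UI UI_chart(2)[OF x0 e(2)] f this]
 obtain \<psi> where \<psi>: "\<psi> \<in> forms_on ?V k" "ext_on ?V \<psi> = fm e" by (rule bexE)
 define g where "g l = (if small l \<and> set l \<subseteq> ?V \<and> length l = Suc k then Iv T \<psi> l - ch e l else 0)" for l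
 have sm: "small l" if "set l \<subseteq> ?V" "l \<noteq> []" for l by (rule small_UI[OF that(1) e(2) that(2)])
 have ag: "altsum g l = 0" if l: "set l \<subseteq> ?V" "length l = Suc (Suc k)" for l
 proof -
  have sl: "small l" by (rule sm[OF l(1)]) (use l(2) in auto)
  from sl[unfolded small_def, THEN conjunct2] obtain m where m: "set l \<subseteq> B m" by (rule exE)
  have "altsum g l = altsum (%l. Iv T \<psi> l - ch e l) l"
  proof (rule altsum_cong)
   fix n assume n: "Suc (length n) = length l" "set n \<subseteq> set l"
   hence "small n" using l by (intro small_subset[OF sl]) auto
   thus "g n = Iv T \<psi> n - ch e n" using n l by (auto simp: g_def)
  qed
  also have "\<dots> = Iv T (fm e) l - altsum (ch e) l"
   using Iv_ext_on[OF \<psi>(1) open_UI range_cu_UI[OF sl l(1)] l(2) m e(4)]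
   by (simp add: altsum_diff \<psi>(2))
  also have "\<dots> = 0" using fun_cong[OF e(3), of "Inr l"] sl l by (simp add: dD_def)
  finally show ?thesis .
 qed
 have cone: "g l = altsum (%m. g (x0 # m)) l" if "set l \<subseteq> ?V" "length l = Suc k" for l
  using ag[of "x0 # l"] that x0 by (simp add: altsum_Cons)
 have "\<exists>\<psi>' h. \<psi>' \<in> forms_on ?V k \<and> ext_on ?V \<psi>' = fm e \<and> (\<forall>l. h l \<noteq> 0 --> small l \<and> length l = k \<and> set l \<subseteq> ?V) \<and>
  (\<forall>l. small l \<and> set l \<subseteq> ?V \<and> length l = Suc k --> Iv T \<psi>' l - altsum h l = ch e l)"
 proof (cases k)
  case 0
  \<comment> \<open>In this degree no cochain is available one step lower, since the empty tuple is
    not small. The cocycle \<open>g\<close> is constant and is absorbed into \<psi>.\<close>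
  define c where "c = g [x0]"
  have gc: "g [y] = c" if "y \<in> ?V" for y using cone[of "[y]"] that 0 by (simp add: altsum_Cons c_def)
  let ?c = "%x vs. if x \<in> ?V \<and> vs = [] then c else 0"
  note cf = const_form_on[OF open_UI[of I], of c]
  define \<psi>' where "\<psi>' = (%x vs. \<psi> x vs - ?c x vs)"
  have \<psi>': "\<psi>' \<in> forms_on ?V k" "ext_on ?V \<psi>' = fm e"
   using forms_on_vector(3)[OF \<psi>(1)[unfolded 0] cf(1) open_UI] ext_on_diff[OF \<psi>(1)[unfolded 0] cf(1) open_UI]
   unfolding \<psi>'_def cf(2) \<psi>(2) using 0 by simp_all
  have "Iv T \<psi>' l = ch e l" if l: "small l" "set l \<subseteq> ?V" "length l = Suc k" for l
  proof -
   obtain y where y: "l = [y]" "y \<in> ?V" using 0 l by (cases l) auto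
   have "Iv T \<phi> [y] = \<phi> y []" for \<phi> by (simp add: Iv_def cint_def pb_def ebs_def cu_def)
   thus ?thesis using gc[OF y(2)] l y by (simp add: g_def) (simp add: \<psi>'_def)
  qed
  with \<psi>' show ?thesis by (intro exI[of _ \<psi>'] exI[of _ "%_. 0"]) (simp add: altsum_def)
 next
  case (Suc k')
  define h where "h m = (if small m \<and> set m \<subseteq> ?V \<and> length m = k then g (x0 # m) else 0)" for m
  have "Iv T \<psi> l - altsum h l = ch e l" if l: "small l" "set l \<subseteq> ?V" "length l = Suc k" for l
  proof -
   have "altsum h l = altsum (%m. g (x0 # m)) l"
   proof (rule altsum_cong)
    fix n assume n: "Suc (length n) = length l" "set n \<subseteq> set l"
    have "small n" by (rule small_subset[of l n]) (use l Suc n in auto)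
    from this show "h n = g (x0 # n)" using n l by (auto simp: h_def)
   qed
   also have "\<dots> = g l" by (rule cone[symmetric]) (use l in auto)
   finally show ?thesis using l by (simp add: g_def)
  qed
  thus ?thesis using \<psi> by (intro exI[of _ \<psi>] exI[of _ h]) (simp add: h_def)
 qed
 then obtain \<psi>' h where P: "\<psi>' \<in> forms_on ?V k" "ext_on ?V \<psi>' = fm e"
  "\<forall>l. h l \<noteq> 0 --> small l \<and> length l = k \<and> set l \<subseteq> ?V"
  "\<forall>l. small l \<and> set l \<subseteq> ?V \<and> length l = Suc k --> Iv T \<psi>' l - altsum h l = ch e l"
  by (elim exE conjE)
 let ?e = "case_sum (%p. \<psi>' (fst p) (snd p)) h :: ('a, 'e) elem"
 have fe: "fm ?e = \<psi>'" "ch ?e = h" by (simp_all add: fm_def ch_def)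
 have ee: "?e \<in> el ?V k" unfolding el_def mem_Collect_eq fe using P(1,3) by simp
 have "dD T ?V ?e = e"
 proof
  fix z
  show "dD T ?V ?e z = e z"
  proof (cases z)
   case (Inl p)
   thus ?thesis by (simp add: dD_def fe P(2)) (simp add: fm_def)
  next
   case (Inr l)
   have "ch (dD T ?V ?e) l = ch e l"
   proof (cases "small l \<and> set l \<subseteq> ?V \<and> length l = Suc k")
    case True
    thus ?thesis using P(4)[rule_format, OF True] by (simp add: ch_dD fe)
   next
    case False
    thus ?thesis using el_ch_zero[OF dD_el[OF ee open_UI], of l] el_ch_zero[OF e(1), of l] by simp
   qed
   thus ?thesis using Inr by (simp add: ch_def)
  qed
 qed
 from this ee show ?thesis by (rule bexI)
qed

text \<open>In degree 0 the cochain part is zero and integration over a point is evaluation, so the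
  cochain component of the differential already determines the function.\<close>

lemma column_exact_0:
 assumes e: "e \<in> el V 0" "V = UI I" "I \<noteq> []" "dD T V e = 0"
 shows "e = 0"
proof -
 have c: "ch e l = 0" for l using el_simps(2)[OF e(1), of l] by (auto simp: small_def)
 have "fm e x vs = 0" for x vs
 proof (rule ccontr)
  assume nz: "fm e x vs \<noteq> 0"
  from forms_on_nz[OF el_simps(1)[OF e(1)] this] have x: "x \<in> V" "vs = []" by auto
  have "small [x]" by (rule small_UI[of _ I]) (use x e(2,3) in auto)
  hence "Iv T (fm e) [x] - altsum (ch e) [x] = 0"
   using fun_cong[OF e(4), of "Inr [x]"] x by (simp add: dD_def)
  moreover have "altsum (ch e) [x] = 0" by (simp add: altsum_def c)
  moreover have "Iv T (fm e) [x] = fm e x []" by (simp add: Iv_def cint_def pb_def ebs_def cu_def)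
  ultimately show False using nz x by simp
 qed
 show ?thesis
 proof
  fix z
  show "e z = 0 z"
  proof (cases z)
   case (Inl p)
   thus ?thesis using \<open>\<And>x vs. fm e x vs = 0\<close>[of "fst p" "snd p"] by (simp add: fm_def)
  next
   case (Inr l)
   thus ?thesis using c[of l] by (simp add: ch_def)
  qed
 qed
qed

text \<open>The cochain \<open>f\<close> completes \<phi> to a global element of the cone which the
  differential annihilates. The double complex gives a global primitive of this pair, whose form
  part is a primitive of \<phi>.\<close>

theorem closed_form_exact:
 fixes T :: "'v::euclidean_space itself"
 assumes \<phi>: "\<phi> \<in> forms \<A> (Suc k)" "ext_deriv \<A> \<phi> = (%x vs. 0)" and k: "k < DIM('v)"
  and f: "\<And>l. small l ==> length l = Suc (Suc k) ==> Iv T \<phi> l = altsum f l"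
 shows "\<exists>\<psi>\<in>forms \<A> k. ext_deriv \<A> \<psi> = \<phi>"
proof -
 define e :: "('a, 'e) elem" where
  "e = case_sum (%p. \<phi> (fst p) (snd p)) (%l. if small l \<and> length l = Suc k then f l else 0)"
 \<comment> \<open>Global data sit at the empty index tuple.\<close>
 define x :: "nat list => ('a, 'e) elem" where "x I = (if I = [] then e else 0)" for I
 have U: "UI [] = UNIV" by (simp add: UI_def)
 have fe: "fm e = \<phi>" by (simp add: fm_def e_def)
 have ee: "e \<in> el UNIV (Suc k)"
  using \<phi>(1) unfolding el_def mem_Collect_eq fe forms_on_UNIV by (auto simp: ch_def e_def split: if_splits)
 have xK: "x \<in> KK 0 (Suc k)" using ee by (simp add: KK_def x_def U)
 have De: "dD T UNIV e = 0"
 proof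
  fix z
  show "dD T UNIV e z = 0 z"
  proof (cases z)
   case (Inl p)
   thus ?thesis by (simp add: dD_def fe ext_on_UNIV \<phi>(2))
  next
   case (Inr l)
   show ?thesis
   proof (cases "small l \<and> length l = Suc (Suc k)")
    case True
    have "altsum (ch e) l = altsum f l"
    proof (rule altsum_cong)
     fix n assume n: "Suc (length n) = length l" "set n \<subseteq> set l"
     have "small n" by (rule small_subset[of l n]) (use True n in auto)
     thus "ch e n = f n" using n True by (simp add: ch_def e_def)
    qed
    thus ?thesis using f True Inr by (simp add: dD_def fe)
   next
    case False
    from el_simps(2)[OF dD_el[OF ee open_UNIV], of T l] False
    show ?thesis using Inr by (auto simp: ch_def)
   qed
  qed
 qed
 have Dx: "DD T x = 0"
 proof
  fix I show "DD T x I = 0 I"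
   by (cases "I = []") (simp_all add: DD_def x_def U De dD_zero[folded zero_fun_def])
 qed
 have "\<exists>y\<in>KK 0 k. DD T y = x"
 proof (rule double_complex[where K=KK and D="DD T" and \<delta>=cech and P="DIM('v)"])
  show "\<exists>y\<in>KK q k. cech y = x" if "x \<in> KK (Suc q) k" "cech x = 0" for q k x
   using glue_KK[OF that(1)] cech_glue[OF that] by blast
  show "\<exists>y\<in>KK (Suc q) k. DD T y = x" if k: "k < DIM('v)" and x: "x \<in> KK (Suc q) (Suc k)" "DD T x = 0" for q k x
  proof -
   have "\<exists>e. length I = Suc q --> e \<in> el (UI I) k \<and> dD T (UI I) e = x I" for I
   proof (cases "length I = Suc q")
    case True
    have "dD T (UI I) (x I) = 0" using fun_cong[OF x(2), of I] by (simp add: DD_def)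
    from column_exact[OF KK_el[OF x(1) True] _ this k] True show ?thesis by fastforce
   qed simp
   then obtain y where y: "\<And>I. length I = Suc q ==> y I \<in> el (UI I) k \<and> dD T (UI I) (y I) = x I" by metis
   let ?y = "%I. if length I = Suc q then y I else 0"
   have "?y \<in> KK (Suc q) k" using y by (simp add: KK_def)
   moreover have "DD T ?y = x"
   proof
    fix I
    show "DD T ?y I = x I"
     using y KK_zero[OF x(1), of I] dD_zero[of T "UI I"] by (auto simp: DD_def zero_fun_def)
   qed
   ultimately show ?thesis by blast
  qed
  show "x = 0" if x: "x \<in> KK (Suc q) 0" "DD T x = 0" for q x
  proof
   fix I
   show "x I = 0 I"
   proof (cases "length I = Suc q")
    case True
    have "dD T (UI I) (x I) = 0" using fun_cong[OF x(2), of I] by (simp add: DD_def)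
    moreover have "I \<noteq> []" using True by auto
    ultimately show ?thesis using column_exact_0[OF KK_el[OF x(1) True] refl] by simp
   next
    case False
    thus ?thesis using KK_zero[OF x(1) False] by auto
   qed
  qed
 qed (assumption | rule xK Dx k cech_diff cech_cech KK_diff DD_KK cech_KK DD_diff DD_DD DD_cech cech_inj)+
 then obtain y where y: "y \<in> KK 0 k" "DD T y = x" by blast
 have "fm (y []) \<in> forms \<A> k"
  using el_simps(1)[OF KK_el[OF y(1), of "[]"]] by (simp add: U forms_on_UNIV)
 moreover have "ext_deriv \<A> (fm (y [])) = \<phi>"
 proof -
  have "dD T UNIV (y []) = e" using fun_cong[OF y(2), of "[]"] by (simp add: DD_def U x_def)
  hence "fm (dD T UNIV (y [])) = \<phi>" using fe by simp
  moreover have "fm (dD T UNIV (y [])) = ext_on UNIV (fm (y []))" by (simp add: fm_def dD_def)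
  ultimately show ?thesis by (simp add: ext_on_UNIV)
 qed
 ultimately show ?thesis by blast
qed

end

section \<open>Linear algebra: cochains with prescribed coboundary\<close>

section \<open>Functions with prescribed alternating sums\<close>

lemma sum_fun_apply: "(\<Sum>i\<in>I. f i) x = (\<Sum>i\<in>I. f i x :: real)"
 by (induction I rule: infinite_finite_induct) auto

text \<open>Values on the family \<open>b\<close> can be prescribed once they respect its finite
  linear relations: a functional is defined on a basis chosen from the family, and every other
  member is tested against the relation that expresses it by the basis.\<close>

lemma linear_functional_exists:
 fixes I :: "'i => real" and b :: "'i => 'k => real"
 assumes "\<And>A a. finite A ==> A \<subseteq> S ==> (\<And>m. (\<Sum>i\<in>A. a i * b i m) = 0) ==> (\<Sum>i\<in>A. a i * I i) = 0"
 obtains L :: "('k => real) => real" where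
  "\<And>(J :: nat set) c u. L (%m. \<Sum>j\<in>J. c j * u j m) = (\<Sum>j\<in>J. c j * L (u j))" "\<And>i. i \<in> S ==> L (b i) = I i"
proof -
 interpret vp: vector_space_pair "%r (u::'k => real) m. r * u m" "(*) :: real => real => real"
  by unfold_locales (auto simp: fun_eq_iff algebra_simps)
 obtain B where B: "B \<subseteq> b ` S" "vp.vs1.independent B" "b ` S \<subseteq> vp.vs1.span B"
  using vp.vs1.maximal_independent_subset[of "b ` S"] by metis
 define iv where "iv = inv_into S b"
 have iv: "iv v \<in> S" "b (iv v) = v" if "v \<in> B" for v
  using B(1) that unfolding iv_def by (auto intro: inv_into_into f_inv_into_f)
 obtain L where L: "Vector_Spaces.linear (%r (u::'k => real) m. r * u m) (*) L" "\<And>v. v \<in> B ==> L v = I (iv v)"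
  using vp.linear_independent_extend[OF B(2), of "%v. I (iv v)"] by blast
 have Ls: "L (%m. \<Sum>j\<in>J. c j * u j m) = (\<Sum>j\<in>J. c j * L (u j))" for J :: "'z set" and c u
 proof -
  have "(%m. \<Sum>j\<in>J. c j * u j m) = (\<Sum>j\<in>J. (%m. c j * u j m))" by (rule ext) (simp add: sum_fun_apply)
  thus ?thesis by (simp only: vp.linear_sum[OF L(1)] vp.linear_scale[OF L(1)])
 qed
 have "L (b i) = I i" if i: "i \<in> S" for i
 proof -
  have "b i \<in> vp.vs1.span B" using B(3) i by blast
  then obtain t r where t: "finite t" "t \<subseteq> B" "b i = (\<Sum>v\<in>t. (%m. r v * v m))"
   unfolding vp.vs1.span_explicit by blast
  have bi: "b i = (%m. \<Sum>v\<in>t. r v * v m)" unfolding t(3) by (rule ext) (simp add: sum_fun_apply)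
  show ?thesis
  proof (cases "i \<in> iv ` t")
   case True
   then obtain v where v: "v \<in> t" "i = iv v" by blast
   hence "v \<in> B" using t(2) by blast
   thus ?thesis using iv(2) L(2) v by simp
  next
   case False
   have inj: "inj_on iv t" using iv(2) t(2) by (metis inj_onI subsetD)
   \<comment> \<open>The relation that expresses \<open>b i\<close> by basis vectors, written with
     indices in place of vectors. The preceding case keeps \<open>i\<close> apart from these
     indices, so that its coefficient is 1.\<close>
   define a where "a j = (if j = i then 1 else - r (b j))" for j
   have red: "(\<Sum>j\<in>insert i (iv ` t). a j * h j) = h i - (\<Sum>v\<in>t. r v * h (iv v))" for h
   proof -
    have "(\<Sum>j\<in>iv ` t. a j * h j) = (\<Sum>v\<in>t. a (iv v) * h (iv v))"
     using sum.reindex[OF inj] by simp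
    also have "\<dots> = (\<Sum>v\<in>t. - (r v * h (iv v)))"
     by (rule sum.cong[OF refl]) (use False t(2) iv in "auto simp: a_def")
    finally have "(\<Sum>j\<in>iv ` t. a j * h j) = - (\<Sum>v\<in>t. r v * h (iv v))" by (simp add: sum_negf)
    moreover have "a i = 1" by (simp add: a_def)
    ultimately show ?thesis using t(1) False by simp
   qed
   have "(\<Sum>j\<in>insert i (iv ` t). a j * b j m) = 0" for m
   proof -
    have "(\<Sum>v\<in>t. r v * b (iv v) m) = (\<Sum>v\<in>t. r v * v m)"
     by (rule sum.cong[OF refl]) (use t(2) iv in auto)
    thus ?thesis unfolding red[of "%j. b j m"] by (simp add: bi)
   qed
   hence "(\<Sum>j\<in>insert i (iv ` t). a j * I j) = 0" by (rule assms[rotated 2]) (use t i iv in auto)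
   moreover have "L (b i) = (\<Sum>v\<in>t. r v * L v)" unfolding bi by (rule Ls)
   moreover have "(\<Sum>v\<in>t. r v * L v) = (\<Sum>v\<in>t. r v * I (iv v))"
    by (rule sum.cong[OF refl]) (use t(2) L(2) in auto)
   ultimately show ?thesis unfolding red by simp
  qed
 qed
 with Ls show ?thesis by (rule that)
qed

text \<open>On one tuple, \<open>altsum\<close> is a finite combination of values at faces, that is,
  a combination of point masses \<open>e n\<close>. A functional with the right value on all these
  combinations exists, and its values on the point masses form the solution.\<close>

lemma altsum_solvable:
 fixes I :: "'b list => real"
 assumes "\<And>A a. finite A ==> A \<subseteq> S ==> (\<And>g. (\<Sum>l\<in>A. a l * altsum g l) = 0) ==> (\<Sum>l\<in>A. a l * I l) = 0"
 obtains f where "\<And>l. l \<in> S ==> I l = altsum f l"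
proof -
 define e :: "'b list => 'b list => real" where "e n m = (if n = m then 1 else 0)" for n m
 define b where "b l m = altsum (%n. e n m) l" for l m
 have *: "(\<Sum>l\<in>A. a l * I l) = 0" if A: "finite A" "A \<subseteq> S" and z: "\<And>m. (\<Sum>l\<in>A. a l * b l m) = 0" for A a
 proof (rule assms[OF A])
  fix g :: "'b list => real"
  \<comment> \<open>A test cochain matters only on the finitely many faces of the tuples in
    \<open>A\<close>, so testing against point masses is enough.\<close>
  define M where "M = (\<Union>l\<in>A. (%j. del_nth j l) ` {..<length l})"
  have fM: "finite M" using A(1) by (simp add: M_def)
  have "altsum g l = (\<Sum>m\<in>M. g m * b l m)" if l: "l \<in> A" for l
  proof -
   have "(\<Sum>m\<in>M. g m * b l m) = (\<Sum>j<length l. (-1) ^ j * (\<Sum>m\<in>M. g m * e (del_nth j l) m))"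
    unfolding b_def altsum_def sum_distrib_left by (subst sum.swap) (simp add: mult.left_commute)
   also have "\<dots> = (\<Sum>j<length l. (-1) ^ j * g (del_nth j l))"
   proof (rule sum.cong[OF refl])
    fix j assume "j \<in> {..<length l}"
    hence "del_nth j l \<in> M" using l by (auto simp: M_def)
    hence "(\<Sum>m\<in>M. g m * e (del_nth j l) m) = g (del_nth j l)"
     using fM by (simp add: e_def if_distrib cong: if_cong)
    thus "(-1) ^ j * (\<Sum>m\<in>M. g m * e (del_nth j l) m) = (-1) ^ j * g (del_nth j l)" by simp
   qed
   finally show ?thesis by (simp add: altsum_def)
  qed
  hence "(\<Sum>l\<in>A. a l * altsum g l) = (\<Sum>l\<in>A. \<Sum>m\<in>M. g m * (a l * b l m))"
   by (simp add: sum_distrib_left mult.left_commute)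
  also have "\<dots> = (\<Sum>m\<in>M. g m * (\<Sum>l\<in>A. a l * b l m))"
   by (subst sum.swap) (simp add: sum_distrib_left)
  finally show "(\<Sum>l\<in>A. a l * altsum g l) = 0" by (simp add: z)
 qed
 show ?thesis
 proof (rule linear_functional_exists[of S b I])
  show "(\<Sum>l\<in>A. a l * I l) = 0" if "finite A" "A \<subseteq> S" "\<And>m. (\<Sum>l\<in>A. a l * b l m) = 0" for A a
   by (rule *[OF that])
  fix L :: "('b list => real) => real"
  assume L: "\<And>(J :: nat set) c u. L (%m. \<Sum>j\<in>J. c j * u j m) = (\<Sum>j\<in>J. c j * L (u j))"
   "\<And>i. i \<in> S ==> L (b i) = I i"
  have "I l = altsum (%n. L (e n)) l" if "l \<in> S" for l
  proof -
   have "I l = L (b l)" using L(2)[OF that] by simp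
   also have "b l = (%m. \<Sum>j\<in>{..<length l}. (-1) ^ j * e (del_nth j l) m)"
    by (rule ext) (simp add: b_def altsum_def)
   also have "L \<dots> = altsum (%n. L (e n)) l" unfolding altsum_def by (rule L(1))
   finally show ?thesis .
  qed
  thus thesis by (rule that)
 qed
qed

section \<open>Invariance of cycle integrals along the flow\<close>

section \<open>Moving a map on a cycle within a chart\<close>

context manifold
begin

text \<open>One chart representation near each point is enough; the smooth transition maps settle
  all other charts.\<close>

lemma C1M_localI:
 fixes h :: "'v::euclidean_space => 'a"
 assumes "\<And>s. \<exists>N c g. open N \<and> s \<in> N \<and> c \<in> \<A> \<and> Ck_on (Suc 0) N g \<and> g ` N \<subseteq> snd c ` fst c \<and>
  (\<forall>r\<in>N. h r = chart_inv c (g r))"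
 shows "C1M h"
proof -
 have ch: "continuous_on UNIV h" unfolding continuous_on_eq_continuous_at[OF open_UNIV]
 proof
  fix s
  obtain N c g where N: "open N" "s \<in> N" "c \<in> \<A>" "Ck_on (Suc 0) N g" "g ` N \<subseteq> snd c ` fst c"
    "\<forall>r\<in>N. h r = chart_inv c (g r)" using assms[of s] by blast
  have "continuous_on N (%r. chart_inv c (g r))"
   by (rule continuous_on_compose2[OF continuous_on_chart_inv[OF N(3)] Ck_on_continuous[OF N(4)] N(5)])
  hence "continuous_on N h" by (rule continuous_on_cong[THEN iffD1, OF refl, rotated]) (use N(6) in simp)
  thus "isCont h s" using N(1,2) continuous_on_eq_continuous_at by blast
 qed
 show ?thesis unfolding C1M_def
 proof (intro conjI ballI ch Ck_on_local)
  fix d s assume d: "d \<in> \<A>" "s \<in> h -` fst d"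
  obtain N c g where N: "open N" "s \<in> N" "c \<in> \<A>" "Ck_on (Suc 0) N g" "g ` N \<subseteq> snd c ` fst c"
    "\<forall>r\<in>N. h r = chart_inv c (g r)" using assms[of s] by blast
  let ?S = "N \<inter> h -` fst d"
  have o: "open ?S" using N(1) open_vimage[OF chart_open(1)[OF d(1)] ch] by blast
  have im: "g ` ?S \<subseteq> snd c ` (fst c \<inter> fst d)"
  proof
   fix y assume "y \<in> g ` ?S"
   then obtain r where r: "y = g r" "r \<in> N" "h r \<in> fst d" by auto
   have gr: "g r \<in> snd c ` fst c" using N(5) r(2) by auto
   show "y \<in> snd c ` (fst c \<inter> fst d)"
    using r N(6) snd_chart_inv[OF N(3) gr] chart_inv_in[OF N(3) gr]
    by (intro image_eqI[of _ _ "chart_inv c (g r)"]) auto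
  qed
  have tr: "Ck_on (Suc 0) (snd c ` (fst c \<inter> fst d)) (snd d \<circ> chart_inv c)"
   using transition_smooth[OF N(3) d(1)] unfolding smooth_on_def by blast
  have "Ck_on (Suc 0) ?S (%r. (snd d \<circ> chart_inv c) (g r))"
   by (rule Ck_on_compose[OF o open_chart_image[OF N(3) chart_open(1)[OF d(1)]] im Ck_on_subset[OF N(4)] tr]) simp
  hence "Ck_on (Suc 0) ?S (%r. snd d (h r))" by (rule Ck_on_cong[OF o, rotated]) (use N(6) in simp)
  thus "\<exists>T. open T \<and> s \<in> T \<and> Ck_on (Suc 0) T (%r. snd d (h r))"
   using o N(2) d(2) by (intro exI[of _ ?S]) simp
 qed
qed

end

text \<open>A finite real chain counts as a cycle if its pairing with every coboundary vanishes, the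
  form in which \<open>altsum_solvable\<close> asks for it.\<close>

locale good_cycle = good_cover \<A> B cc \<rho>
 for \<A> :: "('a::{second_countable_topology,t2_space}, 'e::euclidean_space) chart set" and B cc \<rho> +
 fixes T :: "'v::euclidean_space itself" and \<phi> :: "('a, 'e) form" and k A and a :: "'a list => real"
 assumes \<phi>: "\<phi> \<in> forms \<A> (Suc k)" "ext_deriv \<A> \<phi> = (%x vs. 0)" and k: "k < DIM('v)"
  and A: "finite A" "\<And>l. l \<in> A ==> small l \<and> length l = Suc (Suc k)"
  and cyc: "\<And>g. (\<Sum>l\<in>A. a l * altsum g l) = 0"
begin

lemma \<phi>U: "\<phi> \<in> forms_on UNIV (Suc k)"
 using \<phi>(1) by (simp add: forms_on_UNIV)

definition C1A :: "('a => 'a) => bool" where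
 "C1A G \<longleftrightarrow> (\<forall>l\<in>A. C1M (%s::'v. G (cu l s)))"

definition Nc :: "('a, 'e) form => ('a => 'a) => real" where
 "Nc \<psi> G = (\<Sum>l\<in>A. a l * cint (Suc k) (pb \<psi> (%s::'v. G (cu l s)) (ebs (Suc k))))"

text \<open>The two maps differ only while both lie in a compact part of a set on which \<phi> has a
  primitive \<psi>. Subtracting the exact form d(\<beta> \<psi>) makes \<phi> vanish on this part,
  so the integrands coincide; the exact form itself integrates to 0 over the cycle by Stokes'
  theorem.\<close>

lemma Nc_move:
 assumes c: "c \<in> \<A>" "U \<subseteq> fst c" "open U" "convex (snd c ` U)" "compact C" "C \<subseteq> U"
  and G: "\<And>l. l \<in> A ==> C1M (%s::'v. G (cu l s))" "\<And>l. l \<in> A ==> C1M (%s::'v. G' (cu l s))"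
  and GG: "\<And>l s. l \<in> A ==> G (cu l (s::'v)) = G' (cu l s) \<or> G (cu l s) \<in> C \<and> G' (cu l s) \<in> C"
 shows "Nc \<phi> G = Nc \<phi> G'"
proof -
 let ?g = "%H l (s::'v). H (cu l s)" and ?I = "%\<phi> h. cint (Suc k) (pb \<phi> h (ebs (Suc k)))"
 have "ext_on U (res U \<phi>) = (%x vs. 0)"
  using ext_on_res[OF c(3) subset_UNIV, of \<phi>] by (simp add: ext_on_UNIV \<phi>(2) res_def)
 from poincare_lemma[OF c(1-4) res_forms_on[OF \<phi>U subset_UNIV c(3)] this]
 obtain \<psi> where \<psi>: "\<psi> \<in> forms_on U k" "ext_on U \<psi> = res U \<phi>" by (rule bexE)
 obtain \<beta> :: "'a => real" and C' N where \<beta>: "smooth_fun_on UNIV \<beta>" "\<And>x. 0 \<le> \<beta> x \<and> \<beta> x \<le> 1" "open N" "C \<subseteq> N"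
  "\<And>x. x \<in> N ==> \<beta> x = 1" "compact C'" "C' \<subseteq> U" "\<And>x. x \<notin> C' ==> \<beta> x = 0"
  by (rule bump_compact[OF c(3,5,6)]) (rule that; assumption)
 define \<theta> where "\<theta> = (%x vs. \<beta> x * \<psi> x vs)"
 have \<theta>: "\<theta> \<in> forms_on UNIV k" unfolding \<theta>_def
 proof (rule forms_on_extend[OF open_UNIV c(3)])
  show "smooth_fun_on (UNIV \<inter> U) \<beta>" by (rule smooth_fun_on_subset[OF \<beta>(1)]) simp
  show "\<psi> \<in> forms_on (UNIV \<inter> U) k" using \<psi>(1) by simp
  show "\<exists>N. open N \<and> y \<in> N \<and> (\<forall>y\<in>N. \<beta> y = 0)" if "y \<notin> U" for y
   using that \<beta>(7,8) compact_imp_closed[OF \<beta>(6)] by (intro exI[of _ "- C'"]) auto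
 qed
 have d\<theta>: "ext_deriv \<A> \<theta> \<in> forms_on UNIV (Suc k)"
  using ext_on_forms_on[OF \<theta> open_UNIV] by (simp add: ext_on_UNIV)
 define \<phi>' where "\<phi>' = (%x vs. \<phi> x vs - ext_deriv \<A> \<theta> x vs)"
 have \<phi>'0: "\<phi>' x vs = 0" if x: "x \<in> C" for x vs
 proof -
  have "ext_deriv \<A> \<theta> x vs = ext_deriv \<A> \<psi> x vs"
   by (rule ext_deriv_cong_open[OF \<beta>(3)]) (use x \<beta>(4,5) in "auto simp: \<theta>_def")
  moreover have "ext_on U \<psi> x vs = res U \<phi> x vs" by (simp add: \<psi>(2))
  ultimately show ?thesis using x c(6) by (auto simp: \<phi>'_def ext_on_def res_def)
 qed
 have *: "Nc \<phi> H = Nc \<phi>' H" if H: "\<And>l. l \<in> A ==> C1M (?g H l)" for H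
 proof -
  let ?J = "%l. cint k (pb \<theta> (?g H l) (ebs k))"
  have 1: "?I (ext_deriv \<A> \<theta>) (?g H l) = altsum ?J l" if l: "l \<in> A" for l
  proof -
   obtain m where m: "set l \<subseteq> B m" using A(2)[OF l] by (auto simp: small_def)
   have sup: "\<theta> x vs = 0" if "x \<notin> C'" for x vs using \<beta>(8)[OF that] by (simp add: \<theta>_def)
   have "C' \<subseteq> fst c" using \<beta>(7) c(2) by blast
   from stokes_chart[OF H[OF l] \<theta> c(1) \<beta>(6) this sup k]
   show ?thesis by (intro stokes_faces[OF _ m k H[OF l] \<theta>]) (use A(2)[OF l] in auto)
  qed
  have 2: "?I \<phi> (?g H l) =
   ?I \<phi>' (?g H l) + altsum ?J l" if l: "l \<in> A" for l
  proof -
   have "pb \<phi>' (?g H l) (ebs (Suc k)) =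
    (%s. pb \<phi> (?g H l) (ebs (Suc k)) s - pb (ext_deriv \<A> \<theta>) (?g H l) (ebs (Suc k)) s)"
    by (rule ext) (simp add: pb_def \<phi>'_def)
   hence "?I \<phi>' (?g H l) =
    ?I \<phi> (?g H l) - ?I (ext_deriv \<A> \<theta>) (?g H l)"
    by (simp add: cint_diff continuous_on_pb[OF H[OF l] \<phi>U] continuous_on_pb[OF H[OF l] d\<theta>])
   thus ?thesis using 1[OF l] by simp
  qed
  show ?thesis unfolding Nc_def using cyc[of ?J] by (simp add: 2 distrib_left sum.distrib)
 qed
 have "pb \<phi>' (?g G l) (ebs (Suc k)) s = pb \<phi>' (?g G' l) (ebs (Suc k)) s" if l: "l \<in> A" for l s
 proof (cases "G (cu l s) \<in> C")
  case True
  hence "G' (cu l s) \<in> C" using GG[OF l, of s] by auto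
  thus ?thesis using True by (simp add: pb_def \<phi>'0)
 next
  \<comment> \<open>Off \<open>C\<close> the maps agree on a whole neighbourhood of
    \<open>s\<close>, hence their tangent maps agree too.\<close>
  case False
  let ?N = "(?g G l) -` (- C)"
  have "open ?N" by (rule C1M_vimage[OF G(1)[OF l]]) (use compact_imp_closed[OF c(5)] in auto)
  hence "Tm (?g G l) s = Tm (?g G' l) s" by (rule Tm_cong_open) (use False GG[OF l] in auto)
  thus ?thesis using GG[OF l, of s] False by (simp add: pb_def)
 qed
 hence "pb \<phi>' (?g G l) (ebs (Suc k)) = pb \<phi>' (?g G' l) (ebs (Suc k))" if l: "l \<in> A" for l
  using l by (intro ext)
 hence "Nc \<phi>' G = Nc \<phi>' G'" by (simp add: Nc_def)
 thus ?thesis using *[of G, OF G(1)] *[of G', OF G(2)] by simp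
qed

end

section \<open>Locally uniform convergence\<close>

text \<open>On a compact set this is convergence in the compact-open topology, in a form that is
 preserved by composition with continuous maps.\<close>

definition cvg :: "'i filter => 'a::topological_space set => ('i => 'a => 'b::topological_space) => ('a => 'b) => bool" where
 "cvg \<Phi> K G H \<longleftrightarrow> (\<forall>x\<in>K. ((%z. G (fst z) (snd z)) \<longlongrightarrow> H x) (\<Phi> \<times>\<^sub>F inf (nhds x) (principal K)))"

lemma cvg_const:
 assumes "continuous_on K H"
 shows "cvg \<Phi> K (%i. H) H"
 unfolding cvg_def
proof
 fix x assume "x \<in> K"
 hence "(H \<longlongrightarrow> H x) (inf (nhds x) (principal K))"
  using assms by (simp add: continuous_on_def tendsto_at_within_iff_tendsto_nhds)
 thus "((%z. H (snd z)) \<longlongrightarrow> H x) (\<Phi> \<times>\<^sub>F inf (nhds x) (principal K))"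
  by (rule filterlim_compose[OF _ filterlim_snd])
qed

text \<open>Joint convergence at a point provides a condition on the index and a neighbourhood of
  the point; finitely many of these neighbourhoods cover \<open>L\<close>.\<close>

lemma cvg_compact:
 assumes "cvg \<Phi> K G H" "compact L" "L \<subseteq> K" "open V" "H ` L \<subseteq> V"
 shows "\<forall>\<^sub>F i in \<Phi>. \<forall>y\<in>L. G i y \<in> V"
proof -
 have "\<forall>x\<in>L. \<exists>p. open (fst p) \<and> x \<in> fst p \<and> eventually (snd p) \<Phi> \<and>
   (\<forall>i y. snd p i --> y \<in> fst p --> y \<in> K --> G i y \<in> V)"
 proof
  fix x assume x: "x \<in> L"
  have "((%z. G (fst z) (snd z)) \<longlongrightarrow> H x) (\<Phi> \<times>\<^sub>F inf (nhds x) (principal K))"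
   using assms(1,3) x unfolding cvg_def by blast
  from topological_tendstoD[OF this assms(4)]
  have "\<forall>\<^sub>F z in \<Phi> \<times>\<^sub>F inf (nhds x) (principal K). G (fst z) (snd z) \<in> V" using assms(5) x by blast
  then obtain P Q where PQ: "eventually P \<Phi>" "eventually Q (inf (nhds x) (principal K))"
    "\<forall>i y. P i --> Q y --> G (fst (i, y)) (snd (i, y)) \<in> V"
   unfolding eventually_prod_filter by (elim exE conjE)
  obtain S where S: "open S" "x \<in> S" "\<forall>y\<in>S. y \<in> K --> Q y"
   using PQ(2)[unfolded eventually_inf_principal eventually_nhds] by (elim exE conjE)
  show "\<exists>p. open (fst p) \<and> x \<in> fst p \<and> eventually (snd p) \<Phi> \<and>
   (\<forall>i y. snd p i --> y \<in> fst p --> y \<in> K --> G i y \<in> V)"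
   by (rule exI[of _ "(S, P)"]) (use S PQ in simp)
 qed
 from bchoice[OF this] obtain f where f: "\<forall>x\<in>L. open (fst (f x)) \<and> x \<in> fst (f x) \<and> eventually (snd (f x)) \<Phi> \<and>
   (\<forall>i y. snd (f x) i --> y \<in> fst (f x) --> y \<in> K --> G i y \<in> V)" by (rule exE)
 define S P where "S x = fst (f x)" and "P x = snd (f x)" for x
 have SP: "\<And>x. x \<in> L ==> open (S x)" "\<And>x. x \<in> L ==> x \<in> S x" "\<And>x. x \<in> L ==> eventually (P x) \<Phi>"
   "\<And>x i y. x \<in> L ==> P x i ==> y \<in> S x ==> y \<in> K ==> G i y \<in> V"
  using f by (simp_all add: S_def P_def)
 obtain D where D: "D \<subseteq> L" "finite D" "L \<subseteq> (\<Union>x\<in>D. S x)"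
 proof (rule compactE_image[OF assms(2), of L S])
  show "L \<subseteq> (\<Union>x\<in>L. S x)" using SP(2) by blast
 qed (use SP(1) in simp_all)
 have "\<forall>\<^sub>F i in \<Phi>. \<forall>x\<in>D. P x i"
  by (rule eventually_ball_finite[OF D(2)]) (use SP(3) D(1) in blast)
 thus ?thesis
 proof (rule eventually_mono)
  fix i assume i: "\<forall>x\<in>D. P x i"
  show "\<forall>y\<in>L. G i y \<in> V"
  proof
   fix y assume y: "y \<in> L"
   then obtain x where x: "x \<in> D" "y \<in> S x" using D(3) by blast
   show "G i y \<in> V" by (rule SP(4)[of x]) (use x i y D(1) assms(3) in auto)
  qed
 qed
qed

lemma tendsto_If:
 assumes "(f \<longlongrightarrow> l) F" "(g \<longlongrightarrow> l) F"
 shows "((%z. if P z then f z else g z) \<longlongrightarrow> l) F"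
proof (rule topological_tendstoI)
 fix S assume S: "open S" "l \<in> S"
 show "\<forall>\<^sub>F z in F. (if P z then f z else g z) \<in> S"
  using topological_tendstoD[OF assms(1) S] topological_tendstoD[OF assms(2) S] by eventually_elim auto
qed

text \<open>The set \<open>D\<close> is a closed metric neighbourhood of the convex hull of
  \<open>C\<close>; it is compact and convex as a sum of a compact convex set and a ball.\<close>

lemma compact_convex_nhd:
 fixes C V :: "'e::euclidean_space set"
 assumes "compact C" "C \<subseteq> V" "open V" "convex V"
 obtains D Q where "compact D" "convex D" "D \<subseteq> V" "open Q" "C \<subseteq> Q" "Q \<subseteq> D"
proof -
 let ?H = "convex hull C"
 have H: "compact ?H" "?H \<subseteq> V" using compact_convex_hull[OF assms(1)] hull_minimal[of C V convex] assms by auto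
 obtain e where e: "e > 0" "(\<Union>x\<in>?H. cball x e) \<subseteq> V"
  using compact_subset_open_imp_cball_epsilon_subset[OF H(1) assms(3) H(2)] by blast
 have "(\<Union>y\<in>cball 0 e. {x + y}) = cball x e" for x :: 'e
 proof (rule subset_antisym; rule subsetI)
  fix z assume "z \<in> cball x e"
  hence "z - x \<in> cball 0 e" by (simp add: dist_norm norm_minus_commute)
  thus "z \<in> (\<Union>y\<in>cball 0 e. {x + y})" by (rule UN_I) simp
 qed (auto simp: dist_norm)
 hence eq: "(\<Union>x\<in>?H. \<Union>y\<in>cball 0 e. {x + y}) = (\<Union>x\<in>?H. cball x e)" by simp
 show ?thesis
 proof (rule that[of "\<Union>x\<in>?H. cball x e" "\<Union>x\<in>?H. ball x e"])
  show "compact (\<Union>x\<in>?H. cball x e)"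
   unfolding eq[symmetric] by (rule compact_sums'[OF H(1) compact_cball])
  show "convex (\<Union>x\<in>?H. cball x e)"
   unfolding eq[symmetric] by (rule convex_sums[OF convex_convex_hull convex_cball])
  show "C \<subseteq> (\<Union>x\<in>?H. ball x e)"
  proof
   fix x assume "x \<in> C"
   hence "x \<in> ?H" by (rule hull_inc)
   thus "x \<in> (\<Union>x\<in>?H. ball x e)" by (rule UN_I) (simp add: e(1))
  qed
  show "(\<Union>x\<in>?H. cball x e) \<subseteq> V" by (rule e(2))
  show "open (\<Union>x\<in>?H. ball x e)" by (rule open_UN) simp
  show "(\<Union>x\<in>?H. ball x e) \<subseteq> (\<Union>x\<in>?H. cball x e)" by (rule UN_mono[OF subset_refl ball_subset_cball])
 qed
qed

context manifold
begin

text \<open>Uniform convergence on a coordinate ball around \<open>x\<close>, together with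
  continuity of the limit, gives convergence jointly in index and point.\<close>

lemma C1_tendsto_joint:
 assumes C: "C1_tendsto \<A> U G W H \<Phi>" and W: "open W" "continuous_on W H" "x \<in> W"
 shows "((%z. G (fst z) (snd z)) \<longlongrightarrow> H x) (\<Phi> \<times>\<^sub>F nhds x)"
proof -
 let ?c = "chart_at \<A> x" and ?d = "chart_at \<A> (H x)"
 note c = chart_at[of x] and d = chart_at[of "H x"]
 let ?S = "H -` fst ?d \<inter> W"
 have S: "open ?S" using continuous_on_open_vimage[OF W(1), of H] W(2) chart_open(1)[OF d(1)] by blast
 have "open (snd ?c ` (fst ?c \<inter> ?S))" "snd ?c x \<in> snd ?c ` (fst ?c \<inter> ?S)"
  using open_chart_image[OF c(1) S] c(2) d(2) W(3) by auto
 then obtain r where r: "r > 0" "cball (snd ?c x) r \<subseteq> snd ?c ` (fst ?c \<inter> ?S)"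
  unfolding open_contains_cball by blast
 let ?K = "chart_inv ?c ` cball (snd ?c x) r"
 have "cball (snd ?c x) r \<subseteq> snd ?c ` fst ?c" using r(2) by blast
 note K = compact_chart_preimage[OF c(1) compact_cball this]
 have KS: "?K \<subseteq> ?S" using r(2) chart_inv_snd[OF c(1)] by force
 have "?K \<subseteq> fst ?c \<inter> W" "H ` ?K \<subseteq> fst ?d" using KS K(2) by auto
 with C[unfolded C1_tendsto_def, rule_format, of ?c ?d ?K] c(1) d(1) K(1)
 have ev: "\<forall>\<^sub>F i in \<Phi>. ?K \<subseteq> U i \<and> G i ` ?K \<subseteq> fst ?d"
  and ul: "uniform_limit (cball (snd ?c x) r) (%i. snd ?d \<circ> G i \<circ> chart_inv ?c) (snd ?d \<circ> H \<circ> chart_inv ?c) \<Phi>"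
  unfolding K(3) by auto
 let ?N = "chart_inv ?c ` ball (snd ?c x) r"
 have "ball (snd ?c x) r \<subseteq> snd ?c ` fst ?c" using r(2) by force
 from open_chart_inv_image[OF c(1) open_ball this] have oN: "open ?N" .
 have xN: "x \<in> ?N" using r(1) chart_inv_snd[OF c] by (intro image_eqI[of _ _ "snd ?c x"]) auto
 have evN: "\<forall>\<^sub>F y in nhds x. y \<in> ?N" using eventually_nhds_in_open[OF oN xN] .
 have evS: "\<forall>\<^sub>F z in \<Phi> \<times>\<^sub>F nhds x. G (fst z) (snd z) \<in> fst ?d"
  by (rule eventually_mono[OF eventually_prodI[OF ev evN]]) (use ball_subset_cball in blast)
 have lim: "((%z. snd ?d (G (fst z) (snd z))) \<longlongrightarrow> snd ?d (H x)) (\<Phi> \<times>\<^sub>F nhds x)"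
 proof (rule tendstoI)
  fix e :: real assume e: "e > 0"
  have 1: "\<forall>\<^sub>F i in \<Phi>. \<forall>z\<in>cball (snd ?c x) r. dist (snd ?d (G i (chart_inv ?c z))) (snd ?d (H (chart_inv ?c z))) < e / 2"
   using uniform_limitD[OF ul, of "e / 2"] e by simp
  have "continuous_on ?S (%y. snd ?d (H y))"
   by (rule continuous_on_compose2[OF continuous_on_chart[OF d(1)] continuous_on_subset[OF W(2)]]) auto
  hence "isCont (%y. snd ?d (H y)) x"
   using continuous_on_eq_continuous_at[OF S, of "%y. snd ?d (H y)"] d(2) W(3) by simp
  hence "((%y. snd ?d (H y)) \<longlongrightarrow> snd ?d (H x)) (nhds x)"
   unfolding isCont_def by (rule tendsto_at_iff_tendsto_nhds[of "%y. snd ?d (H y)" x, THEN iffD1])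
  hence 2: "\<forall>\<^sub>F y in nhds x. dist (snd ?d (H y)) (snd ?d (H x)) < e / 2"
   by (rule tendstoD) (use e in simp)
  from eventually_prodI[OF 1 eventually_conj[OF 2 evN]]
  show "\<forall>\<^sub>F z in \<Phi> \<times>\<^sub>F nhds x. dist (snd ?d (G (fst z) (snd z))) (snd ?d (H x)) < e"
  proof (rule eventually_mono)
   fix z assume z: "(\<forall>z'\<in>cball (snd ?c x) r. dist (snd ?d (G (fst z) (chart_inv ?c z'))) (snd ?d (H (chart_inv ?c z'))) < e / 2) \<and>
    dist (snd ?d (H (snd z))) (snd ?d (H x)) < e / 2 \<and> snd z \<in> ?N"
   hence "dist (snd ?d (G (fst z) (snd z))) (snd ?d (H (snd z))) < e / 2" by auto
   moreover have "dist (snd ?d (H (snd z))) (snd ?d (H x)) < e / 2" using z by simp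
   ultimately show "dist (snd ?d (G (fst z) (snd z))) (snd ?d (H x)) < e"
    using dist_triangle[of "snd ?d (G (fst z) (snd z))" "snd ?d (H x)" "snd ?d (H (snd z))"] by linarith
  qed
 qed
 have "isCont (chart_inv ?d) (snd ?d (H x))"
  using continuous_on_chart_inv[OF d(1)] chart_open(2)[OF d(1)] d(2)
  by (simp add: continuous_on_eq_continuous_at)
 from isCont_tendsto_compose[OF this lim]
 have "((%z. chart_inv ?d (snd ?d (G (fst z) (snd z)))) \<longlongrightarrow> H x) (\<Phi> \<times>\<^sub>F nhds x)"
  by (simp add: chart_inv_snd[OF d])
 thus ?thesis
  by (rule tendsto_cong[THEN iffD1, rotated]) (use evS in "eventually_elim, simp add: chart_inv_snd[OF d(1)]")
qed

lemma C1_tendsto_cvg: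
 assumes "C1_tendsto \<A> U G W H \<Phi>" "open W" "continuous_on W H" "K \<subseteq> W"
 shows "cvg \<Phi> K G H"
 unfolding cvg_def
proof
 fix x assume "x \<in> K"
 hence "((%z. G (fst z) (snd z)) \<longlongrightarrow> H x) (\<Phi> \<times>\<^sub>F nhds x)"
  using C1_tendsto_joint[OF assms(1-3)] assms(4) by blast
 thus "((%z. G (fst z) (snd z)) \<longlongrightarrow> H x) (\<Phi> \<times>\<^sub>F inf (nhds x) (principal K))"
  by (rule filterlim_mono[OF _ order_refl prod_filter_mono]) auto
qed

lemma C1M_compose:
 fixes h :: "'v::euclidean_space => 'a"
 assumes h: "C1M h" and G: "C1_map_on \<A> W G" "open W" "range h \<subseteq> W"
 shows "C1M (%s. G (h s))"
proof (rule C1M_localI)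
 fix s
 let ?c = "chart_at \<A> (h s)" and ?d = "chart_at \<A> (G (h s))"
 note c = chart_at[of "h s"] and d = chart_at[of "G (h s)"]
 let ?S = "fst ?c \<inter> W \<inter> G -` fst ?d"
 have cG: "continuous_on W G" using G(1) by (simp add: C1_map_on_def)
 have "open (G -` fst ?d \<inter> W)" using continuous_on_open_vimage[OF G(2), of G] cG chart_open(1)[OF d(1)] by blast
 moreover have eq: "?S = fst ?c \<inter> (G -` fst ?d \<inter> W)" by auto
 ultimately have S: "open ?S" "open (snd ?c ` ?S)" using open_chart_image[OF c(1)] chart_open(1)[OF c(1)] by auto
 have oN: "open (h -` ?S)" by (rule C1M_vimage[OF h S(1)])
 have "Ck_on 1 (snd ?c ` ?S) (snd ?d \<circ> G \<circ> chart_inv ?c)"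
  using G(1)[unfolded C1_map_on_def] c(1) d(1) by blast
 hence k: "Ck_on (Suc 0) (snd ?c ` ?S) (snd ?d \<circ> G \<circ> chart_inv ?c)" by simp
 let ?g = "%r. (snd ?d \<circ> G \<circ> chart_inv ?c) (snd ?c (h r))"
 have "Ck_on (Suc 0) (h -` ?S) ?g"
  by (rule Ck_on_compose[OF oN S(2) _ Ck_on_subset[OF C1M_Ck[OF h c(1)]] k]) auto
 moreover have "?g r = snd ?d (G (h r))" if "r \<in> h -` ?S" for r
  using that by (simp add: chart_inv_snd[OF c(1)])
 ultimately show "\<exists>N c g. open N \<and> s \<in> N \<and> c \<in> \<A> \<and> Ck_on (Suc 0) N g \<and> g ` N \<subseteq> snd c ` fst c \<and>
   (\<forall>r\<in>N. G (h r) = chart_inv c (g r))"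
  using oN c(2) d G(3) by (intro exI[of _ "h -` ?S"] exI[of _ ?d] exI[of _ ?g]) (auto simp: chart_inv_snd[OF d(1)])
qed

text \<open>The properties of a single path of the stochastic flow, separated from
  probability.\<close>

definition C1_flow :: "(real => 'a set) => (real => 'a => 'a) => bool" where
 "C1_flow W F \<longleftrightarrow> (\<forall>x. F 0 x = x) \<and> (\<forall>t\<ge>0. open (W t) \<and> C1_map_on \<A> (W t) (F t) \<and>
  C1_tendsto \<A> W F (W t) (F t) (at t within {0..}))"

end

section \<open>Invariance of integrals over cycles along a flow\<close>

context good_cycle
begin

lemma A_ne: "l \<in> A ==> l \<noteq> [] \<and> (\<exists>j. set l \<subseteq> B j)"
 using A(2)[of l] by (auto simp: small_def)

lemma C1M_cu: "l \<in> A ==> C1M (cu l :: 'v => 'a)"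
 using A_ne SM_C1M[OF SM_cu] by blast

definition KA :: "'a set" where
 "KA = (\<Union>l\<in>A. range (cu l :: 'v => 'a))"

lemma cu_in_KA: "l \<in> A ==> cu l (s::'v) \<in> KA"
 by (auto simp: KA_def)

lemma compact_KA: "compact KA"
 unfolding KA_def using A_ne compact_range_cu by (intro compact_UN[OF A(1)]) blast

text \<open>\<open>G''\<close> moves from \<open>G'\<close> towards \<open>G\<close> along
  coordinate segments with a weight evaluated at the limit map \<open>H\<close>. The weight does not
  depend on the index, so convergence to \<open>H\<close> persists. Eventually both ends of each
  segment lie in one compact convex set of the chart, and \<open>Nc_move\<close> shows that the
  integral is unchanged.\<close>

lemma patch_step:
 assumes c: "c \<in> \<A>" "U \<subseteq> fst c" "open U" "convex (snd c ` U)" "compact C" "C \<subseteq> U"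
  and \<beta>: "smooth_fun_on UNIV \<beta>" "\<And>x. 0 \<le> \<beta> x \<and> \<beta> x \<le> (1::real)" "\<And>x. x \<notin> C ==> \<beta> x = 0"
  and H: "continuous_on KA H" "\<And>l. l \<in> A ==> C1M (%s::'v. H (cu l s))"
  and G: "cvg \<Phi> KA G H" "\<forall>\<^sub>F i in \<Phi>. C1A (G i)"
  and G': "cvg \<Phi> KA G' H" "\<forall>\<^sub>F i in \<Phi>. C1A (G' i)"
  and G''_def: "G'' = (%i x. if H x \<in> C then chart_inv c ((1 - \<beta> (H x)) *\<^sub>R snd c (G' i x) + \<beta> (H x) *\<^sub>R snd c (G i x)) else G' i x)"
 shows "cvg \<Phi> KA G'' H"
  and "\<forall>\<^sub>F i in \<Phi>. C1A (G'' i) \<and> Nc \<phi> (G'' i) = Nc \<phi> (G' i) \<and>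
   (\<forall>x\<in>KA. \<beta> (H x) = 1 \<or> G' i x = G i x --> G'' i x = G i x)"
proof -
 let ?V = "snd c ` U"
 have oV: "open ?V" using open_chart_image[OF c(1,3)] c(2) by (simp add: Int_absorb1)
 have VU: "y \<in> U \<longleftrightarrow> snd c y \<in> ?V" if "y \<in> fst c" for y
 proof
  assume "snd c y \<in> ?V"
  then obtain u where u: "u \<in> U" "snd c y = snd c u" by auto
  hence "u \<in> fst c" using c(2) by blast
  hence "chart_inv c (snd c y) = u" using u(2) chart_inv_snd[OF c(1)] by simp
  thus "y \<in> U" using chart_inv_snd[OF c(1) that] u(1) by simp
 qed simp
 have ci: "chart_inv c z \<in> U" "snd c (chart_inv c z) = z" if "z \<in> ?V" for z
 proof -
  have z: "z \<in> snd c ` fst c" using that c(2) by blast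
  show 1: "snd c (chart_inv c z) = z" by (rule snd_chart_inv[OF c(1) z])
  show "chart_inv c z \<in> U" using VU[OF chart_inv_in[OF c(1) z]] that 1 by simp
 qed
 have "C \<subseteq> fst c" using c(2,6) by blast
 hence "compact (snd c ` C)"
  by (rule compact_continuous_image[OF continuous_on_subset[OF continuous_on_chart[OF c(1)]] c(5)])
 moreover have "snd c ` C \<subseteq> ?V" using c(6) by blast
 ultimately obtain D Q where D: "compact D" "convex D" "D \<subseteq> ?V" "open Q" "snd c ` C \<subseteq> Q" "Q \<subseteq> D"
  by (rule compact_convex_nhd[OF _ _ oV c(4)])
 have Dc: "D \<subseteq> snd c ` fst c" and Qc: "Q \<subseteq> snd c ` fst c" using D(3,6) c(2) by blast+
 let ?W = "chart_inv c ` Q" and ?C = "chart_inv c ` D"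
 have oW: "open ?W" by (rule open_chart_inv_image[OF c(1) D(4) Qc])
 have cC: "compact ?C" by (rule compact_chart_preimage[OF c(1) D(1) Dc])
 have CU: "?C \<subseteq> U" using ci(1) D(3) by auto
 have CW: "C \<subseteq> ?W"
 proof
  fix x assume "x \<in> C"
  hence "snd c x \<in> Q" "chart_inv c (snd c x) = x" using D(5) \<open>C \<subseteq> fst c\<close> chart_inv_snd[OF c(1)] by auto
  thus "x \<in> ?W" by (metis imageI)
 qed
 have WQ: "snd c y \<in> Q" "y \<in> U" if "y \<in> ?W" for y
 proof -
  from that obtain q where q: "y = chart_inv c q" "q \<in> Q" by (rule imageE)
  hence "q \<in> ?V" using D(3,6) by blast
  thus "snd c y \<in> Q" "y \<in> U" using ci q by simp_all
 qed
 let ?L = "KA \<inter> (H -` C \<inter> KA)"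
 have L: "compact ?L"
  by (rule compact_Int_closed[OF compact_KA continuous_on_closed_vimage[OF compact_imp_closed[OF compact_KA], THEN iffD1, OF H(1), rule_format]])
   (rule compact_imp_closed[OF c(5)])
 have e1: "\<forall>\<^sub>F i in \<Phi>. \<forall>x\<in>?L. G i x \<in> ?W" by (rule cvg_compact[OF G(1) L _ oW]) (use CW in blast)+
 have e2: "\<forall>\<^sub>F i in \<Phi>. \<forall>x\<in>?L. G' i x \<in> ?W" by (rule cvg_compact[OF G'(1) L _ oW]) (use CW in blast)+
 show "\<forall>\<^sub>F i in \<Phi>. C1A (G'' i) \<and> Nc \<phi> (G'' i) = Nc \<phi> (G' i) \<and>
   (\<forall>x\<in>KA. \<beta> (H x) = 1 \<or> G' i x = G i x --> G'' i x = G i x)"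
  using e1 e2 G(2) G'(2)
 proof eventually_elim
  case (elim i)
  let ?f = "%x. (1 - \<beta> (H x)) *\<^sub>R snd c (G' i x) + \<beta> (H x) *\<^sub>R snd c (G i x)"
  have fV: "?f x \<in> ?V" if "G' i x \<in> U" "G i x \<in> U" for x
   by (rule convexD_alt[OF c(4)]) (use that \<beta>(2)[of "H x"] in auto)
  \<comment> \<open>As \<beta> vanishes off \<open>C\<close>, both branches of \<open>G''\<close>
    obey the segment formula whenever \<open>G' i x\<close> lies in \<open>U\<close>; so nothing
    breaks where \<open>H\<close> enters or leaves \<open>C\<close>.\<close>
  have G''U: "G'' i x = chart_inv c (?f x)" if "G' i x \<in> U" for x
   using \<beta>(3)[of "H x"] that c(2) chart_inv_snd[OF c(1), of "G' i x"] by (auto simp: G''_def)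
  have C1: "C1M (%s::'v. G'' i (cu l s))" if l: "l \<in> A" for l
  proof (rule C1M_localI)
   fix s :: 'v
   have g: "C1M (%s::'v. G i (cu l s))" "C1M (%s::'v. G' i (cu l s))" using elim(3,4) l unfolding C1A_def by blast+
   show "\<exists>N c g. open N \<and> s \<in> N \<and> c \<in> \<A> \<and> Ck_on (Suc 0) N g \<and> g ` N \<subseteq> snd c ` fst c \<and>
    (\<forall>r\<in>N. G'' i (cu l r) = chart_inv c (g r))"
   proof (cases "H (cu l s) \<in> C")
    case True
    hence sU: "G i (cu l s) \<in> U" "G' i (cu l s) \<in> U" using elim(1,2) cu_in_KA[OF l] WQ(2) by blast+
    let ?N = "(%s::'v. G i (cu l s)) -` U \<inter> (%s::'v. G' i (cu l s)) -` U"
    have oN: "open ?N" using C1M_vimage[OF g(1) c(3)] C1M_vimage[OF g(2) c(3)] by blast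
    have k1: "Ck_on (Suc 0) ?N (%s::'v. snd c (G i (cu l s)))"
     by (rule Ck_on_subset[OF C1M_Ck[OF g(1) c(1)]]) (use c(2) in auto)
    have k2: "Ck_on (Suc 0) ?N (%s::'v. snd c (G' i (cu l s)))"
     by (rule Ck_on_subset[OF C1M_Ck[OF g(2) c(1)]]) (use c(2) in auto)
    have k3: "Ck_on (Suc 0) ?N (%s::'v. \<beta> (H (cu l s)))"
     by (rule Ck_on_subset[OF C1M_smooth_fun[OF H(2)[OF l] \<beta>(1)]]) simp
    have k4: "Ck_on (Suc 0) ?N (%s::'v. ?f (cu l s))"
     by (rule Ck_on_add[OF oN Ck_on_scaleR[OF oN Ck_on_diff[OF oN Ck_on_const k3] k2] Ck_on_scaleR[OF oN k3 k1]])
    show ?thesis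
    proof (rule exI[of _ ?N], rule exI[of _ c], rule exI[of _ "%s::'v. ?f (cu l s)"], intro conjI ballI)
     show "s \<in> ?N" using sU by simp
     show "(%s::'v. ?f (cu l s)) ` ?N \<subseteq> snd c ` fst c" using fV c(2) by blast
     show "G'' i (cu l r) = chart_inv c (?f (cu l r))" if "r \<in> ?N" for r
      by (rule G''U) (use that in simp)
    qed (rule oN c(1) k4)+
   next
    case False
    let ?d = "chart_at \<A> (G' i (cu l s))"
    note d = chart_at[of "G' i (cu l s)"]
    let ?N = "(%s::'v. H (cu l s)) -` (- C) \<inter> (%s::'v. G' i (cu l s)) -` fst ?d"
    have "open (- C)" using compact_imp_closed[OF c(5)] by auto
    hence oN: "open ?N" using C1M_vimage[OF H(2)[OF l]] C1M_vimage[OF g(2) chart_open(1)[OF d(1)]] by blast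
    have k1: "Ck_on (Suc 0) ?N (%s::'v. snd ?d (G' i (cu l s)))"
     by (rule Ck_on_subset[OF C1M_Ck[OF g(2) d(1)]]) auto
    show ?thesis
    proof (rule exI[of _ ?N], rule exI[of _ ?d], rule exI[of _ "%s::'v. snd ?d (G' i (cu l s))"], intro conjI ballI)
     show "s \<in> ?N" using False d(2) by simp
     show "(%s::'v. snd ?d (G' i (cu l s))) ` ?N \<subseteq> snd ?d ` fst ?d" by auto
     show "G'' i (cu l r) = chart_inv ?d (snd ?d (G' i (cu l r)))" if "r \<in> ?N" for r
      using that chart_inv_snd[OF d(1)] by (simp add: G''_def)
    qed (rule oN d(1) k1)+
   qed
  qed
  have "Nc \<phi> (G'' i) = Nc \<phi> (G' i)"
  proof (rule Nc_move[OF c(1-4) cC CU C1])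
   show "C1M (%s::'v. G' i (cu l s))" if "l \<in> A" for l using elim(4) that unfolding C1A_def by blast
   show "G'' i (cu l s) = G' i (cu l s) \<or> G'' i (cu l s) \<in> ?C \<and> G' i (cu l s) \<in> ?C" if l: "l \<in> A" for l and s :: 'v
   proof (cases "H (cu l s) \<in> C")
    case True
    hence W: "G i (cu l s) \<in> ?W" "G' i (cu l s) \<in> ?W" using elim(1,2) cu_in_KA[OF l] by blast+
    have "snd c (G i (cu l s)) \<in> D" "snd c (G' i (cu l s)) \<in> D" using WQ(1)[OF W(1)] WQ(1)[OF W(2)] D(6) by auto
    hence "?f (cu l s) \<in> D" using \<beta>(2)[of "H (cu l s)"] by (intro convexD_alt[OF D(2)]) auto
    hence "G'' i (cu l s) \<in> ?C" using G''U[OF WQ(2)[OF W(2)]] by (metis imageI)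
    moreover have "G' i (cu l s) \<in> ?C" using W(2) D(6) by blast
    ultimately show ?thesis by blast
   qed (simp add: G''_def)
  qed
  moreover have "G'' i x = G i x" if x: "x \<in> KA" and e: "\<beta> (H x) = 1 \<or> G' i x = G i x" for x
  proof (cases "H x \<in> C")
   case True
   hence U: "G i x \<in> U" "G' i x \<in> U" using elim(1,2) x WQ(2) by blast+
   have "?f x = snd c (G i x)" using e by (auto simp: scaleR_left_distrib[symmetric])
   thus ?thesis using G''U[OF U(2)] U(1) c(2) chart_inv_snd[OF c(1), of "G i x"] by auto
  next
   case False
   thus ?thesis using e \<beta>(3)[OF False] by (simp add: G''_def)
  qed
  ultimately show ?case using C1 unfolding C1A_def by blast
 qed
 show "cvg \<Phi> KA G'' H" unfolding cvg_def
 proof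
  fix x assume x: "x \<in> KA"
  let ?F = "\<Phi> \<times>\<^sub>F inf (nhds x) (principal KA)"
  have tG: "((%z. G (fst z) (snd z)) \<longlongrightarrow> H x) ?F" "((%z. G' (fst z) (snd z)) \<longlongrightarrow> H x) ?F"
   using G(1) G'(1) x unfolding cvg_def by blast+
  have tH: "((%z. H (snd z)) \<longlongrightarrow> H x) ?F" using cvg_const[OF H(1), of \<Phi>] x unfolding cvg_def by blast
  show "((%z. G'' (fst z) (snd z)) \<longlongrightarrow> H x) ?F"
  proof (cases "H x \<in> C")
   case True
   hence Hc: "H x \<in> fst c" using c(2,6) by blast
   have i1: "isCont (snd c) (H x)"
    using continuous_on_chart[OF c(1)] continuous_on_eq_continuous_at[OF chart_open(1)[OF c(1)], of "snd c"] Hc by simp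
   have i2: "isCont (chart_inv c) (snd c (H x))"
    using continuous_on_chart_inv[OF c(1)] continuous_on_eq_continuous_at[OF chart_open(2)[OF c(1)], of "chart_inv c"] Hc by simp
   have i3: "isCont \<beta> (H x)"
    using smooth_fun_on_continuous[OF \<beta>(1)] continuous_on_eq_continuous_at[OF open_UNIV, of \<beta>] by simp
   note t = isCont_tendsto_compose[OF i1 tG(1)] isCont_tendsto_compose[OF i1 tG(2)] isCont_tendsto_compose[OF i3 tH]
   have "((%z. (1 - \<beta> (H (snd z))) *\<^sub>R snd c (G' (fst z) (snd z)) + \<beta> (H (snd z)) *\<^sub>R snd c (G (fst z) (snd z))) \<longlongrightarrow>
     (1 - \<beta> (H x)) *\<^sub>R snd c (H x) + \<beta> (H x) *\<^sub>R snd c (H x)) ?F"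
    by (rule tendsto_add[OF tendsto_scaleR[OF tendsto_diff[OF tendsto_const t(3)] t(2)] tendsto_scaleR[OF t(3) t(1)]])
   moreover have "(1 - \<beta> (H x)) *\<^sub>R snd c (H x) + \<beta> (H x) *\<^sub>R snd c (H x) = snd c (H x)"
    by (simp add: scaleR_left_distrib[symmetric])
   ultimately have "((%z. chart_inv c ((1 - \<beta> (H (snd z))) *\<^sub>R snd c (G' (fst z) (snd z)) + \<beta> (H (snd z)) *\<^sub>R snd c (G (fst z) (snd z)))) \<longlongrightarrow>
     chart_inv c (snd c (H x))) ?F"
    by (intro isCont_tendsto_compose[OF i2]) simp
   thus ?thesis unfolding G''_def chart_inv_snd[OF c(1) Hc] by (rule tendsto_If[OF _ tG(2)])
  next
   case False
   have "\<forall>\<^sub>F z in ?F. H (snd z) \<in> - C"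
    by (rule topological_tendstoD[OF tH]) (use compact_imp_closed[OF c(5)] False in auto)
   hence "\<forall>\<^sub>F z in ?F. G' (fst z) (snd z) = G'' (fst z) (snd z)"
    by eventually_elim (simp add: G''_def)
   from tendsto_cong[OF this] tG(2) show ?thesis by simp
  qed
 qed
qed

lemma Nc_eventually:
 assumes H: "continuous_on KA H" "\<And>l. l \<in> A ==> C1M (%s::'v. H (cu l s))"
  and G: "cvg \<Phi> KA G H" "\<forall>\<^sub>F i in \<Phi>. C1A (G i)"
 shows "\<forall>\<^sub>F i in \<Phi>. Nc \<phi> (G i) = Nc \<phi> H"
proof -
 let ?q = "%\<beta> C N j y. smooth_fun_on UNIV \<beta> \<and> (\<forall>x. 0 \<le> \<beta> x \<and> \<beta> x \<le> (1::real)) \<and> open N \<and> y \<in> N \<and>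
   (\<forall>x\<in>N. \<beta> x = 1) \<and> compact C \<and> C \<subseteq> B j \<and> (\<forall>x. x \<notin> C --> \<beta> x = 0) \<and> y \<in> B j"
 have "\<forall>y. \<exists>p. case p of (\<beta>, C, N, j) => ?q \<beta> C N j y"
 proof
  fix y
  obtain j where j: "y \<in> B j" using B_cover by blast
  obtain \<beta> :: "'a => real" and C N where \<beta>: "smooth_fun_on UNIV \<beta>" "\<And>x. 0 \<le> \<beta> x \<and> \<beta> x \<le> 1" "open N" "y \<in> N"
   "\<And>x. x \<in> N ==> \<beta> x = 1" "compact C" "C \<subseteq> B j" "\<And>x. x \<notin> C ==> \<beta> x = 0"
   by (rule bump_point[OF B_open j]) (rule that; assumption)
  show "\<exists>p. case p of (\<beta>, C, N, j) => ?q \<beta> C N j y"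
   by (rule exI[of _ "(\<beta>, C, N, j)"]) (use \<beta> j in simp)
 qed
 from choice[OF this] obtain p where p: "\<forall>y. case p y of (\<beta>, C, N, j) => ?q \<beta> C N j y" by (rule exE)
 define \<beta> C N j where "\<beta> y = fst (p y)" and "C y = fst (snd (p y))" and "N y = fst (snd (snd (p y)))" and "j y = snd (snd (snd (p y)))" for y
 have q: "smooth_fun_on UNIV (\<beta> y)" "\<And>x. 0 \<le> \<beta> y x \<and> \<beta> y x \<le> 1" "open (N y)" "y \<in> N y"
   "\<And>x. x \<in> N y ==> \<beta> y x = 1" "compact (C y)" "C y \<subseteq> B (j y)" "\<And>x. x \<notin> C y ==> \<beta> y x = 0" "y \<in> B (j y)" for y
  using p[rule_format, of y] by (simp_all add: split_beta \<beta>_def C_def N_def j_def)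
 have step: "\<exists>G'. cvg \<Phi> KA G' H \<and> (\<forall>\<^sub>F i in \<Phi>. C1A (G' i) \<and> Nc \<phi> (G' i) = Nc \<phi> H \<and>
   (\<forall>x\<in>KA. (\<exists>y\<in>Y. \<beta> y (H x) = 1) --> G' i x = G i x))" if "finite Y" for Y
  using that
 proof (induction Y)
  case empty
  show ?case by (rule exI[of _ "%i. H"]) (use cvg_const[OF H(1)] H(2) in "simp add: C1A_def")
 next
  case (insert y Y)
  from insert.IH obtain G' where G': "cvg \<Phi> KA G' H" "\<forall>\<^sub>F i in \<Phi>. C1A (G' i) \<and> Nc \<phi> (G' i) = Nc \<phi> H \<and>
   (\<forall>x\<in>KA. (\<exists>y\<in>Y. \<beta> y (H x) = 1) --> G' i x = G i x)" by (elim exE conjE)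
  have e: "\<forall>\<^sub>F i in \<Phi>. C1A (G' i)" by (rule eventually_mono[OF G'(2)]) simp
  have U: "B (j y) \<subseteq> fst (cc y)" "convex (snd (cc y) ` B (j y))" using B_convex[OF q(9)[of y]] by auto
  define G2 where "G2 = (%i x. if H x \<in> C y then chart_inv (cc y)
   ((1 - \<beta> y (H x)) *\<^sub>R snd (cc y) (G' i x) + \<beta> y (H x) *\<^sub>R snd (cc y) (G i x)) else G' i x)"
  have ps: "cvg \<Phi> KA G2 H" "\<forall>\<^sub>F i in \<Phi>. C1A (G2 i) \<and>
    Nc \<phi> (G2 i) = Nc \<phi> (G' i) \<and>
    (\<forall>x\<in>KA. \<beta> y (H x) = 1 \<or> G' i x = G i x --> G2 i x = G i x)"
   by (rule patch_step[OF cc_in U(1) B_open U(2) q(6) q(7) q(1) q(2) q(8) H G G'(1) e G2_def]; assumption)+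
  show ?case
  proof (rule exI[of _ G2], rule conjI[OF ps(1)])
   show "\<forall>\<^sub>F i in \<Phi>. C1A (G2 i) \<and> Nc \<phi> (G2 i) = Nc \<phi> H \<and>
    (\<forall>x\<in>KA. (\<exists>y\<in>insert y Y. \<beta> y (H x) = 1) --> G2 i x = G i x)"
    using ps(2) G'(2)
   proof (eventually_elim, elim conjE, intro conjI)
    fix i
    let ?G'' = "G2 i"
    assume a: "\<forall>x\<in>KA. \<beta> y (H x) = 1 \<or> G' i x = G i x --> ?G'' x = G i x"
     "\<forall>x\<in>KA. (\<exists>y\<in>Y. \<beta> y (H x) = 1) --> G' i x = G i x"
     "Nc \<phi> ?G'' = Nc \<phi> (G' i)" "Nc \<phi> (G' i) = Nc \<phi> H"
     "C1A ?G''"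
    show "C1A ?G''" by (rule a(5))
    show "Nc \<phi> ?G'' = Nc \<phi> H" by (rule trans[OF a(3,4)])
    show "\<forall>x\<in>KA. (\<exists>y\<in>insert y Y. \<beta> y (H x) = 1) --> ?G'' x = G i x"
    proof (intro ballI impI)
     fix x assume x: "x \<in> KA" "\<exists>y\<in>insert y Y. \<beta> y (H x) = 1"
     have "\<beta> y (H x) = 1 \<or> G' i x = G i x"
     proof (cases "\<beta> y (H x) = 1")
      case False
      hence "\<exists>y\<in>Y. \<beta> y (H x) = 1" using x(2) by simp
      thus ?thesis using a(2) x(1) by simp
     qed simp
     thus "?G'' x = G i x" using a(1)[rule_format, OF x(1)] by argo
    qed
   qed
  qed
 qed
 have "compact (H ` KA)" by (rule compact_continuous_image[OF H(1) compact_KA])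
 then obtain Y where Y: "finite Y" "H ` KA \<subseteq> (\<Union>y\<in>Y. N y)"
  by (rule compactE_image[of _ "H ` KA" N]) (use q(3,4) in blast)+
 from step[OF Y(1)] obtain G' where G': "\<forall>\<^sub>F i in \<Phi>. C1A (G' i) \<and> Nc \<phi> (G' i) = Nc \<phi> H \<and>
   (\<forall>x\<in>KA. (\<exists>y\<in>Y. \<beta> y (H x) = 1) --> G' i x = G i x)" by (elim exE conjE)
 show ?thesis
 proof (rule eventually_mono[OF G'], elim conjE)
  fix i assume a: "Nc \<phi> (G' i) = Nc \<phi> H" "\<forall>x\<in>KA. (\<exists>y\<in>Y. \<beta> y (H x) = 1) --> G' i x = G i x"
  have "G' i x = G i x" if x: "x \<in> KA" for x
  proof -
   have "H x \<in> (\<Union>y\<in>Y. N y)" using Y(2) x by blast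
   then obtain y where "y \<in> Y" "H x \<in> N y" by (rule UN_E)
   hence "\<exists>y\<in>Y. \<beta> y (H x) = 1" using q(5) by (intro bexI[of _ y])
   thus ?thesis using a(2) x by simp
  qed
  hence "G' i (cu l s) = G i (cu l s)" if "l \<in> A" for l and s :: 'v using that by (auto simp: KA_def)
  hence "Nc \<phi> (G' i) = Nc \<phi> (G i)" by (simp add: Nc_def)
  thus "Nc \<phi> (G i) = Nc \<phi> H" using a(1) by simp
 qed
qed

text \<open>The integral over the moved cycle is a locally constant function of time on a connected
  half-line, and at time 0 nothing has moved.\<close>

theorem Nc_flow:
 assumes F: "C1_flow W F" "\<And>t. 0 \<le> t ==> KA \<subseteq> W t" and t: "0 \<le> t"
 shows "Nc \<phi> (F t) = (\<Sum>l\<in>A. a l * Iv T \<phi> l)" "C1A (F t)"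
proof -
 have f: "open (W t)" "C1_map_on \<A> (W t) (F t)" "C1_tendsto \<A> W F (W t) (F t) (at t within {0..})"
  if "0 \<le> t" for t using F(1) that unfolding C1_flow_def by blast+
 have F0: "F 0 x = x" for x using F(1) unfolding C1_flow_def by blast
 have C1: "C1M (%s::'v. F t (cu l s))" if "0 \<le> t" "l \<in> A" for t l
  by (rule C1M_compose[OF C1M_cu[OF that(2)] f(2,1)[OF that(1)]]) (use cu_in_KA[OF that(2)] F(2)[OF that(1)] in blast)
 thus "C1A (F t)" using t by (simp add: C1A_def)
 have "Nc \<phi> (F t) = Nc \<phi> (F 0)"
 proof (rule connected_local_const[of "{0..}" t 0 "%t. Nc \<phi> (F t)"])
  show "\<forall>t\<in>{0..}. \<forall>\<^sub>F s in at t within {0..}. Nc \<phi> (F t) = Nc \<phi> (F s)"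
  proof
   fix t :: real assume "t \<in> {0..}"
   hence t: "0 \<le> t" by simp
   have cF: "continuous_on (W t) (F t)" using f(2)[OF t] by (simp add: C1_map_on_def)
   have "\<forall>\<^sub>F s in at t within {0..}. 0 \<le> s" by (simp add: eventually_at_filter)
   hence e: "\<forall>\<^sub>F s in at t within {0..}. C1A (F s)"
    by (rule eventually_mono) (simp add: C1A_def C1)
   have "\<forall>\<^sub>F s in at t within {0..}. Nc \<phi> (F s) = Nc \<phi> (F t)"
    by (rule Nc_eventually[OF continuous_on_subset[OF cF F(2)[OF t]] C1[OF t]
      C1_tendsto_cvg[OF f(3)[OF t] f(1)[OF t] cF F(2)[OF t]] e])
   thus "\<forall>\<^sub>F s in at t within {0..}. Nc \<phi> (F t) = Nc \<phi> (F s)"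
    by (rule eventually_mono) (rule sym)
  qed
 qed (use t in "auto simp: connected_iff_interval")
 also have "\<dots> = (\<Sum>l\<in>A. a l * Iv T \<phi> l)"
  unfolding Nc_def by (rule sum.cong[OF refl]) (use A(2) F0 in "simp add: Iv_def")
 finally show "Nc \<phi> (F t) = (\<Sum>l\<in>A. a l * Iv T \<phi> l)" .
qed

end

section \<open>Norm estimates for forms and tangent maps\<close>

section \<open>Norms of forms and of tangent maps\<close>

text \<open>Bounds on basis vectors, uniform in the point, pass to all vectors by expanding one
  argument at a time.\<close>

lemma multilin_bound:
 fixes a :: "'w::euclidean_space list => 'y => real"
 assumes "\<And>y. y \<in> Y ==> multilin k (%us. a us y)"
  and "\<And>us. length us = k ==> set us \<subseteq> Basis ==> \<exists>C. \<forall>y\<in>Y. \<bar>a us y\<bar> \<le> C"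
 shows "\<exists>C\<ge>0. \<forall>y\<in>Y. \<forall>us. length us = k --> \<bar>a us y\<bar> \<le> C * prod_list (map norm us)"
 using assms
proof (induction k arbitrary: a)
 case 0
 from 0(2)[of "[]"] obtain C where C: "\<forall>y\<in>Y. \<bar>a [] y\<bar> \<le> C" by auto
 show ?case by (rule exI[of _ "max 0 C"]) (use C in "auto simp: le_max_iff_disj")
next
 case (Suc k)
 have "\<forall>b. \<exists>C. C \<ge> 0 \<and> (b \<in> Basis --> (\<forall>y\<in>Y. \<forall>us. length us = k --> \<bar>a (b # us) y\<bar> \<le> C * prod_list (map norm us)))"
 proof
  fix b :: 'w
  show "\<exists>C. C \<ge> 0 \<and> (b \<in> Basis --> (\<forall>y\<in>Y. \<forall>us. length us = k --> \<bar>a (b # us) y\<bar> \<le> C * prod_list (map norm us)))"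
  proof (cases "b \<in> Basis")
   case True
   have "\<exists>C\<ge>0. \<forall>y\<in>Y. \<forall>us. length us = k --> \<bar>a (b # us) y\<bar> \<le> C * prod_list (map norm us)"
   proof (rule Suc.IH[of "%us. a (b # us)"])
    show "multilin k (%us. a (b # us) y)" if "y \<in> Y" for y by (rule multilin_Cons[OF Suc.prems(1)[OF that]])
    show "\<exists>C. \<forall>y\<in>Y. \<bar>a (b # us) y\<bar> \<le> C" if "length us = k" "set us \<subseteq> Basis" for us
     by (rule Suc.prems(2)) (use that True in auto)
   qed
   thus ?thesis using True by simp
  qed (intro exI[of _ 0], simp)
 qed
 from choice[OF this] obtain C where CC: "\<forall>b. C b \<ge> 0 \<and> (b \<in> Basis --> (\<forall>y\<in>Y. \<forall>us. length us = k --> \<bar>a (b # us) y\<bar> \<le> C b * prod_list (map norm us)))"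
  by (rule exE)
 have C: "C b \<ge> 0" "\<And>us y. b \<in> Basis ==> y \<in> Y ==> length us = k ==> \<bar>a (b # us) y\<bar> \<le> C b * prod_list (map norm us)" for b
  using CC[THEN spec, of b] by simp_all
 show ?case
 proof (rule exI[of _ "\<Sum>b\<in>Basis. C b"], intro conjI ballI allI impI)
  show "(\<Sum>b\<in>Basis. C b) \<ge> 0" by (rule sum_nonneg) (rule C(1))
  fix y and us :: "'w list" assume y: "y \<in> Y" and "length us = Suc k"
  then obtain w ws where us: "us = w # ws" "length ws = k" by (cases us) auto
  have "\<bar>a us y\<bar> = \<bar>\<Sum>b\<in>Basis. (w \<bullet> b) * a (b # ws) y\<bar>"
   by (simp only: us(1) multilin_expand[OF Suc.prems(1)[OF y] us(2), of w])
  also have "\<dots> \<le> (\<Sum>b\<in>Basis. \<bar>(w \<bullet> b) * a (b # ws) y\<bar>)" by (rule sum_abs)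
  also have "\<dots> \<le> (\<Sum>b\<in>Basis. norm w * (C b * prod_list (map norm ws)))"
  proof (rule sum_mono)
   fix b :: 'w assume b: "b \<in> Basis"
   show "\<bar>(w \<bullet> b) * a (b # ws) y\<bar> \<le> norm w * (C b * prod_list (map norm ws))"
    unfolding abs_mult by (rule mult_mono[OF Basis_le_norm[OF b] C(2)[OF b y us(2)]]) simp_all
  qed
  also have "\<dots> = (\<Sum>b\<in>Basis. C b) * prod_list (map norm us)"
   by (simp add: us(1) sum_distrib_right sum_distrib_left mult_ac)
  finally show "\<bar>a us y\<bar> \<le> (\<Sum>b\<in>Basis. C b) * prod_list (map norm us)" .
 qed
qed

lemma multilin_scale:
 fixes a :: "'w::real_vector list => real"
 assumes "multilin k a" "length us = k"
 shows "a (map (%u. r u *\<^sub>R u) us) = prod_list (map r us) * a us"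
 using assms
proof (induction us arbitrary: k a)
 case (Cons u us)
 then obtain j where j: "k = Suc j" "length us = j" by auto
 have m: "multilin (Suc j) a" using Cons.prems j by simp
 have "a (r u *\<^sub>R u # map (%u. r u *\<^sub>R u) us) = r u * a (u # map (%u. r u *\<^sub>R u) us)"
  using linear_scale[OF multilin_linear_Cons[OF m, of "map (%u. r u *\<^sub>R u) us"]] j by simp
 also have "a (u # map (%u. r u *\<^sub>R u) us) = prod_list (map r us) * a (u # us)"
  by (rule Cons.IH[OF multilin_Cons[OF m] j(2)])
 finally show ?case by simp
qed simp

lemma prod_list_mono:
 fixes f h :: "'b => real"
 shows "(\<And>u. u \<in> set us ==> 0 \<le> f u \<and> f u \<le> h u) ==> 0 \<le> prod_list (map f us) \<and> prod_list (map f us) \<le> prod_list (map h us)"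
proof (induction us)
 case (Cons u us)
 have 1: "0 \<le> f u \<and> f u \<le> h u" by (rule Cons.prems) simp
 have 2: "0 \<le> prod_list (map f us) \<and> prod_list (map f us) \<le> prod_list (map h us)"
  by (rule Cons.IH, rule Cons.prems) simp
 have "f u * prod_list (map f us) \<le> h u * prod_list (map h us)"
  by (rule mult_mono) (use 1 2 in linarith)+
 thus ?case using 1 2 by simp
qed simp

lemma prod_list_const_mult: "prod_list (map (%u. (r::real) * f u) us) = r ^ length us * prod_list (map f us)"
 by (induction us) (simp_all add: mult_ac)

context manifold
begin

definition nrm :: "('a => ('a, 'e) tangent => ('a, 'e) tangent => real) => 'a => ('a, 'e) tangent => real" where
 "nrm g x v = sqrt (g x v v)"

text \<open>The metric in coordinates: here its arguments form a vector space and the theory of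
  bounded bilinear maps applies, whereas the metric is controlled on tangent vectors only.\<close>

definition gq :: "('a => ('a, 'e) tangent => ('a, 'e) tangent => real) => ('a, 'e) chart => 'a => 'e => 'e => real" where
 "gq g c x u w = g x (tgt c x u) (tgt c x w)"

lemma gq_props:
 assumes rm: "riemannian_metric \<A> g" and c: "c \<in> \<A>" "x \<in> fst c"
 shows "linear (%u. gq g c x u w)" "linear (gq g c x u)" "0 \<le> gq g c x u u" "gq g c x u u = 0 ==> u = 0"
  "bounded_bilinear (gq g c x)" "gq g c x (r *\<^sub>R u) (r *\<^sub>R u) = r\<^sup>2 * gq g c x u u"
proof -
 have T: "tgt c x u \<in> TS x" for u by (rule tgt_in_TS[OF c])
 have R: "g x (tgt c x u) (tgt c x v) = g x (tgt c x v) (tgt c x u) \<and>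
   g x (lin_comb p (tgt c x u) q (tgt c x v)) (tgt c x w) = p * g x (tgt c x u) (tgt c x w) + q * g x (tgt c x v) (tgt c x w) \<and>
   0 \<le> g x (tgt c x u) (tgt c x u) \<and> (g x (tgt c x u) (tgt c x u) = 0 --> tgt c x u = (%_. 0))" for u v w p q
  by (rule rm[unfolded riemannian_metric_def, THEN conjunct1, THEN spec[of _ x], THEN bspec[OF _ T[of u]],
     THEN bspec[OF _ T[of v]], THEN bspec[OF _ T[of w]], THEN spec[of _ p], THEN spec[of _ q]])
 have lc: "gq g c x (p *\<^sub>R u + q *\<^sub>R v) w = p * gq g c x u w + q * gq g c x v w" for p q u v w
  using R[of u v p q w] by (simp add: gq_def tgt_lin_comb[OF c])
 have sym: "gq g c x u v = gq g c x v u" for u v using R[of u v] by (simp add: gq_def)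
 show l1: "linear (%u. gq g c x u w)" for w
 proof (rule linearI)
  show "gq g c x (u + v) w = gq g c x u w + gq g c x v w" for u v using lc[of 1 u 1 v w] by simp
  show "gq g c x (r *\<^sub>R u) w = r *\<^sub>R gq g c x u w" for r u using lc[of r u 0 u w] by simp
 qed
 show l2: "linear (gq g c x u)" for u
 proof -
  have "gq g c x u = (%w. gq g c x w u)" by (rule ext) (rule sym)
  thus ?thesis using l1[of u] by simp
 qed
 show "0 \<le> gq g c x u u" using R[of u u] by (simp add: gq_def)
 show "u = 0" if "gq g c x u u = 0"
 proof -
  have "tgt c x u = (%_. 0)" using R[of u u] that by (simp add: gq_def)
  thus ?thesis using tgt_self[OF c, of u] by simp
 qed
 have "bilinear (gq g c x)" unfolding bilinear_def using l1 l2 by simp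
 thus "bounded_bilinear (gq g c x)" unfolding bilinear_conv_bounded_bilinear .
 show "gq g c x (r *\<^sub>R u) (r *\<^sub>R u) = r\<^sup>2 * gq g c x u u"
  using linear_scale[OF l1, of r u] linear_scale[OF l2, of _ r u] by (simp add: power2_eq_square)
qed

lemma gq_continuous:
 assumes rm: "riemannian_metric \<A> g" and c: "c \<in> \<A>"
  and f: "continuous_on S (%s. snd c (f s))" "f ` S \<subseteq> fst c" and w: "continuous_on S w"
 shows "continuous_on S (%s. gq g c (f s) (w s) (w s))"
proof -
 have cg: "continuous_on S (%s. gq g c (f s) b b')" for b b'
 proof -
  have "smooth_on (snd c ` fst c) (%y. gq g c (chart_inv c y) b b')"
   using rm c unfolding riemannian_metric_def gq_def by blast
  from continuous_on_compose2[OF smooth_on_continuous[OF this] f(1)]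
  have "continuous_on S (%s. gq g c (chart_inv c (snd c (f s))) b b')" using f(2) by auto
  thus ?thesis
   by (rule continuous_on_cong[THEN iffD1, OF refl, rotated]) (use f(2) in "auto simp: chart_inv_snd[OF c]")
 qed
 have "gq g c (f s) (w s) (w s) = (\<Sum>b\<in>Basis. (w s \<bullet> b) * (\<Sum>b'\<in>Basis. (w s \<bullet> b') * gq g c (f s) b b'))"
  if "s \<in> S" for s
 proof -
  have "f s \<in> fst c" using f(2) that by blast
  note G = gq_props[OF rm c this]
  show ?thesis unfolding linear_euclidean_sum[OF G(1), of "w s" "w s"]
   by (rule sum.cong[OF refl]) (simp only: linear_euclidean_sum[OF G(2), of _ "w s"])
 qed
 moreover have "continuous_on S (%s. \<Sum>b\<in>Basis. (w s \<bullet> b) * (\<Sum>b'\<in>Basis. (w s \<bullet> b') * gq g c (f s) b b'))"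
  by (intro continuous_intros w cg)
 ultimately show ?thesis by (simp cong: continuous_on_cong)
qed

text \<open>The metric is continuous and positive on the compact product of \<open>Y\<close> with
  the unit sphere; homogeneity extends its minimum to all vectors.\<close>

lemma gq_lower:
 assumes rm: "riemannian_metric \<A> g" and c: "c \<in> \<A>" and Y: "compact Y" "Y \<subseteq> snd c ` fst c"
 obtains m where "m > 0" "\<And>y u. y \<in> Y ==> m * (norm u)\<^sup>2 \<le> gq g c (chart_inv c y) u u"
proof (cases "Y = {}")
 case True
 show ?thesis by (rule that[of 1]) (use True in auto)
next
 case False
 have in_c: "chart_inv c y \<in> fst c" if "y \<in> Y" for y using chart_inv_in[OF c] Y(2) that by blast
 let ?q = "%z. gq g c (chart_inv c (fst z)) (snd z) (snd z)"
 have "continuous_on (Y \<times> sphere 0 1) ?q"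
 proof (rule gq_continuous[OF rm c _ _ continuous_on_snd[OF continuous_on_id]])
  have "snd c (chart_inv c (fst z)) = fst z" if "z \<in> Y \<times> sphere 0 1" for z :: "'e \<times> 'e"
   using snd_chart_inv[OF c] Y(2) that by auto
  thus "continuous_on (Y \<times> sphere 0 1) (%z :: 'e \<times> 'e. snd c (chart_inv c (fst z)))"
   using continuous_on_fst[OF continuous_on_id] by (simp cong: continuous_on_cong)
 qed (use in_c in auto)
 moreover have "compact (Y \<times> sphere (0::'e) 1)" by (rule compact_Times[OF Y(1) compact_sphere])
 moreover have "Y \<times> sphere (0::'e) 1 \<noteq> {}"
 proof -
  obtain b :: 'e where "b \<in> Basis" using nonempty_Basis by blast
  hence "b \<in> sphere 0 1" by simp
  thus ?thesis using False by blast
 qed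
 ultimately obtain z where z: "z \<in> Y \<times> sphere 0 1" "\<forall>z'\<in>Y \<times> sphere 0 1. ?q z \<le> ?q z'"
  using continuous_attains_inf[of "Y \<times> sphere 0 1" ?q] by blast
 have zc: "chart_inv c (fst z) \<in> fst c" using z(1) in_c by auto
 show ?thesis
 proof (rule that[of "?q z"])
  have "?q z \<noteq> 0" using gq_props(4)[OF rm c zc, of "snd z"] z(1) by auto
  thus "?q z > 0" using gq_props(3)[OF rm c zc, of "snd z"] by simp
  fix y :: 'e and u :: 'e assume y: "y \<in> Y"
  note G = gq_props[OF rm c in_c[OF y]]
  show "?q z * (norm u)\<^sup>2 \<le> gq g c (chart_inv c y) u u"
  proof (cases "u = 0")
   case False
   let ?v = "(1 / norm u) *\<^sub>R u"
   have "(y, ?v) \<in> Y \<times> sphere 0 1" using y False by simp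
   from z(2)[rule_format, OF this] have "?q z \<le> gq g c (chart_inv c y) ?v ?v" by simp
   also have "\<dots> = (1 / norm u)\<^sup>2 * gq g c (chart_inv c y) u u" by (rule G(6))
   finally show ?thesis using False by (simp add: power_divide field_simps)
  qed (simp add: G(3))
 qed
qed

lemma nrm_bounded_coords:
 assumes rm: "riemannian_metric \<A> g" and c: "c \<in> \<A>" and Y: "compact Y" "Y \<subseteq> snd c ` fst c"
 obtains R where "R \<ge> 0" "\<And>y v. y \<in> Y ==> v \<in> TS (chart_inv c y) ==> g (chart_inv c y) v v \<le> 1 ==> norm (v c) \<le> R"
proof -
 obtain m where m: "m > 0" "\<And>y u. y \<in> Y ==> m * (norm u)\<^sup>2 \<le> gq g c (chart_inv c y) u u"
  by (rule gq_lower[OF assms]) (rule that; assumption)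
 show ?thesis
 proof (rule that[of "sqrt (1 / m)"])
  fix y v assume v: "y \<in> Y" "v \<in> TS (chart_inv c y)" "g (chart_inv c y) v v \<le> 1"
  have "chart_inv c y \<in> fst c" using chart_inv_in[OF c] Y(2) v(1) by blast
  hence "m * (norm (v c))\<^sup>2 \<le> 1" using m(2)[OF v(1), of "v c"] v tgt_of_TS[OF v(2) c] by (simp add: gq_def)
  hence "(norm (v c))\<^sup>2 \<le> 1 / m" using m(1) by (simp add: field_simps)
  thus "norm (v c) \<le> sqrt (1 / m)" by (rule real_le_rsqrt)
 qed (use m(1) in simp)
qed

text \<open>Guarantees that the supremum in \<open>form_norm\<close> is over a bounded set, since an
  unbounded real supremum carries no information. Its local uniformity also gives boundedness of
  compactly supported forms.\<close>

lemma form_locally_bounded: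
 assumes rm: "riemannian_metric \<A> g" and \<phi>: "\<phi> \<in> forms_on UNIV p"
 shows "\<exists>S C. open S \<and> x \<in> S \<and> (\<forall>y\<in>S. \<forall>vs. length vs = p --> (\<forall>v\<in>set vs. v \<in> TS y \<and> g y v v \<le> 1) --> \<bar>\<phi> y vs\<bar> \<le> C)"
proof -
 let ?c = "chart_at \<A> x"
 note c = chart_at[of x]
 obtain e where e: "e > 0" "cball (snd ?c x) e \<subseteq> snd ?c ` fst ?c" by (rule chart_ball_nhd[of x])
 let ?Y = "cball (snd ?c x) e" and ?S = "chart_inv ?c ` ball (snd ?c x) e"
 obtain R where R: "R \<ge> 0" "\<And>y v. y \<in> ?Y ==> v \<in> TS (chart_inv ?c y) ==> g (chart_inv ?c y) v v \<le> 1 ==> norm (v ?c) \<le> R"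
  by (rule nrm_bounded_coords[OF rm c(1) compact_cball e(2)]) (rule that; assumption)
 have "\<exists>C\<ge>0. \<forall>y\<in>?Y. \<forall>us. length us = p --> \<bar>loc ?c \<phi> us y\<bar> \<le> C * prod_list (map norm us)"
 proof (rule multilin_bound)
  show "multilin p (%us. loc ?c \<phi> us y)" if "y \<in> ?Y" for y
   by (rule alt_form_multilin[OF alt_form_loc[OF \<phi> c(1)]]) (use that e(2) in blast)
  fix us :: "'e list" assume l: "length us = p"
  have "smooth_on (snd ?c ` fst ?c) (loc ?c \<phi> us)" using forms_onD(5)[OF \<phi> c(1) l] by simp
  from compact_continuous_image[OF continuous_on_subset[OF smooth_on_continuous[OF this] e(2)] compact_cball]
  have "bounded (loc ?c \<phi> us ` ?Y)" by (rule compact_imp_bounded)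
  then obtain C where "\<forall>z\<in>loc ?c \<phi> us ` ?Y. norm z \<le> C" unfolding bounded_iff by (rule exE)
  thus "\<exists>C. \<forall>y\<in>?Y. \<bar>loc ?c \<phi> us y\<bar> \<le> C" by (intro exI[of _ C]) auto
 qed
 then obtain C where C: "C \<ge> 0" "\<forall>y\<in>?Y. \<forall>us. length us = p --> \<bar>loc ?c \<phi> us y\<bar> \<le> C * prod_list (map norm us)"
  by (elim exE conjE)
 have "\<bar>\<phi> z vs\<bar> \<le> C * R ^ p"
  if z: "z \<in> ?S" and vs: "length vs = p" "\<forall>v\<in>set vs. v \<in> TS z \<and> g z v v \<le> 1" for z vs
 proof -
  obtain y where y: "z = chart_inv ?c y" "y \<in> ball (snd ?c x) e" using z by (rule imageE)
  hence yY: "y \<in> ?Y" using ball_subset_cball by blast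
  hence yc: "y \<in> snd ?c ` fst ?c" using e(2) by blast
  have zc: "z \<in> fst ?c" "snd ?c z = y" unfolding y(1) by (rule chart_inv_in[OF c(1) yc], rule snd_chart_inv[OF c(1) yc])
  have n: "norm (v ?c) \<le> R" if "v \<in> set vs" for v
   by (rule R(2)[OF yY]) (use vs(2) that y(1) in auto)
  have "set vs \<subseteq> TS z" using vs(2) by blast
  hence "\<phi> z vs = loc ?c \<phi> (map (%v. v ?c) vs) y"
   using form_eq_loc[OF c(1) zc(1), of vs \<phi>] zc(2) by simp
  moreover have "\<bar>loc ?c \<phi> (map (%v. v ?c) vs) y\<bar> \<le> C * prod_list (map norm (map (%v. v ?c) vs))"
   by (rule C(2)[rule_format, OF yY]) (use vs(1) in simp)
  ultimately have "\<bar>\<phi> z vs\<bar> \<le> C * prod_list (map norm (map (%v. v ?c) vs))" by simp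
  also have "\<dots> \<le> C * prod_list (map (%_. R) vs)" unfolding map_map comp_def
   by (rule mult_left_mono[OF prod_list_mono[THEN conjunct2] C(1)]) (use n in auto)
  also have "prod_list (map (%_. R) vs) = R ^ p"
   using vs(1) prod_list_const_mult[of "R" "%_. 1" vs] by (simp add: map_replicate_const)
  finally show "\<bar>\<phi> z vs\<bar> \<le> C * R ^ p" .
 qed
 moreover have "open ?S"
  by (rule open_chart_inv_image[OF c(1) open_ball]) (use e(2) ball_subset_cball in blast)
 moreover have "x \<in> ?S" using e(1) chart_inv_snd[OF c] by (intro image_eqI[of _ _ "snd ?c x"]) auto
 ultimately show ?thesis by (intro exI[of _ ?S] exI[of _ "C * R ^ p"]) simp
qed

text \<open>\<open>tangent_map\<close> fixes the source chart but prescribes a value for each target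
  chart separately; the chain rule for transition maps shows that these values form one tangent
  vector.\<close>

lemma tangent_map_eq:
 assumes G: "C1_map_on \<A> W G" "open W" "x \<in> W"
 shows "tangent_map \<A> G x v = tgt (chart_at \<A> (G x)) (G x)
   (FD (snd (chart_at \<A> (G x)) \<circ> G \<circ> chart_inv (chart_at \<A> x)) (snd (chart_at \<A> x) x) (v (chart_at \<A> x)))"
  and "linear (FD (snd (chart_at \<A> (G x)) \<circ> G \<circ> chart_inv (chart_at \<A> x)) (snd (chart_at \<A> x) x))"
  and "c \<in> \<A> ==> d \<in> \<A> ==> x \<in> fst c ==> G x \<in> fst d ==> (snd d \<circ> G \<circ> chart_inv c) differentiable (at (snd c x))"
proof -
 let ?h = "%c d. snd d \<circ> G \<circ> chart_inv c"
 let ?c = "chart_at \<A> x" and ?d = "chart_at \<A> (G x)"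
 note c = chart_at[of x] and d = chart_at[of "G x"]
 have df: "(?h c d) differentiable (at (snd c x))"
  if "c \<in> \<A>" "d \<in> \<A>" "x \<in> fst c" "G x \<in> fst d" for c d
 proof -
  have "Ck_on 1 (snd c ` (fst c \<inter> W \<inter> G -` fst d)) (?h c d)"
   using G(1) that unfolding C1_map_on_def by blast
  moreover have "snd c x \<in> snd c ` (fst c \<inter> W \<inter> G -` fst d)" using that G(3) by auto
  ultimately show ?thesis unfolding One_nat_def Ck_on.simps by blast
 qed
 thus "c \<in> \<A> ==> d \<in> \<A> ==> x \<in> fst c ==> G x \<in> fst d ==> (?h c d) differentiable (at (snd c x))" .
 note D0 = df[OF c(1) d(1) c(2) d(2)]
 thus "linear (FD (?h ?c ?d) (snd ?c x))" by (rule linear_FD)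
 show "tangent_map \<A> G x v = tgt ?d (G x) (FD (?h ?c ?d) (snd ?c x) (v ?c))"
 proof
  fix e
  show "tangent_map \<A> G x v e = tgt ?d (G x) (FD (?h ?c ?d) (snd ?c x) (v ?c)) e"
  proof (cases "e \<in> \<A> \<and> G x \<in> fst e")
   case True
   have z: "(?h ?c ?d) (snd ?c x) = snd ?d (G x)" using c by simp
   have "((snd e \<circ> chart_inv ?d) \<circ> (?h ?c ?d) has_derivative
     coord_change ?d e (G x) \<circ> FD (?h ?c ?d) (snd ?c x)) (at (snd ?c x))"
    using diff_chain_at[OF has_FD[OF D0]] transition_has_derivative[OF d(1) _ d(2), of e] True unfolding z by blast
   hence D: "((snd e \<circ> chart_inv ?d) \<circ> (?h ?c ?d) has_derivative
     coord_change ?d e (G x) \<circ> FD (?h ?c ?d) (snd ?c x)) (at (snd ?c x))" .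
   have "open (G -` fst ?d \<inter> W)"
    using continuous_on_open_vimage[OF G(2), of G] G(1) chart_open(1)[OF d(1)] unfolding C1_map_on_def by blast
   hence oS: "open (snd ?c ` (fst ?c \<inter> (G -` fst ?d \<inter> W)))" by (rule open_chart_image[OF c(1)])
   have "((?h ?c e) has_derivative
     coord_change ?d e (G x) \<circ> FD (?h ?c ?d) (snd ?c x)) (at (snd ?c x))"
    by (rule has_derivative_transform_within_open[OF D oS])
     (use c d G(3) chart_inv_snd[OF c(1)] chart_inv_snd[OF d(1)] in auto)
   hence "FD (?h ?c e) (snd ?c x) =
     coord_change ?d e (G x) \<circ> FD (?h ?c ?d) (snd ?c x)" by (rule FD_eqI)
   thus ?thesis using True by (simp add: tangent_map_def tgt_apply Let_def)
  qed (auto simp: tangent_map_def tangent_of_def)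
 qed
qed

lemma Tm_compose:
 fixes h :: "'v::euclidean_space => 'a"
 assumes h: "C1M h" and G: "C1_map_on \<A> W G" "open W" "h s \<in> W"
 shows "Tm (%s. G (h s)) s u = tangent_map \<A> G (h s) (Tm h s u)"
proof -
 let ?c = "chart_at \<A> (h s)" and ?d = "chart_at \<A> (G (h s))"
 note c = chart_at[of "h s"] and d = chart_at[of "G (h s)"]
 note t = tangent_map_eq[OF G]
 have "((snd ?d \<circ> G \<circ> chart_inv ?c) \<circ> (%r. snd ?c (h r)) has_derivative
   FD (snd ?d \<circ> G \<circ> chart_inv ?c) (snd ?c (h s)) \<circ> FD (%r. snd ?c (h r)) s) (at s)"
  by (rule diff_chain_at[OF C1M_has_derivative[OF h c] has_FD[OF t(3)[OF c(1) d(1) c(2) d(2)]]])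
 hence "((%r. snd ?d (G (h r))) has_derivative
   FD (snd ?d \<circ> G \<circ> chart_inv ?c) (snd ?c (h s)) \<circ> FD (%r. snd ?c (h r)) s) (at s)"
  by (rule has_derivative_transform_within_open[OF _ C1M_vimage[OF h chart_open(1)[OF c(1)]]])
   (use c in "auto simp: chart_inv_snd[OF c(1)]")
 from FD_eqI[OF this] show ?thesis
  unfolding t(1) by (simp add: Tm_def[of "%s. G (h s)"] Tm_apply[OF h c])
qed

lemma nrm_nonneg: "riemannian_metric \<A> g ==> v \<in> TS x ==> 0 \<le> g x v v"
 unfolding riemannian_metric_def by blast

text \<open>Vectors of norm at most 1 have bounded coordinates, so the supremum is over a bounded
  set; homogeneity extends the estimate to all vectors.\<close>

lemma tangent_map_norm_bound:
 assumes rm: "riemannian_metric \<A> g" and G: "C1_map_on \<A> W G" "open W" "x \<in> W"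
 shows "0 \<le> tangent_map_norm \<A> g G x"
  and "v \<in> TS x ==> nrm g (G x) (tangent_map \<A> G x v) \<le> tangent_map_norm \<A> g G x * nrm g x v"
proof -
 let ?c = "chart_at \<A> x" and ?d = "chart_at \<A> (G x)"
 note c = chart_at[of x] and d = chart_at[of "G x"]
 note t = tangent_map_eq[OF G]
 let ?L = "FD (snd ?d \<circ> G \<circ> chart_inv ?c) (snd ?c x)"
 note gd = gq_props[OF rm d] and gc = gq_props[OF rm c]
 let ?S = "{v \<in> TS x. g x v v \<le> 1}"
 let ?h = "%v. sqrt (g (G x) (tangent_map \<A> G x v) (tangent_map \<A> G x v))"
 have h: "?h v = sqrt (gq g ?d (G x) (?L (v ?c)) (?L (v ?c)))" for v by (simp add: t(1) gq_def)
 obtain R where R: "R \<ge> 0" "\<And>v. v \<in> TS x ==> g x v v \<le> 1 ==> norm (v ?c) \<le> R"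
  by (rule nrm_bounded_coords[OF rm c(1), of "{snd ?c x}"]) (use c chart_inv_snd[OF c] in simp_all)
 obtain K where K: "K > 0" "\<And>u w. norm (gq g ?d (G x) u w) \<le> norm u * norm w * K"
  using bounded_bilinear.pos_bounded[OF gd(5)] by blast
 obtain L where L: "L > 0" "\<And>u. norm (?L u) \<le> norm u * L"
  using bounded_linear.pos_bounded[OF t(2)[unfolded linear_conv_bounded_linear]] by blast
 have bdd: "bdd_above (?h ` ?S)"
 proof (rule bdd_aboveI2)
  fix v assume v: "v \<in> ?S"
  hence "norm (v ?c) \<le> R" using R(2) by simp
  hence "norm (?L (v ?c)) \<le> R * L" using L(2)[of "v ?c"] L(1) by (meson mult_right_mono less_imp_le order_trans)
  hence "norm (?L (v ?c)) * norm (?L (v ?c)) * K \<le> (R * L) * (R * L) * K"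
   using K(1) R(1) L(1) by (intro mult_mono mult_right_mono) auto
  hence "gq g ?d (G x) (?L (v ?c)) (?L (v ?c)) \<le> (R * L) * (R * L) * K"
   using K(2)[of "?L (v ?c)" "?L (v ?c)"] by simp
  thus "?h v \<le> sqrt ((R * L) * (R * L) * K)" unfolding h by (rule real_sqrt_le_mono)
 qed
 have up: "?h v \<le> tangent_map_norm \<A> g G x" if "v \<in> ?S" for v
  unfolding tangent_map_norm_def by (rule cSUP_upper[OF that bdd])
 have "tgt ?c x 0 \<in> ?S" using tgt_in_TS[OF c, of 0] gc(6)[of 0 0] by (simp add: gq_def)
 from up[OF this] show N0: "0 \<le> tangent_map_norm \<A> g G x"
  unfolding h using real_sqrt_ge_zero[OF gd(3)] order_trans by blast
 assume v: "v \<in> TS x"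
 have vq: "g x v v = gq g ?c x (v ?c) (v ?c)" using tgt_of_TS[OF v c] by (simp add: gq_def)
 show "nrm g (G x) (tangent_map \<A> G x v) \<le> tangent_map_norm \<A> g G x * nrm g x v"
 proof (cases "g x v v = 0")
  case True
  hence "v ?c = 0" using gc(4) vq by simp
  hence "?h v = 0" unfolding h using linear_0[OF t(2)] gd(6)[of 0 0] by simp
  thus ?thesis using True by (simp add: nrm_def)
 next
  case False
  hence pos: "g x v v > 0" using gc(3)[of "v ?c"] vq by simp
  define r where "r = 1 / sqrt (g x v v)"
  have r: "r > 0" using pos by (simp add: r_def)
  let ?v = "tgt ?c x (r *\<^sub>R v ?c)"
  have "g x ?v ?v = r\<^sup>2 * g x v v" using gc(6)[of r "v ?c"] by (simp add: gq_def vq[unfolded gq_def])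
  also have "\<dots> = 1" using pos by (simp add: r_def power_divide)
  finally have "?v \<in> ?S" using tgt_in_TS[OF c] by simp
  from up[OF this] have "sqrt (r\<^sup>2 * gq g ?d (G x) (?L (v ?c)) (?L (v ?c))) \<le> tangent_map_norm \<A> g G x"
   unfolding h tgt_self[OF c] linear_scale[OF t(2)] gd(6) .
  hence "r * ?h v \<le> tangent_map_norm \<A> g G x" using r by (simp add: real_sqrt_mult h)
  thus ?thesis using pos by (simp add: nrm_def r_def field_simps)
 qed
qed

text \<open>Every argument is scaled to unit length and homogeneity is used in each slot. Arguments
  with zero coordinates cannot be scaled and are treated apart; there both sides vanish.\<close>

lemma form_norm_bound:
 assumes rm: "riemannian_metric \<A> g" and \<phi>: "\<phi> \<in> forms_on UNIV p" and vs: "set vs \<subseteq> TS x" "length vs = p"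
 shows "\<bar>\<phi> x vs\<bar> \<le> form_norm \<A> g p \<phi> x * prod_list (map (nrm g x) vs)"
proof -
 let ?sq = "%u. sqrt (gq g (chart_at \<A> x) x u u)"
 let ?c = "chart_at \<A> x"
 note c = chart_at[of x]
 note gc = gq_props[OF rm c]
 define a where "a us = \<phi> x (map (tgt ?c x) us)" for us
 have m: "multilin p a" using alt_form_multilin[OF forms_onD(4)[OF \<phi> c]] by (simp add: a_def[abs_def])
 have bck: "map (tgt ?c x) (map (%v. v ?c) ws) = ws" if "set ws \<subseteq> TS x" for ws
  unfolding map_map by (rule map_idI) (use that tgt_of_TS[OF _ c] in auto)
 let ?S = "{vs. length vs = p \<and> (\<forall>v\<in>set vs. v \<in> TS x \<and> g x v v \<le> 1)}"
 have bdd: "bdd_above ((%vs. \<bar>\<phi> x vs\<bar>) ` ?S)"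
 proof -
  from form_locally_bounded[OF rm \<phi>, of x] obtain S C where S: "x \<in> S"
   "\<forall>y\<in>S. \<forall>vs. length vs = p --> (\<forall>v\<in>set vs. v \<in> TS y \<and> g y v v \<le> 1) --> \<bar>\<phi> y vs\<bar> \<le> C" by (elim exE conjE)
  show ?thesis by (rule bdd_aboveI2[where M = C]) (use S in simp)
 qed
 define us where "us = map (%v. v ?c) vs"
 have us: "length us = p" "\<phi> x vs = a us" using vs bck[OF vs(1)] by (simp_all add: us_def a_def)
 have nv: "nrm g x v = sqrt (gq g ?c x (v ?c) (v ?c))" if "v \<in> set vs" for v
  using tgt_of_TS[OF _ c, of v] vs(1) that by (auto simp: nrm_def gq_def)
 show ?thesis
 proof (cases "\<exists>v\<in>set vs. v ?c = 0")
  case True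
  hence "0 \<in> set us" by (auto simp: us_def)
  hence "\<phi> x vs = 0" unfolding us(2) by (rule multilin_zero[OF m us(1)])
  moreover obtain v where v: "v \<in> set vs" "v ?c = 0" using True by blast
  have "nrm g x v = 0" using nv[OF v(1)] v(2) gc(6)[of 0 0] by simp
  hence "prod_list (map (nrm g x) vs) = 0" using v(1) by (auto simp: prod_list_zero_iff image_iff intro: rev_image_eqI)
  ultimately show ?thesis by simp
 next
  case False
  define r where "r u = 1 / ?sq u" for u
  have pos: "gq g ?c x u u > 0" if "u \<in> set us" for u
   using gc(3)[of u] gc(4)[of u] False that by (fastforce simp: us_def)
  have "map (tgt ?c x) (map (%u. r u *\<^sub>R u) us) \<in> ?S"
  proof -
   have "g x (tgt ?c x (r u *\<^sub>R u)) (tgt ?c x (r u *\<^sub>R u)) \<le> 1" if "u \<in> set us" for u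
    using gc(6)[of "r u" u] pos[OF that] by (simp add: gq_def[symmetric] r_def power_divide)
   thus ?thesis using us(1) tgt_in_TS[OF c] by auto
  qed
  from cSUP_upper[OF this bdd] have "\<bar>a (map (%u. r u *\<^sub>R u) us)\<bar> \<le> form_norm \<A> g p \<phi> x"
   by (simp add: form_norm_def a_def)
  hence *: "\<bar>prod_list (map r us) * a us\<bar> \<le> form_norm \<A> g p \<phi> x"
   unfolding multilin_scale[OF m us(1)] .
  have inv: "prod_list (map r us) * prod_list (map ?sq us) = 1 \<and> prod_list (map r us) > 0" using pos
  proof (induction us)
   case (Cons u us)
   have "gq g ?c x u u > 0" by (rule Cons.prems) simp
   hence "r u * ?sq u = 1" "r u > 0" by (simp_all add: r_def)
   moreover have "prod_list (map r us) * prod_list (map ?sq us) = 1 \<and> prod_list (map r us) > 0"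
    by (rule Cons.IH, rule Cons.prems) simp
   moreover have "(r u * prod_list (map r us)) * (?sq u * prod_list (map ?sq us)) =
    (r u * ?sq u) * (prod_list (map r us) * prod_list (map ?sq us))"
    by (simp only: mult_ac)
   ultimately show ?case by simp
  qed simp
  have "map (nrm g x) vs = map ?sq us" using nv by (simp add: us_def)
  hence pr: "prod_list (map r us) * prod_list (map (nrm g x) vs) = 1" "prod_list (map r us) > 0" using inv by simp_all
  hence q: "prod_list (map (nrm g x) vs) = 1 / prod_list (map r us)" by (simp add: field_simps)
  show ?thesis using * pr(2) unfolding q us(2) by (simp add: abs_mult field_simps)
 qed
qed

text \<open>The chain rule and the operator norm are applied once per argument; this produces the
  power \<open>p\<close> that matches the moment condition.\<close>

lemma pb_bound:
 fixes h :: "'v::euclidean_space => 'a"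
 assumes rm: "riemannian_metric \<A> g" and \<phi>: "\<phi> \<in> forms_on UNIV p" and h: "C1M h"
  and G: "C1_map_on \<A> W G" "open W" "h s \<in> W" and us: "length us = p" and C: "form_norm \<A> g p \<phi> (G (h s)) \<le> C" "0 \<le> C"
 shows "\<bar>pb \<phi> (%s. G (h s)) us s\<bar> \<le> C * (tangent_map_norm \<A> g G (h s) ^ p * prod_list (map (%u. nrm g (h s) (Tm h s u)) us))"
proof -
 let ?G = "%s. G (h s)"
 let ?q = "map (%u. nrm g (G (h s)) (Tm ?G s u)) us" and ?r = "map (%u. tangent_map_norm \<A> g G (h s) * nrm g (h s) (Tm h s u)) us"
 let ?N = "tangent_map_norm \<A> g G (h s)"
 note N = tangent_map_norm_bound[OF rm G]
 have n0: "0 \<le> nrm g x v" if "v \<in> TS x" for x v using nrm_nonneg[OF rm that] by (simp add: nrm_def)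
 have P: "0 \<le> prod_list ?q \<and>
   prod_list ?q \<le> prod_list ?r"
 proof (rule prod_list_mono, rule conjI)
  fix u
  show "0 \<le> nrm g (G (h s)) (Tm ?G s u)" by (rule n0[OF Tm_TS])
  show "nrm g (G (h s)) (Tm ?G s u) \<le> ?N * nrm g (h s) (Tm h s u)"
   unfolding Tm_compose[OF h G] by (rule N(2)[of "Tm h s u", OF Tm_TS])
 qed
 have "set (map (Tm ?G s) us) \<subseteq> TS (G (h s))" using Tm_TS[of ?G s] by auto
 from form_norm_bound[OF rm \<phi> this] us
 have "\<bar>pb \<phi> ?G us s\<bar> \<le> form_norm \<A> g p \<phi> (G (h s)) * prod_list ?q"
  by (simp add: pb_def comp_def)
 also have "\<dots> \<le> C * prod_list ?q" by (rule mult_right_mono[OF C(1)]) (use P in blast)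
 also have "\<dots> \<le> C * prod_list ?r" by (rule mult_left_mono[OF _ C(2)]) (use P in blast)
 finally show ?thesis unfolding prod_list_const_mult us .
qed

lemma continuous_on_nrm:
 fixes h :: "'v::euclidean_space => 'a"
 assumes rm: "riemannian_metric \<A> g" and h: "C1M h"
 shows "continuous_on UNIV (%s. nrm g (h s) (Tm h s u))"
proof -
 have "continuous_on (\<Union>c\<in>\<A>. h -` fst c) (%s. g (h s) (Tm h s u) (Tm h s u))"
 proof (rule continuous_on_open_UN)
  fix c assume c: "c \<in> \<A>"
  show "open (h -` fst c)" by (rule C1M_vimage[OF h chart_open(1)[OF c]])
  let ?D = "%s. FD (%r. snd c (h r)) s u"
  have cD: "continuous_on (h -` fst c) ?D" using C1M_Ck[OF h c] by simp
  have "gq g c (h s) (?D s) (?D s) = g (h s) (Tm h s u) (Tm h s u)" if "s \<in> h -` fst c" for s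
  proof -
   have s: "h s \<in> fst c" using that by simp
   have "tgt c (h s) (?D s) = Tm h s u"
    using tgt_of_TS[OF Tm_TS[of h s u] c s] Tm_apply[OF h c s, of u] by simp
   thus ?thesis by (simp add: gq_def)
  qed
  thus "continuous_on (h -` fst c) (%s. g (h s) (Tm h s u) (Tm h s u))"
   by (rule continuous_on_cong[THEN iffD1, OF refl _ gq_continuous[OF rm c Ck_on_continuous[OF C1M_Ck[OF h c]] _ cD]]) auto
 qed
 moreover have "(\<Union>c\<in>\<A>. h -` fst c) = UNIV" using chart_at by blast
 ultimately have "continuous_on UNIV (%s. g (h s) (Tm h s u) (Tm h s u))" by simp
 thus ?thesis unfolding nrm_def by (rule continuous_on_real_sqrt)
qed

end

section \<open>Expectations and measurability of integrals over cubes\<close>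

section \<open>Expectations of integrals over cubes\<close>

text \<open>By uniform continuity each subinterval contributes an error of at most e/2 times its
  length; an induction over the subintervals adds the errors up.\<close>

lemma riemann_sums_tendsto:
 fixes g :: "real => real"
 assumes g: "continuous_on {0..1} g"
 shows "(%N. (\<Sum>i<N. g (real i / real N)) / real N) \<longlonglongrightarrow> integral {0..1} g"
proof (rule LIMSEQ_I)
 fix e :: real assume e: "0 < e"
 have "uniformly_continuous_on {0..1} g" by (rule compact_uniformly_continuous[OF g compact_Icc])
 then obtain d where d: "d > 0" "\<And>x y. x \<in> {0..1} ==> y \<in> {0..1} ==> dist y x < d ==> dist (g y) (g x) < e / 2"
  unfolding uniformly_continuous_on_def using e by (meson half_gt_zero)
 obtain N0 where N0: "inverse (real (Suc N0)) < d" using reals_Archimedean[OF d(1)] by blast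
 show "\<exists>no. \<forall>n\<ge>no. norm ((\<Sum>i<n. g (real i / real n)) / real n - integral {0..1} g) < e"
 proof (intro exI allI impI)
  fix N assume "Suc N0 \<le> N"
  hence N: "0 < real N" "inverse (real N) \<le> inverse (real (Suc N0))" by (auto intro!: le_imp_inverse_le)
  have Nd: "1 / real N < d" using N N0 by (simp add: inverse_eq_divide)
  have ig: "g integrable_on {a..b}" if "0 \<le> a" "b \<le> 1" for a b
   by (rule integrable_continuous_real, rule continuous_on_subset[OF g]) (use that in auto)
  have "\<bar>integral {0..real n / real N} g - (\<Sum>i<n. g (real i / real N)) / real N\<bar> \<le> (real n / real N) * (e / 2)"
   if "n \<le> N" for n
   using that
  proof (induction n)
   case (Suc n)
   let ?a = "real n / real N" and ?b = "real (Suc n) / real N"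
   have ab: "0 \<le> ?a" "?a \<le> ?b" "?b \<le> 1" "?b - ?a = 1 / real N"
    using Suc.prems N by (auto simp: field_simps)
   have "norm (integral {?a..?b} (%r. g r - g ?a)) \<le> e / 2 * (?b - ?a)"
   proof (rule integral_bound[OF ab(2)])
    show "continuous_on {?a..?b} (%r. g r - g ?a)"
     by (intro continuous_intros continuous_on_subset[OF g]) (use ab in auto)
    fix r assume r: "r \<in> {?a..?b}"
    hence "dist r ?a < d" using Nd ab(4) by (auto simp: dist_real_def)
    thus "norm (g r - g ?a) \<le> e / 2"
    proof -
     have "r \<in> {0..1}" "?a \<in> {0..1}" using r ab order_trans[OF ab(1)] by (simp_all del: of_nat_Suc)
     from d(2)[OF this(2,1) \<open>dist r ?a < d\<close>] show ?thesis by (simp add: dist_norm)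
    qed
   qed
   moreover have "integral {?a..?b} (%r. g r - g ?a) = integral {?a..?b} g - g ?a / real N"
    using ab by (subst integral_diff) (auto intro!: ig simp: content_real)
   moreover have "integral {0..?b} g = integral {0..?a} g + integral {?a..?b} g"
    by (rule Henstock_Kurzweil_Integration.integral_combine[symmetric]) (use ab ig in auto)
   moreover have "real (Suc n) / real N * (e / 2) = real n / real N * (e / 2) + e / 2 * (1 / real N)"
    using N by (simp add: field_simps)
   ultimately show ?case using Suc.IH Suc.prems unfolding ab(4) by (simp add: add_divide_distrib)
  qed simp
  from this[of N] show "norm ((\<Sum>i<N. g (real i / real N)) / real N - integral {0..1} g) < e"
   using N(1) e by (simp add: abs_minus_commute)
 qed
qed

definition cube :: "'v::euclidean_space set" where
 "cube = {s. \<forall>i. 0 \<le> co s i \<and> co s i \<le> 1}"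

lemma upd_cube: "s \<in> cube ==> 0 \<le> r ==> r \<le> 1 ==> upd j r s \<in> cube"
 by (auto simp: cube_def co_upd)

lemma avgs_nonneg:
 assumes "continuous_on UNIV f" "\<And>s. 0 \<le> f s"
 shows "0 \<le> avgs js f s"
proof -
 have "avgs js (%_. 0) s \<le> avgs js f s" by (rule avgs_mono[OF continuous_on_const assms(1)]) (rule assms(2))
 moreover have "avgs js (%_. 0) s = 0" using fun_cong[OF avgs_scale[of js 0 f], of s] by simp
 ultimately show ?thesis by simp
qed

text \<open>Fatou's lemma for Riemann sums replaces Tonelli's theorem, so that no joint measurability is needed.\<close>

lemma nn_integral_avgs_le:
 fixes f :: "'w => 'v::euclidean_space => real"
 assumes cont: "\<And>\<omega>. continuous_on UNIV (f \<omega>)" and nn: "\<And>\<omega> s. 0 \<le> f \<omega> s"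
  and meas: "\<And>s. s \<in> cube ==> (%\<omega>. f \<omega> s) \<in> borel_measurable M"
  and le: "\<And>s. s \<in> cube ==> (\<integral>\<^sup>+\<omega>. ennreal (f \<omega> s) \<partial>M) \<le> ennreal m" and m: "0 \<le> m"
 shows "s \<in> cube ==> (%\<omega>. avgs js (f \<omega>) s) \<in> borel_measurable M \<and> (\<integral>\<^sup>+\<omega>. ennreal (avgs js (f \<omega>) s) \<partial>M) \<le> ennreal m"
proof (induction js arbitrary: s)
 case Nil
 thus ?case using meas le by simp
next
 case (Cons j js)
 let ?F = "%\<omega>. avgs js (f \<omega>)"
 let ?R = "%N \<omega>. (\<Sum>i<N. ?F \<omega> (upd j (real i / real N) s)) / real N"
 have cF: "continuous_on UNIV (?F \<omega>)" for \<omega> by (rule continuous_on_avgs[OF cont])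
 have nF: "0 \<le> ?F \<omega> s" for \<omega> s by (rule avgs_nonneg[OF cont nn])
 have lim: "(%N. ?R N \<omega>) \<longlonglongrightarrow> avgs (j # js) (f \<omega>) s" for \<omega>
  unfolding avgs.simps avg_def
  by (rule riemann_sums_tendsto, rule continuous_on_compose2[OF cF]) (auto intro!: continuous_intros)
 have pt: "upd j (real i / real N) s \<in> cube" if "i < N" for i N
  using that by (intro upd_cube Cons.prems) (auto simp: field_simps)
 have mF: "(%\<omega>. ?F \<omega> (upd j (real i / real N) s)) \<in> borel_measurable M" if "i < N" for i N
  using Cons.IH[OF pt[OF that]] by (rule conjunct1)
 have mR: "?R N \<in> borel_measurable M" for N
  by (intro borel_measurable_divide borel_measurable_sum borel_measurable_const mF) simp
 have meas': "(%\<omega>. avgs (j # js) (f \<omega>) s) \<in> borel_measurable M"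
  by (rule borel_measurable_LIMSEQ_real[OF _ mR]) (rule lim)
 have RI: "(\<integral>\<^sup>+\<omega>. ennreal (?R N \<omega>) \<partial>M) \<le> ennreal m" for N
 \<comment> \<open>For N = 0 the mean is 0, as division by zero gives 0, and the bound is
   trivial.\<close>
 proof (cases "N = 0")
  case False
  have "(\<integral>\<^sup>+\<omega>. ennreal (?R N \<omega>) \<partial>M) = (\<integral>\<^sup>+\<omega>. (\<Sum>i<N. ennreal (1 / real N) * ennreal (?F \<omega> (upd j (real i / real N) s))) \<partial>M)"
   by (rule nn_integral_cong) (simp add: sum_divide_distrib nF ennreal_mult[symmetric])
  also have "\<dots> = (\<Sum>i<N. ennreal (1 / real N) * (\<integral>\<^sup>+\<omega>. ennreal (?F \<omega> (upd j (real i / real N) s)) \<partial>M))"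
   using mF by (subst nn_integral_sum) (auto intro!: sum.cong nn_integral_cmult)
  also have "\<dots> \<le> (\<Sum>i<N. ennreal (1 / real N) * ennreal m)"
   by (intro sum_mono mult_left_mono Cons.IH[THEN conjunct2] pt) auto
  also have "\<dots> = ennreal m"
   using False m by (simp add: ennreal_mult[symmetric] ennreal_of_nat_eq_real_of_nat)
  finally show ?thesis .
 qed simp
 have "(\<integral>\<^sup>+\<omega>. ennreal (avgs (j # js) (f \<omega>) s) \<partial>M) = (\<integral>\<^sup>+\<omega>. liminf (%N. ennreal (?R N \<omega>)) \<partial>M)"
 proof (rule nn_integral_cong)
  fix \<omega>
  have "(%N. ennreal (?R N \<omega>)) \<longlonglongrightarrow> ennreal (avgs (j # js) (f \<omega>) s)"
   by (rule tendsto_ennrealI[OF lim])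
  from lim_imp_Liminf[OF _ this] show "ennreal (avgs (j # js) (f \<omega>) s) = liminf (%N. ennreal (?R N \<omega>))" by simp
 qed
 also have "\<dots> \<le> liminf (%N. \<integral>\<^sup>+\<omega>. ennreal (?R N \<omega>) \<partial>M)"
  by (rule nn_integral_liminf) (rule measurable_compose[OF mR measurable_ennreal])
 also have "\<dots> \<le> limsup (%N. \<integral>\<^sup>+\<omega>. ennreal (?R N \<omega>) \<partial>M)" by (rule Liminf_le_Limsup) simp
 also have "\<dots> \<le> ennreal m" by (rule Limsup_bounded) (simp_all add: RI)
 finally show ?case using meas' by simp
qed

section \<open>Measurability of pull-backs\<close>

text \<open>\<open>Y\<close> is meaningful only where \<open>ok\<close> holds, which for the flow
  means before explosion. Measurability is assumed of events that include \<open>ok\<close>, hence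
  the default value 0 elsewhere.\<close>

lemma measurable_on_open:
 fixes f :: "'a::topological_space => 'z::{topological_space, zero}"
 assumes mY: "\<And>V. open V ==> {\<omega> \<in> space M. ok \<omega> \<and> Y \<omega> \<in> V} \<in> sets M" and U: "open U" "continuous_on U f"
 shows "(%\<omega>. if ok \<omega> \<and> Y \<omega> \<in> U then f (Y \<omega>) else 0) \<in> borel_measurable M"
proof (rule borel_measurableI)
 fix S :: "'z set" assume S: "open S"
 have "open (f -` S \<inter> U)" using continuous_on_open_vimage[OF U(1), of f] U(2) S by blast
 from mY[OF this] mY[OF U(1)]
 have "{\<omega> \<in> space M. ok \<omega> \<and> Y \<omega> \<in> f -` S \<inter> U} \<union> (if 0 \<in> S then space M - {\<omega> \<in> space M. ok \<omega> \<and> Y \<omega> \<in> U} else {}) \<in> sets M"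
  by auto
 also have "{\<omega> \<in> space M. ok \<omega> \<and> Y \<omega> \<in> f -` S \<inter> U} \<union> (if 0 \<in> S then space M - {\<omega> \<in> space M. ok \<omega> \<and> Y \<omega> \<in> U} else {}) =
   (%\<omega>. if ok \<omega> \<and> Y \<omega> \<in> U then f (Y \<omega>) else 0) -` S \<inter> space M"
  by (auto split: if_splits)
 finally show "(%\<omega>. if ok \<omega> \<and> Y \<omega> \<in> U then f (Y \<omega>) else 0) -` S \<inter> space M \<in> sets M" .
qed

text \<open>A derivative as the limit of a sequence built from values of the map, so that
  measurability of the values passes to it.\<close>

lemma difference_quotients_tendsto:
 fixes f :: "'v::real_normed_vector => 'e::real_normed_vector"
 assumes "(f has_derivative f') (at s)"
 shows "(%n. real (Suc n) *\<^sub>R (f (s + (1 / real (Suc n)) *\<^sub>R u) - f s)) \<longlonglongrightarrow> f' u"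
proof (cases "u = 0")
 case True
 thus ?thesis using linear_0[OF has_derivative_linear[OF assms]] by simp
next
 case False
 let ?h = "%n. (1 / real (Suc n)) *\<^sub>R u"
 have lin: "linear f'" by (rule has_derivative_linear[OF assms])
 have "(%n. 1 / real (Suc n)) \<longlonglongrightarrow> 0" using LIMSEQ_inverse_real_of_nat by (simp add: inverse_eq_divide)
 from tendsto_scaleR[OF this tendsto_const[of u]] have "?h \<longlonglongrightarrow> 0" by simp
 hence "filterlim ?h (at 0) sequentially" unfolding filterlim_at using False by simp
 moreover have "((%h. norm (f (s + h) - f s - f' h) / norm h) \<longlongrightarrow> 0) (at 0)"
  using assms by (simp add: has_derivative_at)
 ultimately have "(%n. norm (f (s + ?h n) - f s - f' (?h n)) / norm (?h n)) \<longlonglongrightarrow> 0"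
  by (rule filterlim_compose[rotated])
 from tendsto_mult[OF tendsto_const[of "norm u"] this]
 have "(%n. norm u * (norm (f (s + ?h n) - f s - f' (?h n)) / norm (?h n))) \<longlonglongrightarrow> 0" by simp
 moreover have "norm u * (norm (f (s + ?h n) - f s - f' (?h n)) / norm (?h n)) =
   norm (real (Suc n) *\<^sub>R (f (s + ?h n) - f s) - f' u)" for n
 proof -
  have "real (Suc n) *\<^sub>R (f (s + ?h n) - f s) - f' u = real (Suc n) *\<^sub>R (f (s + ?h n) - f s - f' (?h n))"
   by (simp add: linear_scale[OF lin] scaleR_diff_right)
  hence "norm (real (Suc n) *\<^sub>R (f (s + ?h n) - f s) - f' u) = real (Suc n) * norm (f (s + ?h n) - f s - f' (?h n))"
   by (simp only: norm_scaleR abs_of_nat)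
  moreover have "norm (?h n) = norm u / real (Suc n)" by simp
  ultimately show ?thesis using False by (simp del: of_nat_Suc)
 qed
 ultimately have "(%n. norm (real (Suc n) *\<^sub>R (f (s + ?h n) - f s) - f' u)) \<longlonglongrightarrow> 0" by simp
 thus ?thesis by (rule LIM_zero_cancel[OF tendsto_norm_zero_cancel])
qed

context good_cover
begin

text \<open>In a fixed chart the coordinates are measurable at each parameter, and derivatives are
  limits of their difference quotients. The chart depends on \<omega> through the first of countably
  many cover sets containing the point. The measurable function \<open>h\<close> agrees with the
  pull-back only on paths that survive on the whole cube and are C1.\<close>

lemma pb_measurable:
 fixes Y :: "'w => 'v::euclidean_space => 'a"
 assumes mY: "\<And>r V. open V ==> {\<omega> \<in> space M. ok \<omega> r \<and> Y \<omega> r \<in> V} \<in> sets M"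
  and \<phi>: "\<phi> \<in> forms_on UNIV k" and us: "length us = k"
 shows "\<exists>h\<in>borel_measurable M. \<forall>\<omega>. (\<forall>r. ok \<omega> r) --> C1M (Y \<omega>) --> pb \<phi> (Y \<omega>) us s = h \<omega>"
proof -
 have "\<forall>j. \<exists>c. c \<in> \<A> \<and> B j \<subseteq> fst c"
 proof
  fix j
  show "\<exists>c. c \<in> \<A> \<and> B j \<subseteq> fst c"
  proof (cases "B j = {}")
   case True
   thus ?thesis using cc_in by blast
  next
   case False
   then obtain x where "x \<in> B j" by blast
   thus ?thesis using B_convex[of x j] cc_in by blast
  qed
 qed
 from choice[OF this] obtain c where cA: "\<forall>j. c j \<in> \<A> \<and> B j \<subseteq> fst (c j)" by (rule exE)
 hence c: "c j \<in> \<A>" "B j \<subseteq> fst (c j)" for j by auto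
 define Z where "Z j r \<omega> = (if ok \<omega> r \<and> Y \<omega> r \<in> fst (c j) then snd (c j) (Y \<omega> r) else 0)" for j r \<omega>
 have mZ: "Z j r \<in> borel_measurable M" for j r unfolding Z_def[abs_def]
  by (rule measurable_on_open[of M "%\<omega>. ok \<omega> r" "%\<omega>. Y \<omega> r", OF mY chart_open(1)[OF c(1)] continuous_on_chart[OF c(1)]])
 \<comment> \<open>\<open>lim\<close> is measurable whether or not the quotients converge; it is the
   derivative on the good paths only.\<close>
 define D where "D j u \<omega> = lim (%n. real (Suc n) *\<^sub>R (Z j (s + (1 / real (Suc n)) *\<^sub>R u) \<omega> - Z j s \<omega>))" for j u \<omega>
 have mD: "D j u \<in> borel_measurable M" for j u unfolding D_def[abs_def]
  by (intro borel_measurable_lim_metric borel_measurable_scaleR borel_measurable_const borel_measurable_diff mZ)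
 define a where "a j ws \<omega> = (if ok \<omega> s \<and> Y \<omega> s \<in> fst (c j) then \<phi> (Y \<omega> s) (map (tgt (c j) (Y \<omega> s)) ws) else 0)" for j ws \<omega>
 have ma: "a j ws \<in> borel_measurable M" if "length ws = k" for j ws
 proof -
  have "smooth_on (snd (c j) ` fst (c j)) (loc (c j) \<phi> ws)"
   using forms_onD(5)[OF \<phi> c(1) that] by simp
  from continuous_on_compose2[OF smooth_on_continuous[OF this] continuous_on_chart[OF c(1)] subset_refl]
  have "continuous_on (fst (c j)) (%y. \<phi> y (map (tgt (c j) y) ws))"
   by (rule continuous_on_cong[THEN iffD1, OF refl, rotated]) (simp add: loc_eq[OF c(1)])
  from measurable_on_open[of M "%\<omega>. ok \<omega> s" "%\<omega>. Y \<omega> s", OF mY chart_open(1)[OF c(1)] this]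
  show ?thesis unfolding a_def[abs_def] .
 qed
 define H where "H j \<omega> = a j (map (%W. W \<omega>) (map (D j) us)) \<omega>" for j \<omega>
 have mH: "H j \<in> borel_measurable M" for j unfolding H_def[abs_def]
 proof (rule multilin_regularity[where Q = "%f. f \<in> borel_measurable M" and S = "space M"])
  show "multilin (length (map (D j) us)) (%ws. a j ws \<omega>)" for \<omega>
  proof (cases "ok \<omega> s \<and> Y \<omega> s \<in> fst (c j)")
   case True
   thus ?thesis
    using alt_form_multilin[OF forms_onD(4)[OF \<phi> c(1), of "Y \<omega> s"]] us by (simp add: a_def)
  next
   case False
   hence "(%ws. a j ws \<omega>) = (%_. 0)" by (auto simp: a_def)
   thus ?thesis by (simp add: multilin_def linear_zero)
  qed
  show "(%\<omega>. W \<omega> \<bullet> b) \<in> borel_measurable M" if "W \<in> set (map (D j) us)" for W b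
   using that mD by (auto intro!: borel_measurable_inner)
  show "a j ws \<in> borel_measurable M" if "length ws = length (map (D j) us)" for ws
   by (rule ma) (use that us in simp)
  show "g \<in> borel_measurable M" if "f \<in> borel_measurable M" "\<And>\<omega>. \<omega> \<in> space M ==> f \<omega> = g \<omega>" for f g :: "'w => real"
   using measurable_cong[of M f g borel] that by simp
 qed (auto intro: borel_measurable_times borel_measurable_sum)
 define J where "J \<omega> = (LEAST j. ok \<omega> s \<and> Y \<omega> s \<in> B j)" for \<omega>
 have mJ: "J \<in> measurable M (count_space UNIV)"
  unfolding J_def[abs_def] by (rule measurable_Least) (rule pred_intros_logic(1)[THEN predE] | simp add: pred_def mY[OF B_open])+
 show ?thesis
 proof (rule bexI[of _ "%\<omega>. H (J \<omega>) \<omega>"], intro allI impI)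
  show "(%\<omega>. H (J \<omega>) \<omega>) \<in> borel_measurable M" by (rule measurable_compose_countable[OF mH mJ])
  fix \<omega> assume ok: "\<forall>r. ok \<omega> r" and C: "C1M (Y \<omega>)"
  have "\<exists>j. Y \<omega> s \<in> B j" using B_cover by blast
  hence "\<exists>j. ok \<omega> s \<and> Y \<omega> s \<in> B j" using ok by simp
  hence "ok \<omega> s \<and> Y \<omega> s \<in> B (J \<omega>)" unfolding J_def by (rule LeastI_ex)
  hence Yc: "Y \<omega> s \<in> fst (c (J \<omega>))" using c(2) by blast
  let ?c = "c (J \<omega>)"
  note hd = C1M_has_derivative[OF C c(1) Yc]
  have DD: "D (J \<omega>) u \<omega> = FD (%r. snd ?c (Y \<omega> r)) s u" for u
  proof -
   let ?h = "%n. s + (1 / real (Suc n)) *\<^sub>R u"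
   have "(%n. 1 / real (Suc n)) \<longlonglongrightarrow> 0" using LIMSEQ_inverse_real_of_nat by (simp add: inverse_eq_divide)
   from tendsto_add[OF tendsto_const[of s] tendsto_scaleR[OF this tendsto_const[of u]]] have hs: "?h \<longlonglongrightarrow> s" by simp
   have o: "open (Y \<omega> -` fst ?c)" by (rule C1M_vimage[OF C chart_open(1)[OF c(1)]])
   have "\<forall>\<^sub>F n in sequentially. ?h n \<in> Y \<omega> -` fst ?c"
    by (rule topological_tendstoD[OF hs o]) (use Yc in simp)
   hence ev: "\<forall>\<^sub>F n in sequentially. real (Suc n) *\<^sub>R (snd ?c (Y \<omega> (?h n)) - snd ?c (Y \<omega> s)) =
     real (Suc n) *\<^sub>R (Z (J \<omega>) (?h n) \<omega> - Z (J \<omega>) s \<omega>)"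
    by (rule eventually_mono) (use ok Yc in "simp add: Z_def")
   have "(%n. real (Suc n) *\<^sub>R (Z (J \<omega>) (?h n) \<omega> - Z (J \<omega>) s \<omega>)) \<longlonglongrightarrow> FD (%r. snd ?c (Y \<omega> r)) s u"
    by (rule tendsto_cong[THEN iffD1, OF ev difference_quotients_tendsto[OF hd]])
   thus ?thesis unfolding D_def by (rule limI)
  qed
  have "pb \<phi> (Y \<omega>) us s = loc ?c \<phi> (map (FD (%r. snd ?c (Y \<omega> r)) s) us) (snd ?c (Y \<omega> s))"
   by (rule pb_chart[OF C c(1) Yc])
  also have "\<dots> = H (J \<omega>) \<omega>"
   using ok Yc by (simp add: loc_eq[OF c(1) Yc] H_def a_def comp_def DD)
  finally show "pb \<phi> (Y \<omega>) us s = H (J \<omega>) \<omega>" .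
 qed
qed

end

section \<open>Decay in expectation and vanishing of cycle integrals\<close>

section \<open>Decay of integrals over cycles\<close>

text \<open>A real number strictly between the upper limit and 0 turns the logarithmic rate into an
  exponential bound, uniform over \<open>K\<close> from some time on.\<close>

lemma moment_decay:
 assumes "strongly_moment_stable P \<A> g \<xi> F p" "compact K"
 shows "\<exists>c<0. \<forall>\<^sub>F t in at_top. \<forall>x\<in>K. derivative_moment P \<A> g \<xi> F p t x \<le> ennreal (exp (c * t))"
proof -
 let ?E = "%t x. derivative_moment P \<A> g \<xi> F p t x"
 let ?S = "%t::real. SUP x\<in>K. ereal (1 / t) * log_ennreal (?E t x)"
 have "Limsup at_top ?S < 0" using assms unfolding strongly_moment_stable_def by blast
 from ereal_dense2[OF this] obtain c where c: "Limsup at_top ?S < ereal c" "ereal c < 0" by blast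
 have "\<forall>\<^sub>F t in at_top. \<forall>x\<in>K. ?E t x \<le> ennreal (exp (c * t))"
  using Limsup_lessD[OF c(1)] eventually_gt_at_top[of 0]
 proof eventually_elim
  case (elim t)
  show ?case
  proof
   fix x assume x: "x \<in> K"
   have "ereal (1 / t) * log_ennreal (?E t x) \<le> ?S t" by (rule SUP_upper[OF x])
   hence less: "ereal (1 / t) * log_ennreal (?E t x) < ereal c" using elim(1) by (rule le_less_trans)
   show "?E t x \<le> ennreal (exp (c * t))"
   proof (cases "?E t x" rule: ennreal_cases)
    case (real r)
    show ?thesis
    proof (cases "r = 0")
     case False
     hence r: "r > 0" using real by simp
     hence "log_ennreal (?E t x) = ereal (ln r)" using real by (simp add: log_ennreal_def)
     hence "(1 / t) * ln r < c" using less by simp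
     hence "ln r < c * t" using elim(2) by (simp add: field_simps)
     hence "exp (ln r) < exp (c * t)" by (simp only: exp_less_mono)
     hence "r \<le> exp (c * t)" using r by simp
     thus ?thesis using real by (simp add: ennreal_leI)
    qed (use real in simp)
   next
    case top
    hence "log_ennreal (?E t x) = \<infinity>" by (simp add: log_ennreal_def)
    thus ?thesis using less elim(2) by simp
   qed
  qed
 qed
 thus ?thesis using c(2) by (intro exI[of _ c]) simp
qed

lemma continuous_on_prod_list:
 fixes f :: "'b => 'v::topological_space => real"
 assumes "\<And>u. continuous_on S (f u)"
 shows "continuous_on S (%s. prod_list (map (%u. f u s) us))"
 by (induction us) (auto intro!: continuous_intros assms)

lemma cube_eq: "(cube :: 'v::euclidean_space set) = cbox 0 One"
proof (rule subset_antisym; rule subsetI)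
 fix s :: 'v assume s: "s \<in> cube"
 have "0 \<le> s \<bullet> b \<and> s \<bullet> b \<le> 1" if "b \<in> Basis" for b
 proof -
  have "b \<in> eb ` {..<DIM('v)}" using that bij_betw_imp_surj_on[OF eb_bij[where 'v='v]] by simp
  then obtain i where "b = eb i" by (rule imageE)
  thus ?thesis using s by (simp add: cube_def co_def)
 qed
 thus "s \<in> cbox 0 One" by (simp add: mem_box)
next
 fix s :: 'v assume s: "s \<in> cbox 0 One"
 have "0 \<le> co s i \<and> co s i \<le> 1" for i
 proof (cases "i < DIM('v)")
  case True
  thus ?thesis using s eb_Basis[OF True] by (simp add: mem_box co_def)
 qed (simp add: co_ge)
 thus "s \<in> cube" by (simp add: cube_def)
qed

context good_cycle
begin

text \<open>The sum is not random: on almost every path it equals the integral over the moved cycle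
  at each time \<open>t\<close>. Its absolute value is therefore at most the expectation of a bound
  for the moved integral, which is a constant times exp(c t) for all large \<open>t\<close>.\<close>

theorem cycle_integral_zero:
 fixes F :: "real => 'w => 'a => 'a" and \<xi> :: "'w => 'a => ereal"
 assumes rm: "riemannian_metric \<A> g" and bdd: "bounded_form \<A> g (Suc k) \<phi>" and P: "prob_space P"
  and meas: "\<And>x t U. 0 \<le> t ==> open U ==> {\<omega> \<in> space P. ereal t < \<xi> \<omega> x \<and> F t \<omega> x \<in> U} \<in> sets P"
  and flow: "AE \<omega> in P. C1_flow (%t. {x. ereal t < \<xi> \<omega> x}) (%t. F t \<omega>)"
  and complete: "AE \<omega> in P. \<forall>x\<in>KA. \<xi> \<omega> x = \<infinity>"
  and stable: "strongly_moment_stable P \<A> g \<xi> F (Suc k)"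
 shows "(\<Sum>l\<in>A. a l * Iv T \<phi> l) = 0"
proof -
 let ?G = "%t \<omega> l (s::'v). F t \<omega> (cu l s)" and ?D = "%\<omega> t. {x. ereal t < \<xi> \<omega> x}"
 let ?b = "%t \<omega> l. pb \<phi> (?G t \<omega> l) (ebs (Suc k))" and ?pr = "%l s. prod_list (map (%u. nrm g (cu l s) (Tm (cu l) s (u::'v))) (ebs (Suc k)))"
 interpret prob_space P by (rule P)
 let ?p = "Suc k" and ?S = "\<Sum>l\<in>A. a l * Iv T \<phi> l"
 let ?ok = "%\<omega>. C1_flow (?D \<omega>) (%t. F t \<omega>) \<and> (\<forall>x\<in>KA. \<xi> \<omega> x = \<infinity>)"
 obtain N where N: "{\<omega> \<in> space P. \<not> ?ok \<omega>} \<subseteq> N" "emeasure P N = 0" "N \<in> sets P"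
  by (rule AE_E[OF AE_conjI[OF flow complete]])
 \<comment> \<open>The set where the path properties hold need not be measurable. Removing a
   measurable null set that covers the exceptions gives a measurable event, off which the integrands
   are set to 0.\<close>
 define good where "good \<omega> \<longleftrightarrow> \<omega> \<in> space P \<and> \<omega> \<notin> N" for \<omega>
 have mg: "Measurable.pred P good"
  unfolding good_def[abs_def] pred_def using N(3) by (auto simp: Collect_conj_eq intro!: sets.Int sets.Diff)
 have AEg: "AE \<omega> in P. good \<omega>" by (rule AE_I[OF _ N(2,3)]) (auto simp: good_def)
 have gd: "C1_flow (?D \<omega>) (%t. F t \<omega>)" "KA \<subseteq> ?D \<omega> t" if "good \<omega>" for \<omega> t
 proof -
  have "?ok \<omega>" using N(1) that unfolding good_def by blast
  thus "C1_flow (?D \<omega>) (%t. F t \<omega>)" "KA \<subseteq> ?D \<omega> t" by auto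
 qed
 have inv: "Nc \<phi> (F t \<omega>) = ?S" and C1: "l \<in> A ==> C1M (?G t \<omega> l)" if "0 \<le> t" "good \<omega>" for t \<omega> l
  using Nc_flow[OF gd[OF that(2)] that(1)] unfolding C1A_def by blast+
 from bdd obtain C0 where C0: "\<forall>y\<in>range (form_norm \<A> g ?p \<phi>). y \<le> C0"
  unfolding bounded_form_def bdd_above_def by (rule exE)
 have C: "form_norm \<A> g ?p \<phi> x \<le> max 0 C0" "0 \<le> max 0 C0" for x
  using C0[rule_format, OF rangeI, of x] by simp_all
 have "\<forall>l. \<exists>m\<ge>0. l \<in> A --> (\<forall>s\<in>cube. ?pr l s \<le> m)"
 proof
  fix l
  show "\<exists>m\<ge>0. l \<in> A --> (\<forall>s\<in>cube. ?pr l s \<le> m)"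
  proof (cases "l \<in> A")
   case True
   let ?h = "%s::'v. ?pr l s"
   have "continuous_on UNIV ?h" by (rule continuous_on_prod_list) (rule continuous_on_nrm[OF rm C1M_cu[OF True]])
   hence "compact (?h ` cube)"
    unfolding cube_eq by (intro compact_continuous_image compact_cbox) (rule continuous_on_subset, auto)
   from compact_imp_bounded[OF this] obtain m where m: "\<forall>y\<in>?h ` cube. norm y \<le> m"
    unfolding bounded_iff by (rule exE)
   have "?h s \<le> max 0 m" if "s \<in> cube" for s
   proof -
    have "norm (?h s) \<le> m" by (rule m[rule_format, OF imageI[OF that]])
    thus ?thesis by simp
   qed
   thus ?thesis by (intro exI[of _ "max 0 m"]) simp
  qed (intro exI[of _ 0], simp)
 qed
 from choice[OF this] obtain m where m: "\<forall>l. 0 \<le> m l \<and> (l \<in> A --> (\<forall>s\<in>cube. ?pr l s \<le> m l))"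
  by (rule exE)
 \<comment> \<open>The summand 1 makes \<open>Q l\<close> positive, so that it may be divided
   by.\<close>
 define Q where "Q l = max 0 C0 * m l + 1" for l
 have Q: "Q l > 0" for l using m by (auto simp: Q_def intro!: add_nonneg_pos)
 obtain c where c: "c < 0" "\<forall>\<^sub>F t in at_top. \<forall>x\<in>KA. derivative_moment P \<A> g \<xi> F ?p t x \<le> ennreal (exp (c * t))"
  using moment_decay[OF stable compact_KA] by (elim exE conjE) (rule that)
 define R where "R = (\<Sum>l\<in>A. \<bar>a l\<bar> * Q l)"
 have bound: "\<bar>?S\<bar> \<le> R * exp (c * t)"
  if t: "0 \<le> t" and dm: "\<forall>x\<in>KA. derivative_moment P \<A> g \<xi> F ?p t x \<le> ennreal (exp (c * t))" for t
 proof -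
  define f where "f l \<omega> s = (if good \<omega> then \<bar>?b t \<omega> l s\<bar> else 0)" for l \<omega> s
  have cont: "continuous_on UNIV (f l \<omega>)" if "l \<in> A" for l \<omega>
  proof (cases "good \<omega>")
   case True
   have "continuous_on UNIV (?b t \<omega> l)"
    by (rule continuous_on_pb[OF C1[OF t True that] \<phi>U]) simp_all
   from continuous_on_rabs[OF this] show ?thesis using True by (simp add: f_def[abs_def])
  qed (simp add: f_def[abs_def])
  have nn: "0 \<le> f l \<omega> s" for l \<omega> s by (simp add: f_def)
  have ms: "(%\<omega>. f l \<omega> s) \<in> borel_measurable P" if l: "l \<in> A" for l s
  proof -
   obtain h where h: "h \<in> borel_measurable P" "\<forall>\<omega>. (\<forall>r::'v. ereal t < \<xi> \<omega> (cu l r)) --> C1M (%r::'v. F t \<omega> (cu l r)) -->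
     pb \<phi> (%r::'v. F t \<omega> (cu l r)) (ebs ?p) s = h \<omega>"
    using pb_measurable[where ok = "%\<omega> r::'v. ereal t < \<xi> \<omega> (cu l r)" and Y = "%\<omega> r::'v. F t \<omega> (cu l r)" and M = P and s = s,
      OF meas[OF t] \<phi>U, of "ebs ?p"] by (auto simp del: length_ebs simp: length_ebs)
   have "f l \<omega> s = (if good \<omega> then \<bar>h \<omega>\<bar> else 0)" for \<omega>
   proof (cases "good \<omega>")
    case True
    have "\<forall>r::'v. ereal t < \<xi> \<omega> (cu l r)" using gd(2)[OF True, of t] cu_in_KA[OF l] by blast
    with h(2) C1[OF t True l] have "pb \<phi> (%r::'v. F t \<omega> (cu l r)) (ebs ?p) s = h \<omega>" by simp
    thus ?thesis using True by (simp add: f_def)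
   qed (simp add: f_def)
   hence "(%\<omega>. f l \<omega> s) = (%\<omega>. if good \<omega> then \<bar>h \<omega>\<bar> else 0)" by (rule ext)
   thus ?thesis using measurable_If[OF borel_measurable_abs[OF h(1)] measurable_const[of 0] mg[unfolded pred_def]] by simp
  qed
  have le: "(\<integral>\<^sup>+\<omega>. ennreal (f l \<omega> s) \<partial>P) \<le> ennreal (Q l * exp (c * t))" if l: "l \<in> A" and s: "s \<in> cube" for l and s :: 'v
  proof -
   let ?x = "cu l s"
   have pt: "f l \<omega> s / Q l \<le> tangent_map_norm \<A> g (F t \<omega>) ?x ^ ?p \<and> ereal t < \<xi> \<omega> ?x" if \<omega>: "good \<omega>" for \<omega>
   proof -
    have W: "?x \<in> ?D \<omega> t" using gd(2)[OF \<omega>, of t] cu_in_KA[OF l] by blast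
    have G: "C1_map_on \<A> (?D \<omega> t) (F t \<omega>)" "open (?D \<omega> t)" using gd(1)[OF \<omega>] t unfolding C1_flow_def by blast+
    let ?N = "tangent_map_norm \<A> g (F t \<omega>) ?x"
    have N0: "0 \<le> ?N ^ ?p" by (rule zero_le_power[OF tangent_map_norm_bound(1)[OF rm G W]])
    have "f l \<omega> s \<le> max 0 C0 * (?N ^ ?p * ?pr l s)"
     using pb_bound[where h = "cu l" and s = s, OF rm \<phi>U C1M_cu[OF l] G W length_ebs C] \<omega> by (simp add: f_def)
    also have "\<dots> \<le> max 0 C0 * (?N ^ ?p * m l)"
     using m l s by (intro mult_left_mono[OF mult_left_mono[OF _ N0] C(2)]) blast
    also have "\<dots> \<le> Q l * ?N ^ ?p" using N0 unfolding Q_def by (simp add: distrib_right mult_ac)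
    finally show ?thesis using Q[of l] W by (simp add: field_simps)
   qed
   \<comment> \<open>With \<open>Q l\<close> divided out beforehand, the comparison with the moment
     is plain monotonicity of integrals. The constant is pulled out on the side of
     \<open>f l\<close>, whose measurability is known, and not on that of the operator norm, for
     which it has not been established.\<close>
   have "(\<integral>\<^sup>+\<omega>. ennreal (f l \<omega> s / Q l) \<partial>P) \<le> derivative_moment P \<A> g \<xi> F ?p t ?x"
    unfolding derivative_moment_def
    by (rule nn_integral_mono_AE, rule eventually_mono[OF AEg]) (use pt in "simp add: ennreal_leI")
   also have "\<dots> \<le> ennreal (exp (c * t))" using dm cu_in_KA[OF l] by blast
   finally have "ennreal (Q l) * (\<integral>\<^sup>+\<omega>. ennreal (f l \<omega> s / Q l) \<partial>P) \<le> ennreal (Q l) * ennreal (exp (c * t))"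
    by (rule mult_left_mono) simp
   moreover have "ennreal (Q l) * (\<integral>\<^sup>+\<omega>. ennreal (f l \<omega> s / Q l) \<partial>P) = (\<integral>\<^sup>+\<omega>. ennreal (f l \<omega> s) \<partial>P)"
   proof -
    have "ennreal (Q l) * (\<integral>\<^sup>+\<omega>. ennreal (f l \<omega> s / Q l) \<partial>P) = (\<integral>\<^sup>+\<omega>. ennreal (Q l) * ennreal (f l \<omega> s / Q l) \<partial>P)"
     by (rule nn_integral_cmult[symmetric])
      (intro measurable_compose[OF _ measurable_ennreal] borel_measurable_divide ms[OF l] borel_measurable_const)
    also have "\<dots> = (\<integral>\<^sup>+\<omega>. ennreal (f l \<omega> s) \<partial>P)"
    proof (rule nn_integral_cong)
     fix \<omega>
     have "Q l * (f l \<omega> s / Q l) = f l \<omega> s" using Q[of l] by simp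
     thus "ennreal (Q l) * ennreal (f l \<omega> s / Q l) = ennreal (f l \<omega> s)"
      using Q[of l] nn[of l \<omega> s] by (simp only: ennreal_mult'[symmetric] less_imp_le)
    qed
    finally show ?thesis .
   qed
   ultimately show ?thesis using Q[of l] by (simp add: ennreal_mult)
  qed
  have z: "(0::'v) \<in> cube" by (simp add: cube_def)
  have cl: "(%\<omega>. cint ?p (f l \<omega>)) \<in> borel_measurable P \<and> (\<integral>\<^sup>+\<omega>. ennreal (cint ?p (f l \<omega>)) \<partial>P) \<le> ennreal (Q l * exp (c * t))"
   if l: "l \<in> A" for l
   unfolding cint_def
   by (rule nn_integral_avgs_le[OF cont[OF l] nn ms[OF l] le[OF l] _ z]) (use Q[of l] in auto)
  have cn: "0 \<le> cint ?p (f l \<omega>)" if "l \<in> A" for l \<omega> unfolding cint_def by (rule avgs_nonneg[OF cont[OF that] nn])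
  have Sle: "\<bar>?S\<bar> \<le> (\<Sum>l\<in>A. \<bar>a l\<bar> * cint ?p (f l \<omega>))" if \<omega>: "good \<omega>" for \<omega>
  proof -
   have "\<bar>?S\<bar> = \<bar>\<Sum>l\<in>A. a l * cint ?p (?b t \<omega> l)\<bar>"
    using inv[OF t \<omega>] unfolding Nc_def by simp
   also have "\<dots> \<le> (\<Sum>l\<in>A. \<bar>a l * cint ?p (?b t \<omega> l)\<bar>)" by (rule sum_abs)
   also have "\<dots> \<le> (\<Sum>l\<in>A. \<bar>a l\<bar> * cint ?p (f l \<omega>))"
   proof (rule sum_mono)
    fix l assume l: "l \<in> A"
    have "continuous_on UNIV (?b t \<omega> l)"
     by (rule continuous_on_pb[OF C1[OF t \<omega> l] \<phi>U]) simp_all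
    from abs_cint_le[OF this, of ?p]
    have "\<bar>cint ?p (?b t \<omega> l)\<bar> \<le> cint ?p (f l \<omega>)"
     using \<omega> by (simp add: f_def[abs_def])
    thus "\<bar>a l * cint ?p (?b t \<omega> l)\<bar> \<le> \<bar>a l\<bar> * cint ?p (f l \<omega>)"
     unfolding abs_mult by (rule mult_left_mono) simp
   qed
   finally show ?thesis .
  qed
  \<comment> \<open>A constant is its own expectation under a probability measure.\<close>
  have "ennreal \<bar>?S\<bar> = (\<integral>\<^sup>+\<omega>. ennreal \<bar>?S\<bar> \<partial>P)" by (simp add: emeasure_space_1)
  also have "\<dots> \<le> (\<integral>\<^sup>+\<omega>. (\<Sum>l\<in>A. ennreal \<bar>a l\<bar> * ennreal (cint ?p (f l \<omega>))) \<partial>P)"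
  proof (rule nn_integral_mono_AE, rule eventually_mono[OF AEg])
   fix \<omega> assume "good \<omega>"
   from ennreal_leI[OF Sle[OF this]]
   show "ennreal \<bar>?S\<bar> \<le> (\<Sum>l\<in>A. ennreal \<bar>a l\<bar> * ennreal (cint ?p (f l \<omega>)))"
    using cn by (simp add: sum_ennreal[symmetric] ennreal_mult)
  qed
  also have "\<dots> = (\<Sum>l\<in>A. \<integral>\<^sup>+\<omega>. ennreal \<bar>a l\<bar> * ennreal (cint ?p (f l \<omega>)) \<partial>P)"
   by (rule nn_integral_sum)
    (rule borel_measurable_times_ennreal[OF borel_measurable_const measurable_compose[OF cl[THEN conjunct1] measurable_ennreal]])
  also have "\<dots> = (\<Sum>l\<in>A. ennreal \<bar>a l\<bar> * (\<integral>\<^sup>+\<omega>. ennreal (cint ?p (f l \<omega>)) \<partial>P))"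
   by (rule sum.cong[OF refl], rule nn_integral_cmult, rule measurable_compose[OF cl[THEN conjunct1] measurable_ennreal])
  also have "\<dots> \<le> (\<Sum>l\<in>A. ennreal \<bar>a l\<bar> * ennreal (Q l * exp (c * t)))"
   by (rule sum_mono, rule mult_left_mono, rule cl[THEN conjunct2]) simp_all
  also have "\<dots> = ennreal (R * exp (c * t))"
   using Q by (simp add: R_def ennreal_mult[symmetric] sum_distrib_right mult.assoc less_imp_le)
  finally have le: "ennreal \<bar>?S\<bar> \<le> ennreal (R * exp (c * t))" .
  have "0 \<le> R" unfolding R_def using Q by (intro sum_nonneg mult_nonneg_nonneg) (simp_all add: less_imp_le)
  thus ?thesis using le by (simp add: ennreal_le_iff)
 qed
 have "((%t. R * exp (c * t)) \<longlongrightarrow> R * 0) at_top"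
 proof (rule tendsto_mult[OF tendsto_const])
  have "filterlim (%t. c * t) at_bot at_top"
   by (rule filterlim_tendsto_neg_mult_at_bot[OF tendsto_const c(1) filterlim_ident])
  thus "((%t. exp (c * t)) \<longlongrightarrow> 0) at_top" by (rule filterlim_compose[OF exp_at_bot])
 qed
 moreover have "\<forall>\<^sub>F t in at_top. \<bar>?S\<bar> \<le> R * exp (c * t)"
  using c(2) eventually_ge_at_top[of 0] by eventually_elim (rule bound)
 ultimately have "\<bar>?S\<bar> \<le> R * 0" by (rule tendsto_lowerbound) simp
 thus ?thesis by simp
qed

end

section \<open>Consequences for cohomology and the assembly of the proof\<close>

section \<open>Compactly supported forms are bounded\<close>

context manifold
begin

lemma form_norm_le:
 assumes rm: "riemannian_metric \<A> g"
  and "\<And>vs. length vs = p ==> (\<And>v. v \<in> set vs ==> v \<in> TS x \<and> g x v v \<le> 1) ==> \<bar>\<phi> x vs\<bar> \<le> C"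
 shows "form_norm \<A> g p \<phi> x \<le> C"
 unfolding form_norm_def
proof (rule cSUP_least)
 let ?v = "tgt (chart_at \<A> x) x 0"
 have "?v \<in> TS x" by (rule tgt_in_TS[OF chart_at])
 moreover have "g x ?v ?v \<le> 1" using gq_props(6)[OF rm chart_at(1)[of x] chart_at(2)[of x], where r = 0 and u = 0] by (simp add: gq_def)
 ultimately have "replicate p ?v \<in> {vs. length vs = p \<and> (\<forall>v\<in>set vs. v \<in> TS x \<and> g x v v \<le> 1)}" by simp
 thus "{vs. length vs = p \<and> (\<forall>v\<in>set vs. v \<in> TS x \<and> g x v v \<le> 1)} \<noteq> {}" by blast
 show "\<bar>\<phi> x vs\<bar> \<le> C" if "vs \<in> {vs. length vs = p \<and> (\<forall>v\<in>set vs. v \<in> TS x \<and> g x v v \<le> 1)}" for vs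
  by (rule assms(2)) (use that in auto)
qed

text \<open>Local bounds are collected over a finite cover of the support, and off the support the
  norm is at most 0.\<close>

lemma compactly_supported_bounded:
 assumes rm: "riemannian_metric \<A> g" and \<phi>: "\<phi> \<in> forms \<A> p" "compactly_supported \<phi>"
 shows "bounded_form \<A> g p \<phi>"
proof -
 have \<phi>U: "\<phi> \<in> forms_on UNIV p" using \<phi>(1) by (simp add: forms_on_UNIV)
 let ?K = "closure {x. \<exists>vs. \<phi> x vs \<noteq> 0}"
 have "\<forall>x. \<exists>q. open (fst q) \<and> x \<in> fst q \<and> (\<forall>y\<in>fst q. form_norm \<A> g p \<phi> y \<le> snd q)"
 proof
  fix x
  from form_locally_bounded[OF rm \<phi>U, of x] obtain S C where S: "open S" "x \<in> S"
   "\<forall>y\<in>S. \<forall>vs. length vs = p --> (\<forall>v\<in>set vs. v \<in> TS y \<and> g y v v \<le> 1) --> \<bar>\<phi> y vs\<bar> \<le> C" by (elim exE conjE)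
  have "form_norm \<A> g p \<phi> y \<le> C" if "y \<in> S" for y by (rule form_norm_le[OF rm]) (use S(3) that in blast)
  with S show "\<exists>q. open (fst q) \<and> x \<in> fst q \<and> (\<forall>y\<in>fst q. form_norm \<A> g p \<phi> y \<le> snd q)"
   by (intro exI[of _ "(S, C)"]) simp
 qed
 from choice[OF this] obtain q where q: "\<forall>x. open (fst (q x)) \<and> x \<in> fst (q x) \<and> (\<forall>y\<in>fst (q x). form_norm \<A> g p \<phi> y \<le> snd (q x))"
  by (rule exE)
 obtain D where D: "finite D" "?K \<subseteq> (\<Union>x\<in>D. fst (q x))"
 proof (rule compactE_image[OF \<phi>(2)[unfolded compactly_supported_def], of ?K "%x. fst (q x)"])
  show "open (fst (q x))" for x using q[THEN spec, of x] by (rule conjunct1)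
  show "?K \<subseteq> (\<Union>x\<in>?K. fst (q x))"
  proof
   fix x assume x: "x \<in> ?K"
   show "x \<in> (\<Union>x\<in>?K. fst (q x))" by (rule UN_I[OF x]) (rule q[THEN spec, of x, THEN conjunct2, THEN conjunct1])
  qed
 qed
 \<comment> \<open>The sum of absolute values dominates each of the finitely many local bounds and
   is nonnegative, which serves the points off the support.\<close>
 have "form_norm \<A> g p \<phi> x \<le> (\<Sum>z\<in>D. \<bar>snd (q z)\<bar>)" for x
 proof (cases "x \<in> ?K")
  case True
  hence "x \<in> (\<Union>x\<in>D. fst (q x))" using D(2) by blast
  then obtain z where z: "z \<in> D" "x \<in> fst (q z)" by (rule UN_E)
  from q[THEN spec, of z, THEN conjunct2, THEN conjunct2] z(2) have "form_norm \<A> g p \<phi> x \<le> snd (q z)" by (rule bspec)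
  also have "\<dots> \<le> \<bar>snd (q z)\<bar>" by simp
  also have "\<dots> \<le> (\<Sum>z\<in>D. \<bar>snd (q z)\<bar>)" by (rule member_le_sum[OF z(1)]) (simp_all add: D(1))
  finally show ?thesis .
 next
  case False
  have 0: "\<phi> x vs = 0" for vs
  proof (rule ccontr)
   assume "\<phi> x vs \<noteq> 0"
   hence "x \<in> {x. \<exists>vs. \<phi> x vs \<noteq> 0}" by blast
   hence "x \<in> ?K" by (rule subsetD[OF closure_subset])
   with False show False ..
  qed
  show ?thesis by (rule form_norm_le[OF rm]) (simp only: 0 abs_zero, rule sum_nonneg, simp)
 qed
 thus ?thesis unfolding bounded_form_def by (intro bdd_aboveI2)
qed

section \<open>Cosets of exact forms\<close>

lemma exact_forms_diff:
 assumes "\<phi> \<in> exact_forms \<A> (Suc k)" "\<psi> \<in> exact_forms \<A> (Suc k)"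
 shows "(%x vs. \<phi> x vs - \<psi> x vs) \<in> exact_forms \<A> (Suc k)"
proof -
 obtain \<alpha> \<beta> where ab: "\<alpha> \<in> forms_on UNIV k" "\<phi> = ext_deriv \<A> \<alpha>" "\<beta> \<in> forms_on UNIV k" "\<psi> = ext_deriv \<A> \<beta>"
  using assms by (auto simp: exact_forms_def forms_on_UNIV)
 have "(%x vs. \<phi> x vs - \<psi> x vs) = ext_deriv \<A> (%x vs. \<alpha> x vs - \<beta> x vs)"
  using ext_on_diff[OF ab(1,3) open_UNIV] by (simp add: ext_on_UNIV ab(2,4))
 moreover have "(%x vs. \<alpha> x vs - \<beta> x vs) \<in> forms \<A> k"
  using forms_on_vector(3)[OF ab(1,3) open_UNIV] by (simp add: forms_on_UNIV)
 ultimately show ?thesis by (simp add: exact_forms_def)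
qed

lemma zero_form_exact: "zero_form \<in> exact_forms \<A> (Suc k)" "zero_form \<in> exact_forms_K \<A> (Suc k)"
  "zero_form \<in> closed_forms \<A> k"
proof -
 have z: "zero_form \<in> forms \<A> k" for k using zero_forms_on[of UNIV k] by (simp add: zero_form_def forms_on_UNIV)
 have d: "ext_deriv \<A> zero_form = zero_form"
  using ext_on_diff[OF zero_forms_on[of UNIV k] zero_forms_on open_UNIV] by (simp add: ext_on_UNIV zero_form_def)
 have "compactly_supported zero_form" by (simp add: compactly_supported_def zero_form_def)
 thus "zero_form \<in> exact_forms \<A> (Suc k)" "zero_form \<in> exact_forms_K \<A> (Suc k)" "zero_form \<in> closed_forms \<A> k"
  using z d by (auto simp: exact_forms_def exact_forms_K_def closed_forms_def intro!: image_eqI[of _ _ zero_form])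
qed

lemma exact_forms_add:
 assumes "\<phi> \<in> exact_forms \<A> (Suc k)" "\<psi> \<in> exact_forms \<A> (Suc k)"
 shows "(%x vs. \<phi> x vs + \<psi> x vs) \<in> exact_forms \<A> (Suc k)"
 using exact_forms_diff[OF assms(1) exact_forms_diff[OF zero_form_exact(1) assms(2)]] by (simp add: zero_form_def)

text \<open>Exact forms are closed under sums and differences, so translation by one of them
  permutes them.\<close>

lemma exact_coset:
 assumes "\<phi> \<in> exact_forms \<A> (Suc k)"
 shows "exact_forms \<A> (Suc k) #>\<^bsub>form_group S\<^esub> \<phi> = exact_forms \<A> (Suc k)"
 unfolding r_coset_def form_group_def
proof (rule subset_antisym; rule subsetI)
 fix \<psi> assume \<psi>: "\<psi> \<in> exact_forms \<A> (Suc k)"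
 show "\<psi> \<in> (\<Union>h\<in>exact_forms \<A> (Suc k). {h \<otimes>\<^bsub>\<lparr>carrier = S, mult = %\<phi> \<psi> x vs. \<phi> x vs + \<psi> x vs, one = zero_form\<rparr>\<^esub> \<phi>})"
  by (rule UN_I[OF exact_forms_diff[OF \<psi> assms]]) simp
qed (use exact_forms_add[OF _ assms] in auto)

lemma natural_map_exact:
 assumes "C \<subseteq> exact_forms \<A> (Suc k)" "C \<noteq> {}"
 shows "natural_map \<A> (Suc k) C = exact_forms \<A> (Suc k)"
proof -
 have "natural_map \<A> (Suc k) C = (\<Union>\<phi>\<in>C. exact_forms \<A> (Suc k))"
  unfolding natural_map_def by (rule SUP_cong[OF refl], rule exact_coset) (use assms(1) in blast)
 thus ?thesis using assms(2) by simp
qed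

text \<open>A class with compact supports then consists of exact forms only, so its image is the
  coset of exact forms, the neutral element.\<close>

lemma natural_map_trivial:
 assumes "\<And>\<phi>. \<phi> \<in> closed_forms \<A> (Suc k) ==> compactly_supported \<phi> ==> \<phi> \<in> exact_forms \<A> (Suc k)"
 shows "trivial_homomorphism (de_rham_K \<A> (Suc k)) (de_rham \<A> (Suc k)) (natural_map \<A> (Suc k))"
proof -
 let ?E = "exact_forms \<A> (Suc k)" and ?EK = "exact_forms_K \<A> (Suc k)"
 let ?G = "form_group (closed_forms \<A> (Suc k))"
 have EK: "?EK \<subseteq> ?E" by (auto simp: exact_forms_K_def exact_forms_def)
 have C: "C \<subseteq> ?E \<and> C \<noteq> {}" if cC: "C \<in> carrier (de_rham_K \<A> (Suc k))" for C
 proof -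
  obtain \<phi> where \<phi>: "\<phi> \<in> closed_forms \<A> (Suc k)" "compactly_supported \<phi>" and Ceq: "C = (%h x vs. h x vs + \<phi> x vs) ` ?EK"
   using cC by (auto simp: de_rham_K_def FactGroup_def RCOSETS_def r_coset_def form_group_def)
  have "\<phi> \<in> ?E" by (rule assms[OF \<phi>])
  hence "C \<subseteq> ?E" unfolding Ceq using exact_forms_add EK by blast
  moreover have "C \<noteq> {}" unfolding Ceq using zero_form_exact(2) by blast
  ultimately show ?thesis by simp
 qed
 have nm: "natural_map \<A> (Suc k) C = ?E" if "C \<in> carrier (de_rham_K \<A> (Suc k))" for C
  using natural_map_exact C[OF that] by blast
 have one: "\<one>\<^bsub>de_rham \<A> (Suc k)\<^esub> = ?E" by (simp add: de_rham_def FactGroup_def)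
 have "?E #>\<^bsub>?G\<^esub> zero_form \<in> rcosets\<^bsub>?G\<^esub> ?E"
  unfolding RCOSETS_def using zero_form_exact(3)[of "Suc k"] by (auto simp: form_group_def)
 hence carr: "?E \<in> carrier (de_rham \<A> (Suc k))"
  unfolding exact_coset[OF zero_form_exact(1)] by (simp add: de_rham_def FactGroup_def)
 have mult: "natural_map \<A> (Suc k) (C \<otimes>\<^bsub>de_rham_K \<A> (Suc k)\<^esub> D) = ?E \<otimes>\<^bsub>de_rham \<A> (Suc k)\<^esub> ?E"
  if "C \<in> carrier (de_rham_K \<A> (Suc k))" "D \<in> carrier (de_rham_K \<A> (Suc k))" for C D
 proof -
  have CD: "C \<otimes>\<^bsub>de_rham_K \<A> (Suc k)\<^esub> D = (\<Union>c\<in>C. \<Union>d\<in>D. {%x vs. c x vs + d x vs})"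
   by (simp add: de_rham_K_def FactGroup_def set_mult_def form_group_def)
  have "(\<Union>c\<in>C. \<Union>d\<in>D. {%x vs. c x vs + d x vs}) \<subseteq> ?E"
   using C[OF that(1)] C[OF that(2)] exact_forms_add by blast
  moreover have "(\<Union>c\<in>C. \<Union>d\<in>D. {%x vs. c x vs + d x vs}) \<noteq> {}"
   using C[OF that(1)] C[OF that(2)] by blast
  ultimately have "natural_map \<A> (Suc k) (C \<otimes>\<^bsub>de_rham_K \<A> (Suc k)\<^esub> D) = ?E"
   unfolding CD by (rule natural_map_exact)
  moreover have "?E \<otimes>\<^bsub>de_rham \<A> (Suc k)\<^esub> ?E = ?E"
  proof -
   have "?E \<otimes>\<^bsub>de_rham \<A> (Suc k)\<^esub> ?E = (\<Union>\<psi>\<in>?E. ?E #>\<^bsub>?G\<^esub> \<psi>)"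
    by (auto simp: de_rham_def FactGroup_def set_mult_def r_coset_def)
   also have "\<dots> = (\<Union>\<psi>\<in>?E. ?E)" by (rule SUP_cong[OF refl], rule exact_coset)
   also have "\<dots> = ?E" using zero_form_exact(1) by auto
   finally show ?thesis .
  qed
  ultimately show ?thesis by simp
 qed
 show ?thesis unfolding trivial_homomorphism_def hom_def using nm one carr mult by auto
qed

end

section \<open>Exactness of bounded closed forms\<close>

context good_cover
begin

text \<open>Strong completeness speaks of images of the standard simplex, whereas \<open>cu\<close>
  is parametrised by the cube. Scaling by the dimension makes the simplex contain the unit cube, on
  which \<open>cu\<close> already takes all its values; so the images agree.\<close>

lemma range_cu_smooth_simplex:
 assumes "l \<noteq> []" "set l \<subseteq> B j"
 shows "range (cu l :: real^'p::finite => 'a) \<in> smooth_simplices TYPE('p) \<A>"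
proof -
 let ?c = "cu l :: real^'p => 'a"
 let ?d = "real CARD('p)"
 define \<sigma> :: "real^'p => 'a" where "\<sigma> s = cu l (?d *\<^sub>R s)" for s
 have d: "?d > 0" by simp
 have S: "SM ?c" by (rule SM_cu[OF assms])
 have c: "continuous_on UNIV ?c" using S by (simp add: SM_def)
 have c\<sigma>: "continuous_on UNIV \<sigma>"
  unfolding \<sigma>_def[abs_def] by (rule continuous_on_compose2[OF c]) (auto intro!: continuous_intros)
 have sm: "smooth_on (UNIV \<inter> \<sigma> -` fst c) (snd c \<circ> \<sigma>)" if c': "c \<in> \<A>" for c
 proof -
  have o1: "open (\<sigma> -` fst c)" by (rule open_vimage[OF chart_open(1)[OF c'] c\<sigma>])
  have o2: "open (?c -` fst c)" by (rule open_vimage[OF chart_open(1)[OF c'] c])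
  have sc: "smooth_on (?c -` fst c) (%s. snd c (cu l s))" using S c' by (simp add: SM_def)
  have im: "(%s. ?d *\<^sub>R s) ` (\<sigma> -` fst c) \<subseteq> ?c -` fst c" by (auto simp: \<sigma>_def)
  have "smooth_on (\<sigma> -` fst c) (%s. snd c (cu l (?d *\<^sub>R s)))"
   by (rule smooth_on_compose[OF o1 o2 im smooth_on_bounded_linear[OF bounded_linear_scaleR_right] sc])
  thus ?thesis by (simp add: \<sigma>_def comp_def)
 qed
 have rg: "range ?c = \<sigma> ` (convex hull (insert 0 Basis))"
 proof (rule subset_antisym; rule subsetI)
  fix y assume "y \<in> range ?c"
  then obtain s :: "real^'p" where y: "y = cu l s" by blast
  let ?s = "(1 / ?d) *\<^sub>R clampv s"
  have cb: "0 \<le> clampv s \<bullet> b \<and> clampv s \<bullet> b \<le> 1" if "b \<in> Basis" for b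
   using clampv_cbox[of s] that by (simp add: mem_box)
  have "(\<Sum>b\<in>Basis. clampv s \<bullet> b) \<le> (\<Sum>b\<in>(Basis :: (real^'p) set). 1)" by (rule sum_mono) (use cb in blast)
  also have "\<dots> = ?d" by simp
  finally have "(\<Sum>b\<in>Basis. clampv s \<bullet> b) / ?d \<le> 1" using d by simp
  hence "?s \<in> convex hull (insert 0 Basis)"
   unfolding std_simplex using cb d by (simp add: sum_divide_distrib)
  moreover have "y = \<sigma> ?s" unfolding y \<sigma>_def using cu_clamp[of l s] by simp
  ultimately show "y \<in> \<sigma> ` (convex hull (insert 0 Basis))" by blast
 qed (auto simp: \<sigma>_def)
 show ?thesis unfolding smooth_simplices_def mem_Collect_eq
 proof (rule exI[of _ \<sigma>], rule conjI[OF rg])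
  show "\<exists>W. open W \<and> convex hull (insert 0 Basis) \<subseteq> W \<and> continuous_on W \<sigma> \<and>
   (\<forall>c\<in>\<A>. smooth_on (W \<inter> \<sigma> -` fst c) (snd c \<circ> \<sigma>))"
   using c\<sigma> sm by (intro exI[of _ UNIV] conjI ballI open_UNIV subset_UNIV)
 qed
qed

text \<open>Each finite cycle comes with its own null set, but the resulting identity for the
  integrals contains no randomness. The identities for all cycles therefore hold together, as
  \<open>altsum_solvable\<close> requires.\<close>

lemma bounded_closed_form_exact:
 fixes P :: "'w measure" and \<F> :: "real => 'w measure" and W :: "real => 'w => real^'m"
  and F :: "real => 'w => 'a => 'a"
 assumes rm: "riemannian_metric \<A> g" and k: "CARD('p::finite) = Suc k"
  and P: "filtered_prob_space P \<F>" and sde: "sde_flow P \<F> W \<A> X A \<xi> F"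
  and complete: "strongly_complete TYPE('p) P \<A> \<xi>"
  and stable: "strongly_moment_stable P \<A> g \<xi> F (Suc k)"
  and \<phi>: "\<phi> \<in> closed_forms \<A> (Suc k)" and bd: "bounded_form \<A> g (Suc k) \<phi>"
 shows "\<phi> \<in> exact_forms \<A> (Suc k)"
proof -
 let ?c = "%l. cu l :: real^'p => 'a" and ?S = "{l. small l \<and> length l = Suc (Suc k)}"
 let ?T = "TYPE(real^'p)"
 have kD: "k < DIM(real^'p)" using k by simp
 have \<phi>': "\<phi> \<in> forms \<A> (Suc k)" "ext_deriv \<A> \<phi> = (%x vs. 0)"
  using \<phi> by (simp_all add: closed_forms_def zero_form_def)
 have pP: "prob_space P" and sub: "sets (\<F> t) \<subseteq> sets P" for t
  using P by (simp_all add: filtered_prob_space_def subalgebra_def)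
 have meas: "{\<omega> \<in> space P. ereal t < \<xi> \<omega> x \<and> F t \<omega> x \<in> U} \<in> sets P" if "0 \<le> t" "open U" for x t U
 proof -
  have "maximal_solution P \<F> W \<A> X A x (%\<omega>. \<xi> \<omega> x) (%t \<omega>. F t \<omega> x)"
   using sde unfolding sde_flow_def by blast
  hence "{\<omega> \<in> space P. ereal t < \<xi> \<omega> x \<and> F t \<omega> x \<in> U} \<in> sets (\<F> t)"
   using that unfolding maximal_solution_def by blast
  thus ?thesis using sub by blast
 qed
 have flow: "AE \<omega> in P. C1_flow (%t. {x. ereal t < \<xi> \<omega> x}) (%t. F t \<omega>)"
  using sde[unfolded sde_flow_def, THEN conjunct2] by (rule eventually_mono) (simp add: C1_flow_def)
 have cyc0: "(\<Sum>l\<in>A. a l * Iv ?T \<phi> l) = 0"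
  if A: "finite A" "A \<subseteq> ?S" and cyc: "\<And>q. (\<Sum>l\<in>A. a l * altsum q l) = 0" for A a
 proof -
  interpret good_cycle \<A> B cc \<rho> ?T \<phi> k A a by unfold_locales (use \<phi>' kD A cyc in auto)
  \<comment> \<open>Finiteness of \<open>A\<close> lets the almost sure completeness of the
    individual simplices be used simultaneously.\<close>
  have "AE \<omega> in P. \<forall>l\<in>A. (INF x\<in>range (?c l). \<xi> \<omega> x) = \<infinity>"
  proof (rule AE_finite_allI[OF A(1)])
   fix l assume "l \<in> A"
   from A_ne[OF this] obtain j where "l \<noteq> []" "set l \<subseteq> B j" by blast
   from range_cu_smooth_simplex[OF this, where 'p = 'p]
   show "AE \<omega> in P. (INF x\<in>range (?c l). \<xi> \<omega> x) = \<infinity>"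
    using complete unfolding strongly_complete_def by (rule bspec[rotated])
  qed
  hence compl: "AE \<omega> in P. \<forall>x\<in>KA. \<xi> \<omega> x = \<infinity>"
  proof (rule eventually_mono)
   fix \<omega> assume i: "\<forall>l\<in>A. (INF x\<in>range (?c l). \<xi> \<omega> x) = \<infinity>"
   show "\<forall>x\<in>KA. \<xi> \<omega> x = \<infinity>"
   proof
    fix x assume "x \<in> KA"
    then obtain l where l: "l \<in> A" "x \<in> range (?c l)" unfolding KA_def by (rule UN_E)
    have "(INF x\<in>range (?c l). \<xi> \<omega> x) \<le> \<xi> \<omega> x" by (rule INF_lower[OF l(2)])
    thus "\<xi> \<omega> x = \<infinity>" using i l(1) by simp
   qed
  qed
  show ?thesis by (rule cycle_integral_zero[OF rm bd pP meas flow compl stable])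
 qed
 show ?thesis
 proof (rule altsum_solvable[of "?S" "Iv ?T \<phi>"])
  show "(\<Sum>l\<in>A. a l * Iv ?T \<phi> l) = 0"
   if "finite A" "A \<subseteq> ?S" "\<And>q. (\<Sum>l\<in>A. a l * altsum q l) = 0" for A a
   by (rule cyc0[OF that])
  fix f assume f: "\<And>l. l \<in> ?S ==> Iv ?T \<phi> l = altsum f l"
  have "\<exists>\<psi>\<in>forms \<A> k. ext_deriv \<A> \<psi> = \<phi>"
   by (rule closed_form_exact[OF \<phi>' kD]) (use f in blast)
  thus ?thesis by (auto simp: exact_forms_def)
 qed
qed

end

theorem theorem2p4:
  fixes \<A> :: "('a::{second_countable_topology,t2_space}, 'e::euclidean_space) chart set"
    and g :: "'a \<Rightarrow> ('a, 'e) tangent \<Rightarrow> ('a, 'e) tangent \<Rightarrow> real"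
    and P :: "'w measure" and \<F> :: "real \<Rightarrow> 'w measure"
    and B :: "real \<Rightarrow> 'w \<Rightarrow> real^'m"
    and X :: "'a \<Rightarrow> real^'m \<Rightarrow> ('a, 'e) tangent" and A :: "'a \<Rightarrow> ('a, 'e) tangent"
    and \<xi> :: "'w \<Rightarrow> 'a \<Rightarrow> ereal" and F :: "real \<Rightarrow> 'w \<Rightarrow> 'a \<Rightarrow> 'a"
    and p :: nat
  assumes "connected (UNIV :: 'a set)" and "smooth_atlas \<A>" and "riemannian_metric \<A> g"
    and "1 \<le> p" and "p = CARD('p::finite)"
    and "filtered_prob_space P \<F>" and "brownian_motion P \<F> B"
    and "C2_sde \<A> X A" and "sde_flow P \<F> B \<A> X A \<xi> F"
    and "strongly_complete TYPE('p) P \<A> \<xi>"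
    and "strongly_moment_stable P \<A> g \<xi> F p"
  shows "(\<forall>\<phi>\<in>closed_forms \<A> p. bounded_form \<A> g p \<phi> \<longrightarrow> \<phi> \<in> exact_forms \<A> p) \<and>
    trivial_homomorphism (de_rham_K \<A> p) (de_rham \<A> p) (natural_map \<A> p)"
proof -
 interpret manifold \<A> by unfold_locales (rule assms(2))
 obtain k where k: "p = Suc k" using assms(4) by (cases p) auto
 obtain U :: "nat => 'a set" and cc :: "'a => ('a, 'e) chart" and \<rho> :: "nat => 'a => real"
  where c: "\<And>j. open (U j)" "(\<Union>j. U j) = UNIV" "\<And>x. cc x \<in> \<A>"
  "\<And>x j. x \<in> U j ==> U j \<subseteq> fst (cc x) \<and> convex (snd (cc x) ` U j)"
  "\<And>j. smooth_fun_on UNIV (\<rho> j)" "\<And>j. \<exists>C. compact C \<and> C \<subseteq> U j \<and> (\<forall>x. x \<notin> C --> \<rho> j x = 0)"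
  "\<And>x. \<exists>W n. open W \<and> x \<in> W \<and> (\<forall>y\<in>W. (\<forall>j\<ge>n. \<rho> j y = 0) \<and> (\<Sum>j<n. \<rho> j y) = 1)"
  by (rule good_cover_exists) (rule that; assumption)
 interpret good_cover \<A> U cc \<rho> by unfold_locales (rule c | assumption)+
 have ex: "\<phi> \<in> exact_forms \<A> p" if "\<phi> \<in> closed_forms \<A> p" "bounded_form \<A> g p \<phi>" for \<phi>
  using bounded_closed_form_exact[OF assms(3) _ assms(6,9,10), of k \<phi>] assms(5,11) that k by simp
 have "\<phi> \<in> exact_forms \<A> (Suc k)" if "\<phi> \<in> closed_forms \<A> (Suc k)" "compactly_supported \<phi>" for \<phi>
  using ex compactly_supported_bounded[OF assms(3) _ that(2), of "Suc k"] that(1) k by (simp add: closed_forms_def)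
 hence "trivial_homomorphism (de_rham_K \<A> p) (de_rham \<A> p) (natural_map \<A> p)"
  unfolding k by (rule natural_map_trivial)
 with ex show ?thesis by simp
qed

end
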